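(* Let $R$ be a $d$-dimensional local Gorenstein ring and let $x$ be a non-zerodivisor of $R$ contained in the maximal ideal of $R$. Then: (1) $R$ is an AB ring if and only if $R/(x)$ is an AB ring. (2) $R$ has finite Tor-index if and only if $R/(x)$ has finite Tor-index. (3) $R$ is Ext-bounded if and only if $R/(x)$ is Ext-bounded. (4) $R$ is Tor-bounded if and only if $R/(x)$ is Tor-bounded.
   Context: Local rings are commutative Noetherian local rings. The Ext-index of a commutative ring $R$ is $\sup\{n \mid \operatorname{Ext}^i_R(M,N)=0 \text{ for all } i>n \text{ and } \operatorname{Ext}^n_R(M,N)\neq 0\}$, where the supremum is taken over all pairs $(M,N)$ of finitely generated $R$-modules with $\operatorname{Ext}^i_R(M,N)=0$ for all $i\gg 0$. The Tor-index is defined in the same way with $\operatorname{Tor}^R_i(M,N)$ in place of $\operatorname{Ext}^i_R(M,N)$. An AB ring is a local Gorenstein ring of finite Ext-index. $\operatorname{Ext}^*_R(M,N)$ has a gap of length $t$ if for some $n\geq 0$, $\operatorname{Ext}^i_R(M,N)=0$ for $n+1\leq i\leq n+t$ but $\operatorname{Ext}^n_R(M,N)$ and $\operatorname{Ext}^{n+t+1}_R(M,N)$ are both nonzero (gaps of length $0$ are allowed). Gaps for $\operatorname{Tor}^R_*(M,N)$ are defined analogously. $\operatorname{Ext-gap}(R)$ (resp. $\operatorname{Tor-gap}(R)$) is the supremum of those $t\in\mathbb N$ such that $\operatorname{Ext}^*_R(M,N)$ (resp. $\operatorname{Tor}^R_*(M,N)$) has a gap of length $t$ for some finitely generated $R$-modules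 $M$ and $N$. $R$ is Ext-bounded (resp. Tor-bounded) if $\operatorname{Ext-gap}(R)$ (resp. $\operatorname{Tor-gap}(R)$) is finite. *)

theory Defs
  imports "HOL-Algebra.Module" "HOL-Algebra.QuotRing" "HOL-Algebra.Ring_Divisibility" "HOL-Library.Extended_Nat"
begin

section \<open>Modules and their homomorphisms\<close>

text \<open>The multiplicative fields \<open>mult\<close> and \<open>one\<close> that a module record inherits from ring records
  carry no information; they are left \<^term>\<open>undefined\<close> in all constructions below.
  Homomorphisms are extensional functions, so that equality of functions is equality of
  homomorphisms.\<close>

definition mod_hom ::
    "('a, 'r) ring_scheme \<Rightarrow> ('a, 'b, 'm) module_scheme \<Rightarrow> ('a, 'c, 'n) module_scheme \<Rightarrow> ('b \<Rightarrow> 'c) set"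
  where "mod_hom R M N = {f \<in> carrier M \<rightarrow>\<^sub>E carrier N.
    (\<forall>x \<in> carrier M. \<forall>y \<in> carrier M. f (x \<oplus>\<^bsub>M\<^esub> y) = f x \<oplus>\<^bsub>N\<^esub> f y) \<and>
    (\<forall>r \<in> carrier R. \<forall>x \<in> carrier M. f (r \<odot>\<^bsub>M\<^esub> x) = r \<odot>\<^bsub>N\<^esub> f x)}"

definition mod_kernel ::
    "('a, 'b, 'm) module_scheme \<Rightarrow> ('a, 'c, 'n) module_scheme \<Rightarrow> ('b \<Rightarrow> 'c) \<Rightarrow> 'b set"
  where "mod_kernel M N f = {x \<in> carrier M. f x = \<zero>\<^bsub>N\<^esub>}"

definition hom_module ::
    "('a, 'r) ring_scheme \<Rightarrow> ('a, 'b, 'm) module_scheme \<Rightarrow> ('a, 'c, 'n) module_scheme \<Rightarrow> ('a, 'b \<Rightarrow> 'c) module"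
  where "hom_module R M N =
    \<lparr>carrier = mod_hom R M N, monoid.mult = undefined, one = undefined,
     zero = (\<lambda>x \<in> carrier M. \<zero>\<^bsub>N\<^esub>),
     add = (\<lambda>f g. \<lambda>x \<in> carrier M. f x \<oplus>\<^bsub>N\<^esub> g x),
     smult = (\<lambda>r f. \<lambda>x \<in> carrier M. r \<odot>\<^bsub>N\<^esub> f x)\<rparr>"

definition zero_module :: "('a, 'b, 'm) module_scheme \<Rightarrow> bool"
  where "zero_module M \<longleftrightarrow> carrier M = {\<zero>\<^bsub>M\<^esub>}"

definition quot_module :: "('a, 'b, 'm) module_scheme \<Rightarrow> 'b set \<Rightarrow> ('a, 'b set) module"
  where "quot_module M H =
    \<lparr>carrier = a_rcosets\<^bsub>M\<^esub> H, monoid.mult = undefined, one = undefined,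
     zero = H, add = set_add M,
     smult = (\<lambda>r X. \<Union>x \<in> X. H +>\<^bsub>M\<^esub> (r \<odot>\<^bsub>M\<^esub> x))\<rparr>"

definition regular_module :: "('a, 'r) ring_scheme \<Rightarrow> ('a, 'a) module"
  where "regular_module R =
    \<lparr>carrier = carrier R, monoid.mult = undefined, one = undefined,
     zero = \<zero>\<^bsub>R\<^esub>, add = (\<oplus>\<^bsub>R\<^esub>), smult = (\<otimes>\<^bsub>R\<^esub>)\<rparr>"

text \<open>The free module \<open>R\<^bsup>(X)\<^esup>\<close> on a set \<open>X\<close>, as the finitely supported functions vanishing
  outside \<open>X\<close>.\<close>

definition free_module :: "('a, 'r) ring_scheme \<Rightarrow> 'i set \<Rightarrow> ('a, 'i \<Rightarrow> 'a) module"
  where "free_module R X =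
    \<lparr>carrier = {u. range u \<subseteq> carrier R \<and> finite {i. u i \<noteq> \<zero>\<^bsub>R\<^esub>} \<and> {i. u i \<noteq> \<zero>\<^bsub>R\<^esub>} \<subseteq> X},
     monoid.mult = undefined, one = undefined,
     zero = (\<lambda>i. \<zero>\<^bsub>R\<^esub>),
     add = (\<lambda>u v i. u i \<oplus>\<^bsub>R\<^esub> v i),
     smult = (\<lambda>r u i. r \<otimes>\<^bsub>R\<^esub> u i)\<rparr>"

definition unit_vector :: "('a, 'r) ring_scheme \<Rightarrow> 'i \<Rightarrow> 'i \<Rightarrow> 'a"
  where "unit_vector R i = (\<lambda>j. if j = i then \<one>\<^bsub>R\<^esub> else \<zero>\<^bsub>R\<^esub>)"

definition generated_submodule ::
    "('a, 'r) ring_scheme \<Rightarrow> ('a, 'b, 'm) module_scheme \<Rightarrow> 'b set \<Rightarrow> 'b set"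
  where "generated_submodule R M S = \<Inter>{H. submodule H R M \<and> S \<subseteq> H}"

definition fg_module :: "('a, 'r) ring_scheme \<Rightarrow> ('a, 'b, 'm) module_scheme \<Rightarrow> bool"
  where "fg_module R M \<longleftrightarrow> module R M \<and>
    (\<exists>S. finite S \<and> S \<subseteq> carrier M \<and> generated_submodule R M S = carrier M)"


section \<open>Tensor products\<close>

definition tensor_relations ::
    "('a, 'r) ring_scheme \<Rightarrow> ('a, 'b, 'm) module_scheme \<Rightarrow> ('a, 'c, 'n) module_scheme \<Rightarrow> ('b \<times> 'c \<Rightarrow> 'a) set"
  where "tensor_relations R M N =
    (let F = free_module R (carrier M \<times> carrier N); e = unit_vector R in
     generated_submodule R F
      ({e (x \<oplus>\<^bsub>M\<^esub> x', y) \<ominus>\<^bsub>F\<^esub> (e (x, y) \<oplus>\<^bsub>F\<^esub> e (x', y)) | x x' y.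
          x \<in> carrier M \<and> x' \<in> carrier M \<and> y \<in> carrier N} \<union>
       {e (x, y \<oplus>\<^bsub>N\<^esub> y') \<ominus>\<^bsub>F\<^esub> (e (x, y) \<oplus>\<^bsub>F\<^esub> e (x, y')) | x y y'.
          x \<in> carrier M \<and> y \<in> carrier N \<and> y' \<in> carrier N} \<union>
       {e (r \<odot>\<^bsub>M\<^esub> x, y) \<ominus>\<^bsub>F\<^esub> (r \<odot>\<^bsub>F\<^esub> e (x, y)) | r x y.
          r \<in> carrier R \<and> x \<in> carrier M \<and> y \<in> carrier N} \<union>
       {e (x, r \<odot>\<^bsub>N\<^esub> y) \<ominus>\<^bsub>F\<^esub> (r \<odot>\<^bsub>F\<^esub> e (x, y)) | r x y.
          r \<in> carrier R \<and> x \<in> carrier M \<and> y \<in> carrier N}))"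

definition tensor_module ::
    "('a, 'r) ring_scheme \<Rightarrow> ('a, 'b, 'm) module_scheme \<Rightarrow> ('a, 'c, 'n) module_scheme \<Rightarrow>
      ('a, ('b \<times> 'c \<Rightarrow> 'a) set) module"
  where "tensor_module R M N =
    quot_module (free_module R (carrier M \<times> carrier N)) (tensor_relations R M N)"

definition pure_tensor ::
    "('a, 'r) ring_scheme \<Rightarrow> ('a, 'b, 'm) module_scheme \<Rightarrow> ('a, 'c, 'n) module_scheme \<Rightarrow>
      'b \<Rightarrow> 'c \<Rightarrow> ('b \<times> 'c \<Rightarrow> 'a) set"
  where "pure_tensor R M N x y =
    tensor_relations R M N +>\<^bsub>free_module R (carrier M \<times> carrier N)\<^esub> unit_vector R (x, y)"

text \<open>The map \<open>f \<otimes> id\<close> from \<open>M \<otimes> N\<close> to \<open>M' \<otimes> N\<close>.\<close>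

definition tensor_map ::
    "('a, 'r) ring_scheme \<Rightarrow> ('a, 'b, 'm) module_scheme \<Rightarrow> ('a, 'b', 'm') module_scheme \<Rightarrow>
      ('a, 'c, 'n) module_scheme \<Rightarrow> ('b \<Rightarrow> 'b') \<Rightarrow> ('b \<times> 'c \<Rightarrow> 'a) set \<Rightarrow> ('b' \<times> 'c \<Rightarrow> 'a) set"
  where "tensor_map R M M' N f =
    (THE h. h \<in> mod_hom R (tensor_module R M N) (tensor_module R M' N) \<and>
      (\<forall>x \<in> carrier M. \<forall>y \<in> carrier N.
        h (pure_tensor R M N x y) = pure_tensor R M' N (f x) y))"


section \<open>Homology of complexes\<close>

text \<open>A chain complex has differentials \<open>d n\<close> from \<open>C (n + 1)\<close> to \<open>C n\<close>, a cochain complex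
  from \<open>C n\<close> to \<open>C (n + 1)\<close>; both are zero in negative degrees.\<close>

definition homology :: "(nat \<Rightarrow> ('a, 'b) module) \<Rightarrow> (nat \<Rightarrow> 'b \<Rightarrow> 'b) \<Rightarrow> nat \<Rightarrow> ('a, 'b set) module"
  where "homology C d n =
    quot_module
      (C n \<lparr>carrier := (case n of 0 \<Rightarrow> carrier (C 0) | Suc k \<Rightarrow> mod_kernel (C (Suc k)) (C k) (d k))\<rparr>)
      (d n ` carrier (C (Suc n)))"

definition cohomology :: "(nat \<Rightarrow> ('a, 'b) module) \<Rightarrow> (nat \<Rightarrow> 'b \<Rightarrow> 'b) \<Rightarrow> nat \<Rightarrow> ('a, 'b set) module"
  where "cohomology C d n =
    quot_module
      (C n \<lparr>carrier := mod_kernel (C n) (C (Suc n)) (d n)\<rparr>)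
      (case n of 0 \<Rightarrow> {\<zero>\<^bsub>C 0\<^esub>} | Suc k \<Rightarrow> d k ` carrier (C k))"


section \<open>Ext and Tor\<close>

text \<open>\<open>(b, d, e)\<close> is a resolution of \<open>M\<close> by the finitely generated free modules \<open>R\<^bsup>b i\<^esup>\<close>,
  with differentials \<open>d i\<close> from \<open>R\<^bsup>b (i + 1)\<^esup>\<close> to \<open>R\<^bsup>b i\<^esup>\<close> and augmentation \<open>e\<close>.
  Every finitely generated module over a Noetherian ring has one.\<close>

definition free_resolution ::
    "('a, 'r) ring_scheme \<Rightarrow> ('a, 'b, 'm) module_scheme \<Rightarrow>
      (nat \<Rightarrow> nat) \<Rightarrow> (nat \<Rightarrow> (nat \<Rightarrow> 'a) \<Rightarrow> (nat \<Rightarrow> 'a)) \<Rightarrow> ((nat \<Rightarrow> 'a) \<Rightarrow> 'b) \<Rightarrow> bool"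
  where "free_resolution R M b d e \<longleftrightarrow>
    (let F = (\<lambda>i. free_module R {..<b i}) in
      e \<in> mod_hom R (F 0) M \<and> e ` carrier (F 0) = carrier M \<and>
      (\<forall>i. d i \<in> mod_hom R (F (Suc i)) (F i)) \<and>
      d 0 ` carrier (F 1) = mod_kernel (F 0) M e \<and>
      (\<forall>i. d (Suc i) ` carrier (F (Suc (Suc i))) = mod_kernel (F (Suc i)) (F i) (d i)))"

definition chosen_resolution ::
    "('a, 'r) ring_scheme \<Rightarrow> ('a, 'b, 'm) module_scheme \<Rightarrow>
      (nat \<Rightarrow> nat) \<times> (nat \<Rightarrow> (nat \<Rightarrow> 'a) \<Rightarrow> (nat \<Rightarrow> 'a)) \<times> ((nat \<Rightarrow> 'a) \<Rightarrow> 'b)"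
  where "chosen_resolution R M = (SOME (b, d, e). free_resolution R M b d e)"

text \<open>Only meaningful for finitely generated \<open>M\<close> over a Noetherian ring; up to isomorphism
  the modules below then do not depend on the chosen resolution.\<close>

definition Ext_module ::
    "('a, 'r) ring_scheme \<Rightarrow> ('a, 'b, 'm) module_scheme \<Rightarrow> ('a, 'c, 'n) module_scheme \<Rightarrow>
      nat \<Rightarrow> ('a, ((nat \<Rightarrow> 'a) \<Rightarrow> 'c) set) module"
  where "Ext_module R M N n =
    (let (b, d, e) = chosen_resolution R M;
         F = (\<lambda>i. free_module R {..<b i})
     in cohomology (\<lambda>i. hom_module R (F i) N)
          (\<lambda>i f. compose (carrier (F (Suc i))) f (d i)) n)"

definition Tor_module ::
    "('a, 'r) ring_scheme \<Rightarrow> ('a, 'b, 'm) module_scheme \<Rightarrow> ('a, 'c, 'n) module_scheme \<Rightarrow>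
      nat \<Rightarrow> ('a, ((nat \<Rightarrow> 'a) \<times> 'c \<Rightarrow> 'a) set set) module"
  where "Tor_module R M N n =
    (let (b, d, e) = chosen_resolution R M;
         F = (\<lambda>i. free_module R {..<b i})
     in homology (\<lambda>i. tensor_module R (F i) N)
          (\<lambda>i. tensor_map R (F (Suc i)) (F i) N (d i)) n)"


section \<open>Indices and gaps\<close>

text \<open>A finitely generated \<open>R\<close>-module is isomorphic to a quotient of some \<open>R\<^bsup>n\<^esup>\<close> (proved at the
  end of this theory), and such quotients are modules of the following type. Quantification over
  all finitely generated \<open>R\<close>-modules is therefore quantification over this type.\<close>

type_synonym 'a coset_module = "('a, (nat \<Rightarrow> 'a) set) module"

definition has_index :: "(nat \<Rightarrow> ('a, 'b) module) \<Rightarrow> nat \<Rightarrow> bool"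
  where "has_index H n \<longleftrightarrow> (\<forall>i > n. zero_module (H i)) \<and> \<not> zero_module (H n)"

definition has_gap :: "(nat \<Rightarrow> ('a, 'b) module) \<Rightarrow> nat \<Rightarrow> bool"
  where "has_gap H t \<longleftrightarrow> (\<exists>n. (\<forall>i. n + 1 \<le> i \<and> i \<le> n + t \<longrightarrow> zero_module (H i)) \<and>
    \<not> zero_module (H n) \<and> \<not> zero_module (H (n + t + 1)))"

definition Ext_index :: "('a, 'r) ring_scheme \<Rightarrow> enat"
  where "Ext_index R = Sup {enat n | n. \<exists>(M :: 'a coset_module) (N :: 'a coset_module).
    fg_module R M \<and> fg_module R N \<and> has_index (Ext_module R M N) n}"

definition Tor_index :: "('a, 'r) ring_scheme \<Rightarrow> enat"
  where "Tor_index R = Sup {enat n | n. \<exists>(M :: 'a coset_module) (N :: 'a coset_module).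
    fg_module R M \<and> fg_module R N \<and> has_index (Tor_module R M N) n}"

definition Ext_gap :: "('a, 'r) ring_scheme \<Rightarrow> enat"
  where "Ext_gap R = Sup {enat t | t. \<exists>(M :: 'a coset_module) (N :: 'a coset_module).
    fg_module R M \<and> fg_module R N \<and> has_gap (Ext_module R M N) t}"

definition Tor_gap :: "('a, 'r) ring_scheme \<Rightarrow> enat"
  where "Tor_gap R = Sup {enat t | t. \<exists>(M :: 'a coset_module) (N :: 'a coset_module).
    fg_module R M \<and> fg_module R N \<and> has_gap (Tor_module R M N) t}"

definition Ext_bounded :: "('a, 'r) ring_scheme \<Rightarrow> bool"
  where "Ext_bounded R \<longleftrightarrow> Ext_gap R < \<infinity>"

definition Tor_bounded :: "('a, 'r) ring_scheme \<Rightarrow> bool"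
  where "Tor_bounded R \<longleftrightarrow> Tor_gap R < \<infinity>"


section \<open>Local Gorenstein rings and AB rings\<close>

definition local_ring :: "('a, 'r) ring_scheme \<Rightarrow> bool"
  where "local_ring R \<longleftrightarrow> cring R \<and> noetherian_ring R \<and> (\<exists>!\<mm>. maximalideal \<mm> R)"

definition krull_dim :: "('a, 'r) ring_scheme \<Rightarrow> enat"
  where "krull_dim R = Sup {enat n | n. \<exists>P :: nat \<Rightarrow> 'a set.
    (\<forall>i \<le> n. primeideal (P i) R) \<and> (\<forall>i < n. P i \<subset> P (Suc i))}"

text \<open>Injectivity is the extension property along all monomorphisms \<open>f\<close>, where the modules
  \<open>A\<close> and \<open>B\<close> range over those with elements of type \<^typ>\<open>nat \<Rightarrow> 'a\<close>. Isomorphic copies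
  of \<open>R\<close> and of its ideals are among them, so by Baer's criterion this restriction loses nothing.\<close>

definition injective_module :: "('a, 'r) ring_scheme \<Rightarrow> ('a, 'b, 'm) module_scheme \<Rightarrow> bool"
  where "injective_module R Q \<longleftrightarrow> module R Q \<and>
    (\<forall>(A :: ('a, nat \<Rightarrow> 'a) module) (B :: ('a, nat \<Rightarrow> 'a) module) f g.
      module R A \<and> module R B \<and> f \<in> mod_hom R A B \<and> inj_on f (carrier A) \<and> g \<in> mod_hom R A Q \<longrightarrow>
      (\<exists>h \<in> mod_hom R B Q. \<forall>a \<in> carrier A. h (f a) = g a))"

text \<open>An injective resolution of \<open>M\<close> of length at most \<open>n\<close>, given by modules \<open>I i\<close>,
  differentials \<open>d i\<close> from \<open>I i\<close> to \<open>I (i + 1)\<close> and an augmentation \<open>\<eta>\<close>.\<close>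

definition injective_resolution ::
    "('a, 'r) ring_scheme \<Rightarrow> ('a, 'b, 'm) module_scheme \<Rightarrow> nat \<Rightarrow>
      (nat \<Rightarrow> ('a, nat \<Rightarrow> 'a) module) \<Rightarrow> (nat \<Rightarrow> (nat \<Rightarrow> 'a) \<Rightarrow> (nat \<Rightarrow> 'a)) \<Rightarrow> ('b \<Rightarrow> (nat \<Rightarrow> 'a)) \<Rightarrow> bool"
  where "injective_resolution R M n I d \<eta> \<longleftrightarrow>
    (\<forall>i. injective_module R (I i)) \<and> (\<forall>i > n. zero_module (I i)) \<and>
    \<eta> \<in> mod_hom R M (I 0) \<and> inj_on \<eta> (carrier M) \<and>
    (\<forall>i. d i \<in> mod_hom R (I i) (I (Suc i))) \<and>
    \<eta> ` carrier M = mod_kernel (I 0) (I 1) (d 0) \<and>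
    (\<forall>i. d i ` carrier (I i) = mod_kernel (I (Suc i)) (I (Suc (Suc i))) (d (Suc i)))"

text \<open>For \<open>R\<close> Noetherian and \<open>M\<close> finitely generated, the injective hull of \<open>M\<close> and all
  cosyzygies have at most \<open>max |R| \<aleph>\<^sub>0\<close> elements (the Noetherian case of Baer's
  construction of an injective extension stops after \<open>\<omega>\<close> steps). Hence the type
  \<^typ>\<open>nat \<Rightarrow> 'a\<close> has room for a minimal injective resolution as soon as \<open>R\<close> is nonzero.\<close>

definition injective_dim :: "('a, 'r) ring_scheme \<Rightarrow> ('a, 'b, 'm) module_scheme \<Rightarrow> enat"
  where "injective_dim R M = Inf {enat n | n. \<exists>I d \<eta>. injective_resolution R M n I d \<eta>}"

definition gorenstein_local_ring :: "('a, 'r) ring_scheme \<Rightarrow> bool"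
  where "gorenstein_local_ring R \<longleftrightarrow> local_ring R \<and> injective_dim R (regular_module R) < \<infinity>"

definition AB_ring :: "('a, 'r) ring_scheme \<Rightarrow> bool"
  where "AB_ring R \<longleftrightarrow> gorenstein_local_ring R \<and> Ext_index R < \<infinity>"


section \<open>Finitely generated modules as quotients of \<open>R\<^bsup>n\<^esup>\<close>\<close>

lemma quot_module_is_module:
  assumes M: "module R M" and H: "submodule H R M"
  shows "module R (quot_module M H)"
proof -
  interpret M: module R M by fact
  interpret S: submodule H R M by fact
  have add: "additive_subgroup H M" by (rule additive_subgroup.intro) (rule S.subgroup_axioms)
  interpret AS: abelian_subgroup H M
    by (rule abelian_subgroupI3[OF add M.M.abelian_group_axioms])
  have sm: "r \<odot>\<^bsub>quot_module M H\<^esub> (H +>\<^bsub>M\<^esub> x) = H +>\<^bsub>M\<^esub> (r \<odot>\<^bsub>M\<^esub> x)"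
    if r: "r \<in> carrier R" and x: "x \<in> carrier M" for r x
  proof -
    have "H +>\<^bsub>M\<^esub> (r \<odot>\<^bsub>M\<^esub> y) = H +>\<^bsub>M\<^esub> (r \<odot>\<^bsub>M\<^esub> x)" if y: "y \<in> H +>\<^bsub>M\<^esub> x" for y
    proof -
      from y obtain h where h: "h \<in> H" and y: "y = h \<oplus>\<^bsub>M\<^esub> x"
        by (auto simp: a_r_coset_def r_coset_def)
      have hc: "h \<in> carrier M" using h AS.a_Hcarr by blast
      have "r \<odot>\<^bsub>M\<^esub> y = r \<odot>\<^bsub>M\<^esub> h \<oplus>\<^bsub>M\<^esub> r \<odot>\<^bsub>M\<^esub> x"
        using y hc r x M.smult_r_distr by simp
      hence "r \<odot>\<^bsub>M\<^esub> y \<in> H +>\<^bsub>M\<^esub> (r \<odot>\<^bsub>M\<^esub> x)"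
        using S.smult_closed[OF r h] by (auto simp: a_r_coset_def r_coset_def)
      thus ?thesis
        using M.M.a_repr_independence[OF _ M.smult_closed[OF r x] S.subgroup_axioms] by simp
    qed
    moreover have "x \<in> H +>\<^bsub>M\<^esub> x" using AS.a_rcos_self x by simp
    ultimately have "(\<Union>y \<in> H +>\<^bsub>M\<^esub> x. H +>\<^bsub>M\<^esub> (r \<odot>\<^bsub>M\<^esub> y)) = H +>\<^bsub>M\<^esub> (r \<odot>\<^bsub>M\<^esub> x)"
      by (intro SUP_eq_const) blast+
    thus ?thesis by (simp add: quot_module_def)
  qed
  have ad: "(H +>\<^bsub>M\<^esub> x) \<oplus>\<^bsub>quot_module M H\<^esub> (H +>\<^bsub>M\<^esub> y) = H +>\<^bsub>M\<^esub> (x \<oplus>\<^bsub>M\<^esub> y)"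
    if "x \<in> carrier M" "y \<in> carrier M" for x y
    using AS.a_rcos_sum that by (simp add: quot_module_def)
  have car: "carrier (quot_module M H) = (\<lambda>x. H +>\<^bsub>M\<^esub> x) ` carrier M"
    by (auto simp: quot_module_def A_RCOSETS_def RCOSETS_def a_r_coset_def)
  have z: "\<zero>\<^bsub>quot_module M H\<^esub> = H +>\<^bsub>M\<^esub> \<zero>\<^bsub>M\<^esub>"
    using M.M.a_coset_add_zero[OF AS.a_subset] by (simp add: quot_module_def)
  have ag: "abelian_group (quot_module M H)"
  proof (rule abelian_groupI)
    fix X assume "X \<in> carrier (quot_module M H)"
    then obtain x where x: "x \<in> carrier M" "X = H +>\<^bsub>M\<^esub> x" unfolding car by blast
    have "H +>\<^bsub>M\<^esub> (\<ominus>\<^bsub>M\<^esub> x) \<in> carrier (quot_module M H)" unfolding car using x by blast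
    moreover have "(H +>\<^bsub>M\<^esub> (\<ominus>\<^bsub>M\<^esub> x)) \<oplus>\<^bsub>quot_module M H\<^esub> X = \<zero>\<^bsub>quot_module M H\<^esub>"
      using x by (simp add: ad z M.M.l_neg)
    ultimately show "\<exists>Y\<in>carrier (quot_module M H). Y \<oplus>\<^bsub>quot_module M H\<^esub> X = \<zero>\<^bsub>quot_module M H\<^esub>"
      by blast
  qed (auto simp: car ad z M.M.a_assoc M.M.a_comm M.M.a_lcomm)
  show ?thesis
    by (rule moduleI[OF M.R.is_cring ag])
       (auto simp: car sm ad M.smult_l_distr M.smult_r_distr M.smult_assoc1)
qed

lemma free_module_is_module:
  assumes "cring R" shows "module R (free_module R X)"
proof -
  interpret R: cring R by fact
  let ?F = "free_module R X"
  have ag: "abelian_group ?F"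
  proof (rule abelian_groupI)
    fix u v assume "u \<in> carrier ?F" "v \<in> carrier ?F"
    then have u: "range u \<subseteq> carrier R" "finite {i. u i \<noteq> \<zero>\<^bsub>R\<^esub>}" "{i. u i \<noteq> \<zero>\<^bsub>R\<^esub>} \<subseteq> X"
      and v: "range v \<subseteq> carrier R" "finite {i. v i \<noteq> \<zero>\<^bsub>R\<^esub>}" "{i. v i \<noteq> \<zero>\<^bsub>R\<^esub>} \<subseteq> X"
      by (auto simp: free_module_def)
    have s: "{i. u i \<oplus>\<^bsub>R\<^esub> v i \<noteq> \<zero>\<^bsub>R\<^esub>} \<subseteq> {i. u i \<noteq> \<zero>\<^bsub>R\<^esub>} \<union> {i. v i \<noteq> \<zero>\<^bsub>R\<^esub>}"
      by auto
    show "u \<oplus>\<^bsub>?F\<^esub> v \<in> carrier ?F"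
      using u v s finite_subset[OF s] by (auto simp: free_module_def image_subset_iff)
    show "u \<oplus>\<^bsub>?F\<^esub> v = v \<oplus>\<^bsub>?F\<^esub> u"
      using u v by (auto simp: free_module_def image_subset_iff R.a_comm)
  next
    fix u assume "u \<in> carrier ?F"
    then have u: "range u \<subseteq> carrier R" "finite {i. u i \<noteq> \<zero>\<^bsub>R\<^esub>}" "{i. u i \<noteq> \<zero>\<^bsub>R\<^esub>} \<subseteq> X"
      by (auto simp: free_module_def)
    have s: "{i. \<ominus>\<^bsub>R\<^esub> u i \<noteq> \<zero>\<^bsub>R\<^esub>} \<subseteq> {i. u i \<noteq> \<zero>\<^bsub>R\<^esub>}" by auto
    show "\<exists>y\<in>carrier ?F. y \<oplus>\<^bsub>?F\<^esub> u = \<zero>\<^bsub>?F\<^esub>"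
      using u s finite_subset[OF s]
      by (intro bexI[of _ "\<lambda>i. \<ominus>\<^bsub>R\<^esub> u i"]) (auto simp: free_module_def image_subset_iff R.l_neg)
  qed (auto simp: free_module_def image_subset_iff R.a_assoc)
  show ?thesis
  proof (rule moduleI[OF assms ag])
    fix a u assume a: "a \<in> carrier R" and "u \<in> carrier ?F"
    then have u: "range u \<subseteq> carrier R" "finite {i. u i \<noteq> \<zero>\<^bsub>R\<^esub>}" "{i. u i \<noteq> \<zero>\<^bsub>R\<^esub>} \<subseteq> X"
      by (auto simp: free_module_def)
    have s: "{i. a \<otimes>\<^bsub>R\<^esub> u i \<noteq> \<zero>\<^bsub>R\<^esub>} \<subseteq> {i. u i \<noteq> \<zero>\<^bsub>R\<^esub>}" using a by auto
    show "a \<odot>\<^bsub>?F\<^esub> u \<in> carrier ?F"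
      using a u s finite_subset[OF s] by (auto simp: free_module_def image_subset_iff)
  qed (auto simp: free_module_def image_subset_iff R.l_distr R.r_distr R.m_assoc)
qed

lemma fg_module_iso_quotient:
  assumes fg: "fg_module R M"
  obtains n K \<phi> where "submodule K R (free_module R {..<n})"
    and "\<phi> \<in> mod_hom R M (quot_module (free_module R {..<n::nat}) K)"
    and "bij_betw \<phi> (carrier M) (carrier (quot_module (free_module R {..<n}) K))"
proof -
  interpret M: module R M using fg by (simp add: fg_module_def)
  obtain S where S: "finite S" "S \<subseteq> carrier M" "generated_submodule R M S = carrier M"
    using fg by (auto simp: fg_module_def)
  obtain n :: nat and s where s: "S = s ` {..<n}"
    using finite_imp_nat_seg_image_inj_on[OF S(1)] by (metis lessThan_def)
  have sc [simp]: "s i \<in> carrier M" if "i < n" for i using s S(2) that by blast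
  let ?F = "free_module R {..<n}"
  interpret F: module R ?F by (rule free_module_is_module) (rule M.R.is_cring)
  define p where "p u = (\<Oplus>\<^bsub>M\<^esub> i \<in> {..<n}. u i \<odot>\<^bsub>M\<^esub> s i)" for u
  have uc: "u i \<in> carrier R" if "u \<in> carrier ?F" for u i
    using that by (auto simp: free_module_def)
  have trm: "(\<lambda>i. u i \<odot>\<^bsub>M\<^esub> s i) \<in> {..<n} \<rightarrow> carrier M" if "u \<in> carrier ?F" for u
    using that uc by auto
  have pc [simp]: "p u \<in> carrier M" if "u \<in> carrier ?F" for u
    unfolding p_def by (rule M.M.finsum_closed) (rule trm[OF that])
  have addF: "(u \<oplus>\<^bsub>?F\<^esub> v) i = u i \<oplus>\<^bsub>R\<^esub> v i" and smF: "(r \<odot>\<^bsub>?F\<^esub> u) i = r \<otimes>\<^bsub>R\<^esub> u i" for u v r i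
    by (simp_all add: free_module_def)
  have padd: "p (u \<oplus>\<^bsub>?F\<^esub> v) = p u \<oplus>\<^bsub>M\<^esub> p v" if "u \<in> carrier ?F" "v \<in> carrier ?F" for u v
  proof -
    have "p (u \<oplus>\<^bsub>?F\<^esub> v) = (\<Oplus>\<^bsub>M\<^esub> i \<in> {..<n}. u i \<odot>\<^bsub>M\<^esub> s i \<oplus>\<^bsub>M\<^esub> v i \<odot>\<^bsub>M\<^esub> s i)"
      unfolding p_def using that
      by (intro M.M.finsum_cong'[OF refl]) (simp_all add: addF uc M.smult_l_distr)
    thus ?thesis using M.M.finsum_addf[OF trm[OF that(1)] trm[OF that(2)]] by (simp add: p_def)
  qed
  have psm: "p (r \<odot>\<^bsub>?F\<^esub> u) = r \<odot>\<^bsub>M\<^esub> p u" if "u \<in> carrier ?F" "r \<in> carrier R" for u r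
  proof -
    have "p (r \<odot>\<^bsub>?F\<^esub> u) = (\<Oplus>\<^bsub>M\<^esub> i \<in> {..<n}. r \<odot>\<^bsub>M\<^esub> (u i \<odot>\<^bsub>M\<^esub> s i))"
      unfolding p_def using that
      by (intro M.M.finsum_cong'[OF refl]) (simp_all add: smF uc M.smult_assoc1)
    thus ?thesis using M.finsum_smult_ldistr[OF _ that(2) trm[OF that(1)]] by (simp add: p_def)
  qed
  have p0: "p \<zero>\<^bsub>?F\<^esub> = \<zero>\<^bsub>M\<^esub>"
    using padd[of "\<zero>\<^bsub>?F\<^esub>" "\<zero>\<^bsub>?F\<^esub>"] by (simp add: M.M.add.r_cancel_one')
  have pm: "p (\<ominus>\<^bsub>?F\<^esub> u) = \<ominus>\<^bsub>M\<^esub> p u" if "u \<in> carrier ?F" for u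
    using padd[of "\<ominus>\<^bsub>?F\<^esub> u" u] that p0 by (simp add: F.M.l_neg M.M.minus_equality)
  have sub: "submodule (p ` carrier ?F) R M"
  proof (rule M.submoduleI)
    show "p ` carrier ?F \<subseteq> carrier M" by auto
    show "\<zero>\<^bsub>M\<^esub> \<in> p ` carrier ?F" using p0 F.M.zero_closed by (metis imageI)
    show "\<ominus>\<^bsub>M\<^esub> a \<in> p ` carrier ?F" if "a \<in> p ` carrier ?F" for a
      using that by (clarsimp simp flip: pm)
    show "a \<oplus>\<^bsub>M\<^esub> b \<in> p ` carrier ?F" if "a \<in> p ` carrier ?F" "b \<in> p ` carrier ?F" for a b
      using that by (clarsimp simp flip: padd)
    show "r \<odot>\<^bsub>M\<^esub> a \<in> p ` carrier ?F" if "r \<in> carrier R" "a \<in> p ` carrier ?F" for r a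
      using that by (clarsimp simp flip: psm)
  qed
  have "s i \<in> p ` carrier ?F" if i: "i < n" for i
  proof (rule image_eqI)
    show u: "unit_vector R i \<in> carrier ?F"
      using i by (auto simp: free_module_def unit_vector_def)
    have "p (unit_vector R i) = (\<Oplus>\<^bsub>M\<^esub> j \<in> {..<n}. if i = j then s j else \<zero>\<^bsub>M\<^esub>)"
      unfolding p_def using i by (intro M.M.finsum_cong') (auto simp: unit_vector_def)
    also have "\<dots> = s i" using M.M.finsum_singleton[of i "{..<n}" s] i by auto
    finally show "s i = p (unit_vector R i)" by simp
  qed
  hence "S \<subseteq> p ` carrier ?F" using s by auto
  hence "carrier M \<subseteq> p ` carrier ?F" using sub S(3) by (auto simp: generated_submodule_def)
  hence surj: "p ` carrier ?F = carrier M" by auto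
  define K where "K = {u \<in> carrier ?F. p u = \<zero>\<^bsub>M\<^esub>}"
  have K: "submodule K R ?F"
    by (rule F.submoduleI) (auto simp: K_def p0 pm padd psm)
  have addK: "additive_subgroup K ?F"
    by (rule additive_subgroup.intro) (rule submodule.axioms(1)[OF K])
  interpret AS: abelian_subgroup K ?F
    by (rule abelian_subgroupI3[OF addK F.M.abelian_group_axioms])
  have coset: "K +>\<^bsub>?F\<^esub> u = {v \<in> carrier ?F. p v = p u}" if u: "u \<in> carrier ?F" for u
  proof (intro equalityI subsetI)
    fix v assume "v \<in> K +>\<^bsub>?F\<^esub> u"
    then obtain k where "k \<in> K" and v: "v = k \<oplus>\<^bsub>?F\<^esub> u" by (auto simp: a_r_coset_def r_coset_def)
    have k: "k \<in> carrier ?F" "p k = \<zero>\<^bsub>M\<^esub>" using \<open>k \<in> K\<close> unfolding K_def by blast+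
    have 1: "p v = p u" unfolding v padd[OF k(1) u] k(2) using u by (intro M.M.l_zero pc)
    have 2: "v \<in> carrier ?F" unfolding v by (intro F.M.a_closed k u)
    show "v \<in> {v \<in> carrier ?F. p v = p u}" using 1 2 by blast
  next
    fix v assume "v \<in> {v \<in> carrier ?F. p v = p u}"
    hence v: "v \<in> carrier ?F" "p v = p u" by simp_all
    let ?w = "v \<oplus>\<^bsub>?F\<^esub> (\<ominus>\<^bsub>?F\<^esub> u)"
    have w: "?w \<in> carrier ?F" by (intro F.M.a_closed F.M.a_inv_closed v u)
    have "p ?w = \<zero>\<^bsub>M\<^esub>"
      unfolding padd[OF v(1) F.M.a_inv_closed[OF u]] pm[OF u] v(2) by (rule M.M.r_neg[OF pc[OF u]])
    with w have "?w \<in> K" unfolding K_def by blast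
    moreover have "?w \<oplus>\<^bsub>?F\<^esub> u = v"
      unfolding F.M.a_assoc[OF v(1) F.M.a_inv_closed[OF u] u] F.M.l_neg[OF u] by (rule F.M.r_zero[OF v(1)])
    ultimately show "v \<in> K +>\<^bsub>?F\<^esub> u" unfolding a_r_coset_def' by blast
  qed
  define \<phi> where "\<phi> = (\<lambda>m \<in> carrier M. {v \<in> carrier ?F. p v = m})"
  have phi: "\<phi> (p u) = K +>\<^bsub>?F\<^esub> u" if "u \<in> carrier ?F" for u
    using that by (simp add: \<phi>_def coset)
  have car: "carrier (quot_module ?F K) = (\<lambda>u. K +>\<^bsub>?F\<^esub> u) ` carrier ?F"
    by (auto simp: quot_module_def A_RCOSETS_def RCOSETS_def a_r_coset_def)
  have "\<phi> ` carrier M = carrier (quot_module ?F K)"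
    unfolding car surj[symmetric] using phi by (auto simp: image_image)
  moreover have "inj_on \<phi> (carrier M)"
  proof (rule inj_onI)
    fix x y assume xy: "x \<in> carrier M" "y \<in> carrier M" "\<phi> x = \<phi> y"
    obtain u where u: "u \<in> carrier ?F" "x = p u" using xy surj by (metis imageE)
    hence "u \<in> \<phi> x" by (simp add: \<phi>_def)
    hence "u \<in> \<phi> y" using xy by simp
    thus "x = y" using u xy by (simp add: \<phi>_def)
  qed
  ultimately have bij: "bij_betw \<phi> (carrier M) (carrier (quot_module ?F K))"
    by (simp add: bij_betw_def)
  have "\<phi> \<in> mod_hom R M (quot_module ?F K)"
    unfolding mod_hom_def
  proof (intro CollectI conjI ballI)
    show "\<phi> \<in> carrier M \<rightarrow>\<^sub>E carrier (quot_module ?F K)"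
      using bij by (auto simp: bij_betw_def \<phi>_def)
  next
    fix x y assume "x \<in> carrier M" "y \<in> carrier M"
    hence "x \<in> p ` carrier ?F" "y \<in> p ` carrier ?F" using surj by blast+
    then obtain u v where u: "u \<in> carrier ?F" and v: "v \<in> carrier ?F" and xy: "x = p u" "y = p v"
      by blast
    have "\<phi> (x \<oplus>\<^bsub>M\<^esub> y) = K +>\<^bsub>?F\<^esub> (u \<oplus>\<^bsub>?F\<^esub> v)"
      unfolding xy padd[OF u v, symmetric] by (rule phi[OF F.M.a_closed[OF u v]])
    also have "\<dots> = set_add ?F (\<phi> x) (\<phi> y)"
      unfolding xy phi[OF u] phi[OF v] by (rule AS.a_rcos_sum[OF u v, symmetric])
    finally show "\<phi> (x \<oplus>\<^bsub>M\<^esub> y) = \<phi> x \<oplus>\<^bsub>quot_module ?F K\<^esub> \<phi> y"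
      by (simp add: quot_module_def)
  next
    fix r x assume r: "r \<in> carrier R" and "x \<in> carrier M"
    hence "x \<in> p ` carrier ?F" using surj by blast
    then obtain u where u: "u \<in> carrier ?F" and x: "x = p u" by blast
    have "K +>\<^bsub>?F\<^esub> (r \<odot>\<^bsub>?F\<^esub> v) = K +>\<^bsub>?F\<^esub> (r \<odot>\<^bsub>?F\<^esub> u)" if "v \<in> K +>\<^bsub>?F\<^esub> u" for v
    proof -
      from that have v: "v \<in> carrier ?F" "p v = p u" unfolding coset[OF u] by blast+
      show ?thesis
        unfolding coset[OF F.smult_closed[OF r u]] coset[OF F.smult_closed[OF r v(1)]]
          psm[OF u r] psm[OF v(1) r] v(2) ..
    qed
    moreover have "u \<in> K +>\<^bsub>?F\<^esub> u" unfolding coset[OF u] using u by blast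
    ultimately have "(\<Union>v \<in> \<phi> x. K +>\<^bsub>?F\<^esub> (r \<odot>\<^bsub>?F\<^esub> v)) = K +>\<^bsub>?F\<^esub> (r \<odot>\<^bsub>?F\<^esub> u)"
      unfolding x phi[OF u] by (intro SUP_eq_const) blast+
    moreover have "\<phi> (r \<odot>\<^bsub>M\<^esub> x) = K +>\<^bsub>?F\<^esub> (r \<odot>\<^bsub>?F\<^esub> u)"
      unfolding x psm[OF u r, symmetric] by (rule phi[OF F.smult_closed[OF r u]])
    ultimately show "\<phi> (r \<odot>\<^bsub>M\<^esub> x) = r \<odot>\<^bsub>quot_module ?F K\<^esub> \<phi> x"
      by (simp add: quot_module_def)
  qed
  thus ?thesis using that K bij by blast
qed

end

theory Submission
  imports Defs
begin

text \<open>Write \<open>S = R/(x)\<close>. Only the sets of degrees in which Ext and Tor vanish matter; they are read off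
  resolutions by free modules \<open>R\<^bsup>b\<^esup>\<close>, as exactness of sequences of matrices over \<open>R\<close> acting
  on \<open>N\<^bsup>b\<^esup>\<close>.

  For \<open>S\<close>-modules the change of rings sequences \<open>Ext\<^sub>S\<^sup>n\<^sup>-\<^sup>2 \<rightarrow> Ext\<^sub>S\<^sup>n \<rightarrow> Ext\<^sub>R\<^sup>n \<rightarrow> Ext\<^sub>S\<^sup>n\<^sup>-\<^sup>1\<close>
  turn an index \<open>n\<close> over \<open>S\<close> into an index \<open>n + 1\<close> over \<open>R\<close> and a gap of length \<open>t \<ge> 2\<close> into one of length \<open>t - 1\<close>.

  Conversely, replace \<open>R\<close>-modules \<open>M\<close>, \<open>N\<close> by syzygies \<open>M'\<close>, \<open>N'\<close>, on which \<open>x\<close> is regular. Since \<open>R\<close> has finite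
  injective dimension, this changes Ext only in a bounded range of degrees, and it shifts Tor by two. By the long exact
  sequence of \<open>0 \<rightarrow> N' \<rightarrow> N' \<rightarrow> N'/xN' \<rightarrow> 0\<close> and Nakayama's lemma, \<open>Ext\<^sub>S(M'/xM', N'/xN')\<close> and
  \<open>Ext\<^sub>R(M', N')\<close> vanish in the same degrees up to a shift by one. A superfluous generator of \<open>N\<close> gives \<open>N'\<close> a free
  summand, so degree \<open>0\<close> does not vanish and every long run of zeros followed by a nonzero module is part of a gap.

  If \<open>I\<close> is a finite injective resolution of \<open>R\<close>, then \<open>J\<^sub>i = (0 :\<^bsub>I i\<^esub> x)\<close> is injective over \<open>S\<close>, \<open>J\<^sub>0\<close> is a direct summand
  of \<open>J\<^sub>1\<close>, and \<open>S \<rightarrow> J\<^sub>1/J\<^sub>0 \<rightarrow> J\<^sub>2 \<rightarrow> \<dots>\<close> is an injective resolution of \<open>S\<close>.\<close>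

section \<open>Vectors and matrices over a module\<close>

text \<open>The modules that occur on the way (syzygies, quotients by x, modules over the other
  ring) have elements of ever new types, whereas indices and gaps quantify over the single type
  \<open>'a coset_module\<close>. Exactness of a matrix complex makes sense for coefficients of any
  type; \<open>patternI\<close> returns to the fixed type by isomorphism. Reduction to S amounts to
  reading the same matrices modulo x. No homology module is compared with another: of each long
  exact sequence only statements of the form "both neighbours vanish, hence the middle term
  vanishes" are used. They are collected in \<open>coned\<close> and \<open>reduced\<close>,
  predicates on vanishing degrees alone, so the arithmetic of indices and gaps is done once for Ext
  and Tor. A gap needs a nonzero term on its left, which reduction modulo x might destroy; this is
  why nonvanishing in degree 0 is arranged rather than tracked. Injectivity over S is checked by
  Baer's criterion, because \<open>injective_module\<close> tests only one type of elements,
  different for R and S.\<close>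

lemma (in abelian_group) neg_zero [simp]: "\<ominus> \<zero> = \<zero>"
  by (rule minus_equality) simp_all

lemma (in abelian_group) minus_self [simp]: "x \<in> carrier G ==> x \<ominus> x = \<zero>"
  by (simp add: minus_eq r_neg)

lemma (in abelian_group) minus_eq_iff:
  "x \<in> carrier G ==> y \<in> carrier G ==> z \<in> carrier G ==> x \<ominus> y = z \<longleftrightarrow> x = z \<oplus> y"
  by (metis a_inv_closed add.inv_solve_right minus_eq)

lemma (in abelian_group) minus_eq_zero_iff [simp]:
  "x \<in> carrier G ==> y \<in> carrier G ==> x \<ominus> y = \<zero> \<longleftrightarrow> x = y"
  by (simp add: minus_eq_iff)

lemma (in abelian_group) minus_add_cancel [simp]:
  "x \<in> carrier G ==> y \<in> carrier G ==> (x \<ominus> y) \<oplus> y = x"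
  by (metis minus_closed minus_eq_iff)

lemma (in abelian_group) minus_add_minus:
  assumes "x \<in> carrier G" "y \<in> carrier G" "z \<in> carrier G"
  shows "(x \<ominus> y) \<oplus> (y \<ominus> z) = x \<ominus> z"
proof -
  have "(x \<ominus> y) \<oplus> (y \<ominus> z) = ((x \<ominus> y) \<oplus> y) \<oplus> (\<ominus> z)"
    using assms by (simp add: minus_eq[of y z] a_assoc del: minus_add_cancel)
  then show ?thesis using assms by (simp add: minus_eq[of x z])
qed

lemma (in abelian_group) minus_zero_right [simp]: "x \<in> carrier G ==> x \<ominus> \<zero> = x"
  by (simp add: minus_eq)

lemma regular_module_simps [simp]:
  "carrier (regular_module R) = carrier R" "zero (regular_module R) = zero R"
  "add (regular_module R) = add R" "smult (regular_module R) = monoid.mult R"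
  by (simp_all add: regular_module_def)

lemma regular_module_inv [simp]: "a_inv (regular_module R) = a_inv R" "a_minus (regular_module R) = a_minus R"
  by (simp_all add: a_inv_def a_minus_def m_inv_def fun_eq_iff)

lemma (in cring) regular_module_is_module: "module R (regular_module R)"
proof (rule moduleI)
  show "abelian_group (regular_module R)"
  proof (rule abelian_groupI)
    fix x assume "x \<in> carrier (regular_module R)"
    then show "\<exists>y\<in>carrier (regular_module R). y \<oplus>\<^bsub>regular_module R\<^esub> x = \<zero>\<^bsub>regular_module R\<^esub>"
      by (intro bexI[of _ "\<ominus> x"]) (auto simp: l_neg)
  qed (auto simp: a_assoc, simp_all add: a_comm)
qed (auto simp: l_distr r_distr m_assoc is_cring)

text \<open>A recursive sum instead of \<open>finsum\<close>: its equations need no closure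
  assumptions and involve only zero, addition and scalar multiplication, so it is literally the same
  for modules that share these operations.\<close>

primrec lincomb :: "('a, 'b, 'm) module_scheme => (nat => 'a) => (nat => 'b) => nat => 'b" where
  "lincomb M r z 0 = (zero M)"
| "lincomb M r z (Suc n) = lincomb M r z n \<oplus>\<^bsub>M\<^esub> r n \<odot>\<^bsub>M\<^esub> z n"

lemma lincomb_cong:
  "(\<And>i. i < n ==> r i = r' i) ==> (\<And>i. i < n ==> z i = z' i) ==> lincomb M r z n = lincomb M r' z' n"
  by (induction n) auto

text \<open>Total functions that vanish from q on, as in \<open>free_module R {..<q}\<close>;
  equality of vectors is equality of functions, with no lengths to compare.\<close>

definition vec :: "('a, 'b, 'm) module_scheme => nat => (nat => 'b) set" where
  "vec M q = {v. (\<forall>i. v i \<in> carrier M) \<and> (\<forall>i\<ge>q. v i = (zero M))}"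

definition mat :: "('a, 'r) ring_scheme => nat => nat => (nat => nat => 'a) set" where
  "mat R p q = {A. (\<forall>i j. A i j \<in> carrier R) \<and> (\<forall>i j. p \<le> i \<or> q \<le> j \<longrightarrow> A i j = (zero R))}"

text \<open>The length q of the sum is an argument since a matrix, being a total function, does not
  record its format.\<close>

definition act :: "('a, 'b, 'm) module_scheme => nat => (nat => nat => 'a) => (nat => 'b) => nat => 'b" where
  "act M q A v = (\<lambda>i. lincomb M (A i) v q)"

definition matmul :: "('a, 'r) ring_scheme => nat => (nat => nat => 'a) => (nat => nat => 'a) => nat => nat => 'a" where
  "matmul R q A B = (\<lambda>i j. lincomb (regular_module R) (A i) (\<lambda>k. B k j) q)"

definition transp :: "(nat => nat => 'a) => nat => nat => 'a" where
  "transp A = (\<lambda>i j. A j i)"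

text \<open>\<open>mod_hom\<close> without extensionality, so that composites and maps given by
  plain lambda terms qualify; \<open>restrict\<close> leads back to \<open>mod_hom\<close>.\<close>

definition lin :: "('a, 'r) ring_scheme => ('a, 'b, 'm) module_scheme => ('a, 'c, 'n) module_scheme => ('b => 'c) => bool" where
  "lin R M N f \<longleftrightarrow> f \<in> carrier M \<rightarrow> carrier N \<and>
    (\<forall>x\<in>carrier M. \<forall>y\<in>carrier M. f (x \<oplus>\<^bsub>M\<^esub> y) = f x \<oplus>\<^bsub>N\<^esub> f y) \<and>
    (\<forall>r\<in>carrier R. \<forall>x\<in>carrier M. f (r \<odot>\<^bsub>M\<^esub> x) = r \<odot>\<^bsub>N\<^esub> f x)"

lemma mod_hom_iff: "f \<in> mod_hom R M N \<longleftrightarrow> lin R M N f \<and> f \<in> extensional (carrier M)"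
  by (auto simp: mod_hom_def lin_def PiE_def)

lemma lin_restrict:
  assumes "module R M" shows "lin R M N (restrict f (carrier M)) \<longleftrightarrow> lin R M N f"
proof -
  interpret module R M by fact
  show ?thesis by (auto simp: lin_def Pi_iff)
qed

lemma lin_restrict_mod_hom: "module R M ==> lin R M N f ==> restrict f (carrier M) \<in> mod_hom R M N"
  by (simp add: mod_hom_iff lin_restrict)

lemma lin_closed: "lin R M N f ==> x \<in> carrier M ==> f x \<in> carrier N"
  and lin_add: "lin R M N f ==> x \<in> carrier M ==> y \<in> carrier M ==> f (x \<oplus>\<^bsub>M\<^esub> y) = f x \<oplus>\<^bsub>N\<^esub> f y"
  and lin_smult: "lin R M N f ==> r \<in> carrier R ==> x \<in> carrier M ==> f (r \<odot>\<^bsub>M\<^esub> x) = r \<odot>\<^bsub>N\<^esub> f x"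
  by (auto simp: lin_def)

lemma lin_comp: "lin R M N f ==> lin R N P g ==> lin R M P (\<lambda>x. g (f x))"
  by (auto simp: lin_def Pi_iff)

context
  fixes R :: "('a, 'r) ring_scheme" and M :: "('a, 'b, 'm) module_scheme" and N :: "('a, 'c, 'n) module_scheme" and f
  assumes M: "module R M" and N: "module R N" and f: "lin R M N f"
begin

interpretation M: module R M by (rule M)
interpretation N: module R N by (rule N)

lemma lin_zero: "f (zero M) = (zero N)"
  using lin_smult[OF f M.R.zero_closed M.zero_closed] lin_closed[OF f M.zero_closed] by simp

lemma lin_neg: "x \<in> carrier M ==> f (\<ominus>\<^bsub>M\<^esub> x) = \<ominus>\<^bsub>N\<^esub> f x"
  by (metis M.M.l_neg M.M.a_inv_closed N.M.minus_equality lin_add[OF f] lin_closed[OF f] lin_zero)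

lemma lin_minus: "x \<in> carrier M ==> y \<in> carrier M ==> f (x \<ominus>\<^bsub>M\<^esub> y) = f x \<ominus>\<^bsub>N\<^esub> f y"
  by (simp add: M.M.minus_eq N.M.minus_eq lin_add[OF f] lin_neg)

lemma lin_inj_on: "(\<And>x. x \<in> carrier M ==> f x = (zero N) ==> x = (zero M)) ==> inj_on f (carrier M)"
  by (rule inj_onI) (metis M.M.minus_closed M.M.minus_eq_zero_iff N.M.minus_eq_zero_iff lin_closed[OF f] lin_minus)

end

context module
begin

lemma lincomb_closed [simp]:
  "(\<And>i. r i \<in> carrier R) ==> (\<And>i. z i \<in> carrier M) ==> lincomb M r z n \<in> carrier M"
  by (induction n) auto

lemma lincomb_add_left:
  "(\<And>i. r i \<in> carrier R) ==> (\<And>i. s i \<in> carrier R) ==> (\<And>i. z i \<in> carrier M) ==>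
    lincomb M (\<lambda>i. r i \<oplus> s i) z n = lincomb M r z n \<oplus>\<^bsub>M\<^esub> lincomb M s z n"
  by (induction n) (auto simp: smult_l_distr M.a_ac)

lemma lincomb_add_right:
  "(\<And>i. r i \<in> carrier R) ==> (\<And>i. y i \<in> carrier M) ==> (\<And>i. z i \<in> carrier M) ==>
    lincomb M r (\<lambda>i. y i \<oplus>\<^bsub>M\<^esub> z i) n = lincomb M r y n \<oplus>\<^bsub>M\<^esub> lincomb M r z n"
  by (induction n) (auto simp: smult_r_distr M.a_ac)

lemma lincomb_smult_left:
  "a \<in> carrier R ==> (\<And>i. r i \<in> carrier R) ==> (\<And>i. z i \<in> carrier M) ==>
    lincomb M (\<lambda>i. a \<otimes> r i) z n = a \<odot>\<^bsub>M\<^esub> lincomb M r z n"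
  by (induction n) (auto simp: smult_r_distr smult_assoc1)

lemma lincomb_smult_right:
  "a \<in> carrier R ==> (\<And>i. r i \<in> carrier R) ==> (\<And>i. z i \<in> carrier M) ==>
    lincomb M r (\<lambda>i. a \<odot>\<^bsub>M\<^esub> z i) n = a \<odot>\<^bsub>M\<^esub> lincomb M r z n"
  by (induction n) (auto simp: smult_r_distr simp flip: smult_assoc1 intro: arg_cong2[where f = "(\<odot>\<^bsub>M\<^esub>)"] R.m_comm)

lemma lincomb_zero_left: "(\<And>i. i < n ==> r i = \<zero>) ==> (\<And>i. z i \<in> carrier M) ==> lincomb M r z n = (zero M)"
  by (induction n) auto

lemma lincomb_zero_right: "(\<And>i. i < n ==> z i = (zero M)) ==> (\<And>i. r i \<in> carrier R) ==> lincomb M r z n = (zero M)"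
  by (induction n) auto

lemma lincomb_neg_left:
  "(\<And>i. r i \<in> carrier R) ==> (\<And>i. z i \<in> carrier M) ==>
    lincomb M (\<lambda>i. \<ominus> r i) z n = \<ominus>\<^bsub>M\<^esub> lincomb M r z n"
  by (induction n) (auto simp: smult_l_minus M.minus_add)

lemma lincomb_neg_right:
  "(\<And>i. r i \<in> carrier R) ==> (\<And>i. z i \<in> carrier M) ==>
    lincomb M r (\<lambda>i. \<ominus>\<^bsub>M\<^esub> z i) n = \<ominus>\<^bsub>M\<^esub> lincomb M r z n"
  by (induction n) (auto simp: smult_r_minus M.minus_add)

lemma lincomb_minus_right:
  "(\<And>i. r i \<in> carrier R) ==> (\<And>i. y i \<in> carrier M) ==> (\<And>i. z i \<in> carrier M) ==>
    lincomb M r (\<lambda>i. y i \<ominus>\<^bsub>M\<^esub> z i) n = lincomb M r y n \<ominus>\<^bsub>M\<^esub> lincomb M r z n"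
  by (simp add: M.minus_eq lincomb_add_right lincomb_neg_right)

lemma lincomb_minus_left:
  "(\<And>i. r i \<in> carrier R) ==> (\<And>i. s i \<in> carrier R) ==> (\<And>i. z i \<in> carrier M) ==>
    lincomb M (\<lambda>i. r i \<ominus> s i) z n = lincomb M r z n \<ominus>\<^bsub>M\<^esub> lincomb M s z n"
  by (simp add: R.minus_eq M.minus_eq lincomb_add_left lincomb_neg_left)

lemma lincomb_unit:
  "i < n ==> (\<And>i. z i \<in> carrier M) ==> lincomb M (unit_vector R i) z n = z i"
proof (induction n)
  case (Suc n)
  show ?case
  proof (cases "i = n")
    case True
    have "lincomb M (unit_vector R i) z n = (zero M)"
      using True Suc.prems by (intro lincomb_zero_left) (auto simp: unit_vector_def)
    with True Suc.prems show ?thesis by (simp add: unit_vector_def)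
  next
    case False
    with Suc show ?thesis by (simp add: unit_vector_def)
  qed
qed simp

lemma lincomb_split:
  "(\<And>i. r i \<in> carrier R) ==> (\<And>i. z i \<in> carrier M) ==>
    lincomb M r z (p + q) = lincomb M r z p \<oplus>\<^bsub>M\<^esub> lincomb M (\<lambda>i. r (p + i)) (\<lambda>i. z (p + i)) q"
  by (induction q) (auto simp: M.a_assoc)

end

lemma lincomb_lin:
  assumes "module R M" "module R N" "lin R M N f" "\<And>i. r i \<in> carrier R" "\<And>i. z i \<in> carrier M"
  shows "f (lincomb M r z n) = lincomb N r (\<lambda>i. f (z i)) n"
proof -
  interpret M: module R M by fact
  show ?thesis
    by (induction n) (simp_all add: lin_zero[OF assms(1-3)] lin_add[OF assms(3)] lin_smult[OF assms(3)] assms)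
qed

lemma (in cring) lincomb_regular_closed [simp]:
  "(\<And>i. r i \<in> carrier R) ==> (\<And>i. z i \<in> carrier R) ==> lincomb (regular_module R) r z n \<in> carrier R"
  using module.lincomb_closed[OF regular_module_is_module, of r z n] by simp

lemma (in cring) lincomb_regular_comm:
  "(\<And>i. r i \<in> carrier R) ==> (\<And>i. z i \<in> carrier R) ==>
    lincomb (regular_module R) r z n = lincomb (regular_module R) z r n"
  by (induction n) (auto simp: m_comm)

context module
begin

text \<open>Interchange of two finite sums, by induction on the outer one. It is the associativity
  of the matrix action, \<open>act_matmul\<close>.\<close>

lemma lincomb_lincomb:
  assumes "\<And>i. r i \<in> carrier R" "\<And>i j. A i j \<in> carrier R" "\<And>i. z i \<in> carrier M"
  shows "lincomb M (\<lambda>j. lincomb (regular_module R) r (\<lambda>i. A i j) m) z n = lincomb M r (\<lambda>i. lincomb M (A i) z n) m"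
proof (induction m)
  case 0
  show ?case using assms by (simp add: lincomb_zero_left)
next
  case (Suc m)
  have "lincomb M (\<lambda>j. lincomb (regular_module R) r (\<lambda>i. A i j) (Suc m)) z n =
     lincomb M (\<lambda>j. lincomb (regular_module R) r (\<lambda>i. A i j) m) z n \<oplus>\<^bsub>M\<^esub> lincomb M (\<lambda>j. r m \<otimes> A m j) z n"
    using assms by (simp add: lincomb_add_left)
  also have "lincomb M (\<lambda>j. r m \<otimes> A m j) z n = r m \<odot>\<^bsub>M\<^esub> lincomb M (A m) z n"
    using assms by (simp add: lincomb_smult_left)
  finally show ?case using Suc by simp
qed

lemma vec_closed [simp]: "v \<in> vec M q ==> v i \<in> carrier M"
  by (simp add: vec_def)

lemma zero_vec [simp]: "(\<lambda>i. (zero M)) \<in> vec M q"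
  and add_vec [simp]: "u \<in> vec M q ==> v \<in> vec M q ==> (\<lambda>i. u i \<oplus>\<^bsub>M\<^esub> v i) \<in> vec M q"
  and neg_vec [simp]: "u \<in> vec M q ==> (\<lambda>i. \<ominus>\<^bsub>M\<^esub> u i) \<in> vec M q"
  and minus_vec [simp]: "u \<in> vec M q ==> v \<in> vec M q ==> (\<lambda>i. u i \<ominus>\<^bsub>M\<^esub> v i) \<in> vec M q"
  and smult_vec [simp]: "a \<in> carrier R ==> u \<in> vec M q ==> (\<lambda>i. a \<odot>\<^bsub>M\<^esub> u i) \<in> vec M q"
  by (auto simp del: vec_closed simp: vec_def M.minus_eq)

lemma mat_closed [simp]: "A \<in> mat R p q ==> A i j \<in> carrier R"
  by (simp del: vec_closed add: mat_def)

lemma act_closed [simp]: "A \<in> mat R p q ==> v \<in> vec M n ==> act M n A v \<in> vec M p"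
  by (auto simp del: vec_closed mat_closed simp: vec_def mat_def act_def intro!: lincomb_closed lincomb_zero_left)

lemma act_add: "A \<in> mat R p q ==> u \<in> vec M n ==> v \<in> vec M n ==>
    act M n A (\<lambda>i. u i \<oplus>\<^bsub>M\<^esub> v i) = (\<lambda>i. act M n A u i \<oplus>\<^bsub>M\<^esub> act M n A v i)"
  by (simp add: act_def lincomb_add_right)

lemma act_minus: "A \<in> mat R p q ==> u \<in> vec M n ==> v \<in> vec M n ==>
    act M n A (\<lambda>i. u i \<ominus>\<^bsub>M\<^esub> v i) = (\<lambda>i. act M n A u i \<ominus>\<^bsub>M\<^esub> act M n A v i)"
  by (simp add: act_def lincomb_minus_right)

lemma act_neg: "A \<in> mat R p q ==> u \<in> vec M n ==>
    act M n A (\<lambda>i. \<ominus>\<^bsub>M\<^esub> u i) = (\<lambda>i. \<ominus>\<^bsub>M\<^esub> act M n A u i)"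
  by (simp add: act_def lincomb_neg_right)

lemma act_smult: "A \<in> mat R p q ==> a \<in> carrier R ==> u \<in> vec M n ==>
    act M n A (\<lambda>i. a \<odot>\<^bsub>M\<^esub> u i) = (\<lambda>i. a \<odot>\<^bsub>M\<^esub> act M n A u i)"
  by (simp add: act_def lincomb_smult_right)

lemma act_zero [simp]: "A \<in> mat R p q ==> act M n A (\<lambda>i. (zero M)) = (\<lambda>i. (zero M))"
  by (simp add: act_def lincomb_zero_right)

lemma act_zero_mat [simp]: "u \<in> vec M n ==> act M n (\<lambda>i j. \<zero>) u = (\<lambda>i. (zero M))"
  by (simp add: act_def lincomb_zero_left)

lemma act_matmul: "A \<in> mat R p q ==> B \<in> mat R q' n' ==> v \<in> vec M n ==>
    act M m A (act M n B v) = act M n (matmul R m A B) v"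
  unfolding act_def matmul_def by (rule ext, rule lincomb_lincomb[symmetric]) simp_all

lemma act_add_mat: "A \<in> mat R p q ==> B \<in> mat R p' q' ==> v \<in> vec M n ==>
    act M n (\<lambda>i j. A i j \<oplus> B i j) v = (\<lambda>i. act M n A v i \<oplus>\<^bsub>M\<^esub> act M n B v i)"
  by (simp add: act_def lincomb_add_left)

lemma act_minus_mat: "A \<in> mat R p q ==> B \<in> mat R p' q' ==> v \<in> vec M n ==>
    act M n (\<lambda>i j. A i j \<ominus> B i j) v = (\<lambda>i. act M n A v i \<ominus>\<^bsub>M\<^esub> act M n B v i)"
  by (simp add: act_def lincomb_minus_left)

lemma act_smult_mat: "A \<in> mat R p q ==> a \<in> carrier R ==> v \<in> vec M n ==>
    act M n (\<lambda>i j. a \<otimes> A i j) v = (\<lambda>i. a \<odot>\<^bsub>M\<^esub> act M n A v i)"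
  by (simp add: act_def lincomb_smult_left)

end

definition one_mat :: "('a, 'r) ring_scheme => nat => nat => nat => 'a" where
  "one_mat R n = (\<lambda>i j. if i = j \<and> i < n then \<one>\<^bsub>R\<^esub> else (zero R))"

lemma (in module) act_one_mat [simp]:
  assumes v: "v \<in> vec M n" shows "act M n (one_mat R n) v = v"
proof
  fix i
  show "act M n (one_mat R n) v i = v i"
  proof (cases "i < n")
    case True
    then have "act M n (one_mat R n) v i = lincomb M (unit_vector R i) v n"
      by (auto simp del: vec_closed mat_closed simp: act_def one_mat_def unit_vector_def intro!: lincomb_cong)
    with True v show ?thesis by (simp add: lincomb_unit)
  next
    case False
    with v show ?thesis by (auto simp del: vec_closed mat_closed simp: act_def one_mat_def vec_def intro!: lincomb_zero_left)
  qed
qed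

text \<open>Naturality of the matrix action in the coefficient module: a linear map applied
  entrywise is a map of complexes.\<close>

lemma act_lin:
  assumes "module R M" "module R N" "lin R M N f" "A \<in> mat R p q" "v \<in> vec M n"
  shows "act N m A (\<lambda>i. f (v i)) = (\<lambda>i. f (act M m A v i))"
  using assms lincomb_lin[OF assms(1-3), of _ v m] by (auto simp: act_def mat_def vec_def)

lemma lin_vec: "module R M ==> module R N ==> lin R M N f ==> v \<in> vec M n ==> (\<lambda>i. f (v i)) \<in> vec N n"
  by (auto simp: vec_def lin_closed lin_zero)

lemma transp_mat [simp]: "transp A \<in> mat R p q \<longleftrightarrow> A \<in> mat R q p"
  by (auto simp: mat_def transp_def)

context cring
begin

lemma mat_entry [simp]: "A \<in> mat R p q ==> A i j \<in> carrier R"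
  by (simp add: mat_def)

lemma zero_mat [simp]: "(\<lambda>i j. \<zero>) \<in> mat R p q"
  and one_mat_mat [simp]: "one_mat R n \<in> mat R n n"
  and add_mat [simp]: "A \<in> mat R p q ==> B \<in> mat R p q ==> (\<lambda>i j. A i j \<oplus> B i j) \<in> mat R p q"
  and minus_mat [simp]: "A \<in> mat R p q ==> B \<in> mat R p q ==> (\<lambda>i j. A i j \<ominus> B i j) \<in> mat R p q"
  and neg_mat [simp]: "A \<in> mat R p q ==> (\<lambda>i j. \<ominus> A i j) \<in> mat R p q"
  and smult_mat [simp]: "a \<in> carrier R ==> A \<in> mat R p q ==> (\<lambda>i j. a \<otimes> A i j) \<in> mat R p q"
  by (auto simp del: mat_entry simp: mat_def one_mat_def minus_eq)

lemma vec_regular_closed [simp]: "v \<in> vec (regular_module R) q ==> v i \<in> carrier R"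
  by (simp del: mat_entry add: vec_def)

lemma matmul_mat [simp]:
  assumes "A \<in> mat R p q" "B \<in> mat R q' r" shows "matmul R n A B \<in> mat R p r"
proof -
  interpret M: module R "regular_module R" by (rule regular_module_is_module)
  have "matmul R n A B i j = \<zero>" if "p \<le> i" for i j
    using assms that M.lincomb_zero_left[of n "A i" "\<lambda>k. B k j"] by (auto simp del: mat_entry vec_regular_closed M.vec_closed M.mat_closed simp: matmul_def mat_def)
  moreover have "matmul R n A B i j = \<zero>" if "r \<le> j" for i j
    using assms that M.lincomb_zero_right[of n "\<lambda>k. B k j" "A i"] by (auto simp del: mat_entry vec_regular_closed M.vec_closed M.mat_closed simp: matmul_def mat_def)
  ultimately show ?thesis using assms by (auto simp del: mat_entry vec_regular_closed M.vec_closed M.mat_closed simp: mat_def) (auto simp del: mat_entry vec_regular_closed simp: matmul_def)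
qed

lemma transp_matmul:
  "A \<in> mat R p q ==> B \<in> mat R q' r ==> transp (matmul R n A B) = matmul R n (transp B) (transp A)"
  unfolding transp_def matmul_def by (intro ext lincomb_regular_comm) simp_all

lemma unit_vector_closed [simp]: "unit_vector R i j \<in> carrier R"
  by (simp add: unit_vector_def)

lemma unit_vector_vec [simp]: "i < n ==> unit_vector R i \<in> vec (regular_module R) n"
  by (auto simp del: mat_entry vec_regular_closed simp: vec_def) (simp add: unit_vector_def)

lemma column_vec [simp]: "A \<in> mat R p q ==> (\<lambda>i. A i j) \<in> vec (regular_module R) p"
  by (auto simp del: mat_entry vec_regular_closed simp: vec_def mat_def)

lemma act_unit_vector:
  assumes "A \<in> mat R p q" "j < n"
  shows "act (regular_module R) n A (unit_vector R j) = (\<lambda>i. A i j)"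
proof -
  interpret M: module R "regular_module R" by (rule regular_module_is_module)
  show ?thesis
    unfolding act_def using assms M.lincomb_unit[of j n "A _"] by (simp add: lincomb_regular_comm[of _ "unit_vector R j"])
qed

lemma mat_eqI:
  assumes "A \<in> mat R p q" "B \<in> mat R p' q"
    and "\<And>v. v \<in> vec (regular_module R) q ==> act (regular_module R) q A v = act (regular_module R) q B v"
  shows "A = B"
proof (intro ext)
  fix i j
  show "A i j = B i j"
  proof (cases "j < q")
    case True
    then show ?thesis
      using assms(3)[OF unit_vector_vec[OF True]] fun_cong[of "\<lambda>i. A i j" "\<lambda>i. B i j" i]
      by (simp add: act_unit_vector[OF assms(1)] act_unit_vector[OF assms(2)])
  next
    case False
    with assms(1,2) show ?thesis by (simp del: mat_entry add: mat_def)
  qed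
qed

text \<open>Projectivity of a free module in matrix form: a matrix whose columns lie in the image of
  A factors through A. Columns from r on are zero and lift to zero.\<close>

lemma lift_matrix:
  assumes C: "C \<in> mat R p r" and A: "A \<in> mat R p' q"
    and lift: "\<And>j. j < r ==> \<exists>w \<in> vec (regular_module R) q. (\<lambda>i. C i j) = act (regular_module R) q A w"
  obtains W where "W \<in> mat R q r" "C = matmul R q A W"
proof -
  interpret M: module R "regular_module R" by (rule regular_module_is_module)
  obtain w where w: "\<And>j. j < r ==> w j \<in> vec (regular_module R) q \<and> (\<lambda>i. C i j) = act (regular_module R) q A (w j)"
    using lift by metis
  let ?W = "\<lambda>i j. if j < r then w j i else \<zero>"
  have W: "?W \<in> mat R q r" using w by (auto simp del: mat_entry vec_regular_closed M.vec_closed M.mat_closed simp: mat_def vec_def)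
  moreover have "C = matmul R q A ?W"
  proof (intro ext)
    fix i j
    show "C i j = matmul R q A ?W i j"
    proof (cases "j < r")
      case True
      then show ?thesis using w[OF True] fun_cong[of "\<lambda>i. C i j" _ i] by (simp add: matmul_def act_def)
    next
      case False
      with C A show ?thesis using M.lincomb_zero_right[of q "\<lambda>_. \<zero>" "A i"]
        by (simp del: mat_entry vec_regular_closed add: mat_def matmul_def)
    qed
  qed
  ultimately show ?thesis by (rule that)
qed

end

section \<open>Exactness\<close>

text \<open>Only the inclusion of the kernel of A in the image of B. That the product of A and B is
  zero is a separate assumption where it matters.\<close>

definition exact_at :: "('a, 'b, 'm) module_scheme => nat => nat => (nat => nat => 'a) => (nat => nat => 'a) => bool" where
  "exact_at M p q B A \<longleftrightarrow>
    (\<forall>v \<in> vec M q. act M q A v = (\<lambda>i. (zero M)) \<longrightarrow> (\<exists>w \<in> vec M p. v = act M p B w))"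

lemma exact_atD:
  assumes "exact_at M p q B A" "v \<in> vec M q" "act M q A v = (\<lambda>i. (zero M))"
  obtains w where "w \<in> vec M p" "v = act M p B w"
  using assms by (auto simp: exact_at_def)

definition short_exact ::
    "('a, 'r) ring_scheme => ('a, 'b, 'm) module_scheme => ('a, 'c, 'n) module_scheme => ('a, 'd, 'o) module_scheme =>
      ('b => 'c) => ('c => 'd) => bool" where
  "short_exact R N' N N'' i p \<longleftrightarrow> module R N' \<and> module R N \<and> module R N'' \<and> lin R N' N i \<and> lin R N N'' p \<and>
    inj_on i (carrier N') \<and> p ` carrier N = carrier N'' \<and>
    (\<forall>x\<in>carrier N. p x = (zero N'') \<longleftrightarrow> x \<in> i ` carrier N')"

lemma vec_choice:
  assumes "module R N" "\<And>j. j < q ==> \<exists>x\<in>carrier N. P j x"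
  obtains v where "v \<in> vec N q" "\<And>j. j < q ==> P j (v j)"
proof -
  interpret module R N by fact
  obtain w where "\<And>j. j < q ==> w j \<in> carrier N \<and> P j (w j)" using assms(2) by metis
  then show ?thesis
    by (intro that[of "\<lambda>j. if j < q then w j else (zero N)"]) (auto simp del: vec_closed simp: vec_def)
qed

lemma vec_zero_outside: "v \<in> vec M q ==> q \<le> i ==> v i = (zero M)"
  by (simp add: vec_def)

lemma vec_ext:
  assumes "u \<in> vec M q" "v \<in> vec M q" "\<And>i. i < q ==> u i = v i" shows "u = v"
  using assms by (intro ext) (metis not_le vec_zero_outside)

lemma lift_vec:
  assumes M: "module R M" and N: "module R N" and f: "lin R M N f" and v: "v \<in> vec N q"
    and im: "\<And>i. i < q ==> v i \<in> f ` carrier M"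
  obtains u where "u \<in> vec M q" "v = (\<lambda>i. f (u i))"
proof -
  have "\<exists>x\<in>carrier M. v j = f x" if "j < q" for j using im[OF that] by auto
  then obtain u where u: "u \<in> vec M q" "\<And>j. j < q ==> v j = f (u j)"
    using vec_choice[OF M, of q "\<lambda>j x. v j = f x"] by metis
  then have "v = (\<lambda>i. f (u i))" using lin_vec[OF M N f u(1)] v by (intro vec_ext) auto
  with u(1) show ?thesis by (rule that)
qed

lemma (in module) act_act_zero:
  assumes "A \<in> mat R r q'" "B \<in> mat R q'' p'" "matmul R q A B = (\<lambda>i j. \<zero>)" "v \<in> vec M p"
  shows "act M q A (act M p B v) = (\<lambda>i. (zero M))"
  using assms by (simp add: act_matmul)

context
  fixes R :: "('a, 'r) ring_scheme" and N' :: "('a, 'b, 'm) module_scheme" and N :: "('a, 'c, 'n) module_scheme"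
    and N'' :: "('a, 'd, 'o) module_scheme" and i p
  assumes se: "short_exact R N' N N'' i p"
begin

lemma se_modules: "module R N'" "module R N" "module R N''" "lin R N' N i" "lin R N N'' p"
  and se_surj: "x \<in> carrier N'' ==> x \<in> p ` carrier N"
  and se_ker: "y \<in> carrier N ==> p y = (zero N'') \<longleftrightarrow> y \<in> i ` carrier N'"
  and se_inj: "inj_on i (carrier N')"
  using se by (auto simp: short_exact_def)

interpretation N': module R N' by (rule se_modules)
interpretation N: module R N by (rule se_modules)
interpretation N'': module R N'' by (rule se_modules)

lemma se_inj_vec:
  assumes "u \<in> vec N' q" "(\<lambda>j. i (u j)) = (\<lambda>j. (zero N))" shows "u = (\<lambda>j. (zero N'))"
proof
  fix j
  have "i (u j) = i (zero N')" using fun_cong[OF assms(2), of j] lin_zero[OF se_modules(1,2,4)] by simp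
  then show "u j = (zero N')" using se_inj assms(1) by (simp add: inj_on_eq_iff)
qed

lemma se_lift_kernel:
  assumes "v \<in> vec N q" "(\<lambda>j. p (v j)) = (\<lambda>j. (zero N''))"
  obtains u where "u \<in> vec N' q" "v = (\<lambda>j. i (u j))"
proof (rule lift_vec[OF se_modules(1,2,4) assms(1)])
  fix j show "v j \<in> i ` carrier N'" using se_ker[of "v j"] assms fun_cong[OF assms(2), of j] by simp
qed (rule that)

lemma se_lift:
  assumes "v \<in> vec N'' q" obtains u where "u \<in> vec N q" "v = (\<lambda>j. p (u j))"
proof (rule lift_vec[OF se_modules(2,3,5) assms])
  fix j show "v j \<in> p ` carrier N" using assms by (intro se_surj) simp
qed (rule that)

text \<open>The piece H(N) -> H(N'') -> H(N') of the long exact sequence, the last term one position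
  further along: if the outer terms vanish, so does the middle one. The chase lifts a cycle to N,
  corrects it by an element coming from N' to a cycle, and uses exactness for N.\<close>

lemma exact_at_quotient:
  assumes A: "A \<in> mat R r q" and B: "B \<in> mat R q k" and D: "D \<in> mat R s r" and DA: "matmul R r D A = (\<lambda>i j. (zero R))"
    and N: "exact_at N k q B A" and N': "exact_at N' q r A D"
  shows "exact_at N'' k q B A"
  unfolding exact_at_def
proof (intro ballI impI)
  fix v'' assume v'': "v'' \<in> vec N'' q" "act N'' q A v'' = (\<lambda>i. (zero N''))"
  obtain v where v: "v \<in> vec N q" "v'' = (\<lambda>j. p (v j))" using v''(1) by (rule se_lift)
  have "(\<lambda>j. p (act N q A v j)) = (\<lambda>i. (zero N''))"
    using v'' act_lin[OF se_modules(2,3,5) A v(1), of q] by (simp add: v(2))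
  with N.act_closed[OF A v(1)] obtain u where u: "u \<in> vec N' r" "act N q A v = (\<lambda>j. i (u j))"
    by (rule se_lift_kernel)
  have "(\<lambda>j. i (act N' r D u j)) = (\<lambda>i. (zero N))"
    using act_lin[OF se_modules(1,2,4) D u(1), of r] N.act_act_zero[OF D A DA v(1)] by (simp add: u(2))
  with N'.act_closed[OF D u(1)] have "act N' r D u = (\<lambda>i. (zero N'))" by (rule se_inj_vec)
  with N' u(1) obtain w where w: "w \<in> vec N' q" "u = act N' q A w" by (rule exact_atD)
  let ?iw = "\<lambda>j. i (w j)" and ?y = "\<lambda>j. v j \<ominus>\<^bsub>N\<^esub> i (w j)"
  have iw: "?iw \<in> vec N q" using w(1) by (rule lin_vec[OF se_modules(1,2,4)])
  then have y: "?y \<in> vec N q" using v(1) by simp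
  have "act N q A ?y = (\<lambda>j. (zero N))"
    using v(1) iw lin_closed[OF se_modules(4) N'.vec_closed[OF N'.act_closed[OF A w(1)]]]
      act_lin[OF se_modules(1,2,4) A w(1), of q]
    by (simp add: N.act_minus[OF A] u(2) w(2))
  with N y obtain z where z: "z \<in> vec N k" "?y = act N k B z" by (rule exact_atD)
  have "v'' = (\<lambda>j. p (act N k B z j))"
  proof
    fix j
    have "p (?y j) = p (v j) \<ominus>\<^bsub>N''\<^esub> p (i (w j))" using v(1) N.vec_closed[OF iw, of j] by (intro lin_minus[OF se_modules(2,3,5)]) simp_all
    moreover have "p (i (w j)) = (zero N'')" using se_ker[OF N.vec_closed[OF iw, of j]] w(1) by simp
    ultimately show "v'' j = p (act N k B z j)"
      using N''.vec_closed[OF v''(1), of j] fun_cong[OF z(2), of j] by (simp add: v(2))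
  qed
  also have "\<dots> = act N'' k B (\<lambda>j. p (z j))" using act_lin[OF se_modules(2,3,5) B z(1), of k] by simp
  finally show "\<exists>w\<in>vec N'' k. v'' = act N'' k B w" using lin_vec[OF se_modules(2,3,5) z(1)] by blast
qed

text \<open>The piece H(N'') -> H(N') -> H(N), the first term one position earlier. A cycle of N'
  becomes B w in N; modulo N' this w is a cycle, hence a boundary, and subtracting a lift of that
  boundary moves w into N'.\<close>

lemma exact_at_sub:
  assumes A: "A \<in> mat R r q" and B: "B \<in> mat R q k" and C: "C \<in> mat R k l" and BC: "matmul R k B C = (\<lambda>i j. (zero R))"
    and N: "exact_at N k q B A" and N'': "exact_at N'' l k C B"
  shows "exact_at N' k q B A"
  unfolding exact_at_def
proof (intro ballI impI)
  fix v assume v: "v \<in> vec N' q" "act N' q A v = (\<lambda>i. (zero N'))"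
  have iv: "(\<lambda>j. i (v j)) \<in> vec N q" using v(1) by (rule lin_vec[OF se_modules(1,2,4)])
  have "act N q A (\<lambda>j. i (v j)) = (\<lambda>i. (zero N))"
    using act_lin[OF se_modules(1,2,4) A v(1), of q] by (simp add: v(2) lin_zero[OF se_modules(1,2,4)])
  with N iv obtain w where w: "w \<in> vec N k" "(\<lambda>j. i (v j)) = act N k B w" by (rule exact_atD)
  have pw: "(\<lambda>j. p (w j)) \<in> vec N'' k" using w(1) by (rule lin_vec[OF se_modules(2,3,5)])
  have pi: "p (i x) = (zero N'')" if "x \<in> carrier N'" for x
    using se_ker[of "i x"] that lin_closed[OF se_modules(4) that] by simp
  have "act N'' k B (\<lambda>j. p (w j)) = (\<lambda>j. (zero N''))"
    using act_lin[OF se_modules(2,3,5) B w(1), of k] v(1) by (simp add: w(2)[symmetric] pi)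
  with N'' pw obtain z'' where z'': "z'' \<in> vec N'' l" "(\<lambda>j. p (w j)) = act N'' l C z''" by (rule exact_atD)
  obtain z where z: "z \<in> vec N l" "z'' = (\<lambda>j. p (z j))" using z''(1) by (rule se_lift)
  let ?y = "\<lambda>j. w j \<ominus>\<^bsub>N\<^esub> act N l C z j"
  have Cz: "act N l C z \<in> vec N k" by (rule N.act_closed[OF C z(1)])
  have y: "?y \<in> vec N k" using w(1) Cz by simp
  have "(\<lambda>j. p (?y j)) = (\<lambda>j. (zero N''))"
  proof
    fix j
    have "p (?y j) = p (w j) \<ominus>\<^bsub>N''\<^esub> p (act N l C z j)"
      using w(1) N.vec_closed[OF Cz] by (intro lin_minus[OF se_modules(2,3,5)]) simp_all
    also have "p (act N l C z j) = p (w j)"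
      using fun_cong[OF z''(2), of j] fun_cong[OF act_lin[OF se_modules(2,3,5) C z(1), of l], of j] by (simp add: z(2))
    finally show "p (?y j) = (zero N'')" using w(1) lin_closed[OF se_modules(5)] by simp
  qed
  with y obtain u where u: "u \<in> vec N' k" "?y = (\<lambda>j. i (u j))" by (rule se_lift_kernel)
  have "(\<lambda>j. i (act N' k B u j)) = act N k B ?y"
    using act_lin[OF se_modules(1,2,4) B u(1), of k] by (simp add: u(2))
  also have "\<dots> = (\<lambda>j. i (v j))"
    using w Cz N.act_act_zero[OF B C BC z(1)] N.act_closed[OF B w(1)] by (simp add: N.act_minus[OF B])
  finally have "i (act N' k B u j) = i (v j)" for j by meson
  then have "v = act N' k B u"
    using se_inj v(1) u(1) N'.vec_closed[OF N'.act_closed[OF B u(1)]] by (auto simp: inj_on_eq_iff)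
  with u(1) show "\<exists>w\<in>vec N' k. v = act N' k B w" by blast
qed

end

text \<open>The input for Nakayama's lemma: when the homology of \<open>N / xN\<close> vanishes, the homology
  \<open>H\<close> of \<open>N\<close> satisfies \<open>H = x H\<close>.\<close>

lemma exact_at_mod_regular:
  assumes se: "short_exact R N N N'' (\<lambda>y. x \<odot>\<^bsub>N\<^esub> y) p" and x: "x \<in> carrier R"
    and A: "A \<in> mat R r q" and B: "B \<in> mat R q k" and AB: "matmul R q A B = (\<lambda>i j. (zero R))"
    and N'': "exact_at N'' k q B A" and v: "v \<in> vec N q" "act N q A v = (\<lambda>i. (zero N))"
  obtains u w where "u \<in> vec N q" "act N q A u = (\<lambda>i. (zero N))" "w \<in> vec N k"
    "v = (\<lambda>j. x \<odot>\<^bsub>N\<^esub> u j \<oplus>\<^bsub>N\<^esub> act N k B w j)"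
proof -
  note m = se_modules[OF se]
  interpret N: module R N by (rule m)
  interpret N'': module R N'' by (rule m)
  have pv: "(\<lambda>j. p (v j)) \<in> vec N'' q" using v(1) by (rule lin_vec[OF m(2,3,5)])
  have "act N'' q A (\<lambda>j. p (v j)) = (\<lambda>i. (zero N''))"
    using act_lin[OF m(2,3,5) A v(1), of q] by (simp add: v(2) lin_zero[OF m(2,3,5)])
  with N'' pv obtain w'' where w'': "w'' \<in> vec N'' k" "(\<lambda>j. p (v j)) = act N'' k B w''" by (rule exact_atD)
  obtain w where w: "w \<in> vec N k" "w'' = (\<lambda>j. p (w j))" using se w''(1) by (rule se_lift)
  let ?y = "\<lambda>j. v j \<ominus>\<^bsub>N\<^esub> act N k B w j"
  have Bw: "act N k B w \<in> vec N q" by (rule N.act_closed[OF B w(1)])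
  have y: "?y \<in> vec N q" using v(1) Bw by simp
  have "(\<lambda>j. p (?y j)) = (\<lambda>j. (zero N''))"
  proof
    fix j
    have "p (?y j) = p (v j) \<ominus>\<^bsub>N''\<^esub> p (act N k B w j)"
      using v(1) N.vec_closed[OF Bw] by (intro lin_minus[OF m(2,3,5)]) simp_all
    also have "p (act N k B w j) = p (v j)"
      using fun_cong[OF w''(2), of j] fun_cong[OF act_lin[OF m(2,3,5) B w(1), of k], of j] by (simp add: w(2))
    finally show "p (?y j) = (zero N'')" using v(1) lin_closed[OF m(5)] by simp
  qed
  with se y obtain u where u: "u \<in> vec N q" "?y = (\<lambda>j. x \<odot>\<^bsub>N\<^esub> u j)" by (rule se_lift_kernel)
  have "act N q A ?y = (\<lambda>i. (zero N))"
    using v Bw N.act_act_zero[OF A B AB w(1)] by (simp add: N.act_minus[OF A])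
  \<comment> \<open>The left-hand side is A applied to x u. Regularity of x on N makes u itself a
    cycle, which is what yields H = x H.\<close>
  then have "(\<lambda>j. x \<odot>\<^bsub>N\<^esub> act N q A u j) = (\<lambda>i. (zero N))"
    using N.act_smult[OF A x u(1)] by (simp add: u(2))
  with se N.act_closed[OF A u(1)] have "act N q A u = (\<lambda>i. (zero N))" by (rule se_inj_vec)
  moreover have "v = (\<lambda>j. x \<odot>\<^bsub>N\<^esub> u j \<oplus>\<^bsub>N\<^esub> act N k B w j)"
    using v(1) N.vec_closed[OF Bw] by (simp flip: fun_cong[OF u(2)])
  ultimately show ?thesis using u(1) w(1) that by blast
qed

text \<open>\<open>f\<close> and \<open>fr\<close>, \<open>g\<close> and \<open>gp\<close> are
  consecutive components of chain maps in opposite directions, \<open>s\<close> and \<open>t\<close>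
  of a homotopy between g f and the identity. On a cycle v the term with \<open>t\<close> drops out,
  so v is g f v minus B s v, and f v is a boundary in the exact complex.\<close>

lemma exact_at_homotopy:
  assumes M: "module R M"
    and A: "A \<in> mat R r q" and B: "B \<in> mat R q p" and A': "A' \<in> mat R r' q'" and B': "B' \<in> mat R q' p'"
    and f: "f \<in> mat R q' q" and fr: "fr \<in> mat R r' r" and g: "g \<in> mat R q q'" and gp: "gp \<in> mat R p p'"
    and s: "s \<in> mat R p q" and t: "t \<in> mat R q r"
    and Af: "matmul R q' A' f = matmul R r fr A" and gB: "matmul R q' g B' = matmul R p B gp"
    and st: "(\<lambda>i j. matmul R q' g f i j \<ominus>\<^bsub>R\<^esub> one_mat R q i j) = (\<lambda>i j. matmul R p B s i j \<oplus>\<^bsub>R\<^esub> matmul R r t A i j)"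
    and ex: "exact_at M p' q' B' A'"
  shows "exact_at M p q B A"
  unfolding exact_at_def
proof (intro ballI impI)
  interpret M: module R M by fact
  fix v assume v: "v \<in> vec M q" "act M q A v = (\<lambda>i. (zero M))"
  have fv: "act M q f v \<in> vec M q'" by (rule M.act_closed[OF f v(1)])
  have "act M q' A' (act M q f v) = act M r fr (act M q A v)"
    using v(1) by (simp add: M.act_matmul[OF A' f] M.act_matmul[OF fr A] Af)
  then have "act M q' A' (act M q f v) = (\<lambda>i. (zero M))" using M.act_zero[OF fr] by (simp add: v(2))
  with ex fv obtain w where w: "w \<in> vec M p'" "act M q f v = act M p' B' w" by (rule exact_atD)
  have gf: "act M q' g (act M q f v) = act M p B (act M p' gp w)"
    unfolding w(2) using w(1) by (simp add: M.act_matmul[OF g B'] M.act_matmul[OF B gp] gB)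
  have gpw: "act M p' gp w \<in> vec M p" and sv: "act M q s v \<in> vec M p"
    using M.act_closed[OF gp w(1)] M.act_closed[OF s v(1)] .
  have "act M q (\<lambda>i j. matmul R q' g f i j \<ominus>\<^bsub>R\<^esub> one_mat R q i j) v =
      (\<lambda>i. act M p B (act M p' gp w) i \<ominus>\<^bsub>M\<^esub> v i)"
    using M.act_minus_mat[OF M.R.matmul_mat[OF g f] M.R.one_mat_mat v(1), of q' q] v(1)
    by (simp add: M.act_matmul[OF g f, symmetric] gf)
  moreover have "act M q (\<lambda>i j. matmul R p B s i j \<oplus>\<^bsub>R\<^esub> matmul R r t A i j) v = act M p B (act M q s v)"
    using M.act_add_mat[OF M.R.matmul_mat[OF B s] M.R.matmul_mat[OF t A] v(1), of p r] v(1)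
      M.act_zero[OF t] M.vec_closed[OF M.act_closed[OF B sv]]
    by (simp add: M.act_matmul[OF B s, symmetric] M.act_matmul[OF t A, symmetric] v(2))
  ultimately have *: "act M p B (act M p' gp w) i \<ominus>\<^bsub>M\<^esub> v i = act M p B (act M q s v) i" for i
    unfolding st by metis
  have "v = act M p B (\<lambda>i. act M p' gp w i \<ominus>\<^bsub>M\<^esub> act M q s v i)"
  proof
    fix i
    have c: "act M p B (act M p' gp w) i \<in> carrier M" "act M p B (act M q s v) i \<in> carrier M"
      using M.vec_closed[OF M.act_closed[OF B gpw]] M.vec_closed[OF M.act_closed[OF B sv]] .
    have "act M p B (act M p' gp w) i = v i \<oplus>\<^bsub>M\<^esub> act M p B (act M q s v) i"
      using *[of i] c v(1) by (simp add: M.minus_eq_iff M.a_comm)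
    then show "v i = act M p B (\<lambda>i. act M p' gp w i \<ominus>\<^bsub>M\<^esub> act M q s v i) i"
      using c v(1) M.minus_eq_iff[OF c(1,2), of "v i"] by (simp add: M.act_minus[OF B gpw sv])
  qed
  with M.minus_vec[OF gpw sv] show "\<exists>w\<in>vec M p. v = act M p B w" by blast
qed

section \<open>Resolutions\<close>

text \<open>The n-th syzygy: the kernel of the augmentation in degree 0, that of \<open>A n\<close>
  in higher degrees. The two cases cannot be merged because \<open>A 0\<close> is the padding matrix
  without rows.\<close>

definition res_ker :: "('a, 'r) ring_scheme => ('a, 'b, 'm) module_scheme => (nat => nat) =>
    (nat => nat => nat => 'a) => (nat => 'b) => nat => (nat => 'a) set" where
  "res_ker R M b A e n = {v \<in> vec (regular_module R) (b (Suc n)).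
    if n = 0 then lincomb M v e (b (Suc n)) = (zero M)
    else act (regular_module R) (b (Suc n)) (A n) v = (\<lambda>i. (zero R))}"

text \<open>Indices are shifted by one against the usual convention: \<open>A (n + 1)\<close> is the matrix of the
  \<open>n\<close>-th differential \<open>R\<^bsup>b (n + 2)\<^esup> \<rightarrow> R\<^bsup>b (n + 1)\<^esup>\<close>, and \<open>b 0 = 0\<close> is a padding zero module,
  so that degree \<open>0\<close> needs no special treatment in the complexes below.\<close>

definition mres :: "('a, 'r) ring_scheme => ('a, 'b, 'm) module_scheme => (nat => nat) =>
    (nat => nat => nat => 'a) => (nat => 'b) => bool" where
  "mres R M b A e \<longleftrightarrow> module R M \<and> b 0 = 0 \<and> (\<forall>n. A n \<in> mat R (b n) (b (Suc n))) \<and> e \<in> vec M (b (Suc 0)) \<and>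
    (\<forall>m\<in>carrier M. \<exists>v\<in>vec (regular_module R) (b (Suc 0)). m = lincomb M v e (b (Suc 0))) \<and>
    (\<forall>n. res_ker R M b A e n =
      act (regular_module R) (b (Suc (Suc n))) (A (Suc n)) ` vec (regular_module R) (b (Suc (Suc n))))"

text \<open>Exactness at Hom of the n-th free module into N, which is a power of N: precomposition
  with a differential is the action of the transposed matrix. \<open>TOR\<close> does the same for
  the tensor product, without transposing.\<close>

definition EXT :: "('a, 'c, 'n) module_scheme => (nat => nat) => (nat => nat => nat => 'a) => nat => bool" where
  "EXT N b A n \<longleftrightarrow> exact_at N (b n) (b (Suc n)) (transp (A n)) (transp (A (Suc n)))"

definition TOR :: "('a, 'c, 'n) module_scheme => (nat => nat) => (nat => nat => nat => 'a) => nat => bool" where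
  "TOR N b A n \<longleftrightarrow> exact_at N (b (Suc (Suc n))) (b (Suc n)) (A (Suc n)) (A n)"

lemma mat_zero_rows: "A \<in> mat R 0 q ==> A = (\<lambda>i j. (zero R))"
  by (auto simp: mat_def fun_eq_iff)

context
  fixes R :: "('a, 'r) ring_scheme" and M :: "('a, 'b, 'm) module_scheme" and b A e
  assumes res: "mres R M b A e"
begin

lemma mres_module: "module R M"
  and mres_b0: "b 0 = 0"
  and mres_mat: "A n \<in> mat R (b n) (b (Suc n))"
  and mres_gen: "e \<in> vec M (b (Suc 0))"
  and mres_surj: "m \<in> carrier M ==> \<exists>v\<in>vec (regular_module R) (b (Suc 0)). m = lincomb M v e (b (Suc 0))"
  and mres_exact: "res_ker R M b A e n =
      act (regular_module R) (b (Suc (Suc n))) (A (Suc n)) ` vec (regular_module R) (b (Suc (Suc n)))"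
  using res by (auto simp: mres_def)

interpretation M: module R M by (rule mres_module)
interpretation Rg: module R "regular_module R" by (rule M.R.regular_module_is_module)

lemma res_ker_vec: "v \<in> res_ker R M b A e n ==> v \<in> vec (regular_module R) (b (Suc n))"
  by (simp add: res_ker_def)

lemma res_ker_act:
  assumes "v \<in> res_ker R M b A e n" shows "act (regular_module R) (b (Suc n)) (A n) v = (\<lambda>i. (zero R))"
proof (cases n)
  case 0
  have "A 0 = (\<lambda>i j. (zero R))" using mres_mat[of 0] by (intro mat_zero_rows) (simp add: mres_b0)
  then show ?thesis using 0 res_ker_vec[OF assms] by (simp only: Rg.act_zero_mat) simp
qed (use assms in \<open>simp add: res_ker_def\<close>)

lemma act_mem_res_ker:
  "v \<in> vec (regular_module R) (b (Suc (Suc n))) ==>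
    act (regular_module R) (b (Suc (Suc n))) (A (Suc n)) v \<in> res_ker R M b A e n"
  by (simp add: mres_exact)

lemma res_ker_SucI:
  "v \<in> vec (regular_module R) (b (Suc (Suc n))) ==>
    act (regular_module R) (b (Suc (Suc n))) (A (Suc n)) v = (\<lambda>i. (zero R)) ==> v \<in> res_ker R M b A e (Suc n)"
  by (simp add: res_ker_def)

lemma mres_complex: "matmul R (b (Suc n)) (A n) (A (Suc n)) = (\<lambda>i j. (zero R))"
proof (rule M.R.mat_eqI)
  show "matmul R (b (Suc n)) (A n) (A (Suc n)) \<in> mat R (b n) (b (Suc (Suc n)))"
    using mres_mat by (rule M.R.matmul_mat) (rule mres_mat)
  fix v assume v: "v \<in> vec (regular_module R) (b (Suc (Suc n)))"
  show "act (regular_module R) (b (Suc (Suc n))) (matmul R (b (Suc n)) (A n) (A (Suc n))) v =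
    act (regular_module R) (b (Suc (Suc n))) (\<lambda>i j. (zero R)) v"
    using v res_ker_act[OF act_mem_res_ker[OF v]]
    by (simp add: Rg.act_matmul[OF mres_mat mres_mat v, symmetric])
qed simp

lemma mres_complex_transp: "matmul R (b (Suc n)) (transp (A (Suc n))) (transp (A n)) = (\<lambda>i j. (zero R))"
  using M.R.transp_matmul[OF mres_mat mres_mat, of "b (Suc n)" n "Suc n"]
  by (simp add: mres_complex) (simp add: transp_def)

end

text \<open>Moves F from the coefficients to the generators; this is where composition with a
  differential turns into the action of its transpose.\<close>

lemma (in module) lincomb_act:
  assumes F: "F \<in> mat R p q'" and v: "v \<in> vec (regular_module R) q''" and e: "\<And>i. e i \<in> carrier M"
  shows "lincomb M (act (regular_module R) q F v) e p = lincomb M v (\<lambda>j. lincomb M (\<lambda>i. F i j) e p) q"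
proof -
  have "act (regular_module R) q F v = (\<lambda>j. lincomb (regular_module R) v (\<lambda>i. F j i) q)"
    unfolding act_def using F v by (intro ext lincomb_regular_comm) simp_all
  then show ?thesis using lincomb_lincomb[of v "\<lambda>i j. F j i" e q p] F v e by simp
qed

text \<open>Comparison theorem: the identity of M lifts to a map of resolutions. The recursion
  carries along that \<open>f n\<close> maps syzygies to syzygies, which is exactly what makes the
  next square solvable.\<close>

lemma mres_chain_map:
  assumes M: "mres R M b A e" and M': "mres R M b' A' e'"
  obtains f where "\<forall>n. f n \<in> mat R (b' (Suc n)) (b (Suc n))"
    "\<forall>n. matmul R (b' (Suc (Suc n))) (A' (Suc n)) (f (Suc n)) = matmul R (b (Suc n)) (f n) (A (Suc n))"
    "\<forall>v\<in>vec (regular_module R) (b (Suc 0)).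
      lincomb M (act (regular_module R) (b (Suc 0)) (f 0) v) e' (b' (Suc 0)) = lincomb M v e (b (Suc 0))"
proof -
  interpret M: module R M by (rule mres_module[OF M])
  interpret Rg: module R "regular_module R" by (rule M.R.regular_module_is_module)
  let ?Rg = "regular_module R"
  let ?G = "\<lambda>n x. x \<in> mat R (b' (Suc n)) (b (Suc n)) \<and>
    (\<forall>v \<in> res_ker R M b A e n. act ?Rg (b (Suc n)) x v \<in> res_ker R M b' A' e' n)"
  let ?aug = "\<lambda>x. \<forall>v. v \<in> vec ?Rg (b (Suc 0)) \<longrightarrow>
      lincomb M (act ?Rg (b (Suc 0)) x v) e' (b' (Suc 0)) = lincomb M v e (b (Suc 0))"
  have "\<exists>f. \<forall>n. (?G n (f n) \<and> (n = 0 \<longrightarrow> ?aug (f n))) \<and>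
    matmul R (b' (Suc (Suc n))) (A' (Suc n)) (f (Suc n)) = matmul R (b (Suc n)) (f n) (A (Suc n))"
  proof (rule dependent_nat_choice)
    have "\<exists>v\<in>vec ?Rg (b' (Suc 0)). e j = lincomb M v e' (b' (Suc 0))" for j
      using mres_gen[OF M] by (intro mres_surj[OF M']) simp
    then obtain w where w: "\<And>j. w j \<in> vec ?Rg (b' (Suc 0)) \<and> e j = lincomb M (w j) e' (b' (Suc 0))"
      by metis
    let ?F = "\<lambda>i j. if j < b (Suc 0) then w j i else (zero R)"
    have F: "?F \<in> mat R (b' (Suc 0)) (b (Suc 0))"
    proof -
      have "w j i = (zero R)" if "b' (Suc 0) \<le> i" for i j
        using w vec_zero_outside[of "w j" ?Rg "b' (Suc 0)" i] that by simp
      moreover have "w j i \<in> carrier R" for i j using Rg.vec_closed[of "w j" "b' (Suc 0)" i] w by simp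
      ultimately show ?thesis
        by (auto simp del: M.mat_closed Rg.mat_closed M.R.mat_entry simp: mat_def)
    qed
    have aug: "?aug ?F"
    proof (intro allI impI)
      fix v assume v: "v \<in> vec ?Rg (b (Suc 0))"
      show "lincomb M (act ?Rg (b (Suc 0)) ?F v) e' (b' (Suc 0)) = lincomb M v e (b (Suc 0))"
        unfolding M.lincomb_act[OF F v M.vec_closed[OF mres_gen[OF M']]]
        using w by (intro lincomb_cong) simp_all
    qed
    moreover have "?G 0 ?F"
      using F aug Rg.act_closed[OF F] by (auto simp: res_ker_def)
    ultimately show "\<exists>x. ?G 0 x \<and> (0 = (0::nat) \<longrightarrow> ?aug x)" by blast
  next
    fix x n assume "?G n x \<and> (n = 0 \<longrightarrow> ?aug x)"
    then have x: "x \<in> mat R (b' (Suc n)) (b (Suc n))"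
      and G: "\<And>v. v \<in> res_ker R M b A e n ==> act ?Rg (b (Suc n)) x v \<in> res_ker R M b' A' e' n" by auto
    let ?C = "matmul R (b (Suc n)) x (A (Suc n))"
    have C: "?C \<in> mat R (b' (Suc n)) (b (Suc (Suc n)))" by (rule M.R.matmul_mat[OF x mres_mat[OF M]])
    \<comment> \<open>Each column is the image of a boundary under the map already constructed,
      hence lies in the syzygy of the target and lifts.\<close>
    have "\<exists>w\<in>vec ?Rg (b' (Suc (Suc n))). (\<lambda>i. ?C i j) = act ?Rg (b' (Suc (Suc n))) (A' (Suc n)) w"
      if j: "j < b (Suc (Suc n))" for j
    proof -
      have "(\<lambda>i. ?C i j) = act ?Rg (b (Suc n)) x (act ?Rg (b (Suc (Suc n))) (A (Suc n)) (unit_vector R j))"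
        using j by (simp add: M.R.act_unit_vector[OF C, symmetric] Rg.act_matmul[OF x mres_mat[OF M]])
      also have "\<dots> \<in> res_ker R M b' A' e' n" using j by (intro G act_mem_res_ker[OF M]) simp
      finally show ?thesis by (auto simp: mres_exact[OF M'])
    qed
    then obtain W where W: "W \<in> mat R (b' (Suc (Suc n))) (b (Suc (Suc n)))"
      "?C = matmul R (b' (Suc (Suc n))) (A' (Suc n)) W"
      by (rule M.R.lift_matrix[OF C mres_mat[OF M']])
    have "act ?Rg (b (Suc (Suc n))) W v \<in> res_ker R M b' A' e' (Suc n)" if v: "v \<in> res_ker R M b A e (Suc n)" for v
    proof (rule res_ker_SucI[OF M'])
      note vv = res_ker_vec[OF M v]
      show "act ?Rg (b (Suc (Suc n))) W v \<in> vec ?Rg (b' (Suc (Suc n)))" by (rule Rg.act_closed[OF W(1) vv])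
      show "act ?Rg (b' (Suc (Suc n))) (A' (Suc n)) (act ?Rg (b (Suc (Suc n))) W v) = (\<lambda>i. (zero R))"
        unfolding Rg.act_matmul[OF mres_mat[OF M'] W(1) vv] W(2)[symmetric]
          Rg.act_matmul[OF x mres_mat[OF M] vv, symmetric] res_ker_act[OF M v]
        using Rg.act_zero[OF x] by simp
    qed
    with W show "\<exists>y. (?G (Suc n) y \<and> (Suc n = 0 \<longrightarrow> ?aug y)) \<and>
      matmul R (b' (Suc (Suc n))) (A' (Suc n)) y = matmul R (b (Suc n)) x (A (Suc n))" by auto
  qed
  then obtain f where f: "\<And>n. ?G n (f n)" "?aug (f 0)"
    "\<And>n. matmul R (b' (Suc (Suc n))) (A' (Suc n)) (f (Suc n)) = matmul R (b (Suc n)) (f n) (A (Suc n))" by blast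
  show ?thesis by (rule that[of f]) (use f in auto)
qed

text \<open>A chain endomorphism covering zero on M is null-homotopic. The defect
  \<open>?D n\<close> is what remains of \<open>\<phi> (Suc n)\<close> after subtracting
  \<open>s n\<close> times the differential; the invariant says that it takes values in the syzygy,
  so it factors through the next differential.\<close>

lemma mres_null_homotopy:
  assumes M: "mres R M b A e" and \<phi>: "\<And>n. \<phi> n \<in> mat R (b (Suc n)) (b (Suc n))"
    and comm: "\<And>n. matmul R (b (Suc (Suc n))) (A (Suc n)) (\<phi> (Suc n)) = matmul R (b (Suc n)) (\<phi> n) (A (Suc n))"
    and aug: "\<And>v. v \<in> vec (regular_module R) (b (Suc 0)) ==>
      lincomb M (act (regular_module R) (b (Suc 0)) (\<phi> 0) v) e (b (Suc 0)) = (zero M)"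
  obtains s where "\<forall>n. s n \<in> mat R (b (Suc (Suc n))) (b (Suc n))"
    "\<phi> 0 = matmul R (b (Suc (Suc 0))) (A (Suc 0)) (s 0)"
    "\<forall>n. \<phi> (Suc n) = (\<lambda>i j. matmul R (b (Suc (Suc (Suc n)))) (A (Suc (Suc n))) (s (Suc n)) i j \<oplus>\<^bsub>R\<^esub>
      matmul R (b (Suc n)) (s n) (A (Suc n)) i j)"
proof -
  interpret M: module R M by (rule mres_module[OF M])
  interpret Rg: module R "regular_module R" by (rule M.R.regular_module_is_module)
  let ?Rg = "regular_module R"
  let ?D = "\<lambda>n x i j. \<phi> (Suc n) i j \<ominus>\<^bsub>R\<^esub> matmul R (b (Suc n)) x (A (Suc n)) i j"
  let ?G = "\<lambda>n x. x \<in> mat R (b (Suc (Suc n))) (b (Suc n)) \<and>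
    (\<forall>v \<in> vec ?Rg (b (Suc (Suc n))). act ?Rg (b (Suc (Suc n))) (?D n x) v \<in> res_ker R M b A e (Suc n))"
  have lift: "\<exists>W. W \<in> mat R (b (Suc (Suc n))) (b q) \<and> C = matmul R (b (Suc (Suc n))) (A (Suc n)) W"
    if C: "C \<in> mat R (b (Suc n)) (b q)" and im: "\<And>v. v \<in> vec ?Rg (b q) ==> act ?Rg (b q) C v \<in> res_ker R M b A e n"
    for C n q
  proof -
    have "\<exists>w\<in>vec ?Rg (b (Suc (Suc n))). (\<lambda>i. C i j) = act ?Rg (b (Suc (Suc n))) (A (Suc n)) w"
      if j: "j < b q" for j
      using im[OF M.R.unit_vector_vec[OF j]] j by (auto simp: M.R.act_unit_vector[OF C] mres_exact[OF M])
    then show ?thesis by (rule M.R.lift_matrix[OF C mres_mat[OF M]]) blast+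
  qed
  have "\<exists>s. \<forall>n. (?G n (s n) \<and> (n = 0 \<longrightarrow> \<phi> 0 = matmul R (b (Suc (Suc 0))) (A (Suc 0)) (s n))) \<and>
    ?D n (s n) = matmul R (b (Suc (Suc (Suc n)))) (A (Suc (Suc n))) (s (Suc n))"
  proof (rule dependent_nat_choice)
    have "act ?Rg (b (Suc 0)) (\<phi> 0) v \<in> res_ker R M b A e 0" if "v \<in> vec ?Rg (b (Suc 0))" for v
      using that aug[OF that] Rg.act_closed[OF \<phi> that] by (simp add: res_ker_def)
    then obtain W where W: "W \<in> mat R (b (Suc (Suc 0))) (b (Suc 0))" "\<phi> 0 = matmul R (b (Suc (Suc 0))) (A (Suc 0)) W"
      using lift[OF \<phi>[of 0]] by blast
    have "act ?Rg (b (Suc (Suc 0))) (?D 0 W) v \<in> res_ker R M b A e (Suc 0)" if v: "v \<in> vec ?Rg (b (Suc (Suc 0)))" for v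
    proof (rule res_ker_SucI[OF M])
      have mm: "matmul R (b (Suc 0)) W (A (Suc 0)) \<in> mat R (b (Suc (Suc 0))) (b (Suc (Suc 0)))"
        by (rule M.R.matmul_mat[OF W(1) mres_mat[OF M]])
      have c: "act ?Rg (b (Suc (Suc 0))) (\<phi> (Suc 0)) v \<in> vec ?Rg (b (Suc (Suc 0)))"
         "act ?Rg (b (Suc (Suc 0))) (matmul R (b (Suc 0)) W (A (Suc 0))) v \<in> vec ?Rg (b (Suc (Suc 0)))"
        using Rg.act_closed[OF \<phi> v] Rg.act_closed[OF mm v] .
      have Av: "act ?Rg (b (Suc (Suc 0))) (A (Suc 0)) v \<in> vec ?Rg (b (Suc 0))" by (rule Rg.act_closed[OF mres_mat[OF M] v])
      show "act ?Rg (b (Suc (Suc 0))) (?D 0 W) v \<in> vec ?Rg (b (Suc (Suc 0)))"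
        by (rule Rg.act_closed[OF M.R.minus_mat[OF \<phi> mm] v])
      \<comment> \<open>A s A equals \<phi> A equals A \<phi>, so the differential kills the
        defect.\<close>
      have "act ?Rg (b (Suc (Suc 0))) (A (Suc 0)) (act ?Rg (b (Suc (Suc 0))) (matmul R (b (Suc 0)) W (A (Suc 0))) v) =
         act ?Rg (b (Suc 0)) (\<phi> 0) (act ?Rg (b (Suc (Suc 0))) (A (Suc 0)) v)"
        unfolding Rg.act_matmul[OF W(1) mres_mat[OF M] v, symmetric] Rg.act_matmul[OF mres_mat[OF M] W(1) Av] W(2) ..
      also have "\<dots> = act ?Rg (b (Suc (Suc 0))) (A (Suc 0)) (act ?Rg (b (Suc (Suc 0))) (\<phi> (Suc 0)) v)"
        unfolding Rg.act_matmul[OF mres_mat[OF M] \<phi> v] Rg.act_matmul[OF \<phi> mres_mat[OF M] v] comm ..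
      finally show "act ?Rg (b (Suc (Suc 0))) (A (Suc 0)) (act ?Rg (b (Suc (Suc 0))) (?D 0 W) v) = (\<lambda>i. (zero R))"
        using Rg.act_minus_mat[OF \<phi> mm v] Rg.act_minus[OF mres_mat[OF M] c]
          Rg.vec_closed[OF Rg.act_closed[OF mres_mat[OF M] c(1)]]
        by simp
    qed
    with W show "\<exists>x. ?G 0 x \<and> (0 = (0::nat) \<longrightarrow> \<phi> 0 = matmul R (b (Suc (Suc 0))) (A (Suc 0)) x)" by blast
  next
    fix x n assume "?G n x \<and> (n = 0 \<longrightarrow> \<phi> 0 = matmul R (b (Suc (Suc 0))) (A (Suc 0)) x)"
    then have x: "x \<in> mat R (b (Suc (Suc n))) (b (Suc n))"
      and G: "\<And>v. v \<in> vec ?Rg (b (Suc (Suc n))) ==> act ?Rg (b (Suc (Suc n))) (?D n x) v \<in> res_ker R M b A e (Suc n)" by auto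
    have mm: "matmul R (b (Suc n)) x (A (Suc n)) \<in> mat R (b (Suc (Suc n))) (b (Suc (Suc n)))"
      by (rule M.R.matmul_mat[OF x mres_mat[OF M]])
    have D: "?D n x \<in> mat R (b (Suc (Suc n))) (b (Suc (Suc n)))" by (rule M.R.minus_mat[OF \<phi> mm])
    obtain W where W: "W \<in> mat R (b (Suc (Suc (Suc n)))) (b (Suc (Suc n)))"
      "?D n x = matmul R (b (Suc (Suc (Suc n)))) (A (Suc (Suc n))) W"
      using lift[OF D G] by blast
    let ?n = "Suc (Suc (Suc n))"
    have "act ?Rg (b ?n) (?D (Suc n) W) v \<in> res_ker R M b A e (Suc (Suc n))" if v: "v \<in> vec ?Rg (b ?n)" for v
    proof (rule res_ker_SucI[OF M])
      have mmW: "matmul R (b (Suc (Suc n))) W (A (Suc (Suc n))) \<in> mat R (b ?n) (b ?n)"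
        by (rule M.R.matmul_mat[OF W(1) mres_mat[OF M]])
      have c: "act ?Rg (b ?n) (\<phi> (Suc (Suc n))) v \<in> vec ?Rg (b ?n)"
         "act ?Rg (b ?n) (matmul R (b (Suc (Suc n))) W (A (Suc (Suc n)))) v \<in> vec ?Rg (b ?n)"
        using Rg.act_closed[OF \<phi> v] Rg.act_closed[OF mmW v] .
      have Av: "act ?Rg (b ?n) (A (Suc (Suc n))) v \<in> vec ?Rg (b (Suc (Suc n)))" by (rule Rg.act_closed[OF mres_mat[OF M] v])
      show "act ?Rg (b ?n) (?D (Suc n) W) v \<in> vec ?Rg (b ?n)"
        by (rule Rg.act_closed[OF M.R.minus_mat[OF \<phi> mmW] v])
      have "act ?Rg (b ?n) (A (Suc (Suc n))) (act ?Rg (b ?n) (matmul R (b (Suc (Suc n))) W (A (Suc (Suc n)))) v) =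
         act ?Rg (b (Suc (Suc n))) (?D n x) (act ?Rg (b ?n) (A (Suc (Suc n))) v)"
        unfolding Rg.act_matmul[OF W(1) mres_mat[OF M] v, symmetric] Rg.act_matmul[OF mres_mat[OF M] W(1) Av] W(2) ..
      also have "\<dots> = act ?Rg (b (Suc (Suc n))) (\<phi> (Suc n)) (act ?Rg (b ?n) (A (Suc (Suc n))) v)"
        using Rg.act_minus_mat[OF \<phi> mm Av] Rg.act_matmul[OF x mres_mat[OF M] Av, symmetric]
          Rg.act_act_zero[OF mres_mat[OF M] mres_mat[OF M] mres_complex[OF M] v] Rg.act_zero[OF x]
          Rg.vec_closed[OF Rg.act_closed[OF \<phi> Av]]
        by simp
      also have "\<dots> = act ?Rg (b ?n) (A (Suc (Suc n))) (act ?Rg (b ?n) (\<phi> (Suc (Suc n))) v)"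
        unfolding Rg.act_matmul[OF mres_mat[OF M] \<phi> v] Rg.act_matmul[OF \<phi> mres_mat[OF M] v] comm ..
      finally show "act ?Rg (b ?n) (A (Suc (Suc n))) (act ?Rg (b ?n) (?D (Suc n) W) v) = (\<lambda>i. (zero R))"
        using Rg.act_minus_mat[OF \<phi> mmW v] Rg.act_minus[OF mres_mat[OF M] c]
          Rg.vec_closed[OF Rg.act_closed[OF mres_mat[OF M] c(1)]]
        by simp
    qed
    with W show "\<exists>y. (?G (Suc n) y \<and> (Suc n = 0 \<longrightarrow> \<phi> 0 = matmul R (b (Suc (Suc 0))) (A (Suc 0)) y)) \<and>
      ?D n x = matmul R (b (Suc (Suc (Suc n)))) (A (Suc (Suc n))) y" by auto
  qed
  then obtain s where s: "\<And>n. ?G n (s n)" "\<phi> 0 = matmul R (b (Suc (Suc 0))) (A (Suc 0)) (s 0)"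
    "\<And>n. ?D n (s n) = matmul R (b (Suc (Suc (Suc n)))) (A (Suc (Suc n))) (s (Suc n))" by blast
  show ?thesis
  proof (rule that[of s])
    show "\<forall>n. s n \<in> mat R (b (Suc (Suc n))) (b (Suc n))" using s(1) by blast
    have c: "matmul R (b (Suc n)) (s n) (A (Suc n)) i j \<in> carrier R" "\<phi> (Suc n) i j \<in> carrier R" for n i j
      using M.R.mat_entry[OF M.R.matmul_mat[OF _ mres_mat[OF M]]] M.R.mat_entry[OF \<phi>] s(1) by blast+
    show "\<forall>n. \<phi> (Suc n) = (\<lambda>i j. matmul R (b (Suc (Suc (Suc n)))) (A (Suc (Suc n))) (s (Suc n)) i j \<oplus>\<^bsub>R\<^esub>
      matmul R (b (Suc n)) (s n) (A (Suc n)) i j)"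
      unfolding s(3)[symmetric] using c by simp
  qed (rule s(2))
qed

text \<open>With f and g lifting the identity in both directions, \<phi> = g f - 1 covers zero and
  is null-homotopic; \<open>exact_at_homotopy\<close> then transports exactness. The converse
  implication follows by exchanging the resolutions.\<close>

lemma mres_transfer:
  assumes M: "mres R M b A e" and M': "mres R M b' A' e'" and N: "module R N"
  shows "(TOR N b' A' n \<longrightarrow> TOR N b A n) \<and> (EXT N b' A' n \<longrightarrow> EXT N b A n)"
proof -
  interpret M: module R M by (rule mres_module[OF M])
  interpret Rg: module R "regular_module R" by (rule M.R.regular_module_is_module)
  let ?Rg = "regular_module R"
  obtain f where f0: "\<forall>n. f n \<in> mat R (b' (Suc n)) (b (Suc n))"
    "\<forall>n. matmul R (b' (Suc (Suc n))) (A' (Suc n)) (f (Suc n)) = matmul R (b (Suc n)) (f n) (A (Suc n))"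
    "\<forall>v\<in>vec ?Rg (b (Suc 0)). lincomb M (act ?Rg (b (Suc 0)) (f 0) v) e' (b' (Suc 0)) = lincomb M v e (b (Suc 0))"
    by (rule mres_chain_map[OF M M'])
  obtain g where g0: "\<forall>n. g n \<in> mat R (b (Suc n)) (b' (Suc n))"
    "\<forall>n. matmul R (b (Suc (Suc n))) (A (Suc n)) (g (Suc n)) = matmul R (b' (Suc n)) (g n) (A' (Suc n))"
    "\<forall>v\<in>vec ?Rg (b' (Suc 0)). lincomb M (act ?Rg (b' (Suc 0)) (g 0) v) e (b (Suc 0)) = lincomb M v e' (b' (Suc 0))"
    by (rule mres_chain_map[OF M' M])
  note f = f0[rule_format] and g = g0[rule_format]
  define \<phi> where "\<phi> n = (\<lambda>i j. matmul R (b' (Suc n)) (g n) (f n) i j \<ominus>\<^bsub>R\<^esub> one_mat R (b (Suc n)) i j)" for n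
  have gf: "matmul R (b' (Suc n)) (g n) (f n) \<in> mat R (b (Suc n)) (b (Suc n))" for n
    using g(1) f(1) by (rule M.R.matmul_mat)
  have \<phi>: "\<phi> n \<in> mat R (b (Suc n)) (b (Suc n))" for n
    unfolding \<phi>_def using gf M.R.one_mat_mat by (rule M.R.minus_mat)
  have act_\<phi>: "act ?Rg (b (Suc n)) (\<phi> n) v = (\<lambda>i. act ?Rg (b' (Suc n)) (g n) (act ?Rg (b (Suc n)) (f n) v) i \<ominus>\<^bsub>R\<^esub> v i)"
    if v: "v \<in> vec ?Rg (b (Suc n))" for n v
    unfolding \<phi>_def using Rg.act_minus_mat[OF gf M.R.one_mat_mat v] v
    by (simp add: Rg.act_matmul[OF g(1) f(1) v])
  have comm: "matmul R (b (Suc (Suc n))) (A (Suc n)) (\<phi> (Suc n)) = matmul R (b (Suc n)) (\<phi> n) (A (Suc n))" for n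
  proof (rule M.R.mat_eqI)
    show "matmul R (b (Suc (Suc n))) (A (Suc n)) (\<phi> (Suc n)) \<in> mat R (b (Suc n)) (b (Suc (Suc n)))"
      using mres_mat[OF M] \<phi> by (rule M.R.matmul_mat)
    show "matmul R (b (Suc n)) (\<phi> n) (A (Suc n)) \<in> mat R (b (Suc n)) (b (Suc (Suc n)))"
      using \<phi> mres_mat[OF M] by (rule M.R.matmul_mat)
    fix v assume v: "v \<in> vec ?Rg (b (Suc (Suc n)))"
    note Av = Rg.act_closed[OF mres_mat[OF M] v]
    note fv = Rg.act_closed[OF f(1) v]
    have "act ?Rg (b (Suc (Suc n))) (A (Suc n)) (act ?Rg (b' (Suc (Suc n))) (g (Suc n)) (act ?Rg (b (Suc (Suc n))) (f (Suc n)) v)) =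
       act ?Rg (b' (Suc n)) (g n) (act ?Rg (b' (Suc (Suc n))) (A' (Suc n)) (act ?Rg (b (Suc (Suc n))) (f (Suc n)) v))"
      unfolding Rg.act_matmul[OF mres_mat[OF M] g(1) fv] Rg.act_matmul[OF g(1) mres_mat[OF M'] fv] g(2) ..
    also have "\<dots> = act ?Rg (b' (Suc n)) (g n) (act ?Rg (b (Suc n)) (f n) (act ?Rg (b (Suc (Suc n))) (A (Suc n)) v))"
      unfolding Rg.act_matmul[OF mres_mat[OF M'] f(1) v] Rg.act_matmul[OF f(1) mres_mat[OF M] v] f(2) ..
    finally show "act ?Rg (b (Suc (Suc n))) (matmul R (b (Suc (Suc n))) (A (Suc n)) (\<phi> (Suc n))) v =
      act ?Rg (b (Suc (Suc n))) (matmul R (b (Suc n)) (\<phi> n) (A (Suc n))) v"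
      unfolding Rg.act_matmul[OF mres_mat[OF M] \<phi> v, symmetric] Rg.act_matmul[OF \<phi> mres_mat[OF M] v, symmetric]
        act_\<phi>[OF v] act_\<phi>[OF Av]
      using Rg.act_minus[OF mres_mat[OF M] Rg.act_closed[OF g(1) fv] v] by simp
  qed
  have aug: "lincomb M (act ?Rg (b (Suc 0)) (\<phi> 0) v) e (b (Suc 0)) = (zero M)" if v: "v \<in> vec ?Rg (b (Suc 0))" for v
  proof -
    note fv = Rg.act_closed[OF f(1) v]
    note gfv = Rg.act_closed[OF g(1) fv]
    have e: "e i \<in> carrier M" for i using mres_gen[OF M] by simp
    show ?thesis
      unfolding act_\<phi>[OF v]
      using M.lincomb_minus_left[of "act ?Rg (b' (Suc 0)) (g 0) (act ?Rg (b (Suc 0)) (f 0) v)" v e "b (Suc 0)"]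
        M.R.vec_regular_closed[OF gfv] M.R.vec_regular_closed[OF v] e
      by (simp add: g(3)[OF fv] f(3)[OF v])
  qed
  obtain s where s0: "\<forall>n. s n \<in> mat R (b (Suc (Suc n))) (b (Suc n))"
    "\<phi> 0 = matmul R (b (Suc (Suc 0))) (A (Suc 0)) (s 0)"
    "\<forall>n. \<phi> (Suc n) = (\<lambda>i j. matmul R (b (Suc (Suc (Suc n)))) (A (Suc (Suc n))) (s (Suc n)) i j \<oplus>\<^bsub>R\<^esub>
      matmul R (b (Suc n)) (s n) (A (Suc n)) i j)"
    by (rule mres_null_homotopy[OF M \<phi> comm aug])
  note s = s0[rule_format]
  \<comment> \<open>Extended by zero to the padding position, so that degree 0 obeys the same
    identities as the others.\<close>
  define t where "t n = (case n of 0 => (\<lambda>i j. (zero R)) | Suc m => s m)" for n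
  define F where "F n = (case n of 0 => (\<lambda>i j. (zero R)) | Suc m => f m)" for n
  define G where "G n = (case n of 0 => (\<lambda>i j. (zero R)) | Suc m => g m)" for n
  have t: "t n \<in> mat R (b (Suc n)) (b n)" and F: "F n \<in> mat R (b' n) (b n)" and G: "G n \<in> mat R (b n) (b' n)" for n
    using s(1) f(1) g(1) by (auto simp: t_def F_def G_def split: nat.split)
  have F1 [simp]: "F (Suc n) = f n" "G (Suc n) = g n" "t (Suc n) = s n" for n by (simp_all add: F_def G_def t_def)
  have AF: "matmul R (b' (Suc n)) (A' n) (F (Suc n)) = matmul R (b n) (F n) (A n)" for n
  proof (cases n)
    case 0
    have "matmul R (b' (Suc 0)) (A' 0) (F (Suc 0)) \<in> mat R 0 (b (Suc 0))" "matmul R (b 0) (F 0) (A 0) \<in> mat R 0 (b (Suc 0))"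
      using M.R.matmul_mat[OF mres_mat[OF M', of 0] F[of "Suc 0"], of "b' (Suc 0)"]
        M.R.matmul_mat[OF F[of 0] mres_mat[OF M, of 0], of "b 0"] by (simp_all add: mres_b0[OF M'])
    from this[THEN mat_zero_rows] show ?thesis using 0 by simp
  qed (simp add: f(2))
  have AG: "matmul R (b (Suc n)) (A n) (G (Suc n)) = matmul R (b' n) (G n) (A' n)" for n
  proof (cases n)
    case 0
    have "matmul R (b (Suc 0)) (A 0) (G (Suc 0)) \<in> mat R 0 (b' (Suc 0))" "matmul R (b' 0) (G 0) (A' 0) \<in> mat R 0 (b' (Suc 0))"
      using M.R.matmul_mat[OF mres_mat[OF M, of 0] G[of "Suc 0"], of "b (Suc 0)"]
        M.R.matmul_mat[OF G[of 0] mres_mat[OF M', of 0], of "b' 0"] by (simp_all add: mres_b0[OF M])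
    from this[THEN mat_zero_rows] show ?thesis using 0 by simp
  qed (simp add: g(2))
  have st: "\<phi> n = (\<lambda>i j. matmul R (b (Suc (Suc n))) (A (Suc n)) (t (Suc n)) i j \<oplus>\<^bsub>R\<^esub> matmul R (b n) (t n) (A n) i j)" for n
  proof (cases n)
    case 0
    have "matmul R (b 0) (t 0) (A 0) = (\<lambda>i j. (zero R))" by (simp add: mres_b0[OF M] matmul_def)
    then show ?thesis using 0 M.R.mat_entry[OF \<phi>[of 0]] by (simp add: s(2))
  qed (simp add: s(3))
  have "TOR N b A n" if "TOR N b' A' n"
    unfolding TOR_def
  proof (rule exact_at_homotopy[OF N mres_mat[OF M] mres_mat[OF M] mres_mat[OF M'] mres_mat[OF M'] F F G G t t AF])
    show "matmul R (b' (Suc n)) (G (Suc n)) (A' (Suc n)) = matmul R (b (Suc (Suc n))) (A (Suc n)) (G (Suc (Suc n)))"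
      by (simp add: AG del: F1)
    show "(\<lambda>i j. matmul R (b' (Suc n)) (G (Suc n)) (F (Suc n)) i j \<ominus>\<^bsub>R\<^esub> one_mat R (b (Suc n)) i j) =
      (\<lambda>i j. matmul R (b (Suc (Suc n))) (A (Suc n)) (t (Suc n)) i j \<oplus>\<^bsub>R\<^esub> matmul R (b n) (t n) (A n) i j)"
      using st[of n] by (simp add: \<phi>_def)
    show "exact_at N (b' (Suc (Suc n))) (b' (Suc n)) (A' (Suc n)) (A' n)" using that by (simp add: TOR_def)
  qed
  moreover have "EXT N b A n" if "EXT N b' A' n"
    unfolding EXT_def
  \<comment> \<open>Transposition reverses arrows: the maps F and G exchange roles, and so do the
    two summands of the homotopy.\<close>
  proof (rule exact_at_homotopy[OF N, where f = "transp (G (Suc n))" and fr = "transp (G (Suc (Suc n)))" and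
        g = "transp (F (Suc n))" and gp = "transp (F n)" and s = "transp (t n)" and t = "transp (t (Suc n))" and
        A' = "transp (A' (Suc n))" and B' = "transp (A' n)" and q' = "b' (Suc n)" and p' = "b' n" and r' = "b' (Suc (Suc n))"
        and r = "b (Suc (Suc n))"])
    note T = M.R.transp_matmul[symmetric]
    show "matmul R (b' (Suc n)) (transp (A' (Suc n))) (transp (G (Suc n))) =
        matmul R (b (Suc (Suc n))) (transp (G (Suc (Suc n)))) (transp (A (Suc n)))"
      unfolding T[OF G mres_mat[OF M']] T[OF mres_mat[OF M] G] AG ..
    show "matmul R (b' (Suc n)) (transp (F (Suc n))) (transp (A' n)) = matmul R (b n) (transp (A n)) (transp (F n))"
      unfolding T[OF F mres_mat[OF M]] T[OF mres_mat[OF M'] F] AF ..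
    have eq1: "transp (\<phi> n) = (\<lambda>i j. transp (matmul R (b n) (t n) (A n)) i j \<oplus>\<^bsub>R\<^esub>
        transp (matmul R (b (Suc (Suc n))) (A (Suc n)) (t (Suc n))) i j)"
      unfolding st transp_def by (intro ext M.R.a_comm M.R.mat_entry[OF M.R.matmul_mat[OF mres_mat[OF M] t]]
        M.R.mat_entry[OF M.R.matmul_mat[OF t mres_mat[OF M]]])
    have eq2: "transp (\<phi> n) = (\<lambda>i j. transp (matmul R (b' (Suc n)) (G (Suc n)) (F (Suc n))) i j \<ominus>\<^bsub>R\<^esub> one_mat R (b (Suc n)) i j)"
      by (auto simp add: \<phi>_def transp_def one_mat_def fun_eq_iff)
    show "(\<lambda>i j. matmul R (b' (Suc n)) (transp (F (Suc n))) (transp (G (Suc n))) i j \<ominus>\<^bsub>R\<^esub> one_mat R (b (Suc n)) i j) =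
      (\<lambda>i j. matmul R (b n) (transp (A n)) (transp (t n)) i j \<oplus>\<^bsub>R\<^esub>
        matmul R (b (Suc (Suc n))) (transp (t (Suc n))) (transp (A (Suc n))) i j)"
      unfolding T[OF G F] T[OF t mres_mat[OF M]] T[OF mres_mat[OF M] t] by (rule trans[OF eq2[symmetric] eq1])
    show "exact_at N (b' n) (b' (Suc n)) (transp (A' n)) (transp (A' (Suc n)))" using that by (simp add: EXT_def)
  qed (simp_all only: transp_mat mres_mat[OF M] mres_mat[OF M'] F G t)
  ultimately show ?thesis by blast
qed

lemma mres_TOR_unique: "mres R M b A e ==> mres R M b' A' e' ==> module R N ==> TOR N b A n \<longleftrightarrow> TOR N b' A' n"
  and mres_EXT_unique: "mres R M b A e ==> mres R M b' A' e' ==> module R N ==> EXT N b A n \<longleftrightarrow> EXT N b' A' n"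
  using mres_transfer by blast+

section \<open>Extensions of complexes\<close>

text \<open>\<open>pair_exact\<close> is exactness of a complex of vectors \<open>(a, b)\<close> with differential
  \<open>(a, b) \<mapsto> (\<alpha> a, \<beta> b - \<eta> a)\<close>, an extension of the complex of the \<open>\<alpha>\<close> by that of the \<open>\<beta>\<close> with
  connecting map \<open>\<eta>\<close>; signs are arranged so that none remain.\<close>

definition pair_exact where
  "pair_exact M p1 p2 q1 q2 \<alpha>' \<eta>' \<beta>' \<alpha> \<eta> \<beta> \<longleftrightarrow>
    (\<forall>a\<in>vec M q1. \<forall>b\<in>vec M q2. act M q1 \<alpha> a = (\<lambda>i. (zero M)) \<and> act M q2 \<beta> b = act M q1 \<eta> a \<longrightarrow>
      (\<exists>c\<in>vec M p1. \<exists>e\<in>vec M p2. a = act M p1 \<alpha>' c \<and> b = (\<lambda>i. act M p2 \<beta>' e i \<oplus>\<^bsub>M\<^esub> act M p1 \<eta>' c i)))"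

lemma pair_exactD:
  assumes "pair_exact M p1 p2 q1 q2 \<alpha>' \<eta>' \<beta>' \<alpha> \<eta> \<beta>" "a \<in> vec M q1" "b \<in> vec M q2"
    "act M q1 \<alpha> a = (\<lambda>i. (zero M))" "act M q2 \<beta> b = act M q1 \<eta> a"
  shows "\<exists>c\<in>vec M p1. \<exists>e\<in>vec M p2. a = act M p1 \<alpha>' c \<and> b = (\<lambda>i. act M p2 \<beta>' e i \<oplus>\<^bsub>M\<^esub> act M p1 \<eta>' c i)"
  using assms by (simp add: pair_exact_def)

text \<open>First of three pieces of the long exact sequence of the extension: exactness of the sub
  \<beta> and of the quotient \<alpha> makes the total complex exact. The hypothesis
  \<open>eq\<close> says that \<eta> is a chain map.\<close>

lemma pair_exactI:
  assumes M: "module R M" and "exact_at M p1 q1 \<alpha>' \<alpha>" "exact_at M p2 q2 \<beta>' \<beta>"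
    and eq: "\<And>c. c \<in> vec M p1 ==> act M q2 \<beta> (act M p1 \<eta>' c) = act M q1 \<eta> (act M p1 \<alpha>' c)"
    and \<eta>': "\<eta>' \<in> mat R q2 p1" and \<beta>: "\<beta> \<in> mat R r2 q2" and \<eta>: "\<eta> \<in> mat R r2 q1"
  shows "pair_exact M p1 p2 q1 q2 \<alpha>' \<eta>' \<beta>' \<alpha> \<eta> \<beta>"
  unfolding pair_exact_def
proof (intro ballI impI, elim conjE)
  interpret M: module R M by fact
  fix a b assume a: "a \<in> vec M q1" and b: "b \<in> vec M q2" and 0: "act M q1 \<alpha> a = (\<lambda>i. (zero M))" "act M q2 \<beta> b = act M q1 \<eta> a"
  obtain c where c: "c \<in> vec M p1" "a = act M p1 \<alpha>' c" using assms(2) a 0(1) by (rule exact_atD)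
  note hc = M.act_closed[OF \<eta>' c(1)]
  have "act M q2 \<beta> (\<lambda>i. b i \<ominus>\<^bsub>M\<^esub> act M p1 \<eta>' c i) = (\<lambda>i. (zero M))"
    using 0(2) eq[OF c(1)] M.vec_closed[OF M.act_closed[OF \<eta> a]] by (simp add: M.act_minus[OF \<beta> b hc] c(2))
  from exact_atD[OF assms(3) M.minus_vec[OF b hc] this]
  obtain e where e: "e \<in> vec M p2" "(\<lambda>i. b i \<ominus>\<^bsub>M\<^esub> act M p1 \<eta>' c i) = act M p2 \<beta>' e" by blast
  have "b = (\<lambda>i. act M p2 \<beta>' e i \<oplus>\<^bsub>M\<^esub> act M p1 \<eta>' c i)"
    using M.vec_closed[OF b] M.vec_closed[OF hc] by (simp flip: e(2))
  with c e show "\<exists>c\<in>vec M p1. \<exists>e\<in>vec M p2. a = act M p1 \<alpha>' c \<and> b = (\<lambda>i. act M p2 \<beta>' e i \<oplus>\<^bsub>M\<^esub> act M p1 \<eta>' c i)"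
    by blast
qed

text \<open>From the quotient one position earlier, over the sub, to the total complex. A cycle b is
  the pair (0, b); the c in the element bounding it is a cycle of the quotient, hence a boundary,
  and its contribution through \<open>\<eta>'\<close> is absorbed by
  \<open>\<beta>'\<close>.\<close>

lemma pair_exact_right:
  assumes M: "module R M" and pe: "pair_exact M p1 p2 q1 q2 \<alpha>' \<eta>' \<beta>' \<alpha> \<eta> \<beta>" and ex: "exact_at M o1 p1 \<alpha>'' \<alpha>'"
    and eq: "\<And>c. c \<in> vec M o1 ==> act M p1 \<eta>' (act M o1 \<alpha>'' c) = act M p2 \<beta>' (act M o1 \<eta>'' c)"
    and \<alpha>: "\<alpha> \<in> mat R r1 q1" and \<eta>: "\<eta> \<in> mat R r2 q1" and \<beta>': "\<beta>' \<in> mat R q2 p2" and \<eta>'': "\<eta>'' \<in> mat R p2 o1"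
  shows "exact_at M p2 q2 \<beta>' \<beta>"
  unfolding exact_at_def
proof (intro ballI impI)
  interpret M: module R M by fact
  fix b assume b: "b \<in> vec M q2" "act M q2 \<beta> b = (\<lambda>i. (zero M))"
  obtain c e where c: "c \<in> vec M p1" "e \<in> vec M p2" "(\<lambda>i. (zero M)) = act M p1 \<alpha>' c"
      "b = (\<lambda>i. act M p2 \<beta>' e i \<oplus>\<^bsub>M\<^esub> act M p1 \<eta>' c i)"
    using pair_exactD[OF pe M.zero_vec b(1)] b(2) M.act_zero[OF \<alpha>, of q1] M.act_zero[OF \<eta>, of q1] by auto
  obtain c' where c': "c' \<in> vec M o1" "c = act M o1 \<alpha>'' c'" using ex c(1) c(3)[symmetric] by (rule exact_atD)
  have "b = act M p2 \<beta>' (\<lambda>i. e i \<oplus>\<^bsub>M\<^esub> act M o1 \<eta>'' c' i)"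
    unfolding M.act_add[OF \<beta>' c(2) M.act_closed[OF \<eta>'' c'(1)]] c(4) c'(2) eq[OF c'(1)] ..
  then show "\<exists>w\<in>vec M p2. b = act M p2 \<beta>' w" using M.add_vec[OF c(2) M.act_closed[OF \<eta>'' c'(1)]] by blast
qed

text \<open>From the total complex, over the quotient, to the sub one position later. For a cycle a
  the image under \<eta> is a cycle, hence equal to \<beta> b, and (a, b) is a cycle of the total
  complex.\<close>

lemma pair_exact_left:
  assumes M: "module R M" and pe: "pair_exact M p1 p2 q1 q2 \<alpha>' \<eta>' \<beta>' \<alpha> \<eta> \<beta>" and ex: "exact_at M q2 r2 \<beta> \<gamma>"
    and eq: "\<And>a. a \<in> vec M q1 ==> act M r2 \<gamma> (act M q1 \<eta> a) = act M r1 \<delta> (act M q1 \<alpha> a)"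
    and \<eta>: "\<eta> \<in> mat R r2 q1" and \<delta>: "\<delta> \<in> mat R s2 r1"
  shows "exact_at M p1 q1 \<alpha>' \<alpha>"
  unfolding exact_at_def
proof (intro ballI impI)
  interpret M: module R M by fact
  fix a assume a: "a \<in> vec M q1" "act M q1 \<alpha> a = (\<lambda>i. (zero M))"
  have "act M r2 \<gamma> (act M q1 \<eta> a) = (\<lambda>i. (zero M))" using eq[OF a(1)] M.act_zero[OF \<delta>] by (simp add: a(2))
  with ex M.act_closed[OF \<eta> a(1)] obtain b where "b \<in> vec M q2" "act M q1 \<eta> a = act M q2 \<beta> b" by (rule exact_atD)
  then show "\<exists>w\<in>vec M p1. a = act M p1 \<alpha>' w" using pair_exactD[OF pe a(1) _ a(2)] by metis
qed

section \<open>Submodules and quotients\<close>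

lemma submodule_zero:
  assumes "module R M" "submodule H R M" shows "(zero M) \<in> H"
  using subgroup.one_closed[OF submodule.axioms(1)[OF assms(2)]] by simp

lemma submodule_kernel:
  assumes M: "module R M" and N: "module R N" and f: "lin R M N f"
  shows "submodule {x \<in> carrier M. f x = (zero N)} R M"
proof -
  interpret M: module R M by fact
  interpret N: module R N by fact
  show ?thesis
    by (rule M.submoduleI) (auto simp: lin_zero[OF M N f] lin_neg[OF M N f] lin_add[OF f] lin_smult[OF f])
qed

lemma submodule_image:
  assumes M: "module R M" and N: "module R N" and f: "lin R M N f"
  shows "submodule (f ` carrier M) R N"
proof -
  interpret M: module R M by fact
  interpret N: module R N by fact
  show ?thesis
  proof (rule N.submoduleI)
    show "f ` carrier M \<subseteq> carrier N" using lin_closed[OF f] by auto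
    show "(zero N) \<in> f ` carrier M" by (rule image_eqI[of _ _ "(zero M)"]) (simp_all add: lin_zero[OF M N f])
    show "\<ominus>\<^bsub>N\<^esub> a \<in> f ` carrier M" if "a \<in> f ` carrier M" for a
      using that by (auto simp: lin_neg[OF M N f, symmetric])
    show "a \<oplus>\<^bsub>N\<^esub> b \<in> f ` carrier M" if "a \<in> f ` carrier M" "b \<in> f ` carrier M" for a b
      using that by (auto simp: lin_add[OF f, symmetric])
    show "r \<odot>\<^bsub>N\<^esub> a \<in> f ` carrier M" if "r \<in> carrier R" "a \<in> f ` carrier M" for r a
      using that by (auto simp: lin_smult[OF f, symmetric])
  qed
qed

lemma submodule_mono:
  assumes M: "module R M" and K: "submodule K R M" and H: "submodule H R M" and "H \<subseteq> K"
  shows "submodule H R (M\<lparr>carrier := K\<rparr>)"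
proof -
  interpret M: module R M by fact
  interpret K: module R "M\<lparr>carrier := K\<rparr>" using K M by (rule submodule.submodule_is_module)
  show ?thesis
  proof (rule K.module_incl_imp_submodule)
    show "H \<subseteq> carrier (M\<lparr>carrier := K\<rparr>)" using assms(4) by simp
    show "module R (M\<lparr>carrier := K, carrier := H\<rparr>)" using submodule.submodule_is_module[OF H M] by simp
  qed
qed

context
  fixes R :: "('a, 'r) ring_scheme" and M :: "('a, 'b, 'm) module_scheme" and H
  assumes M: "module R M" and H: "submodule H R M"
begin

interpretation M: module R M by (rule M)
interpretation Q: module R "quot_module M H" using M H by (rule quot_module_is_module)

lemma coset_eq: "x \<in> carrier M ==> H +>\<^bsub>M\<^esub> x = {y \<in> carrier M. y \<ominus>\<^bsub>M\<^esub> x \<in> H}"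
proof (intro equalityI subsetI)
  fix y assume x: "x \<in> carrier M" and "y \<in> H +>\<^bsub>M\<^esub> x"
  then obtain h where h: "h \<in> H" "y = h \<oplus>\<^bsub>M\<^esub> x" by (auto simp: a_r_coset_def r_coset_def)
  then have "h \<in> carrier M" using M.submoduleE(1)[OF H] by auto
  with h x show "y \<in> {y \<in> carrier M. y \<ominus>\<^bsub>M\<^esub> x \<in> H}" using M.minus_eq_iff[of y x h] by auto
next
  fix y assume x: "x \<in> carrier M" and "y \<in> {y \<in> carrier M. y \<ominus>\<^bsub>M\<^esub> x \<in> H}"
  then show "y \<in> H +>\<^bsub>M\<^esub> x" using M.minus_add_cancel[of y x] by (force simp: a_r_coset_def r_coset_def)
qed

lemma coset_self: "x \<in> carrier M ==> x \<in> H +>\<^bsub>M\<^esub> x"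
  by (simp add: coset_eq submodule_zero[OF M H])

lemma quot_carrier: "carrier (quot_module M H) = (\<lambda>x. H +>\<^bsub>M\<^esub> x) ` carrier M"
  by (auto simp: quot_module_def A_RCOSETS_def RCOSETS_def a_r_coset_def)

lemma coset_eq_iff:
  assumes x: "x \<in> carrier M" and y: "y \<in> carrier M"
  shows "H +>\<^bsub>M\<^esub> x = H +>\<^bsub>M\<^esub> y \<longleftrightarrow> x \<ominus>\<^bsub>M\<^esub> y \<in> H"
proof
  assume "H +>\<^bsub>M\<^esub> x = H +>\<^bsub>M\<^esub> y"
  then show "x \<ominus>\<^bsub>M\<^esub> y \<in> H" using coset_self[OF x] by (simp add: coset_eq[OF y])
next
  assume xy: "x \<ominus>\<^bsub>M\<^esub> y \<in> H"
  have eq: "(z \<ominus>\<^bsub>M\<^esub> x) \<oplus>\<^bsub>M\<^esub> (x \<ominus>\<^bsub>M\<^esub> y) = z \<ominus>\<^bsub>M\<^esub> y" if "z \<in> carrier M" for z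
    using that x y by (rule M.minus_add_minus)
  have "z \<ominus>\<^bsub>M\<^esub> x \<in> H \<longleftrightarrow> z \<ominus>\<^bsub>M\<^esub> y \<in> H" if z: "z \<in> carrier M" for z
  proof
    assume "z \<ominus>\<^bsub>M\<^esub> x \<in> H"
    from M.submoduleE(5)[OF H this xy] show "z \<ominus>\<^bsub>M\<^esub> y \<in> H" by (simp add: eq[OF z])
  next
    assume "z \<ominus>\<^bsub>M\<^esub> y \<in> H"
    from M.submoduleE(5)[OF H this M.submoduleE(3)[OF H xy]]
    have "(z \<ominus>\<^bsub>M\<^esub> y) \<oplus>\<^bsub>M\<^esub> (\<ominus>\<^bsub>M\<^esub> (x \<ominus>\<^bsub>M\<^esub> y)) \<in> H" .
    moreover have "(z \<ominus>\<^bsub>M\<^esub> y) \<oplus>\<^bsub>M\<^esub> (\<ominus>\<^bsub>M\<^esub> (x \<ominus>\<^bsub>M\<^esub> y)) = z \<ominus>\<^bsub>M\<^esub> x"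
      using M.minus_eq_iff[of "z \<ominus>\<^bsub>M\<^esub> y" "x \<ominus>\<^bsub>M\<^esub> y" "z \<ominus>\<^bsub>M\<^esub> x"] eq[OF z] x y z by (simp add: M.minus_eq)
    ultimately show "z \<ominus>\<^bsub>M\<^esub> x \<in> H" by simp
  qed
  then show "H +>\<^bsub>M\<^esub> x = H +>\<^bsub>M\<^esub> y" by (auto simp: coset_eq[OF x] coset_eq[OF y])
qed

lemma lin_coset: "lin R M (quot_module M H) (\<lambda>x. H +>\<^bsub>M\<^esub> x)"
proof -
  have add: "additive_subgroup H M" by (rule additive_subgroup.intro) (rule submodule.axioms(1)[OF H])
  interpret AS: abelian_subgroup H M by (rule abelian_subgroupI3[OF add M.M.abelian_group_axioms])
  have "r \<odot>\<^bsub>quot_module M H\<^esub> (H +>\<^bsub>M\<^esub> x) = H +>\<^bsub>M\<^esub> (r \<odot>\<^bsub>M\<^esub> x)"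
    if r: "r \<in> carrier R" and x: "x \<in> carrier M" for r x
  proof -
    have "H +>\<^bsub>M\<^esub> (r \<odot>\<^bsub>M\<^esub> y) = H +>\<^bsub>M\<^esub> (r \<odot>\<^bsub>M\<^esub> x)" if "y \<in> H +>\<^bsub>M\<^esub> x" for y
    proof -
      from that have y: "y \<in> carrier M" "y \<ominus>\<^bsub>M\<^esub> x \<in> H" by (auto simp: coset_eq[OF x])
      then have "r \<odot>\<^bsub>M\<^esub> y \<ominus>\<^bsub>M\<^esub> r \<odot>\<^bsub>M\<^esub> x \<in> H"
        using M.submoduleE(4)[OF H r y(2)] r x y(1) by (simp add: M.minus_eq M.smult_r_distr M.smult_r_minus)
      with r x y(1) show ?thesis by (simp add: coset_eq_iff)
    qed
    then have "(\<Union>y \<in> H +>\<^bsub>M\<^esub> x. H +>\<^bsub>M\<^esub> (r \<odot>\<^bsub>M\<^esub> y)) = H +>\<^bsub>M\<^esub> (r \<odot>\<^bsub>M\<^esub> x)"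
      using coset_self[OF x] by (intro SUP_eq_const) blast+
    then show ?thesis by (simp add: quot_module_def)
  qed
  moreover have "(H +>\<^bsub>M\<^esub> x) \<oplus>\<^bsub>quot_module M H\<^esub> (H +>\<^bsub>M\<^esub> y) = H +>\<^bsub>M\<^esub> (x \<oplus>\<^bsub>M\<^esub> y)"
    if "x \<in> carrier M" "y \<in> carrier M" for x y
    using AS.a_rcos_sum[OF that] by (simp add: quot_module_def)
  ultimately show ?thesis by (simp add: lin_def quot_carrier)
qed

lemma coset_eq_zero_iff: "x \<in> carrier M ==> H +>\<^bsub>M\<^esub> x = \<zero>\<^bsub>quot_module M H\<^esub> \<longleftrightarrow> x \<in> H"
  using coset_eq_iff[of x "(zero M)"] lin_zero[OF M Q.module_axioms lin_coset] by simp

lemma zero_module_quot: "zero_module (quot_module M H) \<longleftrightarrow> carrier M \<subseteq> H"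
proof
  assume "zero_module (quot_module M H)"
  then have "H +>\<^bsub>M\<^esub> x = \<zero>\<^bsub>quot_module M H\<^esub>" if "x \<in> carrier M" for x
    using that unfolding zero_module_def quot_carrier by blast
  then show "carrier M \<subseteq> H" using coset_eq_zero_iff by blast
next
  assume "carrier M \<subseteq> H"
  then have "H +>\<^bsub>M\<^esub> x = \<zero>\<^bsub>quot_module M H\<^esub>" if "x \<in> carrier M" for x using that coset_eq_zero_iff by blast
  then have "carrier (quot_module M H) \<subseteq> {\<zero>\<^bsub>quot_module M H\<^esub>}" by (auto simp: quot_carrier)
  then show "zero_module (quot_module M H)" using Q.M.zero_closed by (auto simp: zero_module_def)
qed

end

section \<open>Finitely generated modules over Noetherian rings\<close>

text \<open>A submodule of the q-th power of M, spelled out on vectors: those of its members whose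
  last coordinate is zero are again such a set, for one coordinate less, without any change of
  type.\<close>

definition closed_vec :: "('a, 'r) ring_scheme => ('a, 'b, 'm) module_scheme => nat => (nat => 'b) set => bool" where
  "closed_vec R M q Z \<longleftrightarrow> Z \<subseteq> vec M q \<and> (\<lambda>i. (zero M)) \<in> Z \<and>
    (\<forall>u\<in>Z. \<forall>v\<in>Z. (\<lambda>i. u i \<oplus>\<^bsub>M\<^esub> v i) \<in> Z) \<and> (\<forall>r\<in>carrier R. \<forall>u\<in>Z. (\<lambda>i. r \<odot>\<^bsub>M\<^esub> u i) \<in> Z)"

definition noeth :: "('a, 'r) ring_scheme => ('a, 'b, 'm) module_scheme => bool" where
  "noeth R M \<longleftrightarrow> module R M \<and> (\<forall>Z. submodule Z R M \<longrightarrow>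
    (\<exists>k z. (\<forall>i. z i \<in> Z) \<and> (\<forall>y\<in>Z. \<exists>r. (\<forall>i. r i \<in> carrier R) \<and> y = lincomb M r z k)))"

lemma (in module) span_submodule:
  assumes z: "\<And>i. z i \<in> carrier M"
  shows "submodule {lincomb M r z k | r. \<forall>i. r i \<in> carrier R} R M" (is "submodule ?S R M")
proof (rule submoduleI)
  have I: "lincomb M r z k \<in> ?S" if "\<And>i. r i \<in> carrier R" for r using that by blast
  show "?S \<subseteq> carrier M" using z by auto
  show "(zero M) \<in> ?S"
    using lincomb_zero_left[of k "\<lambda>_. \<zero>" z] z I[of "\<lambda>_. \<zero>"] by simp
  fix a assume "a \<in> ?S"
  then obtain r where r: "\<And>i. r i \<in> carrier R" "a = lincomb M r z k" by auto
  show "\<ominus>\<^bsub>M\<^esub> a \<in> ?S" using lincomb_neg_left[of r z k] r z I[of "\<lambda>i. \<ominus> r i"] by simp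
  show "c \<odot>\<^bsub>M\<^esub> a \<in> ?S" if "c \<in> carrier R" for c
    using lincomb_smult_left[of c r z k] r z that I[of "\<lambda>i. c \<otimes> r i"] by simp
  fix b assume "b \<in> ?S"
  then obtain s where s: "\<And>i. s i \<in> carrier R" "b = lincomb M s z k" by auto
  show "a \<oplus>\<^bsub>M\<^esub> b \<in> ?S" using lincomb_add_left[of r s z k] r s z I[of "\<lambda>i. r i \<oplus> s i"] by simp
qed

lemma (in module) lincomb_gen_mem:
  assumes z: "\<And>i. z i \<in> carrier M" and "i < k"
  shows "z i \<in> {lincomb M r z k | r. \<forall>i. r i \<in> carrier R}"
proof -
  have "z i = lincomb M (unit_vector R i) z k" using lincomb_unit[OF assms(2), of z] z by simp
  then show ?thesis by (auto intro: R.unit_vector_closed)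
qed

lemma finite_enum:
  assumes "finite S" "S \<subseteq> C" "c \<in> C"
  shows "\<exists>z. \<exists>k::nat. (\<forall>i. z i \<in> C) \<and> S = z ` {..<k}"
proof -
  obtain k :: nat and s where s: "S = s ` {..<k}"
    using finite_imp_nat_seg_image_inj_on[OF assms(1)] by (metis lessThan_def)
  have "\<forall>i. (if i < k then s i else c) \<in> C" using assms s by auto
  moreover have "S = (\<lambda>i. if i < k then s i else c) ` {..<k}" using s by auto
  ultimately show ?thesis by (intro exI[of _ "\<lambda>i. if i < k then s i else c"] exI[of _ k] conjI)
qed

lemma fg_module_gens:
  assumes "fg_module R M"
  obtains n e where "e \<in> vec M n" "\<forall>m\<in>carrier M. \<exists>v\<in>vec (regular_module R) n. m = lincomb M v e n"
proof -
  interpret M: module R M using assms by (simp add: fg_module_def)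
  obtain S where S: "finite S" "S \<subseteq> carrier M" "generated_submodule R M S = carrier M"
    using assms by (auto simp: fg_module_def)
  obtain z and k :: nat where z0: "\<forall>i. z i \<in> carrier M" "S = z ` {..<k}"
    using finite_enum[OF S(1,2) M.zero_closed] by blast
  note z = z0(1)[rule_format] z0(2)
  let ?e = "\<lambda>i. if i < k then z i else (zero M)"
  have "S \<subseteq> {lincomb M r z k | r. \<forall>i. r i \<in> carrier R}"
    using M.lincomb_gen_mem[OF z(1)] z(2) by auto
  moreover have sm: "submodule {lincomb M r z k | r. \<forall>i. r i \<in> carrier R} R M"
    by (rule M.span_submodule) (rule z(1))
  ultimately have sp: "carrier M \<subseteq> {lincomb M r z k | r. \<forall>i. r i \<in> carrier R}"
    using S(3) sm by (auto simp: generated_submodule_def)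
  have "?e \<in> vec M k" using z(1) by (auto simp del: M.vec_closed simp: vec_def)
  moreover have "\<forall>m\<in>carrier M. \<exists>v\<in>vec (regular_module R) k. m = lincomb M v ?e k"
  proof
    fix m assume "m \<in> carrier M"
    then obtain r where r: "\<And>i. r i \<in> carrier R" "m = lincomb M r z k" using sp by blast
    have "m = lincomb M (\<lambda>i. if i < k then r i else (zero R)) ?e k"
      unfolding r(2) by (intro lincomb_cong) auto
    moreover have "(\<lambda>i. if i < k then r i else (zero R)) \<in> vec (regular_module R) k"
      using r(1) by (auto simp del: M.R.vec_regular_closed simp: vec_def)
    ultimately show "\<exists>v\<in>vec (regular_module R) k. m = lincomb M v ?e k" by blast
  qed
  ultimately show ?thesis by (rule that)
qed

lemma fg_moduleI:
  assumes M: "module R M" and z: "\<And>i. z i \<in> carrier M"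
    and gen: "\<And>m. m \<in> carrier M ==> \<exists>r. (\<forall>i. r i \<in> carrier R) \<and> m = lincomb M r z k"
  shows "fg_module R M"
proof -
  interpret M: module R M by fact
  have "lincomb M r z k \<in> H" if H: "submodule H R M" "z ` {..<k} \<subseteq> H" and r: "\<And>i. r i \<in> carrier R" for r H
    using H(2) by (induction k) (auto simp: lessThan_Suc submodule_zero[OF M H(1)] intro!: M.submoduleE(5)[OF H(1)] M.submoduleE(4)[OF H(1)] r)
  then have "carrier M \<subseteq> generated_submodule R M (z ` {..<k})"
    using gen by (force simp: generated_submodule_def)
  moreover have "generated_submodule R M (z ` {..<k}) \<subseteq> carrier M"
    using M.carrier_is_submodule z by (auto simp: generated_submodule_def)
  ultimately show ?thesis using M z unfolding fg_module_def by (intro conjI exI[of _ "z ` {..<k}"]) auto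
qed

lemma noeth_fg: "noeth R M ==> submodule Z R M ==> fg_module R (M\<lparr>carrier := Z\<rparr>)"
proof -
  assume n: "noeth R M" and Z: "submodule Z R M"
  then have M: "module R M" by (simp add: noeth_def)
  have lc: "lincomb (M\<lparr>carrier := Z\<rparr>) r z k = lincomb M r z k" for r z k by (induction k) auto
  obtain k z where z: "\<forall>i. z i \<in> Z" "\<forall>y\<in>Z. \<exists>r. (\<forall>i. r i \<in> carrier R) \<and> y = lincomb M r z k"
    using n Z unfolding noeth_def by blast
  show ?thesis by (rule fg_moduleI[OF submodule.submodule_is_module[OF Z M], of z k]) (use z in \<open>auto simp: lc\<close>)
qed

text \<open>Induction on q: lift generators of the module of last coordinates, which lies in M, and
  add generators of the vectors with last coordinate zero.\<close>

lemma noeth_closed_vec: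
  assumes n: "noeth R M"
  shows "closed_vec R M q Z ==> \<exists>k z. (\<forall>j. z j \<in> Z) \<and>
    (\<forall>v\<in>Z. \<exists>r. (\<forall>i. r i \<in> carrier R) \<and> v = (\<lambda>i. lincomb M r (\<lambda>j. z j i) k))"
proof (induction q arbitrary: Z)
  case 0
  then have "v = (\<lambda>i. (zero M))" if "v \<in> Z" for v using that by (auto simp: closed_vec_def vec_def)
  moreover interpret M: module R M using n by (simp add: noeth_def)
  have "\<exists>r. \<forall>i. r i \<in> carrier R" by (rule exI[of _ "\<lambda>_. (zero R)"]) simp
  ultimately show ?case using 0 by (intro exI[of _ 0] exI[of _ "\<lambda>_ _. (zero M)"]) (auto simp: closed_vec_def)
next
  case (Suc q)
  interpret M: module R M using n by (simp add: noeth_def)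
  have Z: "Z \<subseteq> vec M (Suc q)" "(\<lambda>i. (zero M)) \<in> Z" "\<And>u v. u \<in> Z ==> v \<in> Z ==> (\<lambda>i. u i \<oplus>\<^bsub>M\<^esub> v i) \<in> Z"
    "\<And>r u. r \<in> carrier R ==> u \<in> Z ==> (\<lambda>i. r \<odot>\<^bsub>M\<^esub> u i) \<in> Z"
    using Suc.prems by (auto simp: closed_vec_def)
  have cl: "v i \<in> carrier M" if "v \<in> Z" for v i using Z(1) that M.vec_closed by blast
  have Zneg: "(\<lambda>i. \<ominus>\<^bsub>M\<^esub> u i) \<in> Z" if "u \<in> Z" for u
    using Z(4)[OF _ that, of "\<ominus>\<^bsub>R\<^esub> \<one>\<^bsub>R\<^esub>"] cl[OF that] by (simp add: M.smult_l_minus)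
  have Zminus: "(\<lambda>i. u i \<ominus>\<^bsub>M\<^esub> v i) \<in> Z" if "u \<in> Z" "v \<in> Z" for u v
    using Z(3)[OF that(1) Zneg[OF that(2)]] by (simp add: M.minus_eq)
  have Zlin: "(\<lambda>i. lincomb M r (\<lambda>j. z j i) k) \<in> Z" if "\<And>i. r i \<in> carrier R" "\<And>j. z j \<in> Z" for r z k
    by (induction k) (use Z(2) Z(3)[OF _ Z(4)[OF that(1) that(2)]] in auto)
  have "submodule ((\<lambda>v. v q) ` Z) R M"
  proof (rule M.submoduleI)
    show "(\<lambda>v. v q) ` Z \<subseteq> carrier M" using cl by auto
    show "(zero M) \<in> (\<lambda>v. v q) ` Z" using Z(2) by (intro image_eqI[of _ _ "\<lambda>_. (zero M)"]) auto
    show "\<ominus>\<^bsub>M\<^esub> a \<in> (\<lambda>v. v q) ` Z" if "a \<in> (\<lambda>v. v q) ` Z" for a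
      using that Zneg by (force simp: image_iff)
    show "a \<oplus>\<^bsub>M\<^esub> b \<in> (\<lambda>v. v q) ` Z" if "a \<in> (\<lambda>v. v q) ` Z" "b \<in> (\<lambda>v. v q) ` Z" for a b
      using that Z(3) by (force simp: image_iff)
    show "r \<odot>\<^bsub>M\<^esub> a \<in> (\<lambda>v. v q) ` Z" if "r \<in> carrier R" "a \<in> (\<lambda>v. v q) ` Z" for r a
      using that Z(4) by (force simp: image_iff)
  qed
  then obtain k y where y: "\<forall>i. y i \<in> (\<lambda>v. v q) ` Z"
    "\<forall>x\<in>(\<lambda>v. v q) ` Z. \<exists>r. (\<forall>i. r i \<in> carrier R) \<and> x = lincomb M r y k"
    using n unfolding noeth_def by blast
  have "\<forall>i. \<exists>v\<in>Z. y i = v q" using y(1) by auto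
  then obtain u where u: "\<And>i. u i \<in> Z" "\<And>i. y i = u i q" by metis
  have "closed_vec R M q {v \<in> Z. v q = (zero M)}"
    unfolding closed_vec_def
  proof (intro conjI)
    show "{v \<in> Z. v q = (zero M)} \<subseteq> vec M q"
    proof
      fix v assume "v \<in> {v \<in> Z. v q = (zero M)}"
      then have "v \<in> vec M (Suc q)" "v q = (zero M)" using Z(1) by auto
      moreover from this have "v i = (zero M)" if "q \<le> i" for i
        using that vec_zero_outside[of v M "Suc q" i] by (cases "i = q") auto
      ultimately show "v \<in> vec M q" by (auto simp del: M.vec_closed simp: vec_def)
    qed
  qed (use Z cl in auto)
  then obtain l z where z: "\<forall>j. z j \<in> {v \<in> Z. v q = (zero M)}"
    "\<forall>v\<in>{v \<in> Z. v q = (zero M)}. \<exists>r. (\<forall>i. r i \<in> carrier R) \<and> v = (\<lambda>i. lincomb M r (\<lambda>j. z j i) l)"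
    using Suc.IH by blast
  let ?w = "\<lambda>j. if j < k then u j else z (j - k)"
  have "\<exists>r. (\<forall>i. r i \<in> carrier R) \<and> v = (\<lambda>i. lincomb M r (\<lambda>j. ?w j i) (k + l))" if v: "v \<in> Z" for v
  proof -
    obtain r where r: "\<And>i. r i \<in> carrier R" "v q = lincomb M r y k" using y(2) v by blast
    let ?t = "\<lambda>i. lincomb M r (\<lambda>j. u j i) k"
    have t: "?t \<in> Z" by (rule Zlin) (use r u in auto)
    have "(\<lambda>i. v i \<ominus>\<^bsub>M\<^esub> ?t i) \<in> {v \<in> Z. v q = (zero M)}"
      using Zminus[OF v t] cl[OF t, of q] r(2) by (simp flip: u(2))
    then obtain s where s: "\<And>i. s i \<in> carrier R" "(\<lambda>i. v i \<ominus>\<^bsub>M\<^esub> ?t i) = (\<lambda>i. lincomb M s (\<lambda>j. z j i) l)"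
      using z(2) by blast
    let ?r = "\<lambda>j. if j < k then r j else s (j - k)"
    have "v = (\<lambda>i. lincomb M ?r (\<lambda>j. ?w j i) (k + l))"
    proof
      fix i
      have zc: "z j i \<in> carrier M" for j using z(1) cl by blast
      have wc: "?w j i \<in> carrier M" for j using zc cl[OF u(1)] by simp
      have "lincomb M ?r (\<lambda>j. ?w j i) (k + l) = lincomb M ?r (\<lambda>j. ?w j i) k \<oplus>\<^bsub>M\<^esub>
          lincomb M (\<lambda>j. ?r (k + j)) (\<lambda>j. ?w (k + j) i) l"
        by (rule M.lincomb_split) (use r s wc in auto)
      also have "lincomb M ?r (\<lambda>j. ?w j i) k = ?t i" by (rule lincomb_cong) auto
      also have "lincomb M (\<lambda>j. ?r (k + j)) (\<lambda>j. ?w (k + j) i) l = v i \<ominus>\<^bsub>M\<^esub> ?t i"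
        using fun_cong[OF s(2), of i] by simp
      also have "?t i \<oplus>\<^bsub>M\<^esub> (v i \<ominus>\<^bsub>M\<^esub> ?t i) = v i"
        using cl[OF v, of i] cl[OF t, of i] by (simp add: M.a_comm[of "?t i"])
      finally show "v i = lincomb M ?r (\<lambda>j. ?w j i) (k + l)" by simp
    qed
    moreover have "\<forall>i. ?r i \<in> carrier R" using r s by auto
    ultimately show ?thesis by (intro exI[of _ ?r] conjI)
  qed
  moreover have "\<forall>j. ?w j \<in> Z" using u(1) z(1) by auto
  ultimately show ?case by (intro exI[of _ "k + l"] exI[of _ ?w] conjI ballI)
qed

text \<open>Submodules of the regular module are ideals, which are finitely generated by the
  definition of \<open>noetherian_ring\<close>.\<close>

lemma noeth_regular:
  assumes "cring R" "noetherian_ring R" shows "noeth R (regular_module R)"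
proof -
  interpret R: cring R by fact
  interpret N: noetherian_ring R by fact
  let ?Rg = "regular_module R"
  interpret M: module R ?Rg by (rule R.regular_module_is_module)
  have "\<exists>k z. (\<forall>i. z i \<in> Z) \<and> (\<forall>y\<in>Z. \<exists>r. (\<forall>i. r i \<in> carrier R) \<and> y = lincomb ?Rg r z k)"
    if Z: "submodule Z R ?Rg" for Z
  proof -
    note s = M.submoduleE[OF Z, simplified]
    have id: "ideal I R" if I: "submodule I R ?Rg" for I
    proof (rule idealI)
      note s = M.submoduleE[OF I, simplified]
      show "subgroup I (add_monoid R)"
        using s submodule_zero[OF M.module_axioms I] by (intro R.add.subgroupI) auto
      show "a \<in> I ==> x \<in> carrier R ==> x \<otimes>\<^bsub>R\<^esub> a \<in> I" for a x using s(4) by simp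
      then show "a \<in> I ==> x \<in> carrier R ==> a \<otimes>\<^bsub>R\<^esub> x \<in> I" for a x using s(1) R.m_comm[of a x] by auto
    qed (rule R.ring_axioms)
    obtain A where A: "A \<subseteq> carrier R" "finite A" "Z = Idl\<^bsub>R\<^esub> A" using N.finetely_gen[OF id[OF Z]] by blast
    have AZ: "A \<subseteq> Z" using A R.genideal_self by simp
    obtain z and k :: nat where z0: "\<forall>i. z i \<in> Z" "A = z ` {..<k}"
      using finite_enum[OF A(2) AZ submodule_zero[OF M.module_axioms Z]] by blast
    note z = z0(1)[rule_format] z0(2)
    have zc: "\<And>i. z i \<in> carrier ?Rg" using z(1) s(1) by auto
    have "Z \<subseteq> {lincomb ?Rg r z k | r. \<forall>i. r i \<in> carrier R}"
      unfolding A(3) using M.lincomb_gen_mem[OF zc, of _ k] z(2)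
      by (intro R.genideal_minimal id M.span_submodule zc) auto
    with z(1) show ?thesis by (intro exI[of _ k] exI[of _ z]) auto
  qed
  then show ?thesis using M.module_axioms by (simp add: noeth_def)
qed

lemma closed_vec_kernel:
  assumes "module R M" "A \<in> mat R p q"
  shows "closed_vec R M q {v \<in> vec M q. act M q A v = (\<lambda>i. (zero M))}"
proof -
  interpret M: module R M by fact
  show ?thesis using assms(2) by (auto simp: closed_vec_def M.act_add M.act_smult)
qed

text \<open>The preimage of a submodule Z in a free module mapping onto M is finitely generated
  since R is Noetherian; the images of its generators generate Z.\<close>

lemma noeth_fg_module:
  assumes "cring R" "noetherian_ring R" and fg: "fg_module R M" shows "noeth R M"
proof -
  let ?Rg = "regular_module R"
  interpret M: module R M using fg by (simp add: fg_module_def)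
  interpret Rg: module R ?Rg by (rule M.R.regular_module_is_module)
  obtain n e where e: "e \<in> vec M n" "\<forall>m\<in>carrier M. \<exists>v\<in>vec ?Rg n. m = lincomb M v e n"
    using fg by (rule fg_module_gens)
  have "\<exists>k z. (\<forall>i. z i \<in> Z) \<and> (\<forall>y\<in>Z. \<exists>r. (\<forall>i. r i \<in> carrier R) \<and> y = lincomb M r z k)"
    if Z: "submodule Z R M" for Z
  proof -
    note s = M.submoduleE[OF Z]
    have ec: "e i \<in> carrier M" for i using e(1) by simp
    have "closed_vec R ?Rg n {v \<in> vec ?Rg n. lincomb M v e n \<in> Z}"
      unfolding closed_vec_def
    proof (intro conjI)
      show "(\<lambda>i. \<zero>\<^bsub>?Rg\<^esub>) \<in> {v \<in> vec ?Rg n. lincomb M v e n \<in> Z}"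
        using ec M.lincomb_zero_left[of n "\<lambda>_. (zero R)" e] submodule_zero[OF M.module_axioms Z] Rg.zero_vec[of n] by simp
      show "\<forall>u\<in>{v \<in> vec ?Rg n. lincomb M v e n \<in> Z}. \<forall>v\<in>{v \<in> vec ?Rg n. lincomb M v e n \<in> Z}.
          (\<lambda>i. u i \<oplus>\<^bsub>?Rg\<^esub> v i) \<in> {v \<in> vec ?Rg n. lincomb M v e n \<in> Z}"
        using ec Rg.add_vec[of _ n] s(5) by (auto simp: M.lincomb_add_left)
      show "\<forall>r\<in>carrier R. \<forall>u\<in>{v \<in> vec ?Rg n. lincomb M v e n \<in> Z}.
          (\<lambda>i. r \<odot>\<^bsub>?Rg\<^esub> u i) \<in> {v \<in> vec ?Rg n. lincomb M v e n \<in> Z}"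
        using ec Rg.smult_vec[of _ _ n] s(4) by (auto simp: M.lincomb_smult_left)
    qed auto
    from noeth_closed_vec[OF noeth_regular[OF assms(1,2)] this]
    obtain k z where z: "\<forall>j. z j \<in> {v \<in> vec ?Rg n. lincomb M v e n \<in> Z}"
      "\<forall>v\<in>{v \<in> vec ?Rg n. lincomb M v e n \<in> Z}. \<exists>r. (\<forall>i. r i \<in> carrier R) \<and> v = (\<lambda>i. lincomb ?Rg r (\<lambda>j. z j i) k)" by blast
    have zc: "z j i \<in> carrier R" for j i using z(1) M.R.vec_regular_closed by blast
    have "\<exists>r. (\<forall>i. r i \<in> carrier R) \<and> y = lincomb M r (\<lambda>j. lincomb M (z j) e n) k" if y: "y \<in> Z" for y
    proof -
      obtain v where v: "v \<in> vec ?Rg n" "y = lincomb M v e n" using e(2) y s(1) by blast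
      with y obtain r where r: "\<And>i. r i \<in> carrier R" "v = (\<lambda>i. lincomb ?Rg r (\<lambda>j. z j i) k)" using z(2) by blast
      have "y = lincomb M r (\<lambda>j. lincomb M (z j) e n) k"
        unfolding v(2) r(2) by (rule M.lincomb_lincomb) (use r zc ec in auto)
      with r(1) show ?thesis by blast
    qed
    with z(1) show ?thesis by (intro exI[of _ k] exI[of _ "\<lambda>j. lincomb M (z j) e n"]) auto
  qed
  then show ?thesis using M.module_axioms by (simp add: noeth_def)
qed

section \<open>Existence of resolutions\<close>

text \<open>The columns of A are finitely many generators of Z, which exist because R is
  Noetherian.\<close>

lemma closed_vec_image_matrix:
  assumes R: "cring R" "noetherian_ring R" and Z: "closed_vec R (regular_module R) q Z"
  shows "\<exists>k A. A \<in> mat R q k \<and> Z = act (regular_module R) k A ` vec (regular_module R) k"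
proof -
  let ?Rg = "regular_module R"
  interpret R: cring R by fact
  interpret Rg: module R ?Rg by (rule R.regular_module_is_module)
  have cz: "Z \<subseteq> vec ?Rg q" "(\<lambda>i. (zero R)) \<in> Z" "\<And>u v. u \<in> Z ==> v \<in> Z ==> (\<lambda>i. u i \<oplus>\<^bsub>R\<^esub> v i) \<in> Z"
    "\<And>r u. r \<in> carrier R ==> u \<in> Z ==> (\<lambda>i. r \<otimes>\<^bsub>R\<^esub> u i) \<in> Z" using Z by (auto simp: closed_vec_def)
  obtain k z where z: "\<forall>j. z j \<in> Z"
    "\<forall>v\<in>Z. \<exists>r. (\<forall>i. r i \<in> carrier R) \<and> v = (\<lambda>i. lincomb ?Rg r (\<lambda>j. z j i) k)"
    using noeth_closed_vec[OF noeth_regular[OF R] Z] by blast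
  let ?A = "\<lambda>i j. if j < k then z j i else (zero R)"
  have zv: "z j \<in> vec ?Rg q" for j using z(1) cz(1) by blast
  have zc: "z j i \<in> carrier R" for j i by (rule R.vec_regular_closed[OF zv])
  have A: "?A \<in> mat R q k"
    using zc vec_zero_outside[OF zv] by (auto simp del: R.mat_entry Rg.mat_closed simp: mat_def)
  have act: "act ?Rg k ?A r = (\<lambda>i. lincomb ?Rg r (\<lambda>j. z j i) k)" if "\<And>i. r i \<in> carrier R" for r
  proof
    fix i
    have "lincomb ?Rg (?A i) r k = lincomb ?Rg r (?A i) k"
      using that zc by (intro R.lincomb_regular_comm) auto
    also have "\<dots> = lincomb ?Rg r (\<lambda>j. z j i) k" by (intro lincomb_cong) auto
    finally show "act ?Rg k ?A r i = lincomb ?Rg r (\<lambda>j. z j i) k" by (simp add: act_def)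
  qed
  have "(\<lambda>i. lincomb ?Rg r (\<lambda>j. z j i) k') \<in> Z" if "\<And>i. r i \<in> carrier R" for r k'
    by (induction k') (use z(1) cz(2) cz(3)[OF _ cz(4)[OF that]] in auto)
  then have "act ?Rg k ?A ` vec ?Rg k \<subseteq> Z" by (auto simp: act)
  moreover have "Z \<subseteq> act ?Rg k ?A ` vec ?Rg k"
  proof
    fix v assume "v \<in> Z"
    then obtain r where r: "\<And>i. r i \<in> carrier R" "v = (\<lambda>i. lincomb ?Rg r (\<lambda>j. z j i) k)" using z(2) by blast
    let ?r = "\<lambda>i. if i < k then r i else (zero R)"
    have rv: "?r \<in> vec ?Rg k" using r(1) by (auto simp del: Rg.vec_closed R.vec_regular_closed simp: vec_def)
    have "v = act ?Rg k ?A ?r"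
      using r(1) unfolding r(2) by (subst act) (auto intro!: ext lincomb_cong)
    with rv show "v \<in> act ?Rg k ?A ` vec ?Rg k" by blast
  qed
  ultimately show ?thesis using A by blast
qed

lemma mres_exists:
  assumes R: "cring R" "noetherian_ring R" and fg: "fg_module R M"
  obtains b A e where "mres R M b A e"
proof -
  let ?Rg = "regular_module R"
  interpret M: module R M using fg by (simp add: fg_module_def)
  interpret Rg: module R ?Rg by (rule M.R.regular_module_is_module)
  obtain n e where e: "e \<in> vec M n" "\<forall>m\<in>carrier M. \<exists>v\<in>vec ?Rg n. m = lincomb M v e n"
    using fg by (rule fg_module_gens)
  have ec: "e i \<in> carrier M" for i using e(1) by simp
  have "closed_vec R ?Rg n {v \<in> vec ?Rg n. lincomb M v e n = (zero M)}"
    unfolding closed_vec_def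
  proof (intro conjI)
    show "(\<lambda>i. \<zero>\<^bsub>?Rg\<^esub>) \<in> {v \<in> vec ?Rg n. lincomb M v e n = (zero M)}"
      using ec M.lincomb_zero_left[of n "\<lambda>_. (zero R)" e] Rg.zero_vec[of n] by simp
    show "\<forall>u\<in>{v \<in> vec ?Rg n. lincomb M v e n = (zero M)}. \<forall>v\<in>{v \<in> vec ?Rg n. lincomb M v e n = (zero M)}.
          (\<lambda>i. u i \<oplus>\<^bsub>?Rg\<^esub> v i) \<in> {v \<in> vec ?Rg n. lincomb M v e n = (zero M)}"
      using ec Rg.add_vec[of _ n] by (auto simp: M.lincomb_add_left)
    show "\<forall>r\<in>carrier R. \<forall>u\<in>{v \<in> vec ?Rg n. lincomb M v e n = (zero M)}.
          (\<lambda>i. r \<odot>\<^bsub>?Rg\<^esub> u i) \<in> {v \<in> vec ?Rg n. lincomb M v e n = (zero M)}"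
      using ec Rg.smult_vec[of _ _ n] by (auto simp: M.lincomb_smult_left)
  qed auto
  from closed_vec_image_matrix[OF R this] obtain k0 A0 where A0: "A0 \<in> mat R n k0"
    "{v \<in> vec ?Rg n. lincomb M v e n = (zero M)} = act ?Rg k0 A0 ` vec ?Rg k0" by blast
  \<comment> \<open>A state is a triple of row number, column number and matrix; \<open>?Q\<close>
    makes the ranks of neighbours fit and the kernel of one matrix the image of the next.\<close>
  let ?P = "\<lambda>(m::nat) x. snd (snd x) \<in> mat R (fst x) (fst (snd x)) \<and> (m = 0 \<longrightarrow> x = (n, k0, A0))"
  let ?Q = "\<lambda>x y. fst y = fst (snd x) \<and> {v \<in> vec ?Rg (fst y). act ?Rg (fst y) (snd (snd x)) v = (\<lambda>i. (zero R))} =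
     act ?Rg (fst (snd y)) (snd (snd y)) ` vec ?Rg (fst (snd y))"
  have "\<exists>f. \<forall>m. ?P m (f m) \<and> ?Q (f m) (f (Suc m))"
  proof (rule dependent_nat_choice)
    show "\<exists>x. ?P 0 x" using A0(1) by (intro exI[of _ "(n, k0, A0)"]) simp
  next
    fix x m assume x: "?P m x"
    obtain k B where "B \<in> mat R (fst (snd x)) k" "{v \<in> vec ?Rg (fst (snd x)). act ?Rg (fst (snd x)) (snd (snd x)) v = (\<lambda>i. (zero R))} =
        act ?Rg k B ` vec ?Rg k"
      using closed_vec_image_matrix[OF R closed_vec_kernel[OF Rg.module_axioms conjunct1[OF x]]] by auto
    then show "\<exists>y. ?P (Suc m) y \<and> ?Q x y" by (intro exI[of _ "(fst (snd x), k, B)"]) simp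
  qed
  then obtain f where f: "\<And>m. ?P m (f m)" "\<And>m. ?Q (f m) (f (Suc m))" by blast
  define b where "b m = (case m of 0 => 0 | Suc m => fst (f m))" for m
  define A where "A m = (case m of 0 => (\<lambda>i j. (zero R)) | Suc m => snd (snd (f m)))" for m
  have f0: "f 0 = (n, k0, A0)" using f(1)[of 0] by simp
  have b [simp]: "b 0 = 0" "b (Suc m) = fst (f m)" "A (Suc m) = snd (snd (f m))" for m
    by (simp_all add: b_def A_def)
  have "mres R M b A e"
    unfolding mres_def
  proof (intro conjI allI)
    show "A m \<in> mat R (b m) (b (Suc m))" for m
    proof (cases m)
      case (Suc l)
      then show ?thesis using f(1)[of l] f(2)[of l] by simp
    qed (simp add: A_def)
    show "res_ker R M b A e m = act ?Rg (b (Suc (Suc m))) (A (Suc m)) ` vec ?Rg (b (Suc (Suc m)))" for m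
    proof (cases m)
      case 0
      then show ?thesis using A0(2) f(2)[of 0] by (simp add: res_ker_def f0)
    next
      case (Suc l)
      have "fst (f (Suc (Suc l))) = fst (snd (f (Suc l)))" using f(2)[of "Suc l"] by blast
      then show ?thesis using conjunct2[OF f(2)[of l]] Suc by (simp add: res_ker_def)
    qed
  qed (use e f0 M.module_axioms in simp_all)
  then show ?thesis by (rule that)
qed

section \<open>Nakayama's lemma\<close>

definition vec_module :: "('a, 'b, 'm) module_scheme => nat => ('a, nat => 'b) module" where
  "vec_module M q = \<lparr>carrier = vec M q, monoid.mult = undefined, one = undefined, zero = (\<lambda>i. (zero M)),
     add = (\<lambda>u v i. u i \<oplus>\<^bsub>M\<^esub> v i), smult = (\<lambda>r u i. r \<odot>\<^bsub>M\<^esub> u i)\<rparr>"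

lemma vec_module_simps [simp]:
  "carrier (vec_module M q) = vec M q" "\<zero>\<^bsub>vec_module M q\<^esub> = (\<lambda>i. (zero M))"
  "u \<oplus>\<^bsub>vec_module M q\<^esub> v = (\<lambda>i. u i \<oplus>\<^bsub>M\<^esub> v i)" "r \<odot>\<^bsub>vec_module M q\<^esub> u = (\<lambda>i. r \<odot>\<^bsub>M\<^esub> u i)"
  by (simp_all add: vec_module_def)

lemma vec_module_is_module:
  assumes "module R M" shows "module R (vec_module M q)"
proof -
  interpret M: module R M by fact
  show ?thesis
  proof (rule moduleI)
    show "abelian_group (vec_module M q)"
    proof (rule abelian_groupI)
      fix x assume "x \<in> carrier (vec_module M q)"
      then show "\<exists>y\<in>carrier (vec_module M q). y \<oplus>\<^bsub>vec_module M q\<^esub> x = \<zero>\<^bsub>vec_module M q\<^esub>"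
        by (intro bexI[of _ "\<lambda>i. \<ominus>\<^bsub>M\<^esub> x i"]) (auto simp: M.M.l_neg)
    qed (auto simp: M.M.a_assoc M.M.a_comm M.M.a_lcomm)
  qed (auto simp: M.smult_l_distr M.smult_r_distr M.smult_assoc1 M.R.is_cring)
qed

lemma lincomb_vec_module: "lincomb (vec_module M q) r z k = (\<lambda>i. lincomb M r (\<lambda>j. z j i) k)"
  by (induction k) simp_all

lemma noeth_vec_module:
  assumes n: "noeth R M" shows "noeth R (vec_module M q)"
proof -
  interpret M: module R M using n by (simp add: noeth_def)
  interpret V: module R "vec_module M q" by (rule vec_module_is_module) (rule M.module_axioms)
  have "\<exists>k z. (\<forall>i. z i \<in> Z) \<and> (\<forall>y\<in>Z. \<exists>r. (\<forall>i. r i \<in> carrier R) \<and> y = lincomb (vec_module M q) r z k)"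
    if Z: "submodule Z R (vec_module M q)" for Z
    unfolding lincomb_vec_module
    using V.submoduleE[OF Z] submodule_zero[OF V.module_axioms Z]
    by (intro noeth_closed_vec[OF n]) (auto simp: closed_vec_def)
  then show ?thesis using V.module_axioms by (simp add: noeth_def)
qed

text \<open>Zorn's lemma; a nonempty chain of ideals in a Noetherian ring contains its union, which
  is therefore proper.\<close>

lemma maximal_ideal_exists:
  assumes "cring R" "noetherian_ring R" and J: "ideal J R" "J \<noteq> carrier R"
  obtains m where "maximalideal m R" "J \<subseteq> m"
proof -
  interpret R: cring R by fact
  interpret N: noetherian_ring R by fact
  let ?A = "{I. ideal I R \<and> J \<subseteq> I \<and> I \<noteq> carrier R}"
  have "\<exists>M\<in>?A. \<forall>X\<in>?A. M \<subseteq> X \<longrightarrow> X = M"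
  proof (rule subset_Zorn_nonempty)
    show "?A \<noteq> {}" using J by blast
    fix C assume C: "C \<noteq> {}" "subset.chain ?A C"
    then have "subset.chain {I. ideal I R} C" by (auto simp: pred_on.chain_def)
    from N.ideal_chain_is_trivial[OF C(1) this] have "\<Union>C \<in> C" .
    moreover have "C \<subseteq> ?A" using C(2) by (simp add: pred_on.chain_def)
    ultimately show "\<Union>C \<in> ?A" by (rule rev_subsetD)
  qed
  then obtain m where m: "m \<in> ?A" "\<forall>X\<in>?A. m \<subseteq> X \<longrightarrow> X = m" by (rule bexE)
  have "maximalideal m R"
  proof (rule maximalidealI)
    fix I assume "ideal I R" "m \<subseteq> I" "I \<subseteq> carrier R"
    then show "I = m \<or> I = carrier R" using m(1) bspec[OF m(2), of I] by auto
  qed (use m(1) in auto)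
  then show ?thesis using m(1) by (intro that[of m]) auto
qed

lemma local_ring_unit:
  assumes R: "local_ring R" and m: "maximalideal m R" and a: "a \<in> carrier R" "a \<notin> m"
  shows "a \<in> Units R"
proof -
  interpret R: cring R using R by (simp add: local_ring_def)
  have "\<one>\<^bsub>R\<^esub> \<in> PIdl\<^bsub>R\<^esub> a"
  proof (rule ccontr)
    assume "\<one>\<^bsub>R\<^esub> \<notin> PIdl\<^bsub>R\<^esub> a"
    then have "PIdl\<^bsub>R\<^esub> a \<noteq> carrier R" by auto
    with R obtain m' where "maximalideal m' R" "PIdl\<^bsub>R\<^esub> a \<subseteq> m'"
      using maximal_ideal_exists[OF R.is_cring _ R.cgenideal_ideal[OF a(1)]] by (auto simp: local_ring_def)
    moreover from this have "m' = m" using R m by (auto simp: local_ring_def)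
    ultimately show False using R.cgenideal_self[OF a(1)] a(2) by blast
  qed
  then obtain b where "b \<in> carrier R" "\<one>\<^bsub>R\<^esub> = b \<otimes>\<^bsub>R\<^esub> a" by (auto simp: cgenideal_def)
  then show ?thesis using a(1) R.m_comm[of a b] by (auto simp: Units_def)
qed

lemma local_ring_one_minus_unit:
  assumes R: "local_ring R" and m: "maximalideal m R" and x: "x \<in> m" and r: "r \<in> carrier R"
  shows "\<one>\<^bsub>R\<^esub> \<ominus>\<^bsub>R\<^esub> x \<otimes>\<^bsub>R\<^esub> r \<in> Units R"
proof (rule local_ring_unit[OF R m])
  interpret R: cring R using R by (simp add: local_ring_def)
  interpret m: maximalideal m R by fact
  have xr: "x \<otimes>\<^bsub>R\<^esub> r \<in> m" using x r by (rule m.I_r_closed)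
  have c: "x \<otimes>\<^bsub>R\<^esub> r \<in> carrier R" using m.Icarr[OF xr] .
  then show "\<one>\<^bsub>R\<^esub> \<ominus>\<^bsub>R\<^esub> x \<otimes>\<^bsub>R\<^esub> r \<in> carrier R" by simp
  show "\<one>\<^bsub>R\<^esub> \<ominus>\<^bsub>R\<^esub> x \<otimes>\<^bsub>R\<^esub> r \<notin> m"
  proof
    assume "\<one>\<^bsub>R\<^esub> \<ominus>\<^bsub>R\<^esub> x \<otimes>\<^bsub>R\<^esub> r \<in> m"
    from m.a_closed[OF this xr] have "\<one>\<^bsub>R\<^esub> \<in> m" using c by simp
    then show False using m.one_imp_carrier m.I_notcarr by blast
  qed
qed

text \<open>Elimination of generators of Z modulo B. Writing \<open>z k\<close> as x u + w and
  expanding u expresses (1 - x r) times \<open>z k\<close> through the earlier generators and B, and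
  1 - x r is a unit. Induction on the number of generators replaces the determinant
  argument.\<close>

lemma nakayama_step:
  assumes R: "local_ring R" and m: "maximalideal m R" and x: "x \<in> m"
    and V: "module R V" and Z: "submodule Z R V" and B: "submodule B R V"
    and xZ: "\<And>v. v \<in> Z ==> \<exists>u\<in>Z. \<exists>w\<in>B. v = x \<odot>\<^bsub>V\<^esub> u \<oplus>\<^bsub>V\<^esub> w" and z: "\<And>j. z j \<in> Z"
  shows "(\<And>v. v \<in> Z ==> \<exists>r. (\<forall>i. r i \<in> carrier R) \<and> (\<exists>w\<in>B. v = lincomb V r z k \<oplus>\<^bsub>V\<^esub> w)) ==> Z \<subseteq> B"
proof (induction k)
  interpret V: module R V by fact
  {
    case 0
    show ?case
    proof
      fix v assume "v \<in> Z"
      with 0 obtain w where "w \<in> B" "v = (zero V) \<oplus>\<^bsub>V\<^esub> w" by fastforce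
      then show "v \<in> B" using V.submoduleE(1)[OF B] by auto
    qed
  next
    case (Suc k)
    interpret m: maximalideal m R by fact
    have xc: "x \<in> carrier R" using m.Icarr[OF x] .
    have Bc: "w \<in> carrier V" if "w \<in> B" for w using V.submoduleE(1)[OF B] that by blast
    have zc: "z j \<in> carrier V" for j using V.submoduleE(1)[OF Z] z by blast
    have uc: "u \<in> carrier V" if "u \<in> Z" for u using V.submoduleE(1)[OF Z] that by blast
    obtain u w where u: "u \<in> Z" "w \<in> B" "z k = x \<odot>\<^bsub>V\<^esub> u \<oplus>\<^bsub>V\<^esub> w" using xZ[OF z] by blast
    obtain r w' where r: "\<And>i. r i \<in> carrier R" "w' \<in> B" "u = lincomb V r z (Suc k) \<oplus>\<^bsub>V\<^esub> w'"
      using Suc.prems[OF u(1)] by blast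
    let ?l = "lincomb V r z k"
    have l: "?l \<in> carrier V" using r(1) zc by simp
    let ?a = "\<one>\<^bsub>R\<^esub> \<ominus>\<^bsub>R\<^esub> x \<otimes>\<^bsub>R\<^esub> r k"
    have "?a \<in> Units R" by (rule local_ring_one_minus_unit[OF R m x r(1)])
    then obtain c where c: "c \<in> carrier R" "c \<otimes>\<^bsub>R\<^esub> ?a = \<one>\<^bsub>R\<^esub>" by (auto simp: Units_def)
    have ac: "?a \<in> carrier R" using xc r(1) by simp
    let ?w = "x \<odot>\<^bsub>V\<^esub> w' \<oplus>\<^bsub>V\<^esub> w"
    have w: "?w \<in> B" using xc r(2) u(2) by (intro V.submoduleE(4,5)[OF B])
    have eq: "z k = x \<odot>\<^bsub>V\<^esub> ?l \<oplus>\<^bsub>V\<^esub> (x \<otimes>\<^bsub>R\<^esub> r k) \<odot>\<^bsub>V\<^esub> z k \<oplus>\<^bsub>V\<^esub> ?w"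
      using u(3) r xc zc l Bc[OF r(2)] Bc[OF u(2)] by (simp add: V.smult_r_distr V.smult_assoc1 V.M.a_assoc)
    have "?a \<odot>\<^bsub>V\<^esub> z k = z k \<ominus>\<^bsub>V\<^esub> (x \<otimes>\<^bsub>R\<^esub> r k) \<odot>\<^bsub>V\<^esub> z k"
      using xc r(1) zc by (simp add: V.R.minus_eq V.M.minus_eq V.smult_l_distr V.smult_l_minus)
    also have "\<dots> = x \<odot>\<^bsub>V\<^esub> ?l \<oplus>\<^bsub>V\<^esub> ?w"
      using eq xc r(1) zc l Bc[OF w] by (simp add: V.M.minus_eq_iff V.M.a_ac del: V.minus_add_cancel)
    finally have "z k = c \<odot>\<^bsub>V\<^esub> (x \<odot>\<^bsub>V\<^esub> ?l \<oplus>\<^bsub>V\<^esub> ?w)"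
      using V.smult_assoc1[OF c(1) ac zc, of k] V.smult_one[OF zc, of k] unfolding c(2) by simp
    then have zk: "z k = (c \<otimes>\<^bsub>R\<^esub> x) \<odot>\<^bsub>V\<^esub> ?l \<oplus>\<^bsub>V\<^esub> c \<odot>\<^bsub>V\<^esub> ?w"
      using c(1) xc l Bc[OF w] by (simp add: V.smult_r_distr V.smult_assoc1)
    show ?case
    proof (rule Suc.IH)
      fix v assume "v \<in> Z"
      then obtain s t where s: "\<And>i. s i \<in> carrier R" "t \<in> B" "v = lincomb V s z (Suc k) \<oplus>\<^bsub>V\<^esub> t"
        using Suc.prems by blast
      \<comment> \<open>The coefficients after \<open>z k\<close> has been replaced by its
        expression from \<open>zk\<close>.\<close>
      let ?s = "\<lambda>i. s i \<oplus>\<^bsub>R\<^esub> (s k \<otimes>\<^bsub>R\<^esub> (c \<otimes>\<^bsub>R\<^esub> x)) \<otimes>\<^bsub>R\<^esub> r i" and ?t = "s k \<odot>\<^bsub>V\<^esub> (c \<odot>\<^bsub>V\<^esub> ?w) \<oplus>\<^bsub>V\<^esub> t"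
      have t: "?t \<in> B"
        by (rule V.submoduleE(5)[OF B V.submoduleE(4)[OF B s(1) V.submoduleE(4)[OF B c(1) w]] s(2)])
      have "lincomb V ?s z k = lincomb V s z k \<oplus>\<^bsub>V\<^esub> s k \<odot>\<^bsub>V\<^esub> ((c \<otimes>\<^bsub>R\<^esub> x) \<odot>\<^bsub>V\<^esub> ?l)"
        using s(1) c(1) xc r(1) zc l by (simp add: V.lincomb_add_left V.lincomb_smult_left V.smult_assoc1)
      moreover have "s k \<odot>\<^bsub>V\<^esub> z k = s k \<odot>\<^bsub>V\<^esub> ((c \<otimes>\<^bsub>R\<^esub> x) \<odot>\<^bsub>V\<^esub> ?l) \<oplus>\<^bsub>V\<^esub> s k \<odot>\<^bsub>V\<^esub> (c \<odot>\<^bsub>V\<^esub> ?w)"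
        unfolding zk using s(1) c(1) xc l Bc[OF w] by (simp add: V.smult_r_distr)
      ultimately have "v = lincomb V ?s z k \<oplus>\<^bsub>V\<^esub> ?t"
        using s c(1) xc l Bc[OF w] Bc[OF s(2)] zc by (simp add: V.M.a_assoc)
      moreover have "\<forall>i. ?s i \<in> carrier R" using s(1) c(1) xc r(1) by simp
      ultimately show "\<exists>r. (\<forall>i. r i \<in> carrier R) \<and> (\<exists>w\<in>B. v = lincomb V r z k \<oplus>\<^bsub>V\<^esub> w)"
        using t by (intro exI[of _ ?s] conjI bexI[of _ ?t])
    qed
  }
qed

text \<open>In the application V is a power of a module, Z consists of cycles and B of boundaries; Z
  is finitely generated because V is Noetherian.\<close>

lemma nakayama:
  assumes R: "local_ring R" and m: "maximalideal m R" and x: "x \<in> m"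
    and V: "noeth R V" and Z: "submodule Z R V" and B: "submodule B R V"
    and xZ: "\<And>v. v \<in> Z ==> \<exists>u\<in>Z. \<exists>w\<in>B. v = x \<odot>\<^bsub>V\<^esub> u \<oplus>\<^bsub>V\<^esub> w"
  shows "Z \<subseteq> B"
proof -
  interpret V: module R V using V by (simp add: noeth_def)
  obtain k z where z: "\<forall>i. z i \<in> Z" "\<forall>y\<in>Z. \<exists>r. (\<forall>i. r i \<in> carrier R) \<and> y = lincomb V r z k"
    using V Z unfolding noeth_def by blast
  show ?thesis
  proof (rule nakayama_step[OF R m x V.module_axioms Z B xZ, of z k])
    fix v assume v: "v \<in> Z"
    then obtain r where r: "\<forall>i. r i \<in> carrier R" "v = lincomb V r z k" using z(2) by blast
    have "v \<in> carrier V" using v V.submoduleE(1)[OF Z] by blast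
    then show "\<exists>r. (\<forall>i. r i \<in> carrier R) \<and> (\<exists>w\<in>B. v = lincomb V r z k \<oplus>\<^bsub>V\<^esub> w)"
      using r submodule_zero[OF V.module_axioms B] by (intro exI[of _ r] conjI bexI[of _ "(zero V)"]) auto
  qed (use z in auto)
qed

section \<open>Ext in terms of matrices\<close>

lemma carrier_free_module: "cring R ==> carrier (free_module R {..<q}) = vec (regular_module R) q"
proof -
  assume "cring R"
  then interpret R: cring R .
  have "finite {i. u i \<noteq> (zero R)}" if "\<forall>i\<ge>q. u i = (zero R)" for u :: "nat => _"
    by (rule finite_subset[of _ "{..<q}"]) (use that not_less in auto)
  then show ?thesis by (auto simp del: R.vec_regular_closed simp: free_module_def vec_def not_less[symmetric])
qed

lemma free_module_simps [simp]:
  "\<zero>\<^bsub>free_module R X\<^esub> = (\<lambda>i. (zero R))" "u \<oplus>\<^bsub>free_module R X\<^esub> v = (\<lambda>i. u i \<oplus>\<^bsub>R\<^esub> v i)"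
  "r \<odot>\<^bsub>free_module R X\<^esub> u = (\<lambda>i. r \<otimes>\<^bsub>R\<^esub> u i)"
  by (simp_all add: free_module_def)

lemma lincomb_free_module: "lincomb (free_module R X) r z k = (\<lambda>i. lincomb (regular_module R) r (\<lambda>j. z j i) k)"
  by (induction k) simp_all

context module
begin

lemma lin_free_module:
  assumes f: "lin R (free_module R {..<q}) M f" and v: "v \<in> vec (regular_module R) q"
  shows "f v = lincomb M v (\<lambda>j. if j < q then f (unit_vector R j) else (zero M)) q"
proof -
  let ?F = "free_module R {..<q}"
  interpret F: module R ?F by (rule free_module_is_module) (rule R.is_cring)
  interpret Rg: module R "regular_module R" by (rule R.regular_module_is_module)
  let ?z = "\<lambda>j. if j < q then unit_vector R j else \<zero>\<^bsub>?F\<^esub>"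
  have z: "?z j \<in> carrier ?F" for j by (simp add: carrier_free_module[OF R.is_cring] Rg.zero_vec[simplified])
  have "lincomb ?F v ?z q = v"
  proof
    fix i
    have "lincomb (regular_module R) v (\<lambda>j. ?z j i) q = lincomb (regular_module R) (\<lambda>j. ?z j i) v q"
      by (rule R.lincomb_regular_comm) (use v in auto)
    also have "\<dots> = lincomb (regular_module R) (one_mat R q i) v q"
      by (rule lincomb_cong) (auto simp: one_mat_def unit_vector_def)
    also have "\<dots> = v i" using fun_cong[OF Rg.act_one_mat[OF v], of i] by (simp add: act_def)
    finally show "lincomb ?F v ?z q i = v i" by (simp add: lincomb_free_module)
  qed
  then have "f v = f (lincomb ?F v ?z q)" by simp
  also have "\<dots> = lincomb M v (\<lambda>j. f (?z j)) q"
    using v z by (intro lincomb_lin[OF F.module_axioms module_axioms f]) auto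
  also have "\<dots> = lincomb M v (\<lambda>j. if j < q then f (unit_vector R j) else (zero M)) q"
    by (rule lincomb_cong) auto
  finally show ?thesis .
qed

lemma lin_lincomb:
  assumes e: "\<And>i. e i \<in> carrier M" shows "lin R (free_module R {..<q}) M (\<lambda>v. lincomb M v e q)"
  using e by (auto simp: lin_def carrier_free_module[OF R.is_cring] lincomb_add_left lincomb_smult_left)

end

lemma lin_act:
  assumes "cring R" "A \<in> mat R p q"
  shows "lin R (free_module R {..<q}) (free_module R {..<p}) (act (regular_module R) q A)"
proof -
  interpret R: cring R by fact
  interpret Rg: module R "regular_module R" by (rule R.regular_module_is_module)
  show ?thesis
    using assms(2) Rg.act_closed[OF assms(2), of _ q] Rg.act_add[OF assms(2)] Rg.act_smult[OF assms(2)]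
    by (auto simp: lin_def carrier_free_module[OF R.is_cring])
qed

text \<open>Prepends a value; it converts the usual indexing of \<open>free_resolution\<close> into
  the shifted one of \<open>mres\<close>.\<close>

definition hat :: "'x => (nat => 'x) => nat => 'x" where
  "hat z f n = (case n of 0 => z | Suc m => f m)"

lemma hat_simps [simp]: "hat z f 0 = z" "hat z f (Suc m) = f m"
  by (simp_all add: hat_def)

definition diff_mat :: "('a, 'r) ring_scheme => (nat => nat) => (nat => (nat => 'a) => (nat => 'a)) => nat => nat => nat => 'a" where
  "diff_mat R b d n = (\<lambda>i j. if j < b (Suc n) then d n (unit_vector R j) i else (zero R))"

lemma free_resolution_mres:
  assumes M: "module R M" and fr: "free_resolution R M b d e"
  defines "A \<equiv> hat (\<lambda>i j. (zero R)) (diff_mat R b d)"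
  shows "mres R M (hat 0 b) A (\<lambda>j. if j < b 0 then e (unit_vector R j) else (zero M))"
    and "v \<in> vec (regular_module R) (b (Suc n)) ==> d n v = act (regular_module R) (b (Suc n)) (A (Suc n)) v"
proof -
  interpret M: module R M by fact
  let ?Rg = "regular_module R"
  interpret Rg: module R ?Rg by (rule M.R.regular_module_is_module)
  note cf = carrier_free_module[OF M.R.is_cring]
  let ?F = "\<lambda>i. free_module R {..<b i}"
  have F: "module R (?F i)" for i by (rule free_module_is_module[OF M.R.is_cring])
  have e: "lin R (?F 0) M e" "e ` vec ?Rg (b 0) = carrier M"
    and d: "lin R (?F (Suc i)) (?F i) (d i)"
    and ex: "d 0 ` vec ?Rg (b 1) = {v \<in> vec ?Rg (b 0). e v = (zero M)}"
      "d (Suc i) ` vec ?Rg (b (Suc (Suc i))) = {v \<in> vec ?Rg (b (Suc i)). d i v = (\<lambda>i. (zero R))}" for i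
    using fr by (auto simp: free_resolution_def Let_def mod_hom_iff cf mod_kernel_def)
  have uv: "unit_vector R j \<in> vec ?Rg (b i)" if "j < b i" for i j using that by simp
  have dc: "d i v \<in> vec ?Rg (b i)" if "v \<in> vec ?Rg (b (Suc i))" for i v
    using lin_closed[OF d] that by (simp add: cf)
  have dv: "d i v = act ?Rg (b (Suc i)) (A (Suc i)) v" if v: "v \<in> vec ?Rg (b (Suc i))" for i v
  proof
    fix j
    interpret F: module R "?F i" by (rule F)
    have "d i v j = lincomb ?Rg v (\<lambda>k. (if k < b (Suc i) then d i (unit_vector R k) else \<zero>\<^bsub>?F i\<^esub>) j) (b (Suc i))"
      unfolding F.lin_free_module[OF d v] lincomb_free_module ..
    also have "\<dots> = lincomb ?Rg v (A (Suc i) j) (b (Suc i))"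
      by (rule lincomb_cong) (auto simp: A_def diff_mat_def)
    also have "\<dots> = lincomb ?Rg (A (Suc i) j) v (b (Suc i))"
      by (rule M.R.lincomb_regular_comm) (use v M.R.vec_regular_closed[OF dc[OF uv]] in \<open>auto simp: A_def diff_mat_def\<close>)
    finally show "d i v j = act ?Rg (b (Suc i)) (A (Suc i)) v j" by (simp add: act_def)
  qed
  then show "v \<in> vec (regular_module R) (b (Suc n)) ==> d n v = act (regular_module R) (b (Suc n)) (A (Suc n)) v" .
  let ?e = "\<lambda>j. if j < b 0 then e (unit_vector R j) else (zero M)"
  have ev: "e v = lincomb M v ?e (b 0)" if "v \<in> vec ?Rg (b 0)" for v
    by (rule M.lin_free_module[OF e(1) that])
  show "mres R M (hat 0 b) A ?e"
    unfolding mres_def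
  proof (intro conjI allI ballI)
    show "A n \<in> mat R (hat 0 b n) (hat 0 b (Suc n))" for n
    proof (cases n)
      case (Suc k)
      have "d k (unit_vector R j) i \<in> carrier R" if "j < b (Suc k)" for i j
        using M.R.vec_regular_closed[OF dc[OF uv[OF that]]] .
      moreover have "d k (unit_vector R j) i = (zero R)" if "j < b (Suc k)" "b k \<le> i" for i j
        using vec_zero_outside[OF dc[OF uv[OF that(1)]] that(2)] by simp
      ultimately show ?thesis using Suc
        by (auto simp del: M.R.mat_entry Rg.mat_closed M.mat_closed simp: A_def diff_mat_def mat_def)
    qed (simp add: A_def)
    have "e (unit_vector R j) \<in> carrier M" if "j < b 0" for j using lin_closed[OF e(1)] uv[OF that] by (simp add: cf)
    then show "?e \<in> vec M (hat 0 b (Suc 0))" by (auto simp del: M.vec_closed simp: vec_def)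
    show "\<exists>v\<in>vec ?Rg (hat 0 b (Suc 0)). m = lincomb M v ?e (hat 0 b (Suc 0))" if "m \<in> carrier M" for m
      using that ev unfolding e(2)[symmetric] by auto
    show "res_ker R M (hat 0 b) A ?e n =
        act ?Rg (hat 0 b (Suc (Suc n))) (A (Suc n)) ` vec ?Rg (hat 0 b (Suc (Suc n)))" for n
    proof (cases n)
      case 0
      have "res_ker R M (hat 0 b) A ?e 0 = {v \<in> vec ?Rg (b 0). e v = (zero M)}"
        using ev by (auto simp: res_ker_def)
      also have "\<dots> = d 0 ` vec ?Rg (b (Suc 0))" using ex(1) by simp
      also have "\<dots> = act ?Rg (b (Suc 0)) (A (Suc 0)) ` vec ?Rg (b (Suc 0))" using dv by (intro image_cong) auto
      finally show ?thesis using 0 by simp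
    next
      case (Suc k)
      have "res_ker R M (hat 0 b) A ?e n = {v \<in> vec ?Rg (b (Suc k)). d k v = (\<lambda>i. (zero R))}"
        using dv Suc by (auto simp: res_ker_def)
      also have "\<dots> = d n ` vec ?Rg (b (Suc n))" using ex(2) Suc by simp
      also have "\<dots> = act ?Rg (b (Suc n)) (A (Suc n)) ` vec ?Rg (b (Suc n))" using dv by (intro image_cong) auto
      finally show ?thesis by simp
    qed
  qed (use M.module_axioms in simp_all)
qed

lemma mres_free_resolution:
  assumes "mres R M b A e"
  shows "free_resolution R M (\<lambda>n. b (Suc n))
    (\<lambda>n. restrict (act (regular_module R) (b (Suc (Suc n))) (A (Suc n))) (vec (regular_module R) (b (Suc (Suc n)))))
    (restrict (\<lambda>v. lincomb M v e (b (Suc 0))) (vec (regular_module R) (b (Suc 0))))"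
proof -
  interpret M: module R M by (rule mres_module[OF assms])
  let ?Rg = "regular_module R"
  note cf = carrier_free_module[OF M.R.is_cring]
  have F: "module R (free_module R {..<q})" for q by (rule free_module_is_module[OF M.R.is_cring])
  have ec: "e i \<in> carrier M" for i using mres_gen[OF assms] by simp
  have d: "restrict (act ?Rg (b (Suc n)) (A n)) (vec ?Rg (b (Suc n))) \<in>
      mod_hom R (free_module R {..<b (Suc n)}) (free_module R {..<b n})" for n
    using lin_restrict_mod_hom[OF F lin_act[OF M.R.is_cring mres_mat[OF assms]]] by (simp add: cf)
  have e: "restrict (\<lambda>v. lincomb M v e (b (Suc 0))) (vec ?Rg (b (Suc 0))) \<in> mod_hom R (free_module R {..<b (Suc 0)}) M"
    using lin_restrict_mod_hom[OF F M.lin_lincomb[OF ec]] by (simp add: cf)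
  have im: "(\<lambda>v. lincomb M v e (b (Suc 0))) ` vec ?Rg (b (Suc 0)) = carrier M"
    using mres_surj[OF assms] ec by auto
  show ?thesis
    unfolding free_resolution_def Let_def cf mod_kernel_def
  proof (intro conjI allI)
    show "restrict (act ?Rg (b (Suc (Suc 0))) (A (Suc 0))) (vec ?Rg (b (Suc (Suc 0)))) ` vec ?Rg (b (Suc 1)) =
      {x \<in> vec ?Rg (b (Suc 0)). restrict (\<lambda>v. lincomb M v e (b (Suc 0))) (vec ?Rg (b (Suc 0))) x = (zero M)}"
      using mres_exact[OF assms, of 0] by (auto simp: res_ker_def image_restrict_eq)
    show "restrict (act ?Rg (b (Suc (Suc (Suc i)))) (A (Suc (Suc i)))) (vec ?Rg (b (Suc (Suc (Suc i))))) `
        vec ?Rg (b (Suc (Suc (Suc i)))) =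
      {x \<in> vec ?Rg (b (Suc (Suc i))). restrict (act ?Rg (b (Suc (Suc i))) (A (Suc i))) (vec ?Rg (b (Suc (Suc i)))) x =
          \<zero>\<^bsub>free_module R {..<b (Suc i)}\<^esub>}" for i
      using mres_exact[OF assms, of "Suc i"] by (auto simp: res_ker_def image_restrict_eq)
  qed (use d e im in \<open>auto simp: image_restrict_eq\<close>)
qed

text \<open>\<open>SOME\<close> picks a resolution because a matrix resolution witnesses that one
  exists.\<close>

lemma chosen_resolution_mres:
  assumes "mres R M b A e"
  shows "case chosen_resolution R M of (b', d', e') => free_resolution R M b' d' e'"
  unfolding chosen_resolution_def by (rule someI_ex) (use mres_free_resolution[OF assms] in auto)

lemma hom_module_simps [simp]:
  "carrier (hom_module R M N) = mod_hom R M N" "\<zero>\<^bsub>hom_module R M N\<^esub> = (\<lambda>x\<in>carrier M. (zero N))"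
  "f \<oplus>\<^bsub>hom_module R M N\<^esub> g = (\<lambda>x\<in>carrier M. f x \<oplus>\<^bsub>N\<^esub> g x)"
  "r \<odot>\<^bsub>hom_module R M N\<^esub> f = (\<lambda>x\<in>carrier M. r \<odot>\<^bsub>N\<^esub> f x)"
  by (simp_all add: hom_module_def)

lemma mod_hom_closed: "f \<in> mod_hom R M N ==> x \<in> carrier M ==> f x \<in> carrier N"
  by (auto simp: mod_hom_def)

lemma hom_module_is_module:
  assumes M: "module R M" and N: "module R N" shows "module R (hom_module R M N)"
proof -
  interpret M: module R M by fact
  interpret N: module R N by fact
  have eqI: "f = g" if "f \<in> mod_hom R M N" "g \<in> mod_hom R M N" "\<And>x. x \<in> carrier M ==> f x = g x" for f g
    using that by (auto simp: mod_hom_iff intro: extensionalityI)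
  have add: "(\<lambda>x\<in>carrier M. f x \<oplus>\<^bsub>N\<^esub> g x) \<in> mod_hom R M N" if "f \<in> mod_hom R M N" "g \<in> mod_hom R M N" for f g
    using that by (auto simp: mod_hom_iff lin_restrict[OF M]) (auto simp: lin_def Pi_iff N.M.a_ac N.smult_r_distr)
  have smult: "(\<lambda>x\<in>carrier M. r \<odot>\<^bsub>N\<^esub> f x) \<in> mod_hom R M N" if "r \<in> carrier R" "f \<in> mod_hom R M N" for r f
    using that by (auto simp: mod_hom_iff lin_restrict[OF M])
      (auto simp: lin_def Pi_iff N.smult_r_distr M.R.m_comm simp flip: N.smult_assoc1)
  have zero: "(\<lambda>x\<in>carrier M. (zero N)) \<in> mod_hom R M N"
    by (auto simp: mod_hom_iff lin_restrict[OF M]) (auto simp: lin_def)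
  have neg: "(\<lambda>x\<in>carrier M. \<ominus>\<^bsub>N\<^esub> f x) \<in> mod_hom R M N" if "f \<in> mod_hom R M N" for f
    using that by (auto simp: mod_hom_iff lin_restrict[OF M]) (auto simp: lin_def Pi_iff N.M.minus_add N.smult_r_minus)
  have ag: "abelian_group (hom_module R M N)"
  proof (rule abelian_groupI)
    fix f assume "f \<in> carrier (hom_module R M N)"
    then show "\<exists>g\<in>carrier (hom_module R M N). g \<oplus>\<^bsub>hom_module R M N\<^esub> f = \<zero>\<^bsub>hom_module R M N\<^esub>"
      using neg by (intro bexI[of _ "\<lambda>x\<in>carrier M. \<ominus>\<^bsub>N\<^esub> f x"])
        (auto simp: N.M.l_neg mod_hom_closed fun_eq_iff)
  next
    fix f assume f: "f \<in> carrier (hom_module R M N)"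
    show "\<zero>\<^bsub>hom_module R M N\<^esub> \<oplus>\<^bsub>hom_module R M N\<^esub> f = f"
    proof (rule eqI)
      show "\<zero>\<^bsub>hom_module R M N\<^esub> \<oplus>\<^bsub>hom_module R M N\<^esub> f \<in> mod_hom R M N"
        using f by (simp only: hom_module_simps add[OF zero])
    qed (use f in \<open>auto simp: mod_hom_closed\<close>)
  qed (use add zero in \<open>auto simp: N.M.a_ac mod_hom_closed fun_eq_iff\<close>)
  show ?thesis
  proof (rule moduleI[OF M.R.is_cring ag])
    fix f assume f: "f \<in> carrier (hom_module R M N)"
    show "\<one>\<^bsub>R\<^esub> \<odot>\<^bsub>hom_module R M N\<^esub> f = f"
      using f smult by (intro eqI) (auto simp: mod_hom_closed)
  qed (use smult in \<open>auto simp: N.smult_l_distr N.smult_r_distr N.smult_assoc1 mod_hom_closed fun_eq_iff\<close>)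
qed

text \<open>The isomorphism of the q-th power of N with the homomorphisms from the free module of
  rank q: v lists the images of the unit vectors.\<close>

definition vec_hom :: "('a, 'r) ring_scheme => ('a, 'c, 'n) module_scheme => nat => (nat => 'c) => (nat => 'a) => 'c" where
  "vec_hom R N q v = restrict (\<lambda>u. lincomb N u v q) (vec (regular_module R) q)"

context module
begin

lemma vec_hom_mod_hom:
  "v \<in> vec M q ==> vec_hom R M q v \<in> mod_hom R (free_module R {..<q}) M"
  using lin_restrict_mod_hom[OF free_module_is_module[OF R.is_cring] lin_lincomb, of v q]
  by (simp add: vec_hom_def carrier_free_module[OF R.is_cring])

lemma mod_hom_vec_hom:
  assumes "\<phi> \<in> mod_hom R (free_module R {..<q}) M"
  obtains v where "v \<in> vec M q" "\<phi> = vec_hom R M q v"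
proof -
  let ?v = "\<lambda>j. if j < q then \<phi> (unit_vector R j) else (zero M)"
  have l: "lin R (free_module R {..<q}) M \<phi>" and e: "\<phi> \<in> extensional (vec (regular_module R) q)"
    using assms by (auto simp: mod_hom_iff carrier_free_module[OF R.is_cring])
  have "\<phi> (unit_vector R j) \<in> carrier M" if "j < q" for j
    using lin_closed[OF l] that by (simp add: carrier_free_module[OF R.is_cring])
  then have v: "?v \<in> vec M q" by (auto simp del: vec_closed simp: vec_def)
  moreover have "\<phi> = vec_hom R M q ?v"
    using e by (rule extensionalityI) (auto simp: vec_hom_def lin_free_module[OF l])
  ultimately show ?thesis by (rule that)
qed

lemma vec_hom_inj:
  assumes "u \<in> vec M q" "v \<in> vec M q" "vec_hom R M q u = vec_hom R M q v" shows "u = v"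
proof (rule vec_ext[OF assms(1,2)])
  fix j assume j: "j < q"
  then show "u j = v j"
    using fun_cong[OF assms(3), of "unit_vector R j"] lincomb_unit[OF j, of u] lincomb_unit[OF j, of v] assms(1,2)
    by (simp add: vec_hom_def)
qed

lemma vec_hom_zero: "vec_hom R M q (\<lambda>i. (zero M)) = (\<lambda>x\<in>vec (regular_module R) q. (zero M))"
  by (auto simp: vec_hom_def lincomb_zero_right fun_eq_iff)

lemma compose_vec_hom:
  assumes v: "v \<in> vec M q" and A: "A \<in> mat R q q'"
    and d: "\<And>u. u \<in> vec (regular_module R) q' ==> d u = act (regular_module R) q' A u"
  shows "compose (vec (regular_module R) q') (vec_hom R M q v) d = vec_hom R M q' (act M q (transp A) v)"
proof -
  interpret Rg: module R "regular_module R" by (rule R.regular_module_is_module)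
  have "vec_hom R M q v (d u) = lincomb M u (act M q (transp A) v) q'" if u: "u \<in> vec (regular_module R) q'" for u
  proof -
    have "lincomb M (act (regular_module R) q' A u) v q = lincomb M u (\<lambda>j. lincomb M (\<lambda>i. A i j) v q) q'"
      by (rule lincomb_act[OF A u]) (use v in simp)
    then show ?thesis using Rg.act_closed[OF A u] by (simp add: d[OF u] vec_hom_def) (simp add: act_def transp_def)
  qed
  then show ?thesis by (auto simp: compose_def vec_hom_def fun_eq_iff)
qed

end

text \<open>Vectors replace homomorphisms through \<open>vec_hom\<close>, which turns the cochain
  complex of the chosen resolution into a matrix complex; independence of the resolution then allows
  any b and A.\<close>

theorem Ext_module_zero_iff:
  assumes res: "mres R M b A e" and N: "module R N"
  shows "zero_module (Ext_module R M N n) \<longleftrightarrow> EXT N b A n"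
proof -
  interpret M: module R M by (rule mres_module[OF res])
  interpret N: module R N by fact
  let ?Rg = "regular_module R"
  note cf = carrier_free_module[OF M.R.is_cring]
  obtain b' d' e' where ch: "chosen_resolution R M = (b', d', e')" by (metis prod_cases3)
  have fr: "free_resolution R M b' d' e'" using chosen_resolution_mres[OF res] by (simp add: ch)
  define B where "B = hat 0 b'"
  define D where "D = hat (\<lambda>i j. (zero R)) (diff_mat R b' d')"
  have res': "mres R M B D (\<lambda>j. if j < b' 0 then e' (unit_vector R j) else (zero M))"
    and d: "\<And>n v. v \<in> vec ?Rg (b' (Suc n)) ==> d' n v = act ?Rg (b' (Suc n)) (D (Suc n)) v"
    unfolding B_def D_def using free_resolution_mres[OF M.module_axioms fr] by blast+
  let ?F = "\<lambda>i. free_module R {..<b' i}" and ?C = "\<lambda>i. hom_module R (free_module R {..<b' i}) N"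
  let ?D = "\<lambda>i f. compose (carrier (?F (Suc i))) f (d' i)"
  let ?h = "\<lambda>i. vec_hom R N (b' i)"
  have C: "module R (?C i)" for i by (rule hom_module_is_module[OF free_module_is_module[OF M.R.is_cring] N])
  have mat: "D (Suc i) \<in> mat R (b' i) (b' (Suc i))" for i
    using mres_mat[OF res', of "Suc i"] by (simp add: B_def)
  have Dh: "?D i (?h i v) = ?h (Suc i) (act N (b' i) (transp (D (Suc i))) v)" if "v \<in> vec N (b' i)" for i v
    unfolding cf by (rule N.compose_vec_hom[OF that mat d])
  have act: "act N (b' i) (transp (D (Suc i))) v \<in> vec N (b' (Suc i))" if "v \<in> vec N (b' i)" for i v
    by (rule N.act_closed[OF _ that]) (use mat in auto)
  have hv: "\<exists>v\<in>vec N (b' i). f = ?h i v" if "f \<in> mod_hom R (?F i) N" for i f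
    using N.mod_hom_vec_hom[OF that] by blast
  have hom: "?h i v \<in> mod_hom R (?F i) N" if "v \<in> vec N (b' i)" for i v
    using that by (rule N.vec_hom_mod_hom)
  have linD: "lin R (?C i) (?C (Suc i)) (?D i)" for i
    unfolding lin_def
  proof (intro conjI ballI)
    have dF: "d' i u \<in> vec ?Rg (b' i)" if "u \<in> vec ?Rg (b' (Suc i))" for u
      using fr that by (auto simp: free_resolution_def Let_def cf mod_hom_def)
    show "?D i \<in> carrier (?C i) \<rightarrow> carrier (?C (Suc i))"
    proof
      fix f assume "f \<in> carrier (?C i)"
      then obtain v where v: "v \<in> vec N (b' i)" "f = ?h i v" using hv by auto
      show "?D i f \<in> carrier (?C (Suc i))" unfolding v(2) Dh[OF v(1)] using hom[OF act[OF v(1)]] by simp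
    qed
    show "?D i (f \<oplus>\<^bsub>?C i\<^esub> g) = ?D i f \<oplus>\<^bsub>?C (Suc i)\<^esub> ?D i g" for f g
      using dF by (auto simp: compose_def fun_eq_iff cf)
    show "?D i (r \<odot>\<^bsub>?C i\<^esub> f) = r \<odot>\<^bsub>?C (Suc i)\<^esub> ?D i f" for r f
      using dF by (auto simp: compose_def fun_eq_iff cf)
  qed
  let ?K = "mod_kernel (?C n) (?C (Suc n)) (?D n)"
  let ?H = "case n of 0 => {\<zero>\<^bsub>?C 0\<^esub>} | Suc k => ?D k ` carrier (?C k)"
  have zero: "\<zero>\<^bsub>?C i\<^esub> = ?h i (\<lambda>j. (zero N))" for i by (simp add: N.vec_hom_zero cf)
  have K_iff: "?h n v \<in> ?K \<longleftrightarrow> act N (b' n) (transp (D (Suc n))) v = (\<lambda>i. (zero N))" if v: "v \<in> vec N (b' n)" for v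
    using hom[OF v] Dh[OF v] N.vec_hom_inj[OF act[OF v] N.zero_vec] unfolding mod_kernel_def zero by auto
  have H_iff: "?h n v \<in> ?H \<longleftrightarrow> (\<exists>w\<in>vec N (B n). v = act N (B n) (transp (D n)) w)" if v: "v \<in> vec N (b' n)" for v
  proof (cases n)
    \<comment> \<open>The coboundaries in degree 0 are zero by definition; they are also the image
      of the zeroth power of N, as \<open>B 0 = 0\<close>.\<close>
    case 0
    moreover have "\<exists>w. w \<in> vec N 0" using N.zero_vec by blast
    ultimately show ?thesis using N.vec_hom_inj[OF v N.zero_vec]
      by (auto simp: zero B_def act_def simp del: hom_module_simps(2))
  next
    case (Suc k)
    have "?h n v \<in> ?D k ` carrier (?C k) \<longleftrightarrow> (\<exists>w\<in>vec N (b' k). ?h n v = ?D k (?h k w))"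
      using hv[of _ k] hom[of _ k] by auto
    also have "\<dots> \<longleftrightarrow> (\<exists>w\<in>vec N (b' k). v = act N (b' k) (transp (D (Suc k))) w)"
      using N.vec_hom_inj[OF v] Dh[of _ k] act[of _ k] Suc by auto
    finally show ?thesis using Suc by (simp add: B_def)
  qed
  have subK: "submodule ?K R (?C n)" unfolding mod_kernel_def by (rule submodule_kernel[OF C C linD])
  have subH: "submodule ?H R (?C n)"
  proof (cases n)
    case 0
    interpret C0: module R "?C 0" by (rule C)
    have "submodule {\<zero>\<^bsub>?C 0\<^esub>} R (?C 0)" by (rule C0.submoduleI) (auto simp del: hom_module_simps)
    with 0 show ?thesis by simp
  qed (simp add: submodule_image[OF C C linD, simplified])
  have HK: "?H \<subseteq> ?K"
  proof
    fix f assume f: "f \<in> ?H"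
    interpret Cn: module R "?C n" by (rule C)
    have "f \<in> mod_hom R (?F n) N" using f Cn.submoduleE(1)[OF subH] by auto
    then obtain v where v: "v \<in> vec N (b' n)" "f = ?h n v" using hv by blast
    then obtain w where w: "w \<in> vec N (B n)" "v = act N (B n) (transp (D n)) w" using f H_iff[OF v(1)] by blast
    have "act N (b' n) (transp (D (Suc n))) v = (\<lambda>i. (zero N))"
      using N.act_act_zero[OF iffD2[OF transp_mat mres_mat[OF res']] iffD2[OF transp_mat mres_mat[OF res']]
        mres_complex_transp[OF res', of n] w(1)] w(2) by (simp add: B_def)
    with v K_iff show "f \<in> ?K" by blast
  qed
  have "zero_module (Ext_module R M N n) \<longleftrightarrow> ?K \<subseteq> ?H"
    using zero_module_quot[OF submodule.submodule_is_module[OF subK C] submodule_mono[OF C subK subH HK]]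
    by (simp add: Ext_module_def ch cohomology_def Let_def)
  also have "\<dots> \<longleftrightarrow> (\<forall>v\<in>vec N (b' n). ?h n v \<in> ?K \<longrightarrow> ?h n v \<in> ?H)"
    using hv[of _ n] by (force simp: mod_kernel_def)
  also have "\<dots> \<longleftrightarrow> EXT N B D n"
    using K_iff H_iff by (auto simp: EXT_def exact_at_def B_def)
  also have "\<dots> \<longleftrightarrow> EXT N b A n" by (rule mres_EXT_unique[OF res' res N])
  finally show ?thesis .
qed

section \<open>Tor in terms of matrices\<close>

lemma generated_submodule_superset: "S \<subseteq> generated_submodule R M S"
  by (auto simp: generated_submodule_def)

lemma generated_submodule_least: "submodule H R M ==> S \<subseteq> H ==> generated_submodule R M S \<subseteq> H"
  by (auto simp: generated_submodule_def)

lemma (in module) generated_submodule_submodule: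
  assumes "S \<subseteq> carrier M" shows "submodule (generated_submodule R M S) R M"
proof (rule submoduleI)
  show "generated_submodule R M S \<subseteq> carrier M"
    by (rule generated_submodule_least[OF carrier_is_submodule assms])
  show "(zero M) \<in> generated_submodule R M S"
    by (auto simp: generated_submodule_def submodule_zero[OF module_axioms])
qed (auto simp: generated_submodule_def submoduleE)

lemma unit_vector_free [simp]: "cring R ==> p \<in> X ==> unit_vector R p \<in> carrier (free_module R X)"
proof -
  assume "cring R" and p: "p \<in> X"
  then interpret R: cring R by simp
  have "{i. unit_vector R p i \<noteq> (zero R)} \<subseteq> {p}" by (auto simp: unit_vector_def)
  with p show ?thesis by (auto simp: free_module_def unit_vector_def intro: finite_subset)
qed

text \<open>Induction on the support, removing one coordinate at a time. It yields uniqueness of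
  linear maps out of tensor products.\<close>

lemma free_module_induct:
  assumes R: "cring R" and W: "submodule W R (free_module R X)" and unit: "\<And>p. p \<in> X ==> unit_vector R p \<in> W"
  shows "carrier (free_module R X) \<subseteq> W"
proof
  interpret R: cring R by fact
  let ?F = "free_module R X"
  interpret F: module R ?F by (rule free_module_is_module[OF R])
  fix u assume u: "u \<in> carrier ?F"
  have "u \<in> W" if "finite S" "u \<in> carrier ?F" "{p. u p \<noteq> (zero R)} \<subseteq> S" for S u
    using that
  proof (induction S arbitrary: u)
    case empty
    then have "u = \<zero>\<^bsub>?F\<^esub>" by auto
    then show ?case using submodule_zero[OF F.module_axioms W] by (simp only:)
  next
    case (insert p S)
    have uc: "u q \<in> carrier R" for q using insert.prems by (auto simp: free_module_def)
    show ?case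
    proof (cases "u p = (zero R)")
      case True
      with insert show ?thesis by blast
    next
      case False
      let ?u = "u(p := (zero R))"
      have p: "p \<in> X" using False insert.prems by (auto simp: free_module_def)
      have "{q. ?u q \<noteq> (zero R)} \<subseteq> {q. u q \<noteq> (zero R)}" by auto
      from this finite_subset[OF this] have "?u \<in> carrier ?F"
        using insert.prems(1) R.zero_closed by (auto simp: free_module_def)
      moreover have "{q. ?u q \<noteq> (zero R)} \<subseteq> S" using insert.prems(2) by auto
      ultimately have "?u \<in> W" by (rule insert.IH)
      moreover have "u p \<odot>\<^bsub>?F\<^esub> unit_vector R p \<in> W" by (rule F.submoduleE(4)[OF W uc unit[OF p]])
      ultimately have "?u \<oplus>\<^bsub>?F\<^esub> u p \<odot>\<^bsub>?F\<^esub> unit_vector R p \<in> W" by (rule F.submoduleE(5)[OF W])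
      moreover have "?u \<oplus>\<^bsub>?F\<^esub> u p \<odot>\<^bsub>?F\<^esub> unit_vector R p = u"
        using uc by (auto simp: unit_vector_def fun_eq_iff)
      ultimately show ?thesis by (simp only:)
    qed
  qed
  from this[OF _ u] show "u \<in> W" using u by (auto simp: free_module_def)
qed

lemma free_module_universal:
  assumes Q: "module R Q" and \<beta>: "\<And>p. p \<in> X ==> \<beta> p \<in> carrier Q"
  shows "\<exists>h. lin R (free_module R X) Q h \<and> (\<forall>p\<in>X. h (unit_vector R p) = \<beta> p)"
proof -
  interpret Q: module R Q by fact
  let ?F = "free_module R X"
  define h where "h u = (\<Oplus>\<^bsub>Q\<^esub>p\<in>{p. u p \<noteq> (zero R)}. u p \<odot>\<^bsub>Q\<^esub> \<beta> p)" for u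
  have uc: "u p \<in> carrier R" if "u \<in> carrier ?F" for u p using that by (auto simp: free_module_def)
  have h: "h u = (\<Oplus>\<^bsub>Q\<^esub>p\<in>S. u p \<odot>\<^bsub>Q\<^esub> \<beta> p)" if "u \<in> carrier ?F" "finite S" "S \<subseteq> X" "{p. u p \<noteq> (zero R)} \<subseteq> S" for u S
    unfolding h_def
    by (rule Q.M.add.finprod_mono_neutral_cong_left) (use that \<beta> uc[OF that(1)] in auto)
  have fin: "finite {p. u p \<noteq> (zero R)}" "{p. u p \<noteq> (zero R)} \<subseteq> X" if "u \<in> carrier ?F" for u
    using that by (auto simp: free_module_def)
  interpret F: module R ?F by (rule free_module_is_module[OF Q.R.is_cring])
  have "lin R ?F Q h"
    unfolding lin_def
  proof (intro conjI ballI)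
    show "h \<in> carrier ?F \<rightarrow> carrier Q"
    proof (unfold h_def, intro funcsetI Q.M.finsum_closed)
      fix u p assume "u \<in> carrier ?F" "p \<in> {p. u p \<noteq> (zero R)}"
      with fin(2)[of u] \<beta> uc show "u p \<odot>\<^bsub>Q\<^esub> \<beta> p \<in> carrier Q" by blast
    qed
    fix u v assume u: "u \<in> carrier ?F" and v: "v \<in> carrier ?F"
    \<comment> \<open>The support of a sum may shrink, so all three sums are taken over the union of
      the supports.\<close>
    let ?S = "{p. u p \<noteq> (zero R)} \<union> {p. v p \<noteq> (zero R)}"
    have S: "finite ?S" "?S \<subseteq> X" using fin u v by auto
    have b: "\<beta> p \<in> carrier Q" if "p \<in> ?S" for p using S(2) that \<beta> by blast
    have "h (u \<oplus>\<^bsub>?F\<^esub> v) = (\<Oplus>\<^bsub>Q\<^esub>p\<in>?S. (u p \<oplus>\<^bsub>R\<^esub> v p) \<odot>\<^bsub>Q\<^esub> \<beta> p)"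
    proof -
      have "{p. (u \<oplus>\<^bsub>?F\<^esub> v) p \<noteq> (zero R)} \<subseteq> ?S" using Q.R.l_zero[OF Q.R.zero_closed] by auto
      from h[OF F.M.a_closed[OF u v] S this] show ?thesis by simp
    qed
    also have "\<dots> = (\<Oplus>\<^bsub>Q\<^esub>p\<in>?S. u p \<odot>\<^bsub>Q\<^esub> \<beta> p \<oplus>\<^bsub>Q\<^esub> v p \<odot>\<^bsub>Q\<^esub> \<beta> p)"
      using b uc[OF u] uc[OF v] by (intro Q.M.finsum_cong') (auto simp: Q.smult_l_distr)
    also have "\<dots> = (\<Oplus>\<^bsub>Q\<^esub>p\<in>?S. u p \<odot>\<^bsub>Q\<^esub> \<beta> p) \<oplus>\<^bsub>Q\<^esub> (\<Oplus>\<^bsub>Q\<^esub>p\<in>?S. v p \<odot>\<^bsub>Q\<^esub> \<beta> p)"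
      using b uc[OF u] uc[OF v] by (intro Q.M.finsum_addf) auto
    finally show "h (u \<oplus>\<^bsub>?F\<^esub> v) = h u \<oplus>\<^bsub>Q\<^esub> h v"
      using h[OF u S] h[OF v S] by simp
  next
    fix r u assume r: "r \<in> carrier R" and u: "u \<in> carrier ?F"
    let ?S = "{p. u p \<noteq> (zero R)}"
    note S = fin[OF u]
    have b: "\<beta> p \<in> carrier Q" if "p \<in> ?S" for p using S(2) that \<beta> by blast
    have "h (r \<odot>\<^bsub>?F\<^esub> u) = (\<Oplus>\<^bsub>Q\<^esub>p\<in>?S. (r \<otimes>\<^bsub>R\<^esub> u p) \<odot>\<^bsub>Q\<^esub> \<beta> p)"
    proof -
      have "{p. (r \<odot>\<^bsub>?F\<^esub> u) p \<noteq> (zero R)} \<subseteq> ?S" using r by auto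
      from h[OF F.smult_closed[OF r u] S this] show ?thesis by simp
    qed
    also have "\<dots> = (\<Oplus>\<^bsub>Q\<^esub>p\<in>?S. r \<odot>\<^bsub>Q\<^esub> (u p \<odot>\<^bsub>Q\<^esub> \<beta> p))"
      using b uc[OF u] r by (intro Q.M.finsum_cong') (auto simp: Q.smult_assoc1)
    also have "\<dots> = r \<odot>\<^bsub>Q\<^esub> (\<Oplus>\<^bsub>Q\<^esub>p\<in>?S. u p \<odot>\<^bsub>Q\<^esub> \<beta> p)"
      using b uc[OF u] r S by (intro Q.finsum_smult_ldistr[symmetric]) auto
    finally show "h (r \<odot>\<^bsub>?F\<^esub> u) = r \<odot>\<^bsub>Q\<^esub> h u" by (simp add: h_def)
  qed
  moreover have "h (unit_vector R p) = \<beta> p" if p: "p \<in> X" for p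
  proof -
    have "h (unit_vector R p) = (\<Oplus>\<^bsub>Q\<^esub>q\<in>{p}. unit_vector R p q \<odot>\<^bsub>Q\<^esub> \<beta> q)"
      using p Q.R.is_cring by (intro h unit_vector_free) (auto simp: unit_vector_def)
    also have "\<dots> = \<beta> p" using \<beta>[OF p] Q.M.finsum_insert[of "{}" p "\<lambda>q. unit_vector R p q \<odot>\<^bsub>Q\<^esub> \<beta> q"] by (simp add: unit_vector_def)
    finally show ?thesis .
  qed
  ultimately show ?thesis by blast
qed

lemma quot_module_lift:
  assumes M: "module R M" and H: "submodule H R M" and Q: "module R Q" and h: "lin R M Q h"
    and ker: "\<And>u. u \<in> H ==> h u = (zero Q)"
  shows "\<exists>g. lin R (quot_module M H) Q g \<and> (\<forall>u\<in>carrier M. g (H +>\<^bsub>M\<^esub> u) = h u)"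
proof -
  interpret M: module R M by fact
  interpret Q: module R Q by fact
  define g where "g C = h (SOME u. u \<in> carrier M \<and> u \<in> C)" for C
  have g: "g (H +>\<^bsub>M\<^esub> u) = h u" if u: "u \<in> carrier M" for u
  proof -
    let ?w = "SOME w. w \<in> carrier M \<and> w \<in> H +>\<^bsub>M\<^esub> u"
    have "?w \<in> carrier M \<and> ?w \<in> H +>\<^bsub>M\<^esub> u"
      by (rule someI[of _ u]) (use u coset_self[OF M H u] in simp)
    then have w: "?w \<in> carrier M" "?w \<ominus>\<^bsub>M\<^esub> u \<in> H" by (auto simp: coset_eq[OF M H u])
    have "h ?w \<ominus>\<^bsub>Q\<^esub> h u = (zero Q)" using ker[OF w(2)] lin_minus[OF M Q h w(1) u] by simp
    then show ?thesis using lin_closed[OF h] w(1) u by (simp add: g_def)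
  qed
  note l = lin_coset[OF M H]
  have "lin R (quot_module M H) Q g"
    unfolding lin_def quot_carrier[OF M H]
  proof (intro conjI ballI funcsetI)
    fix C assume "C \<in> (\<lambda>x. H +>\<^bsub>M\<^esub> x) ` carrier M"
    then obtain u where u: "u \<in> carrier M" "C = H +>\<^bsub>M\<^esub> u" by blast
    then show "g C \<in> carrier Q" using lin_closed[OF h] by (simp add: g)
    show "g (r \<odot>\<^bsub>quot_module M H\<^esub> C) = r \<odot>\<^bsub>Q\<^esub> g C" if "r \<in> carrier R" for r
      using u that by (simp add: lin_smult[OF l, symmetric] g lin_smult[OF h])
    fix C' assume "C' \<in> (\<lambda>x. H +>\<^bsub>M\<^esub> x) ` carrier M"
    then obtain u' where u': "u' \<in> carrier M" "C' = H +>\<^bsub>M\<^esub> u'" by blast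
    show "g (C \<oplus>\<^bsub>quot_module M H\<^esub> C') = g C \<oplus>\<^bsub>Q\<^esub> g C'"
      using u u' by (simp add: lin_add[OF l, symmetric] g lin_add[OF h])
  qed
  with g show ?thesis by blast
qed

context
  fixes R :: "('a, 'r) ring_scheme" and P :: "('a, 'b, 'm) module_scheme" and N :: "('a, 'c, 'n) module_scheme"
  assumes P: "module R P" and N: "module R N"
begin

interpretation P: module R P by (rule P)
interpretation N: module R N by (rule N)
interpretation F: module R "free_module R (carrier P \<times> carrier N)"
  by (rule free_module_is_module[OF P.R.is_cring])

abbreviation "FX \<equiv> free_module R (carrier P \<times> carrier N)"
abbreviation "rels \<equiv> tensor_relations R P N"

lemma unit_FX: "x \<in> carrier P ==> y \<in> carrier N ==> unit_vector R (x, y) \<in> carrier FX"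
  using P.R.is_cring by simp

lemma tensor_relations_submodule: "submodule rels R FX"
  unfolding tensor_relations_def Let_def
  by (rule F.generated_submodule_submodule)
     (auto simp del: free_module_simps intro!: F.M.minus_closed F.M.a_closed F.smult_closed unit_FX)

lemma tensor_relations_least:
  assumes "submodule H R FX"
    and "\<And>x x' y. x \<in> carrier P ==> x' \<in> carrier P ==> y \<in> carrier N ==>
      unit_vector R (x \<oplus>\<^bsub>P\<^esub> x', y) \<ominus>\<^bsub>FX\<^esub> (unit_vector R (x, y) \<oplus>\<^bsub>FX\<^esub> unit_vector R (x', y)) \<in> H"
    and "\<And>x y y'. x \<in> carrier P ==> y \<in> carrier N ==> y' \<in> carrier N ==>
      unit_vector R (x, y \<oplus>\<^bsub>N\<^esub> y') \<ominus>\<^bsub>FX\<^esub> (unit_vector R (x, y) \<oplus>\<^bsub>FX\<^esub> unit_vector R (x, y')) \<in> H"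
    and "\<And>r x y. r \<in> carrier R ==> x \<in> carrier P ==> y \<in> carrier N ==>
      unit_vector R (r \<odot>\<^bsub>P\<^esub> x, y) \<ominus>\<^bsub>FX\<^esub> (r \<odot>\<^bsub>FX\<^esub> unit_vector R (x, y)) \<in> H"
    and "\<And>r x y. r \<in> carrier R ==> x \<in> carrier P ==> y \<in> carrier N ==>
      unit_vector R (x, r \<odot>\<^bsub>N\<^esub> y) \<ominus>\<^bsub>FX\<^esub> (r \<odot>\<^bsub>FX\<^esub> unit_vector R (x, y)) \<in> H"
  shows "rels \<subseteq> H"
  unfolding tensor_relations_def Let_def
  by (rule generated_submodule_least[OF assms(1)]) (use assms(2-) in \<open>auto simp del: free_module_simps\<close>)

lemma tensor_relations_mem:
  shows "\<And>x x' y. x \<in> carrier P ==> x' \<in> carrier P ==> y \<in> carrier N ==>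
      unit_vector R (x \<oplus>\<^bsub>P\<^esub> x', y) \<ominus>\<^bsub>FX\<^esub> (unit_vector R (x, y) \<oplus>\<^bsub>FX\<^esub> unit_vector R (x', y)) \<in> rels"
    and "\<And>x y y'. x \<in> carrier P ==> y \<in> carrier N ==> y' \<in> carrier N ==>
      unit_vector R (x, y \<oplus>\<^bsub>N\<^esub> y') \<ominus>\<^bsub>FX\<^esub> (unit_vector R (x, y) \<oplus>\<^bsub>FX\<^esub> unit_vector R (x, y')) \<in> rels"
    and "\<And>r x y. r \<in> carrier R ==> x \<in> carrier P ==> y \<in> carrier N ==>
      unit_vector R (r \<odot>\<^bsub>P\<^esub> x, y) \<ominus>\<^bsub>FX\<^esub> (r \<odot>\<^bsub>FX\<^esub> unit_vector R (x, y)) \<in> rels"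
    and "\<And>r x y. r \<in> carrier R ==> x \<in> carrier P ==> y \<in> carrier N ==>
      unit_vector R (x, r \<odot>\<^bsub>N\<^esub> y) \<ominus>\<^bsub>FX\<^esub> (r \<odot>\<^bsub>FX\<^esub> unit_vector R (x, y)) \<in> rels"
  unfolding tensor_relations_def Let_def by (rule subsetD[OF generated_submodule_superset], blast)+

lemma tensor_module_is_module: "module R (tensor_module R P N)"
  unfolding tensor_module_def by (rule quot_module_is_module[OF F.module_axioms tensor_relations_submodule])

lemma pure_tensor_closed: "x \<in> carrier P ==> y \<in> carrier N ==> pure_tensor R P N x y \<in> carrier (tensor_module R P N)"
  unfolding tensor_module_def pure_tensor_def
  by (rule lin_closed[OF lin_coset[OF F.module_axioms tensor_relations_submodule] unit_FX])

lemma pure_tensor_add_left: "x \<in> carrier P ==> x' \<in> carrier P ==> y \<in> carrier N ==>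
    pure_tensor R P N (x \<oplus>\<^bsub>P\<^esub> x') y = pure_tensor R P N x y \<oplus>\<^bsub>tensor_module R P N\<^esub> pure_tensor R P N x' y"
  and pure_tensor_add_right: "x \<in> carrier P ==> y \<in> carrier N ==> y' \<in> carrier N ==>
    pure_tensor R P N x (y \<oplus>\<^bsub>N\<^esub> y') = pure_tensor R P N x y \<oplus>\<^bsub>tensor_module R P N\<^esub> pure_tensor R P N x y'"
  and pure_tensor_smult_left: "r \<in> carrier R ==> x \<in> carrier P ==> y \<in> carrier N ==>
    pure_tensor R P N (r \<odot>\<^bsub>P\<^esub> x) y = r \<odot>\<^bsub>tensor_module R P N\<^esub> pure_tensor R P N x y"
  and pure_tensor_smult_right: "r \<in> carrier R ==> x \<in> carrier P ==> y \<in> carrier N ==>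
    pure_tensor R P N x (r \<odot>\<^bsub>N\<^esub> y) = r \<odot>\<^bsub>tensor_module R P N\<^esub> pure_tensor R P N x y"
proof -
  note l = lin_coset[OF F.module_axioms tensor_relations_submodule]
  note e = coset_eq_iff[OF F.module_axioms tensor_relations_submodule, THEN iffD2]
  show "x \<in> carrier P ==> x' \<in> carrier P ==> y \<in> carrier N ==>
    pure_tensor R P N (x \<oplus>\<^bsub>P\<^esub> x') y = pure_tensor R P N x y \<oplus>\<^bsub>tensor_module R P N\<^esub> pure_tensor R P N x' y"
    unfolding tensor_module_def pure_tensor_def
    by (subst lin_add[OF l, symmetric]; (intro e tensor_relations_mem F.M.a_closed unit_FX)?) auto
  show "x \<in> carrier P ==> y \<in> carrier N ==> y' \<in> carrier N ==>
    pure_tensor R P N x (y \<oplus>\<^bsub>N\<^esub> y') = pure_tensor R P N x y \<oplus>\<^bsub>tensor_module R P N\<^esub> pure_tensor R P N x y'"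
    unfolding tensor_module_def pure_tensor_def
    by (subst lin_add[OF l, symmetric]; (intro e tensor_relations_mem F.M.a_closed unit_FX)?) auto
  show "r \<in> carrier R ==> x \<in> carrier P ==> y \<in> carrier N ==>
    pure_tensor R P N (r \<odot>\<^bsub>P\<^esub> x) y = r \<odot>\<^bsub>tensor_module R P N\<^esub> pure_tensor R P N x y"
    unfolding tensor_module_def pure_tensor_def
    by (subst lin_smult[OF l, symmetric]; (intro e tensor_relations_mem F.smult_closed unit_FX)?) auto
  show "r \<in> carrier R ==> x \<in> carrier P ==> y \<in> carrier N ==>
    pure_tensor R P N x (r \<odot>\<^bsub>N\<^esub> y) = r \<odot>\<^bsub>tensor_module R P N\<^esub> pure_tensor R P N x y"
    unfolding tensor_module_def pure_tensor_def
    by (subst lin_smult[OF l, symmetric]; (intro e tensor_relations_mem F.smult_closed unit_FX)?) auto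
qed

lemma tensor_lift:
  assumes Q: "module R Q" and c: "\<And>x y. x \<in> carrier P ==> y \<in> carrier N ==> \<beta> x y \<in> carrier Q"
    and add_left: "\<And>x x' y. x \<in> carrier P ==> x' \<in> carrier P ==> y \<in> carrier N ==> \<beta> (x \<oplus>\<^bsub>P\<^esub> x') y = \<beta> x y \<oplus>\<^bsub>Q\<^esub> \<beta> x' y"
    and add_right: "\<And>x y y'. x \<in> carrier P ==> y \<in> carrier N ==> y' \<in> carrier N ==> \<beta> x (y \<oplus>\<^bsub>N\<^esub> y') = \<beta> x y \<oplus>\<^bsub>Q\<^esub> \<beta> x y'"
    and smult_left: "\<And>r x y. r \<in> carrier R ==> x \<in> carrier P ==> y \<in> carrier N ==> \<beta> (r \<odot>\<^bsub>P\<^esub> x) y = r \<odot>\<^bsub>Q\<^esub> \<beta> x y"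
    and smult_right: "\<And>r x y. r \<in> carrier R ==> x \<in> carrier P ==> y \<in> carrier N ==> \<beta> x (r \<odot>\<^bsub>N\<^esub> y) = r \<odot>\<^bsub>Q\<^esub> \<beta> x y"
  shows "\<exists>h. lin R (tensor_module R P N) Q h \<and> (\<forall>x\<in>carrier P. \<forall>y\<in>carrier N. h (pure_tensor R P N x y) = \<beta> x y)"
proof -
  interpret Q: module R Q by fact
  obtain h where h: "lin R FX Q h" "\<forall>p\<in>carrier P \<times> carrier N. h (unit_vector R p) = (\<lambda>(x, y). \<beta> x y) p"
    using free_module_universal[OF Q, of "carrier P \<times> carrier N" "\<lambda>(x, y). \<beta> x y"] c by auto
  have hu: "h (unit_vector R (x, y)) = \<beta> x y" if "x \<in> carrier P" "y \<in> carrier N" for x y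
    using h(2) that by auto
  have K: "submodule {u \<in> carrier FX. h u = (zero Q)} R FX" by (rule submodule_kernel[OF F.module_axioms Q h(1)])
  have mem: "u \<ominus>\<^bsub>FX\<^esub> v \<in> {u \<in> carrier FX. h u = (zero Q)}" if "u \<in> carrier FX" "v \<in> carrier FX" "h u = h v" for u v
    using that lin_minus[OF F.module_axioms Q h(1) that(1,2)] F.M.minus_closed[OF that(1,2)] lin_closed[OF h(1) that(2)] by simp
  \<comment> \<open>Bilinearity of \<beta> puts the defining relations into the kernel of the map on
    the free module.\<close>
  have "rels \<subseteq> {u \<in> carrier FX. h u = (zero Q)}"
    by (rule tensor_relations_least[OF K]; intro mem unit_FX F.M.a_closed F.smult_closed P.M.a_closed N.M.a_closed
        P.smult_closed N.smult_closed; assumption?)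
       (auto simp del: free_module_simps simp: lin_add[OF h(1)] lin_smult[OF h(1)] unit_FX hu add_left add_right smult_left smult_right)
  then have "\<exists>g. lin R (quot_module FX rels) Q g \<and> (\<forall>u\<in>carrier FX. g (rels +>\<^bsub>FX\<^esub> u) = h u)"
    by (intro quot_module_lift[OF F.module_axioms tensor_relations_submodule Q h(1)]) auto
  then obtain g where g: "lin R (quot_module FX rels) Q g" "\<And>u. u \<in> carrier FX ==> g (rels +>\<^bsub>FX\<^esub> u) = h u" by blast
  then show ?thesis
    by (intro exI[of _ g]) (auto simp: tensor_module_def pure_tensor_def unit_FX hu simp del: free_module_simps)
qed

text \<open>The elements of the free module on which both maps agree form a submodule containing the
  unit vectors.\<close>

lemma tensor_ext:
  assumes Q: "module R Q" and h: "lin R (tensor_module R P N) Q h" and h': "lin R (tensor_module R P N) Q h'"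
    and eq: "\<And>x y. x \<in> carrier P ==> y \<in> carrier N ==> h (pure_tensor R P N x y) = h' (pure_tensor R P N x y)"
    and t: "t \<in> carrier (tensor_module R P N)"
  shows "h t = h' t"
proof -
  interpret Q: module R Q by fact
  note l = lin_coset[OF F.module_axioms tensor_relations_submodule, folded tensor_module_def]
  note a = lin_comp[OF l h] and b = lin_comp[OF l h']
  let ?W = "{u \<in> carrier FX. h (rels +>\<^bsub>FX\<^esub> u) = h' (rels +>\<^bsub>FX\<^esub> u)}"
  have "submodule ?W R FX"
    by (rule F.submoduleI)
      (auto simp: lin_zero[OF F.module_axioms Q a] lin_zero[OF F.module_axioms Q b] lin_neg[OF F.module_axioms Q a]
        lin_neg[OF F.module_axioms Q b] lin_add[OF a] lin_add[OF b] lin_smult[OF a] lin_smult[OF b] simp del: free_module_simps)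
  then have "carrier FX \<subseteq> ?W"
    by (rule free_module_induct[OF P.R.is_cring]) (use eq unit_FX in \<open>auto simp: pure_tensor_def\<close>)
  then show ?thesis using t unfolding tensor_module_def quot_carrier[OF F.module_axioms tensor_relations_submodule] by auto
qed

end

text \<open>Justifies the definite description: existence by \<open>tensor_lift\<close>, uniqueness
  by \<open>tensor_ext\<close> together with the extensionality built into
  \<open>mod_hom\<close>.\<close>

lemma tensor_map_props:
  assumes P: "module R P" and P': "module R P'" and N: "module R N" and f: "lin R P P' f"
  shows "lin R (tensor_module R P N) (tensor_module R P' N) (tensor_map R P P' N f)"
    and "\<And>x y. x \<in> carrier P ==> y \<in> carrier N ==>
      tensor_map R P P' N f (pure_tensor R P N x y) = pure_tensor R P' N (f x) y"
proof -
  let ?T = "tensor_module R P N" and ?T' = "tensor_module R P' N"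
  interpret P: module R P by fact
  interpret N: module R N by fact
  interpret T: module R ?T by (rule tensor_module_is_module[OF P N])
  interpret T': module R ?T' by (rule tensor_module_is_module[OF P' N])
  let ?p = "\<lambda>h. h \<in> mod_hom R ?T ?T' \<and> (\<forall>x \<in> carrier P. \<forall>y \<in> carrier N. h (pure_tensor R P N x y) = pure_tensor R P' N (f x) y)"
  have "\<exists>h. lin R ?T ?T' h \<and> (\<forall>x\<in>carrier P. \<forall>y\<in>carrier N. h (pure_tensor R P N x y) = pure_tensor R P' N (f x) y)"
    by (rule tensor_lift[OF P N T'.module_axioms])
      (auto simp: pure_tensor_closed[OF P' N] lin_closed[OF f] lin_add[OF f] lin_smult[OF f] pure_tensor_add_left[OF P' N]
        pure_tensor_add_right[OF P' N] pure_tensor_smult_left[OF P' N] pure_tensor_smult_right[OF P' N])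
  then obtain h where h: "lin R ?T ?T' h" "\<forall>x\<in>carrier P. \<forall>y\<in>carrier N. h (pure_tensor R P N x y) = pure_tensor R P' N (f x) y" by blast
  have e: "?p (restrict h (carrier ?T))"
    using h lin_restrict_mod_hom[OF T.module_axioms h(1)] pure_tensor_closed[OF P N] by simp
  have u: "g = g'" if "?p g" "?p g'" for g g'
  proof (rule extensionalityI)
    fix t assume t: "t \<in> carrier ?T"
    show "g t = g' t"
      by (rule tensor_ext[OF P N T'.module_axioms _ _ _ t, where h = g and h' = g']) (use that in \<open>auto simp: mod_hom_iff\<close>)
  qed (use that in \<open>auto simp: mod_hom_iff\<close>)
  have "?p (tensor_map R P P' N f)" unfolding tensor_map_def by (rule theI[of ?p, OF e]) (rule u[OF _ e])
  then show "lin R ?T ?T' (tensor_map R P P' N f)" "\<And>x y. x \<in> carrier P ==> y \<in> carrier N ==>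
      tensor_map R P P' N f (pure_tensor R P N x y) = pure_tensor R P' N (f x) y" by (auto simp: mod_hom_iff)
qed

lemma lincomb_cong_terms:
  "(\<And>i. i < n ==> r i \<odot>\<^bsub>M\<^esub> z i = r' i \<odot>\<^bsub>M\<^esub> z' i) ==> lincomb M r z n = lincomb M r' z' n"
  by (induction n) auto

lemma (in module) lincomb_smult_const:
  "(\<And>i. r i \<in> carrier R) ==> (\<And>i. u i \<in> carrier R) ==> y \<in> carrier M ==>
    lincomb M r (\<lambda>j. u j \<odot>\<^bsub>M\<^esub> y) n = lincomb (regular_module R) r u n \<odot>\<^bsub>M\<^esub> y"
  by (induction n) (auto simp: smult_l_distr smult_assoc1)

lemma lin_act_vec_module:
  assumes "module R N" "A \<in> mat R p q" shows "lin R (vec_module N q) (vec_module N p) (act N q A)"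
proof -
  interpret N: module R N by fact
  show ?thesis using assms(2) by (auto simp: lin_def N.act_add N.act_smult)
qed

text \<open>The inverse \<iota> sends v to the sum of the tensors of the unit vectors with the
  entries of v; the composite on the tensor side is tested on pure tensors.\<close>

lemma tensor_free_iso:
  assumes N: "module R N"
  shows "\<exists>\<theta>. lin R (tensor_module R (free_module R {..<q::nat}) N) (vec_module N q) \<theta> \<and>
    bij_betw \<theta> (carrier (tensor_module R (free_module R {..<q}) N)) (vec N q) \<and>
    (\<forall>u\<in>vec (regular_module R) q. \<forall>y\<in>carrier N. \<theta> (pure_tensor R (free_module R {..<q}) N u y) = (\<lambda>i. u i \<odot>\<^bsub>N\<^esub> y))"
proof -
  interpret N: module R N by fact
  let ?F = "free_module R {..<q}"
  let ?T = "tensor_module R ?F N" and ?V = "vec_module N q" and ?p = "pure_tensor R ?F N"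
  note cf = carrier_free_module[OF N.R.is_cring]
  have F: "module R ?F" by (rule free_module_is_module[OF N.R.is_cring])
  interpret F: module R ?F by (rule F)
  interpret T: module R ?T by (rule tensor_module_is_module[OF F N])
  have V: "module R ?V" by (rule vec_module_is_module[OF N])
  have uy: "(\<lambda>i. u i \<odot>\<^bsub>N\<^esub> y) \<in> vec N q" if "u \<in> vec (regular_module R) q" "y \<in> carrier N" for u y
    using that N.R.vec_regular_closed[OF that(1)] vec_zero_outside[OF that(1)]
    by (auto simp del: N.vec_closed N.R.vec_regular_closed simp: vec_def)
  have sc: "a \<odot>\<^bsub>N\<^esub> (r \<odot>\<^bsub>N\<^esub> y) = r \<odot>\<^bsub>N\<^esub> (a \<odot>\<^bsub>N\<^esub> y)" if "a \<in> carrier R" "r \<in> carrier R" "y \<in> carrier N" for a r y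
    using that by (simp add: N.R.m_comm flip: N.smult_assoc1)
  have "\<exists>h. lin R ?T ?V h \<and> (\<forall>x\<in>carrier ?F. \<forall>y\<in>carrier N. h (?p x y) = (\<lambda>i. x i \<odot>\<^bsub>N\<^esub> y))"
    by (rule tensor_lift[OF F N V])
      (auto simp: cf uy N.smult_l_distr N.smult_r_distr N.smult_assoc1 sc)
  then obtain \<theta> where \<theta>: "lin R ?T ?V \<theta>" "\<And>u y. u \<in> vec (regular_module R) q ==> y \<in> carrier N ==> \<theta> (?p u y) = (\<lambda>i. u i \<odot>\<^bsub>N\<^esub> y)"
    unfolding cf by blast
  define z where "z v i = (if i < q then ?p (unit_vector R i) (v i) else \<zero>\<^bsub>?T\<^esub>)" for v i
  define \<iota> where "\<iota> v = lincomb ?T (\<lambda>_. \<one>\<^bsub>R\<^esub>) (z v) q" for v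
  have pc: "?p u y \<in> carrier ?T" if "u \<in> vec (regular_module R) q" "y \<in> carrier N" for u y
    by (rule pure_tensor_closed[OF F N]) (use that cf in auto)
  have zc: "z v i \<in> carrier ?T" if "v \<in> vec N q" for v i using that pc by (simp add: z_def)
  have z_add: "z (\<lambda>i. u i \<oplus>\<^bsub>N\<^esub> v i) i = z u i \<oplus>\<^bsub>?T\<^esub> z v i" if "u \<in> vec N q" "v \<in> vec N q" for u v i
    using that by (auto simp: z_def cf pure_tensor_add_right[OF F N])
  have z_smult: "z (\<lambda>i. r \<odot>\<^bsub>N\<^esub> v i) i = r \<odot>\<^bsub>?T\<^esub> z v i" if "r \<in> carrier R" "v \<in> vec N q" for r v i
    using that by (auto simp: z_def cf pure_tensor_smult_right[OF F N])
  have \<iota>: "lin R ?V ?T \<iota>"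
    unfolding lin_def
  proof (intro conjI ballI)
    show "\<iota> \<in> carrier ?V \<rightarrow> carrier ?T" using zc by (auto simp: \<iota>_def)
    show "\<iota> (u \<oplus>\<^bsub>?V\<^esub> v) = \<iota> u \<oplus>\<^bsub>?T\<^esub> \<iota> v" if "u \<in> carrier ?V" "v \<in> carrier ?V" for u v
      using that zc T.lincomb_add_right[of "\<lambda>_. \<one>\<^bsub>R\<^esub>" "z u" "z v" q] z_add[of u v]
      by (simp add: \<iota>_def cong: lincomb_cong)
    show "\<iota> (r \<odot>\<^bsub>?V\<^esub> v) = r \<odot>\<^bsub>?T\<^esub> \<iota> v" if "r \<in> carrier R" "v \<in> carrier ?V" for r v
      using that zc T.lincomb_smult_right[of r "\<lambda>_. \<one>\<^bsub>R\<^esub>" "z v" q] z_smult[of r v]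
      by (simp add: \<iota>_def cong: lincomb_cong)
  qed
  have "\<theta> (\<iota> v) = v" if v: "v \<in> vec N q" for v
  proof
    fix k
    have "\<theta> (\<iota> v) = lincomb ?V (\<lambda>_. \<one>\<^bsub>R\<^esub>) (\<lambda>i. \<theta> (z v i)) q"
      unfolding \<iota>_def by (rule lincomb_lin[OF T.module_axioms V \<theta>(1)]) (use zc[OF v] in auto)
    then have "\<theta> (\<iota> v) k = lincomb N (\<lambda>_. \<one>\<^bsub>R\<^esub>) (\<lambda>i. \<theta> (z v i) k) q" by (simp add: lincomb_vec_module)
    also have "\<dots> = lincomb N (one_mat R q k) v q"
    proof (rule lincomb_cong_terms)
      fix i assume i: "i < q"
      have "\<theta> (z v i) = (\<lambda>k. unit_vector R i k \<odot>\<^bsub>N\<^esub> v i)" using i v by (simp add: z_def \<theta>(2))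
      then show "\<one>\<^bsub>R\<^esub> \<odot>\<^bsub>N\<^esub> \<theta> (z v i) k = one_mat R q k i \<odot>\<^bsub>N\<^esub> v i"
        using i v by (simp add: unit_vector_def one_mat_def)
    qed
    also have "\<dots> = v k" using fun_cong[OF N.act_one_mat[OF v], of k] by (simp add: act_def)
    finally show "\<theta> (\<iota> v) k = v k" .
  qed
  moreover have "\<iota> (\<theta> t) = t" if t: "t \<in> carrier ?T" for t
  proof (rule tensor_ext[OF F N T.module_axioms lin_comp[OF \<theta>(1) \<iota>] _ _ t])
    show "lin R ?T ?T (\<lambda>t. t)" by (simp add: lin_def)
    fix u y assume "u \<in> carrier ?F" and y: "y \<in> carrier N"
    then have u: "u \<in> vec (regular_module R) q" by (simp add: cf)
    have l: "lin R ?F ?T (\<lambda>u. ?p u y)"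
      using y by (auto simp: lin_def pure_tensor_closed[OF F N] pure_tensor_add_left[OF F N] pure_tensor_smult_left[OF F N] simp del: free_module_simps)
    have "\<iota> (\<theta> (?p u y)) = lincomb ?T (\<lambda>_. \<one>\<^bsub>R\<^esub>) (z (\<lambda>i. u i \<odot>\<^bsub>N\<^esub> y)) q" by (simp add: \<theta>(2)[OF u y] \<iota>_def)
    also have "\<dots> = lincomb ?T u (\<lambda>i. if i < q then ?p (unit_vector R i) y else \<zero>\<^bsub>?T\<^esub>) q"
      using N.R.vec_regular_closed[OF u] y
      by (intro lincomb_cong_terms) (auto simp: z_def cf pc pure_tensor_smult_right[OF F N])
    also have "\<dots> = ?p u y" using T.lin_free_module[OF l u] by simp
    finally show "\<iota> (\<theta> (?p u y)) = ?p u y" .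
  qed
  ultimately have "bij_betw \<theta> (carrier ?T) (vec N q)"
    using lin_closed[OF \<theta>(1)] lin_closed[OF \<iota>] by (intro bij_betwI[of _ _ _ \<iota>]) auto
  with \<theta> show ?thesis by blast
qed

text \<open>The isomorphisms \<open>\<theta> i\<close> carry the chain complex of the chosen
  resolution to a matrix complex, and any other resolution shows the same vanishing.\<close>

theorem Tor_module_zero_iff:
  assumes res: "mres R M b A e" and N: "module R N"
  shows "zero_module (Tor_module R M N n) \<longleftrightarrow> TOR N b A n"
proof -
  interpret M: module R M by (rule mres_module[OF res])
  interpret N: module R N by fact
  let ?Rg = "regular_module R"
  note cf = carrier_free_module[OF M.R.is_cring]
  obtain b' d' e' where ch: "chosen_resolution R M = (b', d', e')" by (metis prod_cases3)
  have fr: "free_resolution R M b' d' e'" using chosen_resolution_mres[OF res] by (simp add: ch)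
  define B where "B = hat 0 b'"
  define D where "D = hat (\<lambda>i j. (zero R)) (diff_mat R b' d')"
  have res': "mres R M B D (\<lambda>j. if j < b' 0 then e' (unit_vector R j) else (zero M))"
    and d: "\<And>n v. v \<in> vec ?Rg (b' (Suc n)) ==> d' n v = act ?Rg (b' (Suc n)) (D (Suc n)) v"
    unfolding B_def D_def using free_resolution_mres[OF M.module_axioms fr] by blast+
  let ?F = "\<lambda>i. free_module R {..<b' i}"
  let ?C = "\<lambda>i. tensor_module R (?F i) N" and ?D = "\<lambda>i. tensor_map R (?F (Suc i)) (?F i) N (d' i)"
  have F: "module R (?F i)" for i by (rule free_module_is_module[OF M.R.is_cring])
  have C: "module R (?C i)" for i by (rule tensor_module_is_module[OF F N])
  have V: "module R (vec_module N i)" for i by (rule vec_module_is_module[OF N])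
  have dl: "lin R (?F (Suc i)) (?F i) (d' i)" for i
    using fr by (auto simp: free_resolution_def Let_def mod_hom_iff)
  note tm = tensor_map_props[OF F F N dl]
  have mat: "D (Suc i) \<in> mat R (b' i) (b' (Suc i))" for i
    using mres_mat[OF res', of "Suc i"] by (simp add: B_def)
  have "\<forall>i. \<exists>\<theta>. lin R (?C i) (vec_module N (b' i)) \<theta> \<and> bij_betw \<theta> (carrier (?C i)) (vec N (b' i)) \<and>
    (\<forall>u\<in>vec ?Rg (b' i). \<forall>y\<in>carrier N. \<theta> (pure_tensor R (?F i) N u y) = (\<lambda>j. u j \<odot>\<^bsub>N\<^esub> y))"
    using tensor_free_iso[OF N] by blast
  then obtain \<theta> where "\<forall>i. lin R (?C i) (vec_module N (b' i)) (\<theta> i) \<and> bij_betw (\<theta> i) (carrier (?C i)) (vec N (b' i)) \<and>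
    (\<forall>u\<in>vec ?Rg (b' i). \<forall>y\<in>carrier N. \<theta> i (pure_tensor R (?F i) N u y) = (\<lambda>j. u j \<odot>\<^bsub>N\<^esub> y))"
    by (rule choice[THEN exE])
  then have \<theta>: "lin R (?C i) (vec_module N (b' i)) (\<theta> i)" "bij_betw (\<theta> i) (carrier (?C i)) (vec N (b' i))"
    "\<And>u y. u \<in> vec ?Rg (b' i) ==> y \<in> carrier N ==> \<theta> i (pure_tensor R (?F i) N u y) = (\<lambda>j. u j \<odot>\<^bsub>N\<^esub> y)" for i
    by blast+
  have \<theta>0: "\<theta> i t = (\<lambda>j. (zero N)) \<longleftrightarrow> t = \<zero>\<^bsub>?C i\<^esub>" if t: "t \<in> carrier (?C i)" for i t
  proof -
    interpret Ci: module R "?C i" by (rule C)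
    have z: "\<theta> i \<zero>\<^bsub>?C i\<^esub> = (\<lambda>j. (zero N))" using lin_zero[OF C V \<theta>(1), of i] by simp
    have "inj_on (\<theta> i) (carrier (?C i))" using \<theta>(2)[of i] by (simp add: bij_betw_def)
    from inj_onD[OF this _ t Ci.M.zero_closed] z show ?thesis by auto
  qed
  \<comment> \<open>Naturality needs checking only on pure tensors, where both sides are the vector
    of entries of \<open>d' i u\<close>, each multiplied with y.\<close>
  have nat: "\<theta> i (?D i t) = act N (b' (Suc i)) (D (Suc i)) (\<theta> (Suc i) t)" if t: "t \<in> carrier (?C (Suc i))" for i t
  proof (rule tensor_ext[OF F N V lin_comp[OF tm(1) \<theta>(1)] lin_comp[OF \<theta>(1) lin_act_vec_module[OF N mat]] _ t])
    fix u y assume uF: "u \<in> carrier (?F (Suc i))" and y: "y \<in> carrier N"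
    then have u: "u \<in> vec ?Rg (b' (Suc i))" by (simp add: cf)
    have du: "d' i u \<in> vec ?Rg (b' i)" using lin_closed[OF dl uF] by (simp add: cf)
    have "act N (b' (Suc i)) (D (Suc i)) (\<lambda>j. u j \<odot>\<^bsub>N\<^esub> y) = (\<lambda>j. d' i u j \<odot>\<^bsub>N\<^esub> y)"
      unfolding d[OF u] act_def using M.R.mat_entry[OF mat] M.R.vec_regular_closed[OF u] y
      by (simp add: N.lincomb_smult_const)
    then show "\<theta> i (?D i (pure_tensor R (?F (Suc i)) N u y)) =
        act N (b' (Suc i)) (D (Suc i)) (\<theta> (Suc i) (pure_tensor R (?F (Suc i)) N u y))"
      by (simp add: tm(2)[OF uF y] \<theta>(3)[OF du y] \<theta>(3)[OF u y])
  qed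
  let ?K = "case n of 0 => carrier (?C 0) | Suc k => mod_kernel (?C (Suc k)) (?C k) (?D k)"
  let ?H = "?D n ` carrier (?C (Suc n))"
  have subK: "submodule ?K R (?C n)"
  proof (cases n)
    case 0
    interpret C0: module R "?C 0" by (rule C)
    show ?thesis using 0 C0.carrier_is_submodule by simp
  next
    case (Suc k)
    then show ?thesis using submodule_kernel[OF C C tm(1), of k] by (simp add: mod_kernel_def)
  qed
  have subH: "submodule ?H R (?C n)" by (rule submodule_image[OF C C tm(1)])
  have D0: "D 0 = (\<lambda>i j. (zero R))" by (simp add: D_def)
  have K_iff: "t \<in> ?K \<longleftrightarrow> act N (b' n) (D n) (\<theta> n t) = (\<lambda>i. (zero N))" if t: "t \<in> carrier (?C n)" for t
  proof -
    have \<theta>t: "\<theta> n t \<in> vec N (b' n)" using lin_closed[OF \<theta>(1) t] by simp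
    show ?thesis
    proof (cases n)
      \<comment> \<open>Every element is a cycle in degree 0; on the matrix side this is the zero
        padding \<open>D 0\<close>.\<close>
      case 0
      then show ?thesis using t \<theta>t by (simp add: D0)
    next
      case (Suc k)
      then show ?thesis using t nat[of t k] \<theta>0[of "?D k t" k] lin_closed[OF tm(1), of t k] by (auto simp: mod_kernel_def)
    qed
  qed
  have sur: "\<exists>t\<in>carrier (?C i). v = \<theta> i t" if "v \<in> vec N (b' i)" for v i
    using \<theta>(2)[of i] that unfolding bij_betw_def by blast
  have inj: "s = t" if "s \<in> carrier (?C i)" "t \<in> carrier (?C i)" "\<theta> i s = \<theta> i t" for s t i
    using \<theta>(2)[of i] that unfolding bij_betw_def inj_on_def by blast
  have H_iff: "t \<in> ?H \<longleftrightarrow> (\<exists>w\<in>vec N (b' (Suc n)). \<theta> n t = act N (b' (Suc n)) (D (Suc n)) w)" if t: "t \<in> carrier (?C n)" for t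
  proof
    assume "t \<in> ?H"
    then obtain s where s: "s \<in> carrier (?C (Suc n))" "t = ?D n s" by blast
    then show "\<exists>w\<in>vec N (b' (Suc n)). \<theta> n t = act N (b' (Suc n)) (D (Suc n)) w"
      using nat[OF s(1)] lin_closed[OF \<theta>(1) s(1)] by auto
  next
    assume "\<exists>w\<in>vec N (b' (Suc n)). \<theta> n t = act N (b' (Suc n)) (D (Suc n)) w"
    then obtain s where s: "s \<in> carrier (?C (Suc n))" "\<theta> n t = act N (b' (Suc n)) (D (Suc n)) (\<theta> (Suc n) s)"
      using sur by blast
    then have "t = ?D n s" using nat[OF s(1)] lin_closed[OF tm(1) s(1)] by (intro inj[OF t]) auto
    with s(1) show "t \<in> ?H" by blast
  qed
  have HK: "?H \<subseteq> ?K"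
  proof
    fix t assume tH: "t \<in> ?H"
    interpret Cn: module R "?C n" by (rule C)
    have t: "t \<in> carrier (?C n)" using tH Cn.submoduleE(1)[OF subH] by blast
    then obtain w where w: "w \<in> vec N (b' (Suc n))" "\<theta> n t = act N (b' (Suc n)) (D (Suc n)) w" using H_iff tH by blast
    have "act N (B (Suc n)) (D n) (act N (B (Suc (Suc n))) (D (Suc n)) w) = (\<lambda>i. (zero N))"
      using w(1) by (intro N.act_act_zero[OF mres_mat[OF res'] mres_mat[OF res'] mres_complex[OF res']]) (simp add: B_def)
    then show "t \<in> ?K" using K_iff[OF t] w(2) by (simp add: B_def)
  qed
  have Kc: "?K \<subseteq> carrier (?C n)" by (auto simp: mod_kernel_def split: nat.split)
  have "zero_module (Tor_module R M N n) \<longleftrightarrow> ?K \<subseteq> ?H"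
    using zero_module_quot[OF submodule.submodule_is_module[OF subK C] submodule_mono[OF C subK subH HK]]
    by (simp add: Tor_module_def ch homology_def Let_def)
  also have "\<dots> \<longleftrightarrow> (\<forall>t\<in>carrier (?C n). t \<in> ?K \<longrightarrow> t \<in> ?H)" using Kc by blast
  also have "\<dots> \<longleftrightarrow> (\<forall>t\<in>carrier (?C n). act N (b' n) (D n) (\<theta> n t) = (\<lambda>i. (zero N)) \<longrightarrow>
      (\<exists>w\<in>vec N (b' (Suc n)). \<theta> n t = act N (b' (Suc n)) (D (Suc n)) w))"
    using K_iff H_iff by simp
  also have "\<dots> \<longleftrightarrow> TOR N B D n"
    unfolding TOR_def exact_at_def B_def hat_simps using sur[of _ n] lin_closed[OF \<theta>(1), of _ n] by (auto) metis+
  also have "\<dots> \<longleftrightarrow> TOR N b A n" by (rule mres_TOR_unique[OF res' res N])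
  finally show ?thesis .
qed

section \<open>Change of rings\<close>

text \<open>Only a surjection onto S with kernel xR is assumed, with S of arbitrary type; the coset
  ring is one instance.\<close>

locale regular_quotient = R: cring R + S: cring S
  for R :: "('a, 'r) ring_scheme" and S :: "('s, 't) ring_scheme" +
  fixes \<pi> :: "'a => 's" and x :: 'a
  assumes hom: "\<pi> \<in> ring_hom R S"
    and surj: "\<pi> ` carrier R = carrier S"
    and x_closed [simp]: "x \<in> carrier R"
    and regular: "y \<in> carrier R ==> x \<otimes>\<^bsub>R\<^esub> y = (zero R) ==> y = (zero R)"
    and kernel: "y \<in> carrier R ==> \<pi> y = (zero S) \<longleftrightarrow> (\<exists>z\<in>carrier R. y = x \<otimes>\<^bsub>R\<^esub> z)"
begin

abbreviation "Rg \<equiv> regular_module R"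
abbreviation "Sg \<equiv> regular_module S"

sublocale Rg: module R "regular_module R" by (rule R.regular_module_is_module)
sublocale Sg: module S "regular_module S" by (rule S.regular_module_is_module)

lemma pi_closed [simp]: "r \<in> carrier R ==> \<pi> r \<in> carrier S"
  using surj by blast

lemma pi_add: "r \<in> carrier R ==> s \<in> carrier R ==> \<pi> (r \<oplus>\<^bsub>R\<^esub> s) = \<pi> r \<oplus>\<^bsub>S\<^esub> \<pi> s"
  and pi_mult: "r \<in> carrier R ==> s \<in> carrier R ==> \<pi> (r \<otimes>\<^bsub>R\<^esub> s) = \<pi> r \<otimes>\<^bsub>S\<^esub> \<pi> s"
  and pi_one [simp]: "\<pi> \<one>\<^bsub>R\<^esub> = \<one>\<^bsub>S\<^esub>"
  using hom by (auto simp: ring_hom_def)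

lemma pi_x [simp]: "\<pi> x = (zero S)"
  unfolding kernel[OF x_closed] by (rule bexI[of _ "\<one>\<^bsub>R\<^esub>"]) simp_all

lemma pi_zero [simp]: "\<pi> (zero R) = (zero S)"
  unfolding kernel[OF R.zero_closed] by (rule bexI[of _ "(zero R)"]) simp_all

lemma pi_lift: "s \<in> carrier S ==> \<exists>r\<in>carrier R. s = \<pi> r"
  using surj by blast

lemma pi_minus: "r \<in> carrier R ==> s \<in> carrier R ==> \<pi> (r \<ominus>\<^bsub>R\<^esub> s) = \<pi> r \<ominus>\<^bsub>S\<^esub> \<pi> s"
  by (metis R.minus_add_cancel R.minus_closed S.minus_eq_iff pi_add pi_closed)

text \<open>P is N seen as an R-module. Sharing carrier, zero and addition makes their vectors
  literally equal, and a matrix over R acts on P as its reduction does on N.\<close>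

definition compat :: "('a, 'b, 'm) module_scheme => ('s, 'b, 'n) module_scheme => bool" where
  "compat P N \<longleftrightarrow> module R P \<and> module S N \<and> carrier P = carrier N \<and> zero P = zero N \<and> add P = add N \<and>
    (\<forall>r\<in>carrier R. \<forall>m\<in>carrier N. \<pi> r \<odot>\<^bsub>N\<^esub> m = r \<odot>\<^bsub>P\<^esub> m)"

definition map_mat :: "(nat => nat => 'a) => nat => nat => 's" where
  "map_mat A = (\<lambda>i j. \<pi> (A i j))"

lemma map_mat_mat [simp]: "A \<in> mat R p q ==> map_mat A \<in> mat S p q"
  by (auto simp del: R.mat_entry S.mat_entry Rg.mat_closed Sg.mat_closed simp: mat_def map_mat_def)

lemma map_mat_transp: "map_mat (transp A) = transp (map_mat A)"
  by (simp add: map_mat_def transp_def)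

lemma map_vec [simp]: "v \<in> vec Rg q ==> (\<lambda>i. \<pi> (v i)) \<in> vec Sg q"
  by (auto simp del: R.vec_regular_closed S.vec_regular_closed Rg.vec_closed Sg.vec_closed simp: vec_def)

lemma lift_map_vec:
  assumes "v \<in> vec Sg q" obtains u where "u \<in> vec Rg q" "v = (\<lambda>i. \<pi> (u i))"
proof -
  have "\<exists>r\<in>carrier Rg. v j = \<pi> r" for j using pi_lift[of "v j"] assms by simp
  then obtain u where u: "u \<in> vec Rg q" "\<And>j. j < q ==> v j = \<pi> (u j)"
    using vec_choice[OF Rg.module_axioms, of q "\<lambda>j r. v j = \<pi> r"] by metis
  then have "v = (\<lambda>i. \<pi> (u i))" by (intro vec_ext[OF assms map_vec]) auto
  with u(1) show ?thesis by (rule that)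
qed

lemma lift_map_mat:
  assumes A: "A \<in> mat S p q" obtains B where "B \<in> mat R p q" "A = map_mat B"
proof -
  have "\<forall>i j. \<exists>r. r \<in> carrier R \<and> A i j = \<pi> r" using pi_lift A by (metis S.mat_entry)
  then obtain B where B: "\<And>i j. B i j \<in> carrier R \<and> A i j = \<pi> (B i j)" by metis
  let ?B = "\<lambda>i j. if i < p \<and> j < q then B i j else (zero R)"
  have "?B \<in> mat R p q" using B by (auto simp del: R.mat_entry Rg.mat_closed simp: mat_def)
  moreover have "A i j = map_mat ?B i j" for i j
  proof (cases "i < p \<and> j < q")
    case True
    then show ?thesis using conjunct2[OF B[of i j]] by (simp add: map_mat_def)
  next
    case False
    then have "A i j = (zero S)" using A unfolding mat_def by auto
    with False show ?thesis by (auto simp: map_mat_def)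
  qed
  ultimately show ?thesis by (intro that[of ?B]) auto
qed

lemma kernel_vec:
  assumes v: "v \<in> vec Rg q" and 0: "\<And>i. \<pi> (v i) = (zero S)"
  obtains u where "u \<in> vec Rg q" "v = (\<lambda>i. x \<otimes>\<^bsub>R\<^esub> u i)"
proof -
  have "\<exists>r\<in>carrier Rg. v j = x \<otimes>\<^bsub>R\<^esub> r" for j using kernel[of "v j"] v 0 by simp
  then obtain u where u: "u \<in> vec Rg q" "\<And>j. j < q ==> v j = x \<otimes>\<^bsub>R\<^esub> u j"
    using vec_choice[OF Rg.module_axioms, of q "\<lambda>j r. v j = x \<otimes>\<^bsub>R\<^esub> r"] by metis
  then have "v = (\<lambda>i. x \<otimes>\<^bsub>R\<^esub> u i)"
    using Rg.smult_vec[OF x_closed u(1)] by (intro vec_ext[OF v]) auto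
  with u(1) show ?thesis by (rule that)
qed

lemma regular_vec:
  assumes "v \<in> vec Rg q" "(\<lambda>i. x \<otimes>\<^bsub>R\<^esub> v i) = (\<lambda>i. (zero R))" shows "v = (\<lambda>i. (zero R))"
  using assms regular by (auto simp: fun_eq_iff)

lemma pi_lincomb:
  "(\<And>i. r i \<in> carrier R) ==> (\<And>i. z i \<in> carrier R) ==>
    lincomb Sg (\<lambda>i. \<pi> (r i)) (\<lambda>i. \<pi> (z i)) n = \<pi> (lincomb Rg r z n)"
  by (induction n) (auto simp: pi_add pi_mult)

lemma pi_act: "A \<in> mat R p q' ==> v \<in> vec Rg q ==>
    act Sg n (map_mat A) (\<lambda>i. \<pi> (v i)) = (\<lambda>i. \<pi> (act Rg n A v i))"
  unfolding act_def map_mat_def by (intro ext pi_lincomb) simp_all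

context
  fixes P :: "('a, 'b, 'm) module_scheme" and N :: "('s, 'b, 'n) module_scheme"
  assumes PN: "compat P N"
begin

lemma compat_modules: "module R P" "module S N" "carrier P = carrier N" "zero P = zero N" "add P = add N"
  using PN by (auto simp: compat_def)

lemma compat_smult: "r \<in> carrier R ==> m \<in> carrier N ==> \<pi> r \<odot>\<^bsub>N\<^esub> m = r \<odot>\<^bsub>P\<^esub> m"
  using PN by (auto simp: compat_def)

interpretation P: module R P by (rule compat_modules)
interpretation N: module S N by (rule compat_modules)

lemma compat_vec: "vec P q = vec N q"
  by (simp add: vec_def compat_modules del: P.vec_closed N.vec_closed)

lemma compat_lincomb:
  "(\<And>i. r i \<in> carrier R) ==> (\<And>i. z i \<in> carrier N) ==> lincomb N (\<lambda>i. \<pi> (r i)) z n = lincomb P r z n"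
  by (induction n) (auto simp: compat_modules compat_smult)

lemma compat_act: "A \<in> mat R p q' ==> v \<in> vec N q ==> act N n (map_mat A) v = act P n A v"
  unfolding act_def map_mat_def by (intro ext compat_lincomb) simp_all

lemma compat_exact_at: "A \<in> mat R r q ==> B \<in> mat R q p ==>
    exact_at N p q (map_mat B) (map_mat A) \<longleftrightarrow> exact_at P p q B A"
  by (simp add: exact_at_def compat_vec compat_act compat_modules)

lemma compat_x: "m \<in> carrier P ==> x \<odot>\<^bsub>P\<^esub> m = (zero P)"
  using compat_smult[OF x_closed, of m] by (simp add: compat_modules)

lemma compat_fg: "fg_module R P \<longleftrightarrow> fg_module S N"
proof
  assume "fg_module R P"
  then obtain n e where e: "e \<in> vec P n" "\<forall>m\<in>carrier P. \<exists>v\<in>vec Rg n. m = lincomb P v e n" by (rule fg_module_gens)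
  have ec: "e i \<in> carrier N" for i using e(1) by (simp add: compat_vec)
  show "fg_module S N"
  proof (rule fg_moduleI[OF compat_modules(2) ec])
    fix m assume "m \<in> carrier N"
    then obtain v where v: "v \<in> vec Rg n" "m = lincomb P v e n" using e(2) by (auto simp: compat_modules)
    then have "m = lincomb N (\<lambda>i. \<pi> (v i)) e n" using compat_lincomb[of v e n] ec by simp
    moreover have "\<forall>i. \<pi> (v i) \<in> carrier S" using v(1) by simp
    ultimately show "\<exists>r. (\<forall>i. r i \<in> carrier S) \<and> m = lincomb N r e n" by (intro exI[of _ "\<lambda>i. \<pi> (v i)"] conjI)
  qed
next
  assume "fg_module S N"
  then obtain n e where e: "e \<in> vec N n" "\<forall>m\<in>carrier N. \<exists>v\<in>vec Sg n. m = lincomb N v e n" by (rule fg_module_gens)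
  have ec: "e i \<in> carrier N" for i using e(1) by simp
  show "fg_module R P"
  proof (rule fg_moduleI[OF compat_modules(1), of e])
    show "e i \<in> carrier P" for i using ec by (simp add: compat_modules)
    fix m assume "m \<in> carrier P"
    then obtain v where v: "v \<in> vec Sg n" "m = lincomb N v e n" using e(2) by (auto simp: compat_modules)
    obtain u where u: "u \<in> vec Rg n" "v = (\<lambda>i. \<pi> (u i))" using v(1) by (rule lift_map_vec)
    have "m = lincomb P u e n" unfolding v(2) u(2) by (rule compat_lincomb) (use u(1) ec in simp_all)
    moreover have "\<forall>i. u i \<in> carrier R" using u(1) by simp
    ultimately show "\<exists>r. (\<forall>i. r i \<in> carrier R) \<and> m = lincomb P r e n" by blast
  qed
qed

end

section \<open>Restriction of scalars and modules killed by x\<close>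

definition restrict_scalars :: "('s, 'b, 'n) module_scheme => ('a, 'b) module" where
  "restrict_scalars N = \<lparr>carrier = carrier N, monoid.mult = undefined, one = undefined,
     zero = zero N, add = add N, smult = (\<lambda>r m. \<pi> r \<odot>\<^bsub>N\<^esub> m)\<rparr>"

definition induced_module :: "('a, 'b, 'm) module_scheme => ('s, 'b) module" where
  "induced_module P = \<lparr>carrier = carrier P, monoid.mult = undefined, one = undefined,
     zero = zero P, add = add P, smult = (\<lambda>s m. (SOME r. r \<in> carrier R \<and> \<pi> r = s) \<odot>\<^bsub>P\<^esub> m)\<rparr>"

lemma abelian_group_cong:
  assumes "abelian_group G" "carrier H = carrier G" "zero H = zero G" "add H = add G"
  shows "abelian_group H"
proof -
  interpret G: abelian_group G by fact
  show ?thesis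
  proof (rule abelian_groupI)
    fix g assume "g \<in> carrier H"
    then show "\<exists>y\<in>carrier H. y \<oplus>\<^bsub>H\<^esub> g = (zero H)" using assms G.l_neg by (intro bexI[of _ "\<ominus>\<^bsub>G\<^esub> g"]) auto
  qed (auto simp: assms G.a_assoc G.a_comm G.a_lcomm)
qed

lemma restrict_scalars_compat:
  assumes "module S N" shows "compat (restrict_scalars N) N"
proof -
  interpret N: module S N by fact
  have "abelian_group (restrict_scalars N)"
    by (rule abelian_group_cong[OF N.M.abelian_group_axioms]) (simp_all add: restrict_scalars_def)
  then have "module R (restrict_scalars N)"
    by (rule moduleI[OF R.is_cring])
      (auto simp: restrict_scalars_def pi_add pi_mult N.smult_l_distr N.smult_r_distr N.smult_assoc1)
  then show ?thesis using N.module_axioms by (simp add: compat_def restrict_scalars_def)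
qed

text \<open>Two preimages of the same element of S differ by a multiple of x, which kills P, so the
  choice in \<open>induced_module\<close> does not matter.\<close>

lemma induced_module_compat:
  assumes P: "module R P" and xP: "\<And>m. m \<in> carrier P ==> x \<odot>\<^bsub>P\<^esub> m = (zero P)"
  shows "compat P (induced_module P)"
proof -
  interpret P: module R P by fact
  have sm: "\<pi> r \<odot>\<^bsub>induced_module P\<^esub> m = r \<odot>\<^bsub>P\<^esub> m" if r: "r \<in> carrier R" and m: "m \<in> carrier P" for r m
  proof -
    let ?r = "SOME r'. r' \<in> carrier R \<and> \<pi> r' = \<pi> r"
    have r': "?r \<in> carrier R \<and> \<pi> ?r = \<pi> r" by (rule someI[of _ r]) (use r in simp)
    then have "\<pi> (?r \<ominus>\<^bsub>R\<^esub> r) = (zero S)" using r by (simp add: pi_minus)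
    then obtain z where z: "z \<in> carrier R" "?r \<ominus>\<^bsub>R\<^esub> r = x \<otimes>\<^bsub>R\<^esub> z" using kernel[of "?r \<ominus>\<^bsub>R\<^esub> r"] r r' by auto
    have "?r \<odot>\<^bsub>P\<^esub> m = (x \<otimes>\<^bsub>R\<^esub> z \<oplus>\<^bsub>R\<^esub> r) \<odot>\<^bsub>P\<^esub> m"
      using r r' z by (metis R.minus_add_cancel)
    also have "\<dots> = r \<odot>\<^bsub>P\<^esub> m" using r m z(1) xP by (simp add: P.smult_l_distr P.smult_assoc1)
    finally show ?thesis by (simp add: induced_module_def)
  qed
  have "abelian_group (induced_module P)"
    by (rule abelian_group_cong[OF P.M.abelian_group_axioms]) (simp_all add: induced_module_def)
  then have "module S (induced_module P)"
  proof (rule moduleI[OF S.is_cring], goal_cases)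
    have [simp]: "carrier (induced_module P) = carrier P" "add (induced_module P) = add P" by (simp_all add: induced_module_def)
    {
      case (1 a m) then show ?case using pi_lift[of a] sm by auto
    next
      case (2 a b m) then obtain r s where "r \<in> carrier R" "s \<in> carrier R" "a = \<pi> r" "b = \<pi> s" using pi_lift by metis
      with 2 show ?case using sm by (simp flip: pi_add add: P.smult_l_distr)
    next
      case (3 a m m') then show ?case using pi_lift[of a] sm by (auto simp: P.smult_r_distr)
    next
      case (4 a b m) then obtain r s where "r \<in> carrier R" "s \<in> carrier R" "a = \<pi> r" "b = \<pi> s" using pi_lift by metis
      with 4 show ?case using sm by (simp flip: pi_mult add: P.smult_assoc1)
    next
      case (5 m) then show ?case using sm[OF R.one_closed] by simp
    }
  qed
  then show ?thesis using P sm by (simp add: compat_def) (simp add: induced_module_def)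
qed

text \<open>Since x is regular on R and on M, a resolution stays exact modulo x. A cycle modulo x
  lifts to some v whose boundary is x u; regularity makes u a cycle, so u is the boundary of some w,
  and v - x w is a cycle that agrees with v modulo x.\<close>

lemma mres_mod_regular:
  assumes res: "mres R M b A e" and PN: "compat P N" and p: "lin R M P p" "p ` carrier M = carrier P"
    and reg: "\<And>m. m \<in> carrier M ==> x \<odot>\<^bsub>M\<^esub> m = (zero M) ==> m = (zero M)"
    and ker: "\<And>m. m \<in> carrier M ==> p m = (zero P) \<longleftrightarrow> (\<exists>m'\<in>carrier M. m = x \<odot>\<^bsub>M\<^esub> m')"
  shows "mres S N b (\<lambda>n. map_mat (A n)) (\<lambda>i. p (e i))"
proof -
  note cm = compat_modules[OF PN]
  interpret M: module R M by (rule mres_module[OF res])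
  interpret P: module R P by (rule cm)
  interpret N: module S N by (rule cm)
  have e: "e i \<in> carrier M" for i using mres_gen[OF res] by simp
  have pe: "p (e i) \<in> carrier N" for i using lin_closed[OF p(1) e] by (simp add: cm)
  have lc: "lincomb N (\<lambda>i. \<pi> (v i)) (\<lambda>i. p (e i)) n = p (lincomb M v e n)" if v: "v \<in> vec Rg q" for v n q
  proof -
    have vc: "v i \<in> carrier R" for i using v by simp
    show ?thesis
      using compat_lincomb[OF PN vc pe] lincomb_lin[OF M.module_axioms P.module_axioms p(1) vc e] by simp
  qed
  have xlc: "lincomb M (\<lambda>i. x \<otimes>\<^bsub>R\<^esub> u i) e n = x \<odot>\<^bsub>M\<^esub> lincomb M u e n" if "u \<in> vec Rg q" for u n q
    using that e by (intro M.lincomb_smult_left) simp_all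
  have rk: "u \<in> res_ker R M b A e n"
    if u: "u \<in> vec Rg (b (Suc n))" "(\<lambda>i. x \<otimes>\<^bsub>R\<^esub> u i) \<in> res_ker R M b A e n" for u n
  proof (cases n)
    case 0
    have "lincomb M u e (b (Suc n)) \<in> carrier M" using u(1) e by simp
    with u 0 reg show ?thesis by (simp add: res_ker_def xlc[OF u(1)])
  next
    case (Suc k)
    have "act Rg (b (Suc n)) (A n) (\<lambda>i. x \<otimes>\<^bsub>R\<^esub> u i) = (\<lambda>i. x \<otimes>\<^bsub>R\<^esub> act Rg (b (Suc n)) (A n) u i)"
      using Rg.act_smult[OF mres_mat[OF res] x_closed u(1)] by simp
    then have "act Rg (b (Suc n)) (A n) u = (\<lambda>i. (zero R))"
      using u(2) Suc by (intro regular_vec[OF Rg.act_closed[OF mres_mat[OF res] u(1)]]) (simp add: res_ker_def)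
    with u(1) Suc show ?thesis by (simp add: res_ker_def)
  qed
  have mod: "\<exists>w\<in>vec Rg (b (Suc (Suc n))). (\<lambda>i. \<pi> (v i)) = (\<lambda>i. \<pi> (act Rg (b (Suc (Suc n))) (A (Suc n)) w i))"
    if v: "v \<in> vec Rg (b (Suc n))" and u: "u \<in> vec Rg (b (Suc n))" and vu: "(\<lambda>i. v i \<ominus>\<^bsub>R\<^esub> x \<otimes>\<^bsub>R\<^esub> u i) \<in> res_ker R M b A e n" for u v n
  proof -
    obtain w where w: "w \<in> vec Rg (b (Suc (Suc n)))" "(\<lambda>i. v i \<ominus>\<^bsub>R\<^esub> x \<otimes>\<^bsub>R\<^esub> u i) = act Rg (b (Suc (Suc n))) (A (Suc n)) w"
      using vu unfolding mres_exact[OF res] by blast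
    have "\<pi> (v i) = \<pi> (v i \<ominus>\<^bsub>R\<^esub> x \<otimes>\<^bsub>R\<^esub> u i)" for i using v u by (simp add: pi_minus pi_mult)
    then show ?thesis using w fun_cong[OF w(2)] by (intro bexI[OF _ w(1)]) simp
  qed
  show ?thesis
    unfolding mres_def
  proof (intro conjI allI ballI)
    show "(\<lambda>i. p (e i)) \<in> vec N (b (Suc 0))"
      using lin_vec[OF M.module_axioms P.module_axioms p(1) mres_gen[OF res]] by (simp add: compat_vec[OF PN])
    show "\<exists>v\<in>vec Sg (b (Suc 0)). m = lincomb N v (\<lambda>i. p (e i)) (b (Suc 0))" if "m \<in> carrier N" for m
    proof -
      have "m \<in> p ` carrier M" using that by (simp add: p(2) cm)
      then obtain m' where m': "m' \<in> carrier M" "m = p m'" by (rule imageE)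
      obtain v where v: "v \<in> vec Rg (b (Suc 0))" "m' = lincomb M v e (b (Suc 0))" using mres_surj[OF res m'(1)] by blast
      show ?thesis by (rule bexI[of _ "\<lambda>i. \<pi> (v i)"]) (use v m'(2) in \<open>simp_all add: lc[OF v(1)]\<close>)
    qed
    show "res_ker S N b (\<lambda>n. map_mat (A n)) (\<lambda>i. p (e i)) n =
      act Sg (b (Suc (Suc n))) (map_mat (A (Suc n))) ` vec Sg (b (Suc (Suc n)))" for n
    proof (intro equalityI subsetI)
      fix v' assume v': "v' \<in> res_ker S N b (\<lambda>n. map_mat (A n)) (\<lambda>i. p (e i)) n"
      then have "v' \<in> vec Sg (b (Suc n))" by (simp add: res_ker_def)
      then obtain v where v: "v \<in> vec Rg (b (Suc n))" "v' = (\<lambda>i. \<pi> (v i))" by (rule lift_map_vec)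
      have "\<exists>u\<in>vec Rg (b (Suc n)). (\<lambda>i. v i \<ominus>\<^bsub>R\<^esub> x \<otimes>\<^bsub>R\<^esub> u i) \<in> res_ker R M b A e n"
      proof (cases n)
        case 0
        have "p (lincomb M v e (b (Suc 0))) = (zero P)" using v' 0 v by (simp add: res_ker_def lc[OF v(1)] cm)
        then obtain m' where m': "m' \<in> carrier M" "lincomb M v e (b (Suc 0)) = x \<odot>\<^bsub>M\<^esub> m'"
          using ker[of "lincomb M v e (b (Suc 0))"] v(1) e by auto
        obtain u where u: "u \<in> vec Rg (b (Suc 0))" "m' = lincomb M u e (b (Suc 0))" using mres_surj[OF res m'(1)] by blast
        have xu: "(\<lambda>i. x \<otimes>\<^bsub>R\<^esub> u i) \<in> vec Rg (b (Suc 0))" using Rg.smult_vec[OF x_closed u(1)] by simp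
        have "lincomb M (\<lambda>i. v i \<ominus>\<^bsub>R\<^esub> x \<otimes>\<^bsub>R\<^esub> u i) e (b (Suc 0)) = lincomb M v e (b (Suc 0)) \<ominus>\<^bsub>M\<^esub> lincomb M (\<lambda>i. x \<otimes>\<^bsub>R\<^esub> u i) e (b (Suc 0))"
          using v(1) R.vec_regular_closed[OF xu] e by (intro M.lincomb_minus_left) simp_all
        also have "\<dots> = (zero M)" using m' u e by (simp add: xlc[OF u(1)])
        finally have "(\<lambda>i. v i \<ominus>\<^bsub>R\<^esub> x \<otimes>\<^bsub>R\<^esub> u i) \<in> res_ker R M b A e n"
          using 0 Rg.minus_vec[OF _ xu, of v] v(1) by (simp add: res_ker_def)
        then show ?thesis using u(1) 0 by blast
      next
        case (Suc k)
        have "act Sg (b (Suc n)) (map_mat (A n)) v' = (\<lambda>i. (zero S))" using v' Suc by (simp add: res_ker_def)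
        then have 0: "\<pi> (act Rg (b (Suc n)) (A n) v i) = (zero S)" for i
          using pi_act[OF mres_mat[OF res] v(1), of "b (Suc n)" n] v(2) by (metis (no_types))
        obtain u where u: "u \<in> vec Rg (b n)" "act Rg (b (Suc n)) (A n) v = (\<lambda>i. x \<otimes>\<^bsub>R\<^esub> u i)"
          using Rg.act_closed[OF mres_mat[OF res] v(1)] 0 by (rule kernel_vec)
        have "act Rg (b (Suc n)) (A n) v \<in> res_ker R M b A e k" using act_mem_res_ker[OF res, of v k] v(1) Suc by simp
        then have "(\<lambda>i. x \<otimes>\<^bsub>R\<^esub> u i) \<in> res_ker R M b A e k" unfolding u(2) .
        from rk[OF u(1)[unfolded Suc] this] have "u \<in> res_ker R M b A e k" .
        then obtain w where "u = act Rg (b (Suc (Suc k))) (A (Suc k)) w" "w \<in> vec Rg (b (Suc (Suc k)))"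
          unfolding mres_exact[OF res] by (rule imageE)
        then have w: "w \<in> vec Rg (b (Suc n))" "u = act Rg (b (Suc n)) (A n) w" unfolding Suc by blast+
        have xw: "(\<lambda>i. x \<otimes>\<^bsub>R\<^esub> w i) \<in> vec Rg (b (Suc n))" using Rg.smult_vec[OF x_closed w(1)] by simp
        have "act Rg (b (Suc n)) (A n) (\<lambda>i. v i \<ominus>\<^bsub>R\<^esub> x \<otimes>\<^bsub>R\<^esub> w i) = (\<lambda>i. (zero R))"
          using Rg.act_minus[OF mres_mat[OF res] v(1) xw] Rg.act_smult[OF mres_mat[OF res] x_closed w(1)] u R.vec_regular_closed[OF u(1)]
          by (simp add: w(2))
        then have "(\<lambda>i. v i \<ominus>\<^bsub>R\<^esub> x \<otimes>\<^bsub>R\<^esub> w i) \<in> res_ker R M b A e n"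
          using Suc Rg.minus_vec[OF v(1) xw] by (simp add: res_ker_def)
        then show ?thesis using w(1) by blast
      qed
      then obtain w where w: "w\<in>vec Rg (b (Suc (Suc n)))" "v' = (\<lambda>i. \<pi> (act Rg (b (Suc (Suc n))) (A (Suc n)) w i))"
        using mod[OF v(1)] unfolding v(2) by blast
      then have "v' = act Sg (b (Suc (Suc n))) (map_mat (A (Suc n))) (\<lambda>i. \<pi> (w i))"
        using pi_act[OF mres_mat[OF res] w(1)] by simp
      then show "v' \<in> act Sg (b (Suc (Suc n))) (map_mat (A (Suc n))) ` vec Sg (b (Suc (Suc n)))"
        using map_vec[OF w(1)] by blast
    next
      fix v' assume "v' \<in> act Sg (b (Suc (Suc n))) (map_mat (A (Suc n))) ` vec Sg (b (Suc (Suc n)))"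
      then obtain w' where w': "w' \<in> vec Sg (b (Suc (Suc n)))" "v' = act Sg (b (Suc (Suc n))) (map_mat (A (Suc n))) w'" by blast
      obtain w where w: "w \<in> vec Rg (b (Suc (Suc n)))" "w' = (\<lambda>i. \<pi> (w i))" using w'(1) by (rule lift_map_vec)
      let ?v = "act Rg (b (Suc (Suc n))) (A (Suc n)) w"
      have v: "?v \<in> res_ker R M b A e n" by (rule act_mem_res_ker[OF res w(1)])
      have v'eq: "v' = (\<lambda>i. \<pi> (?v i))" unfolding w' w using pi_act[OF mres_mat[OF res] w(1)] by simp
      note vv = res_ker_vec[OF res v]
      show "v' \<in> res_ker S N b (\<lambda>n. map_mat (A n)) (\<lambda>i. p (e i)) n"
      proof (cases n)
        case 0
        then show ?thesis
          using v map_vec[OF vv] lin_zero[OF M.module_axioms P.module_axioms p(1)] lc[OF vv, of "b (Suc 0)"]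
          by (simp add: res_ker_def v'eq cm)
      next
        case (Suc k)
        then show ?thesis using v map_vec[OF vv] pi_act[OF mres_mat[OF res] vv, of "b (Suc n)" n]
          by (simp add: res_ker_def v'eq)
      qed
    qed
  qed (use mres_b0[OF res] mres_mat[OF res] N.module_axioms in auto)
qed

end

section \<open>Block matrices\<close>

definition blk :: "nat => nat => (nat => nat => 'a) => (nat => nat => 'a) => (nat => nat => 'a) => (nat => nat => 'a) => nat => nat => 'a" where
  "blk p q A B C D = (\<lambda>i j. if i < p then (if j < q then A i j else B i (j - q))
     else (if j < q then C (i - p) j else D (i - p) (j - q)))"

definition vapp :: "nat => (nat => 'b) => (nat => 'b) => nat => 'b" where
  "vapp p a b = (\<lambda>i. if i < p then a i else b (i - p))"

lemma transp_blk: "transp (blk p q A B C D) = blk q p (transp A) (transp C) (transp B) (transp D)"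
  by (auto simp: transp_def blk_def fun_eq_iff)

lemma vapp_eq_iff:
  assumes "a \<in> vec M p" "a' \<in> vec M p"
  shows "vapp p a b = vapp p a' b' \<longleftrightarrow> a = a' \<and> b = b'"
proof
  assume eq: "vapp p a b = vapp p a' b'"
  have "b i = b' i" for i using fun_cong[OF eq, of "p + i"] by (simp add: vapp_def)
  moreover have "a = a'"
  proof (rule vec_ext[OF assms])
    fix i assume "i < p"
    then show "a i = a' i" using fun_cong[OF eq, of i] by (simp add: vapp_def)
  qed
  ultimately show "a = a' \<and> b = b'" by auto
qed simp

lemma (in cring) blk_mat:
  assumes "A \<in> mat R p q" "B \<in> mat R p q'" "C \<in> mat R p' q" "D \<in> mat R p' q'"
  shows "blk p q A B C D \<in> mat R (p + p') (q + q')"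
  using assms by (auto simp del: mat_entry simp: mat_def blk_def)

context module
begin

lemma vapp_vec: "a \<in> vec M p ==> b \<in> vec M q ==> vapp p a b \<in> vec M (p + q)"
  by (auto simp del: vec_closed simp: vec_def vapp_def)

lemma vapp_cases:
  assumes "v \<in> vec M (p + q)" obtains a b where "a \<in> vec M p" "b \<in> vec M q" "v = vapp p a b"
proof (rule that[of "\<lambda>i. if i < p then v i else (zero M)" "\<lambda>i. v (p + i)"])
  show "v = vapp p (\<lambda>i. if i < p then v i else (zero M)) (\<lambda>i. v (p + i))" by (auto simp: vapp_def)
qed (use assms in \<open>auto simp del: vec_closed simp: vec_def\<close>)

lemma vapp_zero: "vapp p a b = (\<lambda>i. (zero M)) \<longleftrightarrow> a = (\<lambda>i. (zero M)) \<and> b = (\<lambda>i. (zero M))" if "a \<in> vec M p"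
  using vapp_eq_iff[OF that zero_vec, of b "\<lambda>i. (zero M)"] by (simp add: vapp_def)

lemma act_blk:
  assumes A: "A \<in> mat R p q" and B: "B \<in> mat R p q'" and C: "C \<in> mat R p' q" and D: "D \<in> mat R p' q'"
    and a: "a \<in> vec M q" and b: "b \<in> vec M q'"
  shows "act M (q + q') (blk p q A B C D) (vapp q a b) =
    vapp p (\<lambda>i. act M q A a i \<oplus>\<^bsub>M\<^esub> act M q' B b i) (\<lambda>i. act M q C a i \<oplus>\<^bsub>M\<^esub> act M q' D b i)"
proof
  fix i
  let ?X = "blk p q A B C D"
  have X: "?X \<in> mat R (p + p') (q + q')" using A B C D by (rule R.blk_mat)
  have v: "vapp q a b \<in> vec M (q + q')" using a b by (rule vapp_vec)
  have "act M (q + q') ?X (vapp q a b) i =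
      lincomb M (?X i) (vapp q a b) q \<oplus>\<^bsub>M\<^esub> lincomb M (\<lambda>j. ?X i (q + j)) (\<lambda>j. vapp q a b (q + j)) q'"
    unfolding act_def by (rule lincomb_split) (use X v in simp_all)
  also have "lincomb M (?X i) (vapp q a b) q = lincomb M (if i < p then A i else C (i - p)) a q"
    by (rule lincomb_cong) (auto simp: blk_def vapp_def)
  also have "lincomb M (\<lambda>j. ?X i (q + j)) (\<lambda>j. vapp q a b (q + j)) q' = lincomb M (if i < p then B i else D (i - p)) b q'"
    by (rule lincomb_cong) (auto simp: blk_def vapp_def)
  finally show "act M (q + q') ?X (vapp q a b) i =
    vapp p (\<lambda>i. act M q A a i \<oplus>\<^bsub>M\<^esub> act M q' B b i) (\<lambda>i. act M q C a i \<oplus>\<^bsub>M\<^esub> act M q' D b i) i"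
    by (simp add: vapp_def act_def)
qed

lemma act_neg_mat: "A \<in> mat R p q ==> v \<in> vec M n ==>
    act M n (\<lambda>i j. \<ominus> A i j) v = (\<lambda>i. \<ominus>\<^bsub>M\<^esub> act M n A v i)"
  by (simp add: act_def lincomb_neg_left)

end

section \<open>Resolving a module over the quotient ring\<close>

text \<open>Lift the differentials \<open>d\<close> of a resolution \<open>G\<close> over \<open>S\<close> to \<open>R\<close>. Then \<open>d d = x h\<close>, and
  \<open>(a, b) \<mapsto> (d a + x b, - (h a + d b))\<close> on \<open>G\<^sub>n \<oplus> G\<^sub>n\<^sub>-\<^sub>1\<close> is a resolution over \<open>R\<close>. The operator \<open>h\<close> induces
  the connecting maps of the change of rings sequences
  \<open>Ext\<^sub>S\<^sup>n\<^sup>-\<^sup>2 \<rightarrow> Ext\<^sub>S\<^sup>n \<rightarrow> Ext\<^sub>R\<^sup>n \<rightarrow> Ext\<^sub>S\<^sup>n\<^sup>-\<^sup>1 \<rightarrow> Ext\<^sub>S\<^sup>n\<^sup>+\<^sup>1\<close> and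
  \<open>Tor\<^sup>S\<^sub>n\<^sub>-\<^sub>1 \<rightarrow> Tor\<^sup>R\<^sub>n \<rightarrow> Tor\<^sup>S\<^sub>n \<rightarrow> Tor\<^sup>S\<^sub>n\<^sub>-\<^sub>2 \<rightarrow> Tor\<^sup>R\<^sub>n\<^sub>-\<^sub>1\<close>.\<close>

locale cone = regular_quotient +
  fixes M :: "('c, 'y, 'm) module_scheme" and P :: "('a, 'y, 'n) module_scheme" and g :: "nat => nat"
    and D :: "nat => nat => nat => 'c" and e :: "nat => 'y"
    and d h :: "nat => nat => nat => 'a"
  assumes res: "mres S M g D e" and PM: "compat P M"
    and d_mat [simp]: "d n \<in> mat R (g n) (g (Suc n))" and d_map: "D n = map_mat (d n)"
    and h_mat [simp]: "h n \<in> mat R (g n) (g (Suc (Suc n)))"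
    and dd: "matmul R (g (Suc n)) (d n) (d (Suc n)) = (\<lambda>i j. x \<otimes>\<^bsub>R\<^esub> h n i j)"
begin

lemma act_dd: "v \<in> vec Rg (g (Suc (Suc n))) ==>
    act Rg (g (Suc n)) (d n) (act Rg (g (Suc (Suc n))) (d (Suc n)) v) = (\<lambda>i. x \<otimes>\<^bsub>R\<^esub> act Rg (g (Suc (Suc n))) (h n) v i)"
  using Rg.act_matmul[OF d_mat d_mat, of v "g (Suc (Suc n))" "g (Suc n)" n "Suc n"] Rg.act_smult_mat[OF h_mat x_closed, of v]
  by (simp add: dd)

text \<open>Both sides multiplied by x are d d d, bracketed in the two possible ways, and x
  cancels.\<close>

lemma act_dh:
  assumes v: "v \<in> vec Rg (g (Suc (Suc (Suc n))))"
  shows "act Rg (g (Suc n)) (d n) (act Rg (g (Suc (Suc (Suc n)))) (h (Suc n)) v) =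
    act Rg (g (Suc (Suc n))) (h n) (act Rg (g (Suc (Suc (Suc n)))) (d (Suc (Suc n))) v)" (is "?l = ?r")
proof -
  note hv = Rg.act_closed[OF h_mat v, of "Suc n"] and dv = Rg.act_closed[OF d_mat v]
  have l: "?l \<in> vec Rg (g n)" and r: "?r \<in> vec Rg (g n)"
    using Rg.act_closed[OF d_mat hv] Rg.act_closed[OF h_mat dv] .
  have "(\<lambda>i. x \<otimes>\<^bsub>R\<^esub> ?r i) = act Rg (g (Suc n)) (d n) (act Rg (g (Suc (Suc n))) (d (Suc n)) (act Rg (g (Suc (Suc (Suc n)))) (d (Suc (Suc n))) v))"
    by (rule act_dd[OF dv, symmetric])
  also have "\<dots> = (\<lambda>i. x \<otimes>\<^bsub>R\<^esub> ?l i)"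
    unfolding act_dd[OF v] using Rg.act_smult[OF d_mat x_closed hv] by simp
  finally have eq: "(\<lambda>i. x \<otimes>\<^bsub>R\<^esub> ?r i) = (\<lambda>i. x \<otimes>\<^bsub>R\<^esub> ?l i)" .
  have "x \<otimes>\<^bsub>R\<^esub> (?l i \<ominus>\<^bsub>R\<^esub> ?r i) = (zero R)" for i
  proof -
    have "x \<otimes>\<^bsub>R\<^esub> (?l i \<ominus>\<^bsub>R\<^esub> ?r i) = x \<otimes>\<^bsub>R\<^esub> ?l i \<ominus>\<^bsub>R\<^esub> x \<otimes>\<^bsub>R\<^esub> ?r i"
      using R.vec_regular_closed[OF l] R.vec_regular_closed[OF r] by (simp add: R.minus_eq R.r_distr R.r_minus)
    then show ?thesis using fun_cong[OF eq, of i] R.vec_regular_closed[OF l] by simp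
  qed
  then have "?l i \<ominus>\<^bsub>R\<^esub> ?r i = (zero R)" for i
    by (rule regular[rotated]) (use R.vec_regular_closed[OF l] R.vec_regular_closed[OF r] in simp)
  then show ?thesis using R.vec_regular_closed[OF l] R.vec_regular_closed[OF r] by (intro ext) simp
qed

lemma dh: "matmul R (g (Suc n)) (d n) (h (Suc n)) = matmul R (g (Suc (Suc n))) (h n) (d (Suc (Suc n)))"
proof (rule R.mat_eqI)
  show "matmul R (g (Suc n)) (d n) (h (Suc n)) \<in> mat R (g n) (g (Suc (Suc (Suc n))))" by (rule R.matmul_mat[OF d_mat h_mat])
  show "matmul R (g (Suc (Suc n))) (h n) (d (Suc (Suc n))) \<in> mat R (g n) (g (Suc (Suc (Suc n))))" by (rule R.matmul_mat[OF h_mat d_mat])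
  fix v assume v: "v \<in> vec Rg (g (Suc (Suc (Suc n))))"
  show "act Rg (g (Suc (Suc (Suc n)))) (matmul R (g (Suc n)) (d n) (h (Suc n))) v =
    act Rg (g (Suc (Suc (Suc n)))) (matmul R (g (Suc (Suc n))) (h n) (d (Suc (Suc n)))) v"
    unfolding Rg.act_matmul[OF d_mat h_mat v, symmetric] Rg.act_matmul[OF h_mat d_mat v, symmetric] by (rule act_dh[OF v])
qed

lemma g0: "g 0 = 0"
  by (rule mres_b0[OF res])

definition F :: "nat => nat" where
  "F = hat 0 (\<lambda>n. g (Suc n) + g n)"

definition E :: "nat => nat => nat => 'a" where
  "E = hat (\<lambda>i j. (zero R)) (\<lambda>n. blk (g (Suc n)) (g (Suc (Suc n))) (d (Suc n)) (\<lambda>i j. x \<otimes>\<^bsub>R\<^esub> one_mat R (g (Suc n)) i j)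
     (\<lambda>i j. \<ominus>\<^bsub>R\<^esub> h n i j) (\<lambda>i j. \<ominus>\<^bsub>R\<^esub> d n i j))"

lemma F_Suc [simp]: "F (Suc n) = g (Suc n) + g n" and F_0 [simp]: "F 0 = 0"
  by (simp_all add: F_def)

lemma E_mat: "E n \<in> mat R (F n) (F (Suc n))"
  by (cases n) (auto simp: E_def intro!: R.blk_mat)

lemma act_E:
  assumes Q: "module R Q" and a: "a \<in> vec Q (g (Suc (Suc n)))" and b: "b \<in> vec Q (g (Suc n))"
  shows "act Q (F (Suc (Suc n))) (E (Suc n)) (vapp (g (Suc (Suc n))) a b) =
    vapp (g (Suc n)) (\<lambda>i. act Q (g (Suc (Suc n))) (d (Suc n)) a i \<oplus>\<^bsub>Q\<^esub> x \<odot>\<^bsub>Q\<^esub> b i)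
      (\<lambda>i. \<ominus>\<^bsub>Q\<^esub> (act Q (g (Suc (Suc n))) (h n) a i \<oplus>\<^bsub>Q\<^esub> act Q (g (Suc n)) (d n) b i))"
proof -
  interpret Q: module R Q by fact
  have 1: "act Q (g (Suc n)) (\<lambda>i j. x \<otimes>\<^bsub>R\<^esub> one_mat R (g (Suc n)) i j) b = (\<lambda>i. x \<odot>\<^bsub>Q\<^esub> b i)"
    using Q.act_smult_mat[OF R.one_mat_mat x_closed b] b by simp
  have 2: "act Q (g (Suc (Suc n))) (\<lambda>i j. \<ominus>\<^bsub>R\<^esub> h n i j) a = (\<lambda>i. \<ominus>\<^bsub>Q\<^esub> act Q (g (Suc (Suc n))) (h n) a i)"
    by (rule Q.act_neg_mat[OF h_mat a])
  have 3: "act Q (g (Suc n)) (\<lambda>i j. \<ominus>\<^bsub>R\<^esub> d n i j) b = (\<lambda>i. \<ominus>\<^bsub>Q\<^esub> act Q (g (Suc n)) (d n) b i)"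
    by (rule Q.act_neg_mat[OF d_mat b])
  have "act Q (F (Suc (Suc n))) (E (Suc n)) (vapp (g (Suc (Suc n))) a b) = vapp (g (Suc n))
      (\<lambda>i. act Q (g (Suc (Suc n))) (d (Suc n)) a i \<oplus>\<^bsub>Q\<^esub> act Q (g (Suc n)) (\<lambda>i j. x \<otimes>\<^bsub>R\<^esub> one_mat R (g (Suc n)) i j) b i)
      (\<lambda>i. act Q (g (Suc (Suc n))) (\<lambda>i j. \<ominus>\<^bsub>R\<^esub> h n i j) a i \<oplus>\<^bsub>Q\<^esub> act Q (g (Suc n)) (\<lambda>i j. \<ominus>\<^bsub>R\<^esub> d n i j) b i)"
    unfolding F_Suc E_def hat_simps by (rule Q.act_blk[where p' = "g n"]) (use a b in auto)
  then show ?thesis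
    unfolding 1 2 3 using Q.vec_closed[OF Q.act_closed[OF h_mat a]] Q.vec_closed[OF Q.act_closed[OF d_mat b]]
    by (simp add: Q.M.minus_add)
qed

text \<open>Let (a, b) be a cycle, so d a + x b = 0. Then a is a cycle modulo x, hence a = d c + x
  e'. The boundary of (c, e') is a cycle with the same first component, and regularity of x forces
  the second components to agree too.\<close>

lemma cone_mres: "mres R P F E e"
proof -
  note cm = compat_modules[OF PM]
  interpret M: module S M by (rule cm)
  interpret P: module R P by (rule cm)
  have ec: "e i \<in> carrier M" for i using mres_gen[OF res] by simp
  have lc: "lincomb M (\<lambda>i. \<pi> (v i)) e n = lincomb P v e n" if v: "v \<in> vec Rg q" for v n q
    using v ec by (intro compat_lincomb[OF PM]) simp_all
  have v0: "vapp p a b = a" if "b \<in> vec Rg 0" "a \<in> vec Rg p" for p a b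
    using that vec_zero_outside[of b Rg 0] vec_zero_outside[of a Rg p] by (auto simp: vapp_def fun_eq_iff)
  have img: "(v \<in> act Rg (F (Suc (Suc n))) (E (Suc n)) ` vec Rg (F (Suc (Suc n)))) \<longleftrightarrow>
      (\<exists>a\<in>vec Rg (g (Suc (Suc n))). \<exists>b\<in>vec Rg (g (Suc n)). v = act Rg (F (Suc (Suc n))) (E (Suc n)) (vapp (g (Suc (Suc n))) a b))" for v n
    using Rg.vapp_vec[of _ "g (Suc (Suc n))" _ "g (Suc n)"] Rg.vapp_cases[of _ "g (Suc (Suc n))" "g (Suc n)"]
    unfolding image_iff F_Suc by (metis (no_types))
  \<comment> \<open>Exactness over S, lifted to R: a boundary modulo x is a boundary up to a
    remainder divisible by x.\<close>
  have lift_ker: "\<exists>c\<in>vec Rg (g (Suc (Suc n))). \<exists>b\<in>vec Rg (g (Suc n)). a = (\<lambda>i. act Rg (g (Suc (Suc n))) (d (Suc n)) c i \<oplus>\<^bsub>R\<^esub> x \<otimes>\<^bsub>R\<^esub> b i)"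
    if a: "a \<in> vec Rg (g (Suc n))" and rk: "(\<lambda>i. \<pi> (a i)) \<in> res_ker S M g D e n" for a n
  proof -
    obtain c' where c': "(\<lambda>i. \<pi> (a i)) = act Sg (g (Suc (Suc n))) (D (Suc n)) c'" "c' \<in> vec Sg (g (Suc (Suc n)))"
      using rk unfolding mres_exact[OF res] by (rule imageE)
    obtain c where c: "c \<in> vec Rg (g (Suc (Suc n)))" "c' = (\<lambda>i. \<pi> (c i))" using c'(2) by (rule lift_map_vec)
    note dc = Rg.act_closed[OF d_mat[of "Suc n"] c(1)]
    have eq: "(\<lambda>i. \<pi> (a i)) = (\<lambda>i. \<pi> (act Rg (g (Suc (Suc n))) (d (Suc n)) c i))"
      unfolding c' c(2) d_map by (rule pi_act[OF d_mat c(1)])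
    have "\<pi> (a i \<ominus>\<^bsub>R\<^esub> act Rg (g (Suc (Suc n))) (d (Suc n)) c i) = (zero S)" for i
      using fun_cong[OF eq, of i] R.vec_regular_closed[OF a] R.vec_regular_closed[OF dc] by (simp add: pi_minus)
    moreover have m: "(\<lambda>i. a i \<ominus>\<^bsub>R\<^esub> act Rg (g (Suc (Suc n))) (d (Suc n)) c i) \<in> vec Rg (g (Suc n))"
      using Rg.minus_vec[OF a dc] by simp
    ultimately obtain b where b: "b \<in> vec Rg (g (Suc n))" "(\<lambda>i. a i \<ominus>\<^bsub>R\<^esub> act Rg (g (Suc (Suc n))) (d (Suc n)) c i) = (\<lambda>i. x \<otimes>\<^bsub>R\<^esub> b i)"
      using kernel_vec[OF m] by blast
    have "a i = act Rg (g (Suc (Suc n))) (d (Suc n)) c i \<oplus>\<^bsub>R\<^esub> x \<otimes>\<^bsub>R\<^esub> b i" for i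
      using fun_cong[OF b(2), of i] R.vec_regular_closed[OF a, of i] R.vec_regular_closed[OF dc, of i] R.vec_regular_closed[OF b(1), of i]
      by (simp add: R.minus_eq_iff R.a_comm)
    then show ?thesis using c(1) b(1) by blast
  qed
  have fst0: "(\<lambda>i. act Rg (g (Suc (Suc m))) (d (Suc m)) a i \<oplus>\<^bsub>R\<^esub> x \<otimes>\<^bsub>R\<^esub> b i) = (\<lambda>i. (zero R))"
    if a: "a \<in> vec Rg (g (Suc (Suc m)))" and b: "b \<in> vec Rg (g (Suc m))"
      and E0: "act Rg (F (Suc (Suc m))) (E (Suc m)) (vapp (g (Suc (Suc m))) a b) = (\<lambda>i. (zero R))" for a b m
  proof -
    have av: "(\<lambda>i. act Rg (g (Suc (Suc m))) (d (Suc m)) a i \<oplus>\<^bsub>R\<^esub> x \<otimes>\<^bsub>R\<^esub> b i) \<in> vec Rg (g (Suc m))"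
      using Rg.add_vec[OF Rg.act_closed[OF d_mat[of "Suc m"] a] Rg.smult_vec[OF x_closed b]] by simp
    show ?thesis
      using E0 unfolding act_E[OF Rg.module_axioms a b] regular_module_simps
        Rg.vapp_zero[OF av, unfolded regular_module_simps] by (rule conjunct1)
  qed
  \<comment> \<open>The square of the differential vanishes because d d = x h and d h = h d; the
    signs in \<open>E\<close> are chosen for this.\<close>
  have comp: "act Rg (F (Suc (Suc m))) (E (Suc m)) (act Rg (F (Suc (Suc (Suc m)))) (E (Suc (Suc m))) (vapp (g (Suc (Suc (Suc m)))) c b)) = (\<lambda>i. (zero R))"
    if c: "c \<in> vec Rg (g (Suc (Suc (Suc m))))" and b: "b \<in> vec Rg (g (Suc (Suc m)))" for c b m
  proof -
    let ?n = "Suc m"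
    note dc = Rg.act_closed[OF d_mat[of "Suc ?n"] c] and hc = Rg.act_closed[OF h_mat[of ?n] c]
      and db = Rg.act_closed[OF d_mat[of ?n] b] and hb = Rg.act_closed[OF h_mat[of m] b]
    have xb: "(\<lambda>i. x \<otimes>\<^bsub>R\<^esub> b i) \<in> vec Rg (g (Suc (Suc m)))" using Rg.smult_vec[OF x_closed b] by simp
    let ?a = "\<lambda>i. act Rg (g (Suc (Suc ?n))) (d (Suc ?n)) c i \<oplus>\<^bsub>R\<^esub> x \<otimes>\<^bsub>R\<^esub> b i"
    let ?b = "\<lambda>i. \<ominus>\<^bsub>R\<^esub> (act Rg (g (Suc (Suc ?n))) (h ?n) c i \<oplus>\<^bsub>R\<^esub> act Rg (g (Suc ?n)) (d ?n) b i)"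
    have a: "?a \<in> vec Rg (g (Suc (Suc m)))" using Rg.add_vec[OF dc xb] by simp
    have s: "(\<lambda>i. act Rg (g (Suc (Suc ?n))) (h ?n) c i \<oplus>\<^bsub>R\<^esub> act Rg (g (Suc ?n)) (d ?n) b i) \<in> vec Rg (g (Suc m))"
      using Rg.add_vec[OF hc db] by simp
    have b': "?b \<in> vec Rg (g (Suc m))" using Rg.neg_vec[OF s] by simp
    have E1: "act Rg (F (Suc (Suc ?n))) (E (Suc ?n)) (vapp (g (Suc (Suc ?n))) c b) = vapp (g (Suc ?n)) ?a ?b"
      using act_E[OF Rg.module_axioms c b] by simp
    have da: "act Rg (g (Suc ?n)) (d ?n) ?a i = x \<otimes>\<^bsub>R\<^esub> act Rg (g (Suc (Suc ?n))) (h ?n) c i \<oplus>\<^bsub>R\<^esub> x \<otimes>\<^bsub>R\<^esub> act Rg (g (Suc ?n)) (d ?n) b i" for i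
      using Rg.act_add[OF d_mat[of ?n] dc xb] act_dd[OF c] Rg.act_smult[OF d_mat[of ?n] x_closed b] by simp
    have ha: "act Rg (g (Suc ?n)) (h m) ?a i = act Rg (g (Suc m)) (d m) (act Rg (g (Suc (Suc ?n))) (h ?n) c) i \<oplus>\<^bsub>R\<^esub> x \<otimes>\<^bsub>R\<^esub> act Rg (g (Suc ?n)) (h m) b i" for i
      using Rg.act_add[OF h_mat[of m] dc xb] act_dh[OF c] Rg.act_smult[OF h_mat[of m] x_closed b] by simp
    have dbb: "act Rg (g (Suc m)) (d m) ?b i = \<ominus>\<^bsub>R\<^esub> (act Rg (g (Suc m)) (d m) (act Rg (g (Suc (Suc ?n))) (h ?n) c) i \<oplus>\<^bsub>R\<^esub> x \<otimes>\<^bsub>R\<^esub> act Rg (g (Suc ?n)) (h m) b i)" for i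
      using Rg.act_neg[OF d_mat[of m] s] Rg.act_add[OF d_mat[of m] hc db] act_dd[OF b] by simp
    note cl = R.vec_regular_closed[OF hc] R.vec_regular_closed[OF db] R.vec_regular_closed[OF b] R.vec_regular_closed[OF hb]
      R.vec_regular_closed[OF Rg.act_closed[OF d_mat[of m] hc]]
    have "act Rg (F (Suc (Suc m))) (E (Suc m)) (vapp (g (Suc ?n)) ?a ?b) = (\<lambda>i. (zero R))"
      unfolding act_E[OF Rg.module_axioms a b']
      using cl by (simp add: da ha dbb R.r_minus R.r_distr R.r_neg vapp_def)
    then show ?thesis by (simp only: E1)
  qed
  show ?thesis
    unfolding mres_def
  proof (intro conjI allI ballI)
    show "e \<in> vec P (F (Suc 0))" using mres_gen[OF res] by (simp add: compat_vec[OF PM] g0)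
    show "\<exists>v\<in>vec Rg (F (Suc 0)). m = lincomb P v e (F (Suc 0))" if "m \<in> carrier P" for m
    proof -
      have "m \<in> carrier M" using that by (simp add: cm)
      then obtain v' where v': "v' \<in> vec Sg (g (Suc 0))" "m = lincomb M v' e (g (Suc 0))"
        using mres_surj[OF res] by blast
      obtain v where v: "v \<in> vec Rg (g (Suc 0))" "v' = (\<lambda>i. \<pi> (v i))" using v'(1) by (rule lift_map_vec)
      then show ?thesis using v' by (intro bexI[of _ v]) (simp_all add: g0 lc[OF v(1)])
    qed
    show "res_ker R P F E e n = act Rg (F (Suc (Suc n))) (E (Suc n)) ` vec Rg (F (Suc (Suc n)))" for n
    proof (cases n)
      case 0
      \<comment> \<open>In degree 0 the second component has rank \<open>g 0 = 0\<close>, so a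
        boundary is just d c + x b.\<close>
      have "v \<in> res_ker R P F E e 0 \<longleftrightarrow> (\<exists>a\<in>vec Rg (g (Suc (Suc 0))). \<exists>b\<in>vec Rg (g (Suc 0)).
          v = act Rg (F (Suc (Suc 0))) (E (Suc 0)) (vapp (g (Suc (Suc 0))) a b))" for v
      proof
        assume "v \<in> res_ker R P F E e 0"
        then have v: "v \<in> vec Rg (g (Suc 0))" "lincomb P v e (g (Suc 0)) = (zero P)" by (simp_all add: res_ker_def g0)
        then have "(\<lambda>i. \<pi> (v i)) \<in> res_ker S M g D e 0" by (simp add: res_ker_def lc[OF v(1)] cm)
        from lift_ker[OF v(1) this] obtain c b where cb: "c \<in> vec Rg (g (Suc (Suc 0)))" "b \<in> vec Rg (g (Suc 0))"
          "v = (\<lambda>i. act Rg (g (Suc (Suc 0))) (d (Suc 0)) c i \<oplus>\<^bsub>R\<^esub> x \<otimes>\<^bsub>R\<^esub> b i)" by blast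
        have z: "(\<lambda>i. \<ominus>\<^bsub>R\<^esub> (act Rg (g (Suc (Suc 0))) (h 0) c i \<oplus>\<^bsub>R\<^esub> act Rg (g (Suc 0)) (d 0) b i)) \<in> vec Rg 0"
          using Rg.neg_vec[OF Rg.add_vec[OF Rg.act_closed[OF h_mat[of 0] cb(1)] Rg.act_closed[OF d_mat[of 0] cb(2)]]] g0 by simp
        have "act Rg (F (Suc (Suc 0))) (E (Suc 0)) (vapp (g (Suc (Suc 0))) c b) = v"
          using act_E[OF Rg.module_axioms cb(1,2)] v0[OF z v(1)] cb(3) by simp
        with cb(1,2) show "\<exists>a\<in>vec Rg (g (Suc (Suc 0))). \<exists>b\<in>vec Rg (g (Suc 0)).
          v = act Rg (F (Suc (Suc 0))) (E (Suc 0)) (vapp (g (Suc (Suc 0))) a b)" by metis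
      next
        assume "\<exists>a\<in>vec Rg (g (Suc (Suc 0))). \<exists>b\<in>vec Rg (g (Suc 0)).
          v = act Rg (F (Suc (Suc 0))) (E (Suc 0)) (vapp (g (Suc (Suc 0))) a b)"
        then obtain c b where cb: "c \<in> vec Rg (g (Suc (Suc 0)))" "b \<in> vec Rg (g (Suc 0))"
          "v = act Rg (F (Suc (Suc 0))) (E (Suc 0)) (vapp (g (Suc (Suc 0))) c b)" by blast
        let ?a = "\<lambda>i. act Rg (g (Suc (Suc 0))) (d (Suc 0)) c i \<oplus>\<^bsub>R\<^esub> x \<otimes>\<^bsub>R\<^esub> b i"
        note dc = Rg.act_closed[OF d_mat[of "Suc 0"] cb(1)]
        have a: "?a \<in> vec Rg (g (Suc 0))" using Rg.add_vec[OF dc Rg.smult_vec[OF x_closed cb(2)]] by simp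
        have z: "(\<lambda>i. \<ominus>\<^bsub>R\<^esub> (act Rg (g (Suc (Suc 0))) (h 0) c i \<oplus>\<^bsub>R\<^esub> act Rg (g (Suc 0)) (d 0) b i)) \<in> vec Rg 0"
          using Rg.neg_vec[OF Rg.add_vec[OF Rg.act_closed[OF h_mat[of 0] cb(1)] Rg.act_closed[OF d_mat[of 0] cb(2)]]] g0 by simp
        have v: "v = ?a" using act_E[OF Rg.module_axioms cb(1,2)] v0[OF z a] cb(3) by simp
        have "(\<lambda>i. \<pi> (v i)) = act Sg (g (Suc (Suc 0))) (D (Suc 0)) (\<lambda>i. \<pi> (c i))"
          unfolding v d_map pi_act[OF d_mat cb(1)]
          using R.vec_regular_closed[OF dc] R.vec_regular_closed[OF cb(2)] by (simp add: pi_add pi_mult)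
        then have "(\<lambda>i. \<pi> (v i)) \<in> res_ker S M g D e 0" using act_mem_res_ker[OF res map_vec[OF cb(1)]] by simp
        then have "lincomb P v e (g (Suc 0)) = (zero P)" using lc[OF a] by (simp add: res_ker_def v cm)
        then show "v \<in> res_ker R P F E e 0" using a by (simp add: res_ker_def g0 v)
      qed
      then show ?thesis unfolding 0 using img[of _ 0] by blast
    next
      case (Suc m)
      have "v \<in> res_ker R P F E e n \<longleftrightarrow> (\<exists>a\<in>vec Rg (g (Suc (Suc n))). \<exists>b\<in>vec Rg (g (Suc n)).
          v = act Rg (F (Suc (Suc n))) (E (Suc n)) (vapp (g (Suc (Suc n))) a b))" for v
      proof
        assume vk: "v \<in> res_ker R P F E e n"
        then have "v \<in> vec Rg (g (Suc n) + g n)" by (simp add: res_ker_def)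
        then obtain a b where ab: "a \<in> vec Rg (g (Suc n))" "b \<in> vec Rg (g n)" "v = vapp (g (Suc n)) a b" by (rule Rg.vapp_cases)
        have Ev: "act Rg (F (Suc n)) (E n) v = (\<lambda>i. (zero R))" using vk Suc by (simp add: res_ker_def)
        have da: "act Rg (g (Suc n)) (d n) a \<in> vec Rg (g n)" by (rule Rg.act_closed[OF d_mat ab(1)])
        have Z: "(\<lambda>i. act Rg (g (Suc n)) (d n) a i \<oplus>\<^bsub>R\<^esub> x \<otimes>\<^bsub>R\<^esub> b i) = (\<lambda>i. (zero R))"
          using Ev ab(1,2) unfolding ab(3) Suc by (intro fst0)
        have "(\<lambda>i. \<pi> (a i)) \<in> res_ker S M g D e n"
        proof -
          have "\<pi> (act Rg (g (Suc n)) (d n) a i) = (zero S)" for i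
          proof -
            have "\<pi> (act Rg (g (Suc n)) (d n) a i \<oplus>\<^bsub>R\<^esub> x \<otimes>\<^bsub>R\<^esub> b i) = (zero S)" using fun_cong[OF Z, of i] by simp
            then show ?thesis using R.vec_regular_closed[OF da] R.vec_regular_closed[OF ab(2)] by (simp add: pi_add pi_mult)
          qed
          then show ?thesis using Suc pi_act[OF d_mat ab(1)] map_vec[OF ab(1)] by (simp add: res_ker_def d_map)
        qed
        from lift_ker[OF ab(1) this] obtain c e' where ce: "c \<in> vec Rg (g (Suc (Suc n)))" "e' \<in> vec Rg (g (Suc n))"
          "a = (\<lambda>i. act Rg (g (Suc (Suc n))) (d (Suc n)) c i \<oplus>\<^bsub>R\<^esub> x \<otimes>\<^bsub>R\<^esub> e' i)" by blast
        let ?s = "\<lambda>i. \<ominus>\<^bsub>R\<^esub> (act Rg (g (Suc (Suc n))) (h n) c i \<oplus>\<^bsub>R\<^esub> act Rg (g (Suc n)) (d n) e' i)"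
        have s: "?s \<in> vec Rg (g n)"
          using Rg.neg_vec[OF Rg.add_vec[OF Rg.act_closed[OF h_mat[of n] ce(1)] Rg.act_closed[OF d_mat[of n] ce(2)]]] by simp
        have E1: "act Rg (F (Suc (Suc n))) (E (Suc n)) (vapp (g (Suc (Suc n))) c e') = vapp (g (Suc n)) a ?s"
          using act_E[OF Rg.module_axioms ce(1,2)] ce(3) by simp
        have "(\<lambda>i. act Rg (g (Suc n)) (d n) a i \<oplus>\<^bsub>R\<^esub> x \<otimes>\<^bsub>R\<^esub> ?s i) = (\<lambda>i. (zero R))"
        proof -
          have "act Rg (F (Suc n)) (E n) (vapp (g (Suc n)) a ?s) = (\<lambda>i. (zero R))"
            unfolding E1[symmetric] using ce(1,2) unfolding Suc by (intro comp)
          then show ?thesis using ab(1) s unfolding Suc by (intro fst0)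
        qed
        then have "act Rg (g (Suc n)) (d n) a i \<oplus>\<^bsub>R\<^esub> x \<otimes>\<^bsub>R\<^esub> ?s i = act Rg (g (Suc n)) (d n) a i \<oplus>\<^bsub>R\<^esub> x \<otimes>\<^bsub>R\<^esub> b i" for i
          using Z by (simp add: fun_eq_iff)
        then have "x \<otimes>\<^bsub>R\<^esub> ?s i = x \<otimes>\<^bsub>R\<^esub> b i" for i
          using R.vec_regular_closed[OF da] R.vec_regular_closed[OF ab(2)] R.vec_regular_closed[OF s] by (simp add: R.add.l_cancel)
        then have "x \<otimes>\<^bsub>R\<^esub> (?s i \<ominus>\<^bsub>R\<^esub> b i) = (zero R)" for i
          using R.vec_regular_closed[OF ab(2)] R.vec_regular_closed[OF s] by (simp add: R.minus_eq R.r_distr R.r_minus R.r_neg)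
        then have "?s i \<ominus>\<^bsub>R\<^esub> b i = (zero R)" for i
          by (rule regular[rotated]) (use R.vec_regular_closed[OF ab(2)] R.vec_regular_closed[OF s] in simp)
        then have "?s = b"
          using R.vec_regular_closed[OF ab(2)] R.vec_regular_closed[OF s] by (intro ext) simp
        with E1 ab(3) have "v = act Rg (F (Suc (Suc n))) (E (Suc n)) (vapp (g (Suc (Suc n))) c e')" by simp
        with ce(1,2) show "\<exists>a\<in>vec Rg (g (Suc (Suc n))). \<exists>b\<in>vec Rg (g (Suc n)).
          v = act Rg (F (Suc (Suc n))) (E (Suc n)) (vapp (g (Suc (Suc n))) a b)" by blast
      next
        assume "\<exists>a\<in>vec Rg (g (Suc (Suc n))). \<exists>b\<in>vec Rg (g (Suc n)).
          v = act Rg (F (Suc (Suc n))) (E (Suc n)) (vapp (g (Suc (Suc n))) a b)"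
        then obtain c b where cb: "c \<in> vec Rg (g (Suc (Suc n)))" "b \<in> vec Rg (g (Suc n))"
          "v = act Rg (F (Suc (Suc n))) (E (Suc n)) (vapp (g (Suc (Suc n))) c b)" by blast
        have "v \<in> vec Rg (F (Suc n))"
          unfolding cb(3) by (rule Rg.act_closed[OF E_mat]) (use Rg.vapp_vec[OF cb(1,2)] in simp)
        moreover have "act Rg (F (Suc n)) (E n) v = (\<lambda>i. (zero R))"
          using comp[of c m b] cb unfolding Suc by simp
        ultimately show "v \<in> res_ker R P F E e n" using Suc by (simp add: res_ker_def)
      qed
      then show ?thesis using img[of _ n] by blast
    qed
  qed (use E_mat P.module_axioms in auto)
qed

section \<open>The change of rings sequences for coefficients over S\<close>

context
  fixes N :: "('c, 'e, 'k) module_scheme" and Q :: "('a, 'e, 'l) module_scheme"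
  assumes QN: "compat Q N"
begin

interpretation Q: module R Q by (rule compat_modules[OF QN])

lemma TOR_compat: "TOR N g D n \<longleftrightarrow> exact_at Q (g (Suc (Suc n))) (g (Suc n)) (d (Suc n)) (d n)"
  unfolding TOR_def d_map by (rule compat_exact_at[OF QN d_mat d_mat])

lemma EXT_compat: "EXT N g D n \<longleftrightarrow> exact_at Q (g n) (g (Suc n)) (transp (d n)) (transp (d (Suc n)))"
  unfolding EXT_def d_map map_mat_transp[symmetric]
  by (rule compat_exact_at[OF QN iffD2[OF transp_mat d_mat] iffD2[OF transp_mat d_mat]])

lemma act_E_Q:
  assumes a: "a \<in> vec Q (g (Suc (Suc n)))" and b: "b \<in> vec Q (g (Suc n))"
  shows "act Q (F (Suc (Suc n))) (E (Suc n)) (vapp (g (Suc (Suc n))) a b) =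
    vapp (g (Suc n)) (act Q (g (Suc (Suc n))) (d (Suc n)) a)
      (\<lambda>i. \<ominus>\<^bsub>Q\<^esub> (act Q (g (Suc (Suc n))) (h n) a i \<oplus>\<^bsub>Q\<^esub> act Q (g (Suc n)) (d n) b i))"
  unfolding act_E[OF Q.module_axioms a b]
  using compat_x[OF QN] b Q.vec_closed[OF Q.act_closed[OF d_mat[of "Suc n"] a]] by simp

text \<open>Since x kills Q, the block with x disappears from the differential and the complex is an
  extension of two copies of the reduced one, joined by h. Replacing b by its negative turns the
  signs of \<open>act_E_Q\<close> into the convention of \<open>pair_exact\<close>.\<close>

lemma TOR_pair:
  "TOR Q F E (Suc m) \<longleftrightarrow> pair_exact Q (g (Suc (Suc (Suc m)))) (g (Suc (Suc m))) (g (Suc (Suc m))) (g (Suc m))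
    (d (Suc (Suc m))) (h (Suc m)) (d (Suc m)) (d (Suc m)) (h m) (d m)" (is "_ \<longleftrightarrow> ?pe")
proof
  let ?n = "Suc m"
  assume T: "TOR Q F E (Suc m)"
  show ?pe
    unfolding pair_exact_def
  proof (intro ballI impI, elim conjE)
    fix a b assume a: "a \<in> vec Q (g (Suc (Suc m)))" and b: "b \<in> vec Q (g (Suc m))"
      and 0: "act Q (g (Suc (Suc m))) (d (Suc m)) a = (\<lambda>i. (zero Q))" "act Q (g (Suc m)) (d m) b = act Q (g (Suc (Suc m))) (h m) a"
    let ?b = "\<lambda>i. \<ominus>\<^bsub>Q\<^esub> b i"
    note nb = Q.neg_vec[OF b]
    have "act Q (F (Suc ?n)) (E ?n) (vapp (g (Suc ?n)) a ?b) = (\<lambda>i. (zero Q))"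
      unfolding act_E_Q[OF a nb] Q.act_neg[OF d_mat b] 0
      using Q.vec_closed[OF Q.act_closed[OF h_mat[of m] a]] by (simp add: Q.M.r_neg vapp_def)
    moreover have "vapp (g (Suc ?n)) a ?b \<in> vec Q (F (Suc ?n))" using Q.vapp_vec[OF a nb] by simp
    ultimately obtain w where w: "w \<in> vec Q (F (Suc (Suc ?n)))" "vapp (g (Suc ?n)) a ?b = act Q (F (Suc (Suc ?n))) (E (Suc ?n)) w"
      using T unfolding TOR_def by (metis exact_atD)
    obtain c e' where ce: "c \<in> vec Q (g (Suc (Suc ?n)))" "e' \<in> vec Q (g (Suc ?n))" "w = vapp (g (Suc (Suc ?n))) c e'"
      using w(1) unfolding F_Suc by (rule Q.vapp_cases)
    have eq: "a = act Q (g (Suc (Suc ?n))) (d (Suc ?n)) c"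
      "?b = (\<lambda>i. \<ominus>\<^bsub>Q\<^esub> (act Q (g (Suc (Suc ?n))) (h ?n) c i \<oplus>\<^bsub>Q\<^esub> act Q (g (Suc ?n)) (d ?n) e' i))"
      using w(2)[unfolded ce(3) act_E_Q[OF ce(1,2)] vapp_eq_iff[OF a Q.act_closed[OF d_mat ce(1)]]] by blast+
    have "b i = act Q (g (Suc ?n)) (d ?n) e' i \<oplus>\<^bsub>Q\<^esub> act Q (g (Suc (Suc ?n))) (h ?n) c i" for i
    proof -
      have "\<ominus>\<^bsub>Q\<^esub> (\<ominus>\<^bsub>Q\<^esub> b i) = \<ominus>\<^bsub>Q\<^esub> (\<ominus>\<^bsub>Q\<^esub> (act Q (g (Suc (Suc ?n))) (h ?n) c i \<oplus>\<^bsub>Q\<^esub> act Q (g (Suc ?n)) (d ?n) e' i))"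
        using fun_cong[OF eq(2), of i] by simp
      then show ?thesis
        using Q.vec_closed[OF b, of i] Q.vec_closed[OF Q.act_closed[OF h_mat ce(1)], of _ i] Q.vec_closed[OF Q.act_closed[OF d_mat ce(2)], of _ i]
        by (simp add: Q.M.a_comm)
    qed
    then have "b = (\<lambda>i. act Q (g (Suc ?n)) (d ?n) e' i \<oplus>\<^bsub>Q\<^esub> act Q (g (Suc (Suc ?n))) (h ?n) c i)" by (rule ext)
    with eq(1) ce(1,2) show "\<exists>c\<in>vec Q (g (Suc (Suc (Suc m)))). \<exists>e\<in>vec Q (g (Suc (Suc m))). a = act Q (g (Suc (Suc (Suc m)))) (d (Suc (Suc m))) c \<and>
        b = (\<lambda>i. act Q (g (Suc (Suc m))) (d (Suc m)) e i \<oplus>\<^bsub>Q\<^esub> act Q (g (Suc (Suc (Suc m)))) (h (Suc m)) c i)"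
      by blast
  qed
next
  let ?n = "Suc m"
  assume pe: ?pe
  show "TOR Q F E (Suc m)"
    unfolding TOR_def exact_at_def
  proof (intro ballI impI)
    fix v assume v: "v \<in> vec Q (F (Suc ?n))" "act Q (F (Suc ?n)) (E ?n) v = (\<lambda>i. (zero Q))"
    obtain a b where ab: "a \<in> vec Q (g (Suc ?n))" "b \<in> vec Q (g ?n)" "v = vapp (g (Suc ?n)) a b"
      using v(1) unfolding F_Suc by (rule Q.vapp_cases)
    note c = Q.vec_closed[OF Q.act_closed[OF h_mat[of m] ab(1)]] Q.vec_closed[OF Q.act_closed[OF d_mat[of m] ab(2)]]
    have 0: "act Q (g (Suc ?n)) (d ?n) a = (\<lambda>i. (zero Q))"
      "(\<lambda>i. \<ominus>\<^bsub>Q\<^esub> (act Q (g (Suc ?n)) (h m) a i \<oplus>\<^bsub>Q\<^esub> act Q (g ?n) (d m) b i)) = (\<lambda>i. (zero Q))"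
      using v(2) unfolding ab(3) act_E_Q[OF ab(1,2)] Q.vapp_zero[OF Q.act_closed[OF d_mat ab(1)]] by blast+
    let ?b = "\<lambda>i. \<ominus>\<^bsub>Q\<^esub> b i"
    note nb = Q.neg_vec[OF ab(2)]
    have "act Q (g ?n) (d m) ?b i = act Q (g (Suc ?n)) (h m) a i" for i
    proof -
      have "act Q (g (Suc ?n)) (h m) a i \<oplus>\<^bsub>Q\<^esub> act Q (g ?n) (d m) b i = (zero Q)"
        using fun_cong[OF 0(2), of i] c by (metis Q.M.a_closed Q.M.minus_minus Q.M.neg_zero)
      then have "act Q (g (Suc ?n)) (h m) a i = \<ominus>\<^bsub>Q\<^esub> act Q (g ?n) (d m) b i"
        using c by (metis Q.M.minus_equality)
      then show ?thesis by (simp add: Q.act_neg[OF d_mat ab(2)])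
    qed
    then have "act Q (g ?n) (d m) ?b = act Q (g (Suc ?n)) (h m) a" by blast
    from pair_exactD[OF pe ab(1) nb 0(1) this] obtain c e' where ce: "c \<in> vec Q (g (Suc (Suc ?n)))" "e' \<in> vec Q (g (Suc ?n))"
      "a = act Q (g (Suc (Suc ?n))) (d (Suc ?n)) c"
      "?b = (\<lambda>i. act Q (g (Suc ?n)) (d ?n) e' i \<oplus>\<^bsub>Q\<^esub> act Q (g (Suc (Suc ?n))) (h ?n) c i)" by blast
    have "b i = \<ominus>\<^bsub>Q\<^esub> (act Q (g (Suc (Suc ?n))) (h ?n) c i \<oplus>\<^bsub>Q\<^esub> act Q (g (Suc ?n)) (d ?n) e' i)" for i
    proof -
      have "b i = \<ominus>\<^bsub>Q\<^esub> (\<ominus>\<^bsub>Q\<^esub> b i)" using Q.vec_closed[OF ab(2), of i] by simp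
      also have "\<dots> = \<ominus>\<^bsub>Q\<^esub> (act Q (g (Suc ?n)) (d ?n) e' i \<oplus>\<^bsub>Q\<^esub> act Q (g (Suc (Suc ?n))) (h ?n) c i)"
        using fun_cong[OF ce(4), of i] by simp
      finally show ?thesis
        using Q.vec_closed[OF Q.act_closed[OF h_mat[of ?n] ce(1)], of i] Q.vec_closed[OF Q.act_closed[OF d_mat[of ?n] ce(2)], of i]
        by (simp add: Q.M.a_comm)
    qed
    then have "v = act Q (F (Suc (Suc ?n))) (E (Suc ?n)) (vapp (g (Suc (Suc ?n))) c e')"
      unfolding ab(3) act_E_Q[OF ce(1,2)] ce(3) by (intro arg_cong2[where f = "vapp _"] refl ext)
    then show "\<exists>w\<in>vec Q (F (Suc (Suc ?n))). v = act Q (F (Suc (Suc ?n))) (E (Suc ?n)) w"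
      using Q.vapp_vec[OF ce(1,2)] by (intro bexI) simp_all
  qed
qed

lemma act_E_transp:
  assumes u: "u \<in> vec Q (g (Suc n))" and v: "v \<in> vec Q (g n)"
  shows "act Q (F (Suc n)) (transp (E (Suc n))) (vapp (g (Suc n)) u v) =
    vapp (g (Suc (Suc n))) (\<lambda>i. act Q (g (Suc n)) (transp (d (Suc n))) u i \<ominus>\<^bsub>Q\<^esub> act Q (g n) (transp (h n)) v i)
      (\<lambda>i. \<ominus>\<^bsub>Q\<^esub> act Q (g n) (transp (d n)) v i)"
proof -
  have t: "transp (\<lambda>i j. \<ominus>\<^bsub>R\<^esub> h n i j) = (\<lambda>i j. \<ominus>\<^bsub>R\<^esub> transp (h n) i j)"
    "transp (\<lambda>i j. \<ominus>\<^bsub>R\<^esub> d n i j) = (\<lambda>i j. \<ominus>\<^bsub>R\<^esub> transp (d n) i j)"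
    "transp (\<lambda>i j. x \<otimes>\<^bsub>R\<^esub> one_mat R (g (Suc n)) i j) = (\<lambda>i j. x \<otimes>\<^bsub>R\<^esub> one_mat R (g (Suc n)) i j)"
    by (auto simp: transp_def one_mat_def fun_eq_iff)
  have hT: "transp (h n) \<in> mat R (g (Suc (Suc n))) (g n)" and dT: "transp (d m) \<in> mat R (g (Suc m)) (g m)" for m by simp_all
  have 1: "act Q (g (Suc n)) (\<lambda>i j. x \<otimes>\<^bsub>R\<^esub> one_mat R (g (Suc n)) i j) u = (\<lambda>i. (zero Q))"
    using Q.act_smult_mat[OF R.one_mat_mat x_closed u] u compat_x[OF QN] by simp
  note 2 = Q.act_neg_mat[OF hT v] and 3 = Q.act_neg_mat[OF dT[of n] v]
  have "act Q (F (Suc n)) (transp (E (Suc n))) (vapp (g (Suc n)) u v) = vapp (g (Suc (Suc n)))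
      (\<lambda>i. act Q (g (Suc n)) (transp (d (Suc n))) u i \<oplus>\<^bsub>Q\<^esub> act Q (g n) (\<lambda>i j. \<ominus>\<^bsub>R\<^esub> transp (h n) i j) v i)
      (\<lambda>i. act Q (g (Suc n)) (\<lambda>i j. x \<otimes>\<^bsub>R\<^esub> one_mat R (g (Suc n)) i j) u i \<oplus>\<^bsub>Q\<^esub> act Q (g n) (\<lambda>i j. \<ominus>\<^bsub>R\<^esub> transp (d n) i j) v i)"
    unfolding F_Suc E_def hat_simps transp_blk t
    by (rule Q.act_blk[where p' = "g (Suc n)"]) (use u v hT dT in auto)
  then show ?thesis
    unfolding 1 2 3 using Q.vec_closed[OF Q.act_closed[OF dT[of n] v]] by (simp add: Q.M.minus_eq)
qed

text \<open>After transposing, the two summands exchange roles: the component in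
  \<open>g (Suc m)\<close> is now the quotient and the one in \<open>g (Suc (Suc m))\<close> the
  sub.\<close>

lemma EXT_pair:
  "EXT Q F E (Suc m) \<longleftrightarrow> pair_exact Q (g m) (g (Suc m)) (g (Suc m)) (g (Suc (Suc m)))
    (transp (d m)) (transp (h m)) (transp (d (Suc m))) (transp (d (Suc m))) (transp (h (Suc m))) (transp (d (Suc (Suc m))))"
    (is "_ \<longleftrightarrow> ?pe")
proof -
  let ?n = "Suc m"
  have hT: "transp (h k) \<in> mat R (g (Suc (Suc k))) (g k)" and dT: "transp (d k) \<in> mat R (g (Suc k)) (g k)" for k by simp_all
  show ?thesis
  proof
    assume T: "EXT Q F E (Suc m)"
    show ?pe
      unfolding pair_exact_def
    proof (intro ballI impI, elim conjE)
      fix v u assume v: "v \<in> vec Q (g ?n)" and u: "u \<in> vec Q (g (Suc ?n))"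
        and 0: "act Q (g ?n) (transp (d ?n)) v = (\<lambda>i. (zero Q))"
          "act Q (g (Suc ?n)) (transp (d (Suc ?n))) u = act Q (g ?n) (transp (h ?n)) v"
      have "act Q (F (Suc ?n)) (transp (E (Suc ?n))) (vapp (g (Suc ?n)) u v) = (\<lambda>i. (zero Q))"
        unfolding act_E_transp[OF u v] 0
        using Q.vec_closed[OF Q.act_closed[OF hT[of ?n] v]] by (simp add: vapp_def)
      moreover have "vapp (g (Suc ?n)) u v \<in> vec Q (F (Suc ?n))" using Q.vapp_vec[OF u v] by simp
      ultimately obtain w where w: "w \<in> vec Q (F ?n)" "vapp (g (Suc ?n)) u v = act Q (F ?n) (transp (E ?n)) w"
        using T unfolding EXT_def by (metis exact_atD)
      obtain u' v' where ce: "u' \<in> vec Q (g ?n)" "v' \<in> vec Q (g m)" "w = vapp (g ?n) u' v'"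
        using w(1) unfolding F_Suc by (rule Q.vapp_cases)
      note c = Q.vec_closed[OF Q.act_closed[OF hT[of m] ce(2)]] Q.vec_closed[OF Q.act_closed[OF dT[of ?n] ce(1)]]
      have e1: "(\<lambda>i. act Q (g ?n) (transp (d ?n)) u' i \<ominus>\<^bsub>Q\<^esub> act Q (g m) (transp (h m)) v' i) \<in> vec Q (g (Suc ?n))"
        using Q.minus_vec[OF Q.act_closed[OF dT[of ?n] ce(1)] Q.act_closed[OF hT[of m] ce(2)]] .
      have eq: "u = (\<lambda>i. act Q (g ?n) (transp (d ?n)) u' i \<ominus>\<^bsub>Q\<^esub> act Q (g m) (transp (h m)) v' i)"
        "v = (\<lambda>i. \<ominus>\<^bsub>Q\<^esub> act Q (g m) (transp (d m)) v' i)"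
        using w(2)[unfolded ce(3) act_E_transp[OF ce(1,2)] vapp_eq_iff[OF u e1]] by blast+
      have "v = act Q (g m) (transp (d m)) (\<lambda>i. \<ominus>\<^bsub>Q\<^esub> v' i)" using eq(2) Q.act_neg[OF dT[of m] ce(2)] by simp
      moreover have "u = (\<lambda>i. act Q (g ?n) (transp (d ?n)) u' i \<oplus>\<^bsub>Q\<^esub> act Q (g m) (transp (h m)) (\<lambda>i. \<ominus>\<^bsub>Q\<^esub> v' i) i)"
        using eq(1) Q.act_neg[OF hT[of m] ce(2)] by (simp add: Q.M.minus_eq)
      ultimately show "\<exists>c\<in>vec Q (g m). \<exists>e\<in>vec Q (g (Suc m)). v = act Q (g m) (transp (d m)) c \<and>
          u = (\<lambda>i. act Q (g (Suc m)) (transp (d (Suc m))) e i \<oplus>\<^bsub>Q\<^esub> act Q (g m) (transp (h m)) c i)"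
        using Q.neg_vec[OF ce(2)] ce(1) by blast
    qed
  next
    assume pe: ?pe
    show "EXT Q F E (Suc m)"
      unfolding EXT_def exact_at_def
    proof (intro ballI impI)
      fix w assume w: "w \<in> vec Q (F (Suc ?n))" "act Q (F (Suc ?n)) (transp (E (Suc ?n))) w = (\<lambda>i. (zero Q))"
      obtain u v where uv: "u \<in> vec Q (g (Suc ?n))" "v \<in> vec Q (g ?n)" "w = vapp (g (Suc ?n)) u v"
        using w(1) unfolding F_Suc by (rule Q.vapp_cases)
      note du = Q.act_closed[OF dT[of "Suc ?n"] uv(1)] and hv = Q.act_closed[OF hT[of ?n] uv(2)] and dv = Q.act_closed[OF dT[of ?n] uv(2)]
      have 0: "(\<lambda>i. act Q (g (Suc ?n)) (transp (d (Suc ?n))) u i \<ominus>\<^bsub>Q\<^esub> act Q (g ?n) (transp (h ?n)) v i) = (\<lambda>i. (zero Q))"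
        "(\<lambda>i. \<ominus>\<^bsub>Q\<^esub> act Q (g ?n) (transp (d ?n)) v i) = (\<lambda>i. (zero Q))"
        using w(2) unfolding uv(3) act_E_transp[OF uv(1,2)] Q.vapp_zero[OF Q.minus_vec[OF du hv]] by blast+
      have a: "act Q (g ?n) (transp (d ?n)) v = (\<lambda>i. (zero Q))"
      proof
        fix i show "act Q (g ?n) (transp (d ?n)) v i = (zero Q)"
          using fun_cong[OF 0(2), of i] Q.vec_closed[OF dv, of i] by (metis Q.M.minus_minus Q.M.neg_zero)
      qed
      have b: "act Q (g (Suc ?n)) (transp (d (Suc ?n))) u = act Q (g ?n) (transp (h ?n)) v"
      proof
        fix i show "act Q (g (Suc ?n)) (transp (d (Suc ?n))) u i = act Q (g ?n) (transp (h ?n)) v i"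
          using fun_cong[OF 0(1), of i] Q.vec_closed[OF du, of i] Q.vec_closed[OF hv, of i] by simp
      qed
      from pair_exactD[OF pe uv(2,1) a b] obtain c e' where ce: "c \<in> vec Q (g m)" "e' \<in> vec Q (g ?n)"
        "v = act Q (g m) (transp (d m)) c"
        "u = (\<lambda>i. act Q (g ?n) (transp (d ?n)) e' i \<oplus>\<^bsub>Q\<^esub> act Q (g m) (transp (h m)) c i)" by blast
      note nc = Q.neg_vec[OF ce(1)]
      note cl = Q.vec_closed[OF Q.act_closed[OF hT[of m] ce(1)]] Q.vec_closed[OF Q.act_closed[OF dT[of m] ce(1)]]
      have "act Q (F ?n) (transp (E ?n)) (vapp (g ?n) e' (\<lambda>i. \<ominus>\<^bsub>Q\<^esub> c i)) = w"
        unfolding act_E_transp[OF ce(2) nc] Q.act_neg[OF hT[of m] ce(1)] Q.act_neg[OF dT[of m] ce(1)] uv(3) ce(3,4)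
        using cl by (simp add: Q.M.minus_eq)
      then show "\<exists>w'\<in>vec Q (F ?n). w = act Q (F ?n) (transp (E ?n)) w'"
        using Q.vapp_vec[OF ce(2) nc] unfolding F_Suc by blast
    qed
  qed
qed

lemma act_dh_Q: "c \<in> vec Q (g (Suc (Suc (Suc n)))) ==>
    act Q (g (Suc n)) (d n) (act Q (g (Suc (Suc (Suc n)))) (h (Suc n)) c) =
    act Q (g (Suc (Suc n))) (h n) (act Q (g (Suc (Suc (Suc n)))) (d (Suc (Suc n))) c)"
  by (simp only: Q.act_matmul[OF d_mat h_mat] Q.act_matmul[OF h_mat d_mat] dh)

lemma act_dh_transp_Q:
  assumes c: "c \<in> vec Q (g n)"
  shows "act Q (g (Suc (Suc n))) (transp (d (Suc (Suc n)))) (act Q (g n) (transp (h n)) c) =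
    act Q (g (Suc n)) (transp (h (Suc n))) (act Q (g n) (transp (d n)) c)"
  unfolding Q.act_matmul[OF iffD2[OF transp_mat d_mat] iffD2[OF transp_mat h_mat] c]
    Q.act_matmul[OF iffD2[OF transp_mat h_mat] iffD2[OF transp_mat d_mat] c]
    R.transp_matmul[OF h_mat d_mat, symmetric] R.transp_matmul[OF d_mat h_mat, symmetric] dh ..

text \<open>Three consecutive pieces of the long exact sequence of \<open>TOR_pair\<close>. In
  degree m + 1 of the cone the quotient sits in degree m + 1 over S and the sub in degree m, and h
  connects degree n + 2 with degree n.\<close>

lemma TOR_sequence:
  "TOR N g D (Suc m) ==> TOR N g D m ==> TOR Q F E (Suc m)"
  "TOR Q F E (Suc n) ==> TOR N g D (Suc (Suc n)) ==> TOR N g D n"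
  "TOR Q F E (Suc (Suc k)) ==> TOR N g D k ==> TOR N g D (Suc (Suc k))"
proof -
  show "TOR N g D (Suc m) ==> TOR N g D m ==> TOR Q F E (Suc m)"
    unfolding TOR_pair TOR_compat by (rule pair_exactI[OF Q.module_axioms _ _ act_dh_Q h_mat d_mat h_mat])
  show "TOR Q F E (Suc n) ==> TOR N g D (Suc (Suc n)) ==> TOR N g D n"
    unfolding TOR_pair TOR_compat
    by (rule pair_exact_right[OF Q.module_axioms _ _ act_dh_Q[symmetric] d_mat h_mat d_mat h_mat])
  show "TOR Q F E (Suc (Suc k)) ==> TOR N g D k ==> TOR N g D (Suc (Suc k))"
    unfolding TOR_pair TOR_compat by (rule pair_exact_left[OF Q.module_axioms _ _ act_dh_Q h_mat h_mat])
qed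

text \<open>As sub and quotient have changed places, the second and third pieces come from
  \<open>pair_exact_left\<close> and \<open>pair_exact_right\<close>, opposite to the case of
  Tor.\<close>

lemma EXT_sequence:
  "EXT N g D (Suc m) ==> EXT N g D m ==> EXT Q F E (Suc m)"
  "EXT Q F E (Suc n) ==> EXT N g D (Suc (Suc n)) ==> EXT N g D n"
  "EXT Q F E (Suc (Suc k)) ==> EXT N g D k ==> EXT N g D (Suc (Suc k))"
proof -
  note dT = iffD2[OF transp_mat d_mat] and hT = iffD2[OF transp_mat h_mat]
  show "EXT N g D (Suc m) ==> EXT N g D m ==> EXT Q F E (Suc m)"
    unfolding EXT_pair EXT_compat by (rule pair_exactI[OF Q.module_axioms _ _ act_dh_transp_Q hT dT hT])
  show "EXT Q F E (Suc n) ==> EXT N g D (Suc (Suc n)) ==> EXT N g D n"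
    unfolding EXT_pair EXT_compat by (rule pair_exact_left[OF Q.module_axioms _ _ act_dh_transp_Q hT hT])
  show "EXT Q F E (Suc (Suc k)) ==> EXT N g D k ==> EXT N g D (Suc (Suc k))"
    unfolding EXT_pair EXT_compat
    by (rule pair_exact_right[OF Q.module_axioms _ _ act_dh_transp_Q[symmetric] dT hT dT hT])
qed

end

end

context regular_quotient
begin

text \<open>The entries of d d vanish modulo x because the reduced matrices form a complex; dividing
  them by x gives h.\<close>

lemma cone_exists:
  assumes res: "mres S M g D e" and PM: "compat P M"
  obtains d h where "cone R S \<pi> x M P g D e d h"
proof -
  have "\<forall>n. \<exists>B. B \<in> mat R (g n) (g (Suc n)) \<and> D n = map_mat B"
    using lift_map_mat[OF mres_mat[OF res]] by metis
  then obtain d where "\<forall>n. d n \<in> mat R (g n) (g (Suc n)) \<and> D n = map_mat (d n)" by (rule choice[THEN exE])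
  then have d: "\<And>n. d n \<in> mat R (g n) (g (Suc n))" "\<And>n. D n = map_mat (d n)" by blast+
  have "\<exists>H. H \<in> mat R (g n) (g (Suc (Suc n))) \<and> matmul R (g (Suc n)) (d n) (d (Suc n)) = (\<lambda>i j. x \<otimes>\<^bsub>R\<^esub> H i j)" for n
  proof -
    let ?C = "matmul R (g (Suc n)) (d n) (d (Suc n))"
    have C: "?C \<in> mat R (g n) (g (Suc (Suc n)))" by (rule R.matmul_mat[OF d(1) d(1)])
    have "\<exists>z\<in>carrier R. ?C i j = x \<otimes>\<^bsub>R\<^esub> z" for i j
    proof -
      have "\<pi> (?C i j) = matmul S (g (Suc n)) (D n) (D (Suc n)) i j"
        unfolding matmul_def d(2) map_mat_def by (rule pi_lincomb[symmetric]) (rule R.mat_entry[OF d(1)])+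
      then have "\<pi> (?C i j) = (zero S)" by (simp add: mres_complex[OF res])
      then show ?thesis using kernel[OF R.mat_entry[OF C]] by blast
    qed
    then have "\<forall>i j. \<exists>z. z \<in> carrier R \<and> ?C i j = x \<otimes>\<^bsub>R\<^esub> z" by blast
    then obtain z where z: "\<And>i j. z i j \<in> carrier R" "\<And>i j. ?C i j = x \<otimes>\<^bsub>R\<^esub> z i j" by metis
    let ?H = "\<lambda>i j. if i < g n \<and> j < g (Suc (Suc n)) then z i j else (zero R)"
    have "?H \<in> mat R (g n) (g (Suc (Suc n)))" using z(1) by (auto simp del: R.mat_entry Rg.mat_closed simp: mat_def)
    moreover have "?C i j = x \<otimes>\<^bsub>R\<^esub> ?H i j" for i j
    proof (cases "i < g n \<and> j < g (Suc (Suc n))")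
      case False
      then have "?C i j = (zero R)" using C unfolding mat_def by auto
      with False show ?thesis by auto
    qed (simp add: z(2))
    ultimately show ?thesis by (intro exI[of _ ?H] conjI ext)
  qed
  then have "\<forall>n. \<exists>H. H \<in> mat R (g n) (g (Suc (Suc n))) \<and> matmul R (g (Suc n)) (d n) (d (Suc n)) = (\<lambda>i j. x \<otimes>\<^bsub>R\<^esub> H i j)" by blast
  then obtain h where "\<forall>n. h n \<in> mat R (g n) (g (Suc (Suc n))) \<and> matmul R (g (Suc n)) (d n) (d (Suc n)) = (\<lambda>i j. x \<otimes>\<^bsub>R\<^esub> h n i j)"
    by (rule choice[THEN exE])
  then have "cone R S \<pi> x M P g D e d h"
    using d res PM by unfold_locales auto
  then show ?thesis by (rule that)
qed

end

section \<open>Injective modules\<close>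

lemma injective_moduleD:
  fixes A B :: "('a, nat => 'a) module" and Q :: "('a, 'b, 'm) module_scheme"
  assumes "injective_module R Q" "module R A" "module R B" "f \<in> mod_hom R A B" "inj_on f (carrier A)" "g \<in> mod_hom R A Q"
  obtains h where "h \<in> mod_hom R B Q" "\<forall>a\<in>carrier A. h (f a) = g a"
  using assms unfolding injective_module_def by blast

text \<open>A cocycle v is a map out of a free module that vanishes on the kernel of the
  differential, so it factors through the image of the differential; injectivity extends that map to
  the whole free module. The two modules of this extension problem have elements of type
  \<open>nat \<Rightarrow> 'a\<close>, as \<open>injective_module\<close> requires.\<close>

lemma EXT_injective:
  assumes res: "mres R M b A e" and I: "injective_module R I"
  shows "EXT I b A (Suc i)"
  unfolding EXT_def exact_at_def
proof (intro ballI impI)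
  interpret M: module R M by (rule mres_module[OF res])
  interpret I: module R I using I by (simp add: injective_module_def)
  let ?Rg = "regular_module R" and ?n = "Suc i"
  interpret Rg: module R ?Rg by (rule M.R.regular_module_is_module)
  let ?F = "free_module R {..<b ?n}" and ?G = "free_module R {..<b (Suc ?n)}"
  note cf = carrier_free_module[OF M.R.is_cring]
  have F: "module R ?F" and G: "module R ?G" by (rule free_module_is_module[OF M.R.is_cring])+
  interpret F: module R ?F by (rule F)
  fix v assume v: "v \<in> vec I (b (Suc ?n))" "act I (b (Suc ?n)) (transp (A (Suc ?n))) v = (\<lambda>i. (zero I))"
  let ?a = "act ?Rg (b (Suc ?n)) (A ?n)"
  have la: "lin R ?G ?F ?a" by (rule lin_act[OF M.R.is_cring mres_mat[OF res]])
  let ?H = "?a ` carrier ?G"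
  have H: "submodule ?H R ?F" by (rule submodule_image[OF G F la])
  let ?A = "?F\<lparr>carrier := ?H\<rparr>"
  have A: "module R ?A" by (rule submodule.submodule_is_module[OF H F])
  have lv: "lin R ?G I (\<lambda>w. lincomb I w v (b (Suc ?n)))" by (rule I.lin_lincomb) (use v in simp)
  \<comment> \<open>By exactness of the resolution such a w is a boundary, and v is a
    cocycle.\<close>
  have wd: "lincomb I w v (b (Suc ?n)) = (zero I)" if w: "w \<in> carrier ?G" "?a w = (\<lambda>i. (zero R))" for w
  proof -
    have "w \<in> res_ker R M b A e ?n" using w by (simp add: cf res_ker_def)
    then obtain u where u: "w = act ?Rg (b (Suc (Suc ?n))) (A (Suc ?n)) u" "u \<in> vec ?Rg (b (Suc (Suc ?n)))"
      unfolding mres_exact[OF res] by (rule imageE)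
    have "lincomb I w v (b (Suc ?n)) = lincomb I u (\<lambda>j. lincomb I (\<lambda>i. A (Suc ?n) i j) v (b (Suc ?n))) (b (Suc (Suc ?n)))"
      unfolding u(1) by (rule I.lincomb_act[OF mres_mat[OF res] u(2)]) (use v in simp)
    also have "(\<lambda>j. lincomb I (\<lambda>i. A (Suc ?n) i j) v (b (Suc ?n))) = (\<lambda>i. (zero I))"
      using v(2) by (simp add: act_def transp_def)
    also have "lincomb I u (\<lambda>i. (zero I)) (b (Suc (Suc ?n))) = (zero I)"
      by (rule I.lincomb_zero_right) (use M.R.vec_regular_closed[OF u(2)] in auto)
    finally show ?thesis .
  qed
  have inv: "lincomb I w v (b (Suc ?n)) = lincomb I w' v (b (Suc ?n))"
    if w: "w \<in> carrier ?G" "w' \<in> carrier ?G" "?a w = ?a w'" for w w'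
  proof -
    interpret G: module R ?G by (rule G)
    have c: "?a w' \<in> carrier ?F" using lin_closed[OF la w(2)] .
    have "?a (w \<ominus>\<^bsub>?G\<^esub> w') = \<zero>\<^bsub>?F\<^esub>"
      using lin_minus[OF G F la w(1,2)] w(3) c by (simp del: free_module_simps)
    then have "lincomb I (w \<ominus>\<^bsub>?G\<^esub> w') v (b (Suc ?n)) = (zero I)" using w by (intro wd) simp_all
    then show ?thesis
      using lin_minus[OF G I.module_axioms lv w(1,2)] lin_closed[OF lv w(1)] lin_closed[OF lv w(2)] by simp
  qed
  \<comment> \<open>The factorisation through the image, by choosing preimages; \<open>inv\<close>
    shows that the choice does not matter.\<close>
  define g where "g y = lincomb I (SOME w. w \<in> carrier ?G \<and> ?a w = y) v (b (Suc ?n))" for y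
  have g: "g (?a w) = lincomb I w v (b (Suc ?n))" if w: "w \<in> carrier ?G" for w
  proof -
    have "(SOME w'. w' \<in> carrier ?G \<and> ?a w' = ?a w) \<in> carrier ?G \<and> ?a (SOME w'. w' \<in> carrier ?G \<and> ?a w' = ?a w) = ?a w"
      by (rule someI[of _ w]) (use w in simp)
    then show ?thesis unfolding g_def using w by (intro inv) blast+
  qed
  have lg: "lin R ?A I g"
    unfolding lin_def
  proof (intro conjI ballI)
    show "g \<in> carrier ?A \<rightarrow> carrier I" using g lin_closed[OF lv] by auto
    interpret G: module R ?G by (rule G)
    fix y y' assume "y \<in> carrier ?A" "y' \<in> carrier ?A"
    then obtain w w' where w: "w \<in> carrier ?G" "y = ?a w" "w' \<in> carrier ?G" "y' = ?a w'" by auto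
    have "g (?a (w \<oplus>\<^bsub>?G\<^esub> w')) = g (?a w) \<oplus>\<^bsub>I\<^esub> g (?a w')"
      using w by (simp only: g G.M.a_closed lin_add[OF lv])
    then show "g (y \<oplus>\<^bsub>?A\<^esub> y') = g y \<oplus>\<^bsub>I\<^esub> g y'" using w by (simp add: lin_add[OF la] del: free_module_simps)
  next
    interpret G: module R ?G by (rule G)
    fix r y assume r: "r \<in> carrier R" and "y \<in> carrier ?A"
    then obtain w where w: "w \<in> carrier ?G" "y = ?a w" by auto
    have "g (?a (r \<odot>\<^bsub>?G\<^esub> w)) = r \<odot>\<^bsub>I\<^esub> g (?a w)"
      using w r by (simp only: g G.smult_closed lin_smult[OF lv])
    then show "g (r \<odot>\<^bsub>?A\<^esub> y) = r \<odot>\<^bsub>I\<^esub> g y" using w r by (simp add: lin_smult[OF la] del: free_module_simps)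
  qed
  have "restrict (\<lambda>y. y) ?H \<in> mod_hom R ?A ?F"
    using lin_restrict_mod_hom[OF A, of ?F "\<lambda>y. y"] F.submoduleE(1)[OF H] by (auto simp: lin_def)
  moreover have "restrict g ?H \<in> mod_hom R ?A I" using lin_restrict_mod_hom[OF A lg] by simp
  moreover have "inj_on (restrict (\<lambda>y. y) ?H) (carrier ?A)" by (auto simp: inj_on_def)
  ultimately obtain k where k: "k \<in> mod_hom R ?F I" "\<forall>y\<in>carrier ?A. k (restrict (\<lambda>y. y) ?H y) = restrict g ?H y"
    using injective_moduleD[OF I A F] by blast
  obtain u where u: "u \<in> vec I (b ?n)" "k = vec_hom R I (b ?n) u" using k(1) by (rule I.mod_hom_vec_hom)
  have "lincomb I w v (b (Suc ?n)) = lincomb I w (act I (b ?n) (transp (A ?n)) u) (b (Suc ?n))" if w: "w \<in> vec ?Rg (b (Suc ?n))" for w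
  proof -
    have wG: "w \<in> carrier ?G" using w by (simp add: cf)
    have "lincomb I w v (b (Suc ?n)) = k (?a w)" using k(2) g[OF wG] wG by auto
    also have "\<dots> = lincomb I (?a w) u (b ?n)" using Rg.act_closed[OF mres_mat[OF res] w] by (simp add: u(2) vec_hom_def)
    also have "\<dots> = lincomb I w (\<lambda>j. lincomb I (\<lambda>i. A ?n i j) u (b ?n)) (b (Suc ?n))"
      by (rule I.lincomb_act[OF mres_mat[OF res] w]) (use u in simp)
    finally show ?thesis by (simp add: act_def transp_def)
  qed
  then have "vec_hom R I (b (Suc ?n)) v = vec_hom R I (b (Suc ?n)) (act I (b ?n) (transp (A ?n)) u)"
    by (auto simp: vec_hom_def fun_eq_iff)
  moreover have "act I (b ?n) (transp (A ?n)) u \<in> vec I (b (Suc ?n))"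
    by (rule I.act_closed[OF iffD2[OF transp_mat mres_mat[OF res]] u(1)])
  ultimately have "v = act I (b ?n) (transp (A ?n)) u" using I.vec_hom_inj[OF v(1)] by blast
  with u(1) show "\<exists>w\<in>vec I (b ?n). v = act I (b ?n) (transp (A ?n)) w" by blast
qed

text \<open>Ext into I vanishes in positive degrees, so the long exact sequence shifts the vanishing
  from \<open>N''\<close> up by one degree to \<open>N'\<close>.\<close>

lemma EXT_shift_injective:
  assumes res: "mres R M b A e" and I: "injective_module R I" and se: "short_exact R N' I N'' f g" and N'': "EXT N'' b A i"
  shows "EXT N' b A (Suc i)"
  unfolding EXT_def
  by (rule exact_at_sub[OF se iffD2[OF transp_mat mres_mat[OF res]] iffD2[OF transp_mat mres_mat[OF res]]
      iffD2[OF transp_mat mres_mat[OF res]] mres_complex_transp[OF res]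
      EXT_injective[OF res I, unfolded EXT_def] N''[unfolded EXT_def]])

text \<open>The resolution is cut into short exact sequences of cocycle modules. The cocycles in
  position n + 1 are zero, and the sequences carry this vanishing back to N at the cost of one
  degree each.\<close>

lemma EXT_above_injective_dim:
  assumes res: "mres R M b A e" and inj: "injective_resolution R N n I d \<eta>" and N: "module R N" and i: "n < i"
  shows "EXT N b A i"
proof -
  have Iinj: "injective_module R (I j)" and Iz: "n < j ==> zero_module (I j)" and dj: "lin R (I j) (I (Suc j)) (d j)"
    and ex: "d j ` carrier (I j) = {y \<in> carrier (I (Suc j)). d (Suc j) y = \<zero>\<^bsub>I (Suc (Suc j))\<^esub>}" for j
    using inj by (auto simp: injective_resolution_def mod_hom_iff mod_kernel_def)
  have \<eta>: "lin R N (I 0) \<eta>" "inj_on \<eta> (carrier N)" "\<eta> ` carrier N = {y \<in> carrier (I 0). d 0 y = \<zero>\<^bsub>I (Suc 0)\<^esub>}"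
    using inj by (auto simp: injective_resolution_def mod_hom_iff mod_kernel_def)
  have I: "module R (I j)" for j using Iinj by (simp add: injective_module_def)
  define C where "C j = I j\<lparr>carrier := {y \<in> carrier (I j). d j y = \<zero>\<^bsub>I (Suc j)\<^esub>}\<rparr>" for j
  have subC: "submodule {y \<in> carrier (I j). d j y = \<zero>\<^bsub>I (Suc j)\<^esub>} R (I j)" for j
    by (rule submodule_kernel[OF I I dj])
  have C: "module R (C j)" for j unfolding C_def by (rule submodule.submodule_is_module[OF subC I])
  have dd: "d (Suc j) (d j y) = \<zero>\<^bsub>I (Suc (Suc j))\<^esub>" if "y \<in> carrier (I j)" for j y
    using ex[of j] that by blast
  have dC: "lin R (I j) (C (Suc j)) (d j)" for j
    using dj[of j] dd by (auto simp: lin_def C_def Pi_iff)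
  have se: "short_exact R (C j) (I j) (C (Suc j)) (\<lambda>y. y) (d j)" for j
    unfolding short_exact_def
  proof (intro conjI ballI C I dC)
    show "lin R (C j) (I j) (\<lambda>y. y)" by (auto simp: lin_def C_def)
    show "d j ` carrier (I j) = carrier (C (Suc j))" using ex[of j] by (simp add: C_def)
  qed (simp_all add: C_def)
  \<comment> \<open>Descending induction from \<open>C (Suc n)\<close>, written with the distance k
    from the top.\<close>
  have "EXT (C (Suc (n - k))) b A i" if "k \<le> n" "k \<le> i" for k i
    using that
  proof (induction k arbitrary: i)
    case 0
    interpret C: module R "C (Suc n)" by (rule C)
    have sub: "carrier (C (Suc n)) \<subseteq> {\<zero>\<^bsub>C (Suc n)\<^esub>}" using Iz[of "Suc n"] by (auto simp: C_def zero_module_def)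
    have "v = (\<lambda>i. \<zero>\<^bsub>C (Suc n)\<^esub>)" if "v \<in> vec (C (Suc n)) q" for v q
      using subsetD[OF sub C.vec_closed[OF that]] by (intro ext) simp
    then have "vec (C (Suc n)) q = {\<lambda>i. \<zero>\<^bsub>C (Suc n)\<^esub>}" for q using C.zero_vec by blast
    then show ?case
      using C.act_zero[OF iffD2[OF transp_mat mres_mat[OF res]]] by (auto simp: EXT_def exact_at_def)
  next
    case (Suc k)
    obtain i' where i': "i = Suc i'" using Suc.prems by (cases i) auto
    have eq: "Suc (n - Suc k) = n - k" using Suc.prems by simp
    have "EXT (C (Suc (Suc (n - Suc k)))) b A i'" unfolding eq using Suc i' by simp
    from EXT_shift_injective[OF res Iinj se this] show ?case unfolding i' .
  qed
  from this[of n "i - 1"] have "EXT (C (Suc 0)) b A (i - 1)" using i by simp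
  moreover have "short_exact R N (I 0) (C (Suc 0)) \<eta> (d 0)"
    unfolding short_exact_def
  proof (intro conjI ballI N C I dC \<eta>)
    show "d 0 ` carrier (I 0) = carrier (C (Suc 0))" using ex[of 0] by (simp add: C_def)
  qed (simp_all add: C_def \<eta>(3))
  ultimately have "EXT N b A (Suc (i - 1))" by (intro EXT_shift_injective[OF res Iinj])
  then show ?thesis using i by simp
qed

text \<open>Injectivity tested on ideals, with the extension to R given by its value q at 1. Unlike
  \<open>injective_module\<close> it involves no type of test modules, so it passes between R and
  S.\<close>

definition baer :: "('a, 'r) ring_scheme => ('a, 'b, 'm) module_scheme => bool" where
  "baer R Q \<longleftrightarrow> module R Q \<and> (\<forall>I g. ideal I R \<and> (\<forall>a\<in>I. g a \<in> carrier Q) \<and>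
    (\<forall>a\<in>I. \<forall>b\<in>I. g (a \<oplus>\<^bsub>R\<^esub> b) = g a \<oplus>\<^bsub>Q\<^esub> g b) \<and> (\<forall>r\<in>carrier R. \<forall>a\<in>I. g (r \<otimes>\<^bsub>R\<^esub> a) = r \<odot>\<^bsub>Q\<^esub> g a) \<longrightarrow>
    (\<exists>q\<in>carrier Q. \<forall>a\<in>I. g a = a \<odot>\<^bsub>Q\<^esub> q))"

lemma baerD:
  assumes "baer R Q" "ideal I R" "\<And>a. a \<in> I ==> g a \<in> carrier Q"
    "\<And>a b. a \<in> I ==> b \<in> I ==> g (a \<oplus>\<^bsub>R\<^esub> b) = g a \<oplus>\<^bsub>Q\<^esub> g b"
    "\<And>r a. r \<in> carrier R ==> a \<in> I ==> g (r \<otimes>\<^bsub>R\<^esub> a) = r \<odot>\<^bsub>Q\<^esub> g a"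
  obtains q where "q \<in> carrier Q" "\<forall>a\<in>I. g a = a \<odot>\<^bsub>Q\<^esub> q"
  using assms unfolding baer_def by blast

text \<open>\<open>injective_module\<close> sees only test modules with elements of type
  \<open>nat \<Rightarrow> 'a\<close>, so the ideal is placed inside the free module of rank
  one.\<close>

lemma injective_imp_baer:
  assumes R: "cring R" and Q: "injective_module R Q" shows "baer R Q"
  unfolding baer_def
proof (intro conjI allI impI; (elim conjE)?)
  interpret R: cring R by fact
  show "module R Q" using Q by (simp add: injective_module_def)
  then interpret Q: module R Q .
  let ?Rg = "regular_module R"
  interpret Rg: module R ?Rg by (rule R.regular_module_is_module)
  fix I g assume I: "ideal I R" and g: "\<forall>a\<in>I. g a \<in> carrier Q" "\<forall>a\<in>I. \<forall>b\<in>I. g (a \<oplus>\<^bsub>R\<^esub> b) = g a \<oplus>\<^bsub>Q\<^esub> g b"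
    "\<forall>r\<in>carrier R. \<forall>a\<in>I. g (r \<otimes>\<^bsub>R\<^esub> a) = r \<odot>\<^bsub>Q\<^esub> g a"
  interpret I: ideal I R by fact
  let ?F = "free_module R {..<Suc 0}"
  interpret F: module R ?F by (rule free_module_is_module[OF R])
  note cf = carrier_free_module[OF R, of "Suc 0"]
  let ?H = "{u \<in> carrier ?F. u 0 \<in> I}"
  have H: "submodule ?H R ?F"
  proof (rule F.submoduleI)
    have "\<ominus>\<^bsub>?F\<^esub> a = (\<lambda>i. \<ominus>\<^bsub>R\<^esub> a i)" if "a \<in> carrier ?F" for a
    proof (rule F.M.minus_equality[OF _ that])
      have a: "a \<in> vec ?Rg (Suc 0)" using that by (simp add: cf)
      show "(\<lambda>i. \<ominus>\<^bsub>R\<^esub> a i) \<in> carrier ?F" using Rg.neg_vec[OF a] by (simp add: cf)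
      show "(\<lambda>i. \<ominus>\<^bsub>R\<^esub> a i) \<oplus>\<^bsub>?F\<^esub> a = \<zero>\<^bsub>?F\<^esub>" using R.vec_regular_closed[OF a] by (simp add: R.l_neg)
    qed
    then show "\<ominus>\<^bsub>?F\<^esub> a \<in> ?H" if "a \<in> ?H" for a using that F.M.a_inv_closed[of a] by auto
  qed (use F.M.zero_closed F.M.a_closed F.smult_closed I.I_l_closed in \<open>auto simp del: F.M.zero_closed\<close>)
  let ?A = "?F\<lparr>carrier := ?H\<rparr>"
  have A: "module R ?A" by (rule submodule.submodule_is_module[OF H F.module_axioms])
  have "restrict (\<lambda>u. u) ?H \<in> mod_hom R ?A ?F"
    using lin_restrict_mod_hom[OF A, of ?F "\<lambda>y. y"] by (auto simp: lin_def)
  moreover have "lin R ?A Q (\<lambda>u. g (u 0))" using g by (auto simp: lin_def)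
  then have "restrict (\<lambda>u. g (u 0)) ?H \<in> mod_hom R ?A Q" using lin_restrict_mod_hom[OF A, of Q "\<lambda>u. g (u 0)"] by simp
  moreover have "inj_on (restrict (\<lambda>y. y) ?H) (carrier ?A)" by (auto simp: inj_on_def)
  ultimately obtain k where k: "k \<in> mod_hom R ?F Q" "\<forall>y\<in>carrier ?A. k (restrict (\<lambda>y. y) ?H y) = restrict (\<lambda>u. g (u 0)) ?H y"
    using injective_moduleD[OF Q A F.module_axioms] by blast
  have lk: "lin R ?F Q k" using k(1) by (simp add: mod_hom_iff)
  have u0: "unit_vector R 0 \<in> carrier ?F" by (simp add: R)
  have "g a = a \<odot>\<^bsub>Q\<^esub> k (unit_vector R 0)" if a: "a \<in> I" for a
  proof -
    let ?u = "a \<odot>\<^bsub>?F\<^esub> unit_vector R 0"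
    have ac: "a \<in> carrier R" using a I.Icarr by blast
    have u: "?u \<in> carrier ?F" by (rule F.smult_closed[OF ac u0])
    have "?u 0 = a" using ac by (simp add: unit_vector_def)
    then have "k ?u = g a" using k(2) u a by auto
    then show ?thesis using lin_smult[OF lk ac u0] by simp
  qed
  then show "\<exists>q\<in>carrier Q. \<forall>a\<in>I. g a = a \<odot>\<^bsub>Q\<^esub> q" using lin_closed[OF lk u0] by blast
qed

lemma (in cring) ideal_of_closed:
  assumes "I \<subseteq> carrier R" "\<zero> \<in> I" "\<And>a b. a \<in> I ==> b \<in> I ==> a \<oplus> b \<in> I"
    and mul: "\<And>r a. r \<in> carrier R ==> a \<in> I ==> r \<otimes> a \<in> I"
  shows "ideal I R"
proof (rule idealI[OF ring_axioms])
  show "subgroup I (add_monoid R)"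
  proof (rule add.subgroupI)
    show "\<ominus> a \<in> I" if "a \<in> I" for a
      using mul[OF _ that, of "\<ominus> \<one>"] that assms(1) by (auto simp: l_minus)
  qed (use assms in auto)
  show "a \<in> I ==> y \<in> carrier R ==> a \<otimes> y \<in> I" for a y using mul[of y a] assms(1) m_comm[of a y] by auto
qed (rule mul)

text \<open>Baer's criterion: a maximal extension of \<open>g\<close>, represented by its graph, is defined everywhere.\<close>

lemma baer_extend:
  assumes Q: "baer R Q" and B: "module R B" and A: "submodule A R B" and g: "lin R (B\<lparr>carrier := A\<rparr>) Q g"
  obtains h where "lin R B Q h" "\<forall>a\<in>A. h a = g a"
proof -
  interpret Q: module R Q using Q by (simp add: baer_def)
  interpret B: module R B by fact
  note As = B.submoduleE[OF A]
  \<comment> \<open>Graphs of linear maps that extend g and are defined on submodules of B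
    containing A; the condition over zero makes them single-valued.\<close>
  define ok where "ok G \<longleftrightarrow> G \<subseteq> carrier B \<times> carrier Q \<and> (\<forall>p\<in>G. \<forall>p'\<in>G. (fst p \<oplus>\<^bsub>B\<^esub> fst p', snd p \<oplus>\<^bsub>Q\<^esub> snd p') \<in> G) \<and>
    (\<forall>r\<in>carrier R. \<forall>p\<in>G. (r \<odot>\<^bsub>B\<^esub> fst p, r \<odot>\<^bsub>Q\<^esub> snd p) \<in> G) \<and> (\<forall>q. ((zero B), q) \<in> G \<longrightarrow> q = (zero Q)) \<and> (\<forall>a\<in>A. (a, g a) \<in> G)" for G
  have okI: "ok G" if "G \<subseteq> carrier B \<times> carrier Q"
    "\<And>b q b' q'. (b, q) \<in> G ==> (b', q') \<in> G ==> (b \<oplus>\<^bsub>B\<^esub> b', q \<oplus>\<^bsub>Q\<^esub> q') \<in> G"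
    "\<And>r b q. r \<in> carrier R ==> (b, q) \<in> G ==> (r \<odot>\<^bsub>B\<^esub> b, r \<odot>\<^bsub>Q\<^esub> q) \<in> G"
    "\<And>q. ((zero B), q) \<in> G ==> q = (zero Q)" "\<And>a. a \<in> A ==> (a, g a) \<in> G" for G
    using that unfolding ok_def by auto
  have okD: "(b, q) \<in> G ==> b \<in> carrier B" "(b, q) \<in> G ==> q \<in> carrier Q"
    "(b, q) \<in> G ==> (b', q') \<in> G ==> (b \<oplus>\<^bsub>B\<^esub> b', q \<oplus>\<^bsub>Q\<^esub> q') \<in> G"
    "r \<in> carrier R ==> (b, q) \<in> G ==> (r \<odot>\<^bsub>B\<^esub> b, r \<odot>\<^bsub>Q\<^esub> q) \<in> G"
    "((zero B), q) \<in> G ==> q = (zero Q)" "a \<in> A ==> (a, g a) \<in> G" if "ok G" for G b q b' q' r a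
    using that unfolding ok_def by force+
  have g0: "g (zero B) = (zero Q)"
    using lin_zero[OF submodule.submodule_is_module[OF A B] Q.module_axioms g] by simp
  have "\<exists>M\<in>Collect ok. \<forall>X\<in>Collect ok. M \<subseteq> X \<longrightarrow> X = M"
  proof (rule subset_Zorn_nonempty)
    have "ok ((\<lambda>a. (a, g a)) ` A)"
      by (rule okI) (use As lin_closed[OF g] lin_add[OF g] lin_smult[OF g] g0 in auto)
    then show "Collect ok \<noteq> {}" by blast
    fix C assume C: "C \<noteq> {}" "subset.chain (Collect ok) C"
    then have okC: "ok G" if "G \<in> C" for G using that by (auto simp: pred_on.chain_def)
    have lin: "G \<subseteq> G' \<or> G' \<subseteq> G" if "G \<in> C" "G' \<in> C" for G G' using C(2) that by (auto simp: pred_on.chain_def)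
    have "ok (\<Union>C)"
    proof (rule okI)
      show "\<Union>C \<subseteq> carrier B \<times> carrier Q" using okD(1,2)[OF okC] by fast
      show "(b \<oplus>\<^bsub>B\<^esub> b', q \<oplus>\<^bsub>Q\<^esub> q') \<in> \<Union>C" if bq: "(b, q) \<in> \<Union>C" "(b', q') \<in> \<Union>C" for b q b' q'
      proof -
        obtain G G' where G: "G \<in> C" "(b, q) \<in> G" "G' \<in> C" "(b', q') \<in> G'" using bq by blast
        then obtain G'' where "G'' \<in> C" "(b, q) \<in> G''" "(b', q') \<in> G''" using lin[OF G(1,3)] by blast
        then show ?thesis using okD(3)[OF okC] by blast
      qed
      show "(r \<odot>\<^bsub>B\<^esub> b, r \<odot>\<^bsub>Q\<^esub> q) \<in> \<Union>C" if "r \<in> carrier R" "(b, q) \<in> \<Union>C" for r b q using that okD(4)[OF okC] by blast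
      show "q = (zero Q)" if "((zero B), q) \<in> \<Union>C" for q using that okD(5)[OF okC] by blast
      show "(a, g a) \<in> \<Union>C" if "a \<in> A" for a using that C(1) okD(6)[OF okC] by blast
    qed
    then show "\<Union>C \<in> Collect ok" by simp
  qed
  then obtain G where "G \<in> Collect ok" and max: "\<forall>X\<in>Collect ok. G \<subseteq> X \<longrightarrow> X = G" by (rule bexE)
  then have G: "ok G" by simp
  note D = okD[OF G]
  have zz: "((zero B), (zero Q)) \<in> G" using D(6)[OF submodule_zero[OF B A]] g0 by simp
  have uniq: "q = q'" if "(b, q) \<in> G" "(b, q') \<in> G" for b q q'
  proof -
    have "((\<ominus>\<^bsub>R\<^esub> \<one>\<^bsub>R\<^esub>) \<odot>\<^bsub>B\<^esub> b, (\<ominus>\<^bsub>R\<^esub> \<one>\<^bsub>R\<^esub>) \<odot>\<^bsub>Q\<^esub> q') \<in> G" by (rule D(4)) (use that in auto)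
    then have "(\<ominus>\<^bsub>B\<^esub> b, \<ominus>\<^bsub>Q\<^esub> q') \<in> G" using D(1,2)[OF that(2)] by (simp add: B.smult_l_minus Q.smult_l_minus)
    from D(3)[OF that(1) this] have "((zero B), q \<ominus>\<^bsub>Q\<^esub> q') \<in> G" using D(1)[OF that(1)] by (simp add: B.M.r_neg Q.M.minus_eq)
    from D(5)[OF this] show ?thesis using D(2)[OF that(1)] D(2)[OF that(2)] by simp
  qed
  have dom: "\<exists>q. (b, q) \<in> G" if b: "b \<in> carrier B" for b
  proof -
    \<comment> \<open>The multipliers that bring b into the domain of G; on this ideal k is linear,
      and Baer's criterion supplies the value q0 to be assigned to b.\<close>
    let ?I = "{r \<in> carrier R. \<exists>q. (r \<odot>\<^bsub>B\<^esub> b, q) \<in> G}"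
    define k where "k r = (SOME q. (r \<odot>\<^bsub>B\<^esub> b, q) \<in> G)" for r
    have k: "(r \<odot>\<^bsub>B\<^esub> b, k r) \<in> G" if "r \<in> ?I" for r unfolding k_def using that by (auto intro: someI)
    have kadd: "((r \<oplus>\<^bsub>R\<^esub> s) \<odot>\<^bsub>B\<^esub> b, k r \<oplus>\<^bsub>Q\<^esub> k s) \<in> G" if "r \<in> ?I" "s \<in> ?I" for r s
      using D(3)[OF k[OF that(1)] k[OF that(2)]] that b by (simp add: B.smult_l_distr)
    have kmul: "((s \<otimes>\<^bsub>R\<^esub> r) \<odot>\<^bsub>B\<^esub> b, s \<odot>\<^bsub>Q\<^esub> k r) \<in> G" if "r \<in> ?I" "s \<in> carrier R" for r s
      using D(4)[OF that(2) k[OF that(1)]] that b by (simp add: B.smult_assoc1)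
    have mul: "s \<otimes>\<^bsub>R\<^esub> r \<in> ?I" if "r \<in> ?I" "s \<in> carrier R" for r s using kmul[OF that] that by auto
    have zero: "(zero R) \<in> ?I" using zz b by auto
    have "ideal ?I R"
    proof (rule Q.R.ideal_of_closed[OF _ zero])
      show "a \<oplus>\<^bsub>R\<^esub> c \<in> ?I" if "a \<in> ?I" "c \<in> ?I" for a c using kadd[OF that] that by auto
      show "r \<otimes>\<^bsub>R\<^esub> a \<in> ?I" if "r \<in> carrier R" "a \<in> ?I" for r a by (rule mul[OF that(2,1)])
    qed auto
    then obtain q0 where q0: "q0 \<in> carrier Q" "\<forall>a\<in>?I. k a = a \<odot>\<^bsub>Q\<^esub> q0"
    proof (rule baerD[OF Q])
      show "k a \<in> carrier Q" if "a \<in> ?I" for a using D(2)[OF k[OF that]] .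
      show "k (a \<oplus>\<^bsub>R\<^esub> c) = k a \<oplus>\<^bsub>Q\<^esub> k c" if "a \<in> ?I" "c \<in> ?I" for a c
        using kadd[OF that] that by (intro uniq[OF k]) auto
      show "k (r \<otimes>\<^bsub>R\<^esub> a) = r \<odot>\<^bsub>Q\<^esub> k a" if "r \<in> carrier R" "a \<in> ?I" for r a
        using kmul[OF that(2,1)] mul[OF that(2,1)] by (intro uniq[OF k])
    qed
    let ?G = "{(c \<oplus>\<^bsub>B\<^esub> r \<odot>\<^bsub>B\<^esub> b, q \<oplus>\<^bsub>Q\<^esub> r \<odot>\<^bsub>Q\<^esub> q0) | c q r. (c, q) \<in> G \<and> r \<in> carrier R}"
    have GI: "(c \<oplus>\<^bsub>B\<^esub> r \<odot>\<^bsub>B\<^esub> b, q \<oplus>\<^bsub>Q\<^esub> r \<odot>\<^bsub>Q\<^esub> q0) \<in> ?G" if "(c, q) \<in> G" "r \<in> carrier R" for c q r using that by blast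
    have sub: "G \<subseteq> ?G"
    proof
      fix p assume "p \<in> G"
      then have "(fst p, snd p) \<in> G" by simp
      from GI[OF this Q.R.zero_closed] D(1,2)[OF this] show "p \<in> ?G" using b q0(1) by simp
    qed
    have "ok ?G"
    proof (rule okI)
      show "?G \<subseteq> carrier B \<times> carrier Q" using D(1,2) b q0(1) by auto
      show "(a, g a) \<in> ?G" if "a \<in> A" for a using sub D(6)[OF that] by blast
      show "(c \<oplus>\<^bsub>B\<^esub> c', q \<oplus>\<^bsub>Q\<^esub> q') \<in> ?G" if m: "(c, q) \<in> ?G" "(c', q') \<in> ?G" for c q c' q'
      proof -
        obtain a s r where 1: "c = a \<oplus>\<^bsub>B\<^esub> r \<odot>\<^bsub>B\<^esub> b" "q = s \<oplus>\<^bsub>Q\<^esub> r \<odot>\<^bsub>Q\<^esub> q0" "(a, s) \<in> G" "r \<in> carrier R" using m(1) by blast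
        obtain a' s' r' where 2: "c' = a' \<oplus>\<^bsub>B\<^esub> r' \<odot>\<^bsub>B\<^esub> b" "q' = s' \<oplus>\<^bsub>Q\<^esub> r' \<odot>\<^bsub>Q\<^esub> q0" "(a', s') \<in> G" "r' \<in> carrier R" using m(2) by blast
        have "c \<oplus>\<^bsub>B\<^esub> c' = (a \<oplus>\<^bsub>B\<^esub> a') \<oplus>\<^bsub>B\<^esub> (r \<oplus>\<^bsub>R\<^esub> r') \<odot>\<^bsub>B\<^esub> b"
          using 1 2 D(1)[OF 1(3)] D(1)[OF 2(3)] b by (simp add: B.smult_l_distr B.M.a_ac)
        moreover have "q \<oplus>\<^bsub>Q\<^esub> q' = (s \<oplus>\<^bsub>Q\<^esub> s') \<oplus>\<^bsub>Q\<^esub> (r \<oplus>\<^bsub>R\<^esub> r') \<odot>\<^bsub>Q\<^esub> q0"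
          using 1 2 D(2)[OF 1(3)] D(2)[OF 2(3)] q0(1) by (simp add: Q.smult_l_distr Q.M.a_ac)
        ultimately show ?thesis using GI[OF D(3)[OF 1(3) 2(3)], of "r \<oplus>\<^bsub>R\<^esub> r'"] 1(4) 2(4) by simp
      qed
      show "(t \<odot>\<^bsub>B\<^esub> c, t \<odot>\<^bsub>Q\<^esub> q) \<in> ?G" if t: "t \<in> carrier R" and m: "(c, q) \<in> ?G" for t c q
      proof -
        obtain a s r where 1: "c = a \<oplus>\<^bsub>B\<^esub> r \<odot>\<^bsub>B\<^esub> b" "q = s \<oplus>\<^bsub>Q\<^esub> r \<odot>\<^bsub>Q\<^esub> q0" "(a, s) \<in> G" "r \<in> carrier R" using m by blast
        have "t \<odot>\<^bsub>B\<^esub> c = t \<odot>\<^bsub>B\<^esub> a \<oplus>\<^bsub>B\<^esub> (t \<otimes>\<^bsub>R\<^esub> r) \<odot>\<^bsub>B\<^esub> b"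
          using 1 t D(1)[OF 1(3)] b by (simp add: B.smult_r_distr B.smult_assoc1)
        moreover have "t \<odot>\<^bsub>Q\<^esub> q = t \<odot>\<^bsub>Q\<^esub> s \<oplus>\<^bsub>Q\<^esub> (t \<otimes>\<^bsub>R\<^esub> r) \<odot>\<^bsub>Q\<^esub> q0"
          using 1 t D(2)[OF 1(3)] q0(1) by (simp add: Q.smult_r_distr Q.smult_assoc1)
        ultimately show ?thesis using GI[OF D(4)[OF t 1(3)], of "t \<otimes>\<^bsub>R\<^esub> r"] 1(4) t by simp
      qed
      \<comment> \<open>Single-valuedness of the enlarged graph: if a + r b = 0, then r lies in
        \<open>?I\<close>, where G already prescribes r q0 as the value at r b.\<close>
      show "q = (zero Q)" if m: "((zero B), q) \<in> ?G" for q
      proof -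
        obtain a s r where 1: "(zero B) = a \<oplus>\<^bsub>B\<^esub> r \<odot>\<^bsub>B\<^esub> b" "q = s \<oplus>\<^bsub>Q\<^esub> r \<odot>\<^bsub>Q\<^esub> q0" "(a, s) \<in> G" "r \<in> carrier R" using m by blast
        have "((\<ominus>\<^bsub>R\<^esub> \<one>\<^bsub>R\<^esub>) \<odot>\<^bsub>B\<^esub> a, (\<ominus>\<^bsub>R\<^esub> \<one>\<^bsub>R\<^esub>) \<odot>\<^bsub>Q\<^esub> s) \<in> G" by (rule D(4)) (use 1 in auto)
        moreover have "(\<ominus>\<^bsub>R\<^esub> \<one>\<^bsub>R\<^esub>) \<odot>\<^bsub>B\<^esub> a = r \<odot>\<^bsub>B\<^esub> b"
        proof -
          have "\<ominus>\<^bsub>B\<^esub> a = r \<odot>\<^bsub>B\<^esub> b"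
            using 1(1)[symmetric] D(1)[OF 1(3)] 1(4) b by (intro B.M.minus_equality) (simp_all add: B.M.a_comm)
          then show ?thesis using D(1)[OF 1(3)] by (simp add: B.smult_l_minus)
        qed
        ultimately have "r \<in> ?I" using 1(4) by auto
        from k[OF this] bspec[OF q0(2) this] have "(r \<odot>\<^bsub>B\<^esub> b, r \<odot>\<^bsub>Q\<^esub> q0) \<in> G" by simp
        from D(3)[OF 1(3) this] have "((zero B), q) \<in> G" by (simp flip: 1(1,2))
        then show ?thesis by (rule D(5))
      qed
    qed
    then have "?G \<in> Collect ok" by simp
    from bspec[OF max this] sub have "?G = G" by simp
    moreover have "(b, q0) \<in> ?G" using GI[OF zz Q.R.one_closed] b q0(1) by simp
    ultimately show ?thesis by blast
  qed
  define h where "h b = (SOME q. (b, q) \<in> G)" for b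
  have h: "(b, h b) \<in> G" if "b \<in> carrier B" for b unfolding h_def using dom[OF that] by (rule someI_ex)
  have "lin R B Q h"
    unfolding lin_def
  proof (intro conjI ballI)
    show "h \<in> carrier B \<rightarrow> carrier Q" by (rule funcsetI) (rule D(2)[OF h])
    show "h (b \<oplus>\<^bsub>B\<^esub> c) = h b \<oplus>\<^bsub>Q\<^esub> h c" if "b \<in> carrier B" "c \<in> carrier B" for b c
      using that by (intro uniq[OF h D(3)[OF h h]]) simp_all
    show "h (r \<odot>\<^bsub>B\<^esub> b) = r \<odot>\<^bsub>Q\<^esub> h b" if "r \<in> carrier R" "b \<in> carrier B" for r b
      using that by (intro uniq[OF h D(4)[OF _ h]]) simp_all
  qed
  moreover have "\<forall>a\<in>A. h a = g a"
  proof
    fix a assume a: "a \<in> A"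
    then have "a \<in> carrier B" using As(1) by blast
    from uniq[OF h[OF this] D(6)[OF a]] show "h a = g a" .
  qed
  ultimately show ?thesis by (rule that)
qed

lemma baer_imp_injective:
  assumes "baer R Q" shows "injective_module R Q"
  unfolding injective_module_def
proof (intro conjI allI impI; (elim conjE)?)
  show "module R Q" using assms by (simp add: baer_def)
  fix A B :: "('a, nat => 'a) module" and f g
  assume A: "module R A" and B: "module R B" and f: "f \<in> mod_hom R A B" and inj: "inj_on f (carrier A)" and g: "g \<in> mod_hom R A Q"
  interpret B: module R B by fact
  interpret A: module R A by fact
  have lf: "lin R A B f" and lg: "lin R A Q g" using f g by (simp_all add: mod_hom_iff)
  have H: "submodule (f ` carrier A) R B" by (rule submodule_image[OF A B lf])
  let ?g = "\<lambda>b. g (inv_into (carrier A) f b)"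
  have "?g (f a) = g a" if "a \<in> carrier A" for a using that inj by simp
  then have "lin R (B\<lparr>carrier := f ` carrier A\<rparr>) Q ?g"
    using lin_closed[OF lg] lin_add[OF lg] lin_smult[OF lg] by (auto simp: lin_def lin_add[OF lf, symmetric] lin_smult[OF lf, symmetric])
  then obtain h where h: "lin R B Q h" "\<forall>b\<in>f ` carrier A. h b = ?g b" by (rule baer_extend[OF assms B H])
  have "h (f a) = g a" if "a \<in> carrier A" for a using h(2) that inj by simp
  then show "\<exists>h\<in>mod_hom R B Q. \<forall>a\<in>carrier A. h (f a) = g a"
    using lin_restrict_mod_hom[OF B h(1)] lin_closed[OF lf] by (intro bexI[of _ "restrict h (carrier B)"]) auto
qed

section \<open>The quotient of a Gorenstein ring by a regular element\<close>

text \<open>A copy of K on elements of another type. An injective resolution over S must consist of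
  modules on sequences from the element type of S, whereas the modules constructed from I live on
  \<open>nat \<Rightarrow> 'a\<close>.\<close>

definition image_module :: "('b => 'c) => ('a, 'b, 'm) module_scheme => ('a, 'c) module" where
  "image_module \<sigma> K = \<lparr>carrier = \<sigma> ` carrier K, monoid.mult = undefined, one = undefined, zero = \<sigma> (zero K),
     add = (\<lambda>u v. \<sigma> (the_inv \<sigma> u \<oplus>\<^bsub>K\<^esub> the_inv \<sigma> v)), smult = (\<lambda>s u. \<sigma> (s \<odot>\<^bsub>K\<^esub> the_inv \<sigma> u))\<rparr>"

lemma image_module_simps [simp]:
  "carrier (image_module \<sigma> K) = \<sigma> ` carrier K" "\<zero>\<^bsub>image_module \<sigma> K\<^esub> = \<sigma> (zero K)"
  "inj \<sigma> ==> \<sigma> u \<oplus>\<^bsub>image_module \<sigma> K\<^esub> \<sigma> v = \<sigma> (u \<oplus>\<^bsub>K\<^esub> v)" "inj \<sigma> ==> s \<odot>\<^bsub>image_module \<sigma> K\<^esub> \<sigma> u = \<sigma> (s \<odot>\<^bsub>K\<^esub> u)"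
  by (simp_all add: image_module_def the_inv_f_f)

lemma image_module_is_module:
  assumes \<sigma>: "inj \<sigma>" and K: "module S K" shows "module S (image_module \<sigma> K)"
proof -
  interpret K: module S K by fact
  have "abelian_group (image_module \<sigma> K)"
  proof (rule abelian_groupI)
    fix u assume "u \<in> carrier (image_module \<sigma> K)"
    then obtain y where y: "y \<in> carrier K" "u = \<sigma> y" by auto
    then show "\<exists>v\<in>carrier (image_module \<sigma> K). v \<oplus>\<^bsub>image_module \<sigma> K\<^esub> u = \<zero>\<^bsub>image_module \<sigma> K\<^esub>"
      using \<sigma> by (intro bexI[of _ "\<sigma> (\<ominus>\<^bsub>K\<^esub> y)"]) (auto simp: K.M.l_neg)
  qed (use \<sigma> in \<open>auto simp: K.M.a_ac\<close>)
  then show ?thesis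
    using \<sigma> by (intro moduleI) (auto simp: K.R.is_cring K.smult_l_distr K.smult_r_distr K.smult_assoc1)
qed

lemma lin_image_module:
  assumes \<sigma>: "inj \<sigma>" shows "lin S K (image_module \<sigma> K) \<sigma>" "lin S (image_module \<sigma> K) K (the_inv \<sigma>)"
  using \<sigma> by (auto simp: lin_def the_inv_f_f)

lemma baer_image_module:
  assumes \<sigma>: "inj \<sigma>" and K: "baer S K" shows "baer S (image_module \<sigma> K)"
  unfolding baer_def
proof (intro conjI allI impI; (elim conjE)?)
  show "module S (image_module \<sigma> K)" using K by (intro image_module_is_module[OF \<sigma>]) (simp add: baer_def)
  fix I g assume I: "ideal I S" and g: "\<forall>a\<in>I. g a \<in> carrier (image_module \<sigma> K)"
    "\<forall>a\<in>I. \<forall>b\<in>I. g (a \<oplus>\<^bsub>S\<^esub> b) = g a \<oplus>\<^bsub>image_module \<sigma> K\<^esub> g b" "\<forall>r\<in>carrier S. \<forall>a\<in>I. g (r \<otimes>\<^bsub>S\<^esub> a) = r \<odot>\<^bsub>image_module \<sigma> K\<^esub> g a"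
  note l = lin_image_module(2)[OF \<sigma>, of S K]
  obtain q where q: "q \<in> carrier K" "\<forall>a\<in>I. the_inv \<sigma> (g a) = a \<odot>\<^bsub>K\<^esub> q"
  proof (rule baerD[OF K I, of "\<lambda>a. the_inv \<sigma> (g a)"])
    show "the_inv \<sigma> (g a) \<in> carrier K" if "a \<in> I" for a using lin_closed[OF l] g(1) that by blast
    show "the_inv \<sigma> (g (a \<oplus>\<^bsub>S\<^esub> b)) = the_inv \<sigma> (g a) \<oplus>\<^bsub>K\<^esub> the_inv \<sigma> (g b)" if "a \<in> I" "b \<in> I" for a b
      using lin_add[OF l] g(1,2) that by metis
    show "the_inv \<sigma> (g (r \<otimes>\<^bsub>S\<^esub> a)) = r \<odot>\<^bsub>K\<^esub> the_inv \<sigma> (g a)" if "r \<in> carrier S" "a \<in> I" for r a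
      using lin_smult[OF l] g(1,3) that by metis
  qed
  have "g a = a \<odot>\<^bsub>image_module \<sigma> K\<^esub> \<sigma> q" if "a \<in> I" for a
  proof -
    from bspec[OF g(1) that] obtain y where y: "y \<in> carrier K" "g a = \<sigma> y" by auto
    then have "y = a \<odot>\<^bsub>K\<^esub> q" using bspec[OF q(2) that] the_inv_f_f[OF \<sigma>, of y] by simp
    then show ?thesis using y(2) \<sigma> by simp
  qed
  with q(1) show "\<exists>q\<in>carrier (image_module \<sigma> K). \<forall>a\<in>I. g a = a \<odot>\<^bsub>image_module \<sigma> K\<^esub> q" by auto
qed

section \<open>Submodules killed by x in injective modules\<close>

context regular_quotient
begin

lemma compat_lin:
  assumes "compat P N" "compat P' N'" shows "lin S N N' f \<longleftrightarrow> lin R P P' f"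
proof -
  note a = compat_modules[OF assms(1)] and b = compat_modules[OF assms(2)]
  have "(\<forall>s\<in>carrier S. \<forall>m\<in>carrier N. f (s \<odot>\<^bsub>N\<^esub> m) = s \<odot>\<^bsub>N'\<^esub> f m) \<longleftrightarrow>
      (\<forall>r\<in>carrier R. \<forall>m\<in>carrier N. f (r \<odot>\<^bsub>P\<^esub> m) = r \<odot>\<^bsub>P'\<^esub> f m)" if "f \<in> carrier N \<rightarrow> carrier N'"
  proof -
    have fm: "f m \<in> carrier N'" if "m \<in> carrier N" for m using that \<open>f \<in> carrier N \<rightarrow> carrier N'\<close> by blast
    show ?thesis
      unfolding surj[symmetric] using compat_smult[OF assms(1)] compat_smult[OF assms(2)] fm by auto
  qed
  then show ?thesis unfolding lin_def a b by blast
qed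

text \<open>This is the module of homomorphisms from S to P over R, realised as a submodule of
  P.\<close>

definition killed :: "('a, 'b, 'm) module_scheme => ('a, 'b, 'm) module_scheme" where
  "killed P = P\<lparr>carrier := {y \<in> carrier P. x \<odot>\<^bsub>P\<^esub> y = (zero P)}\<rparr>"

lemma killed_simps [simp]:
  "carrier (killed P) = {y \<in> carrier P. x \<odot>\<^bsub>P\<^esub> y = (zero P)}" "\<zero>\<^bsub>killed P\<^esub> = (zero P)" "add (killed P) = add P" "smult (killed P) = smult P"
  by (simp_all add: killed_def)

lemma lin_x:
  assumes "module R P" shows "lin R P P (\<lambda>y. x \<odot>\<^bsub>P\<^esub> y)"
proof -
  interpret P: module R P by fact
  show ?thesis by (auto simp: lin_def P.smult_r_distr R.m_comm simp flip: P.smult_assoc1)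
qed

lemma killed_is_module:
  assumes "module R P" shows "module R (killed P)"
  unfolding killed_def by (rule submodule.submodule_is_module[OF submodule_kernel[OF assms assms lin_x[OF assms]] assms])

lemma killed_compat:
  assumes "module R P" shows "compat (killed P) (induced_module (killed P))"
  by (rule induced_module_compat[OF killed_is_module[OF assms]]) simp

lemma lin_killed:
  assumes "module R P" "module R P'" "lin R P P' f" shows "lin R (killed P) (killed P') f"
  using assms(3) lin_zero[OF assms] by (auto simp: lin_def Pi_iff) (metis x_closed)

text \<open>Hom(S, -) preserves injectives. The ideal is pulled back to R; x lies in the preimage
  and is sent to zero, so the q found over R is killed by x.\<close>

lemma baer_killed:
  assumes P: "baer R P" shows "baer S (induced_module (killed P))"
  unfolding baer_def
proof (intro conjI allI impI; (elim conjE)?)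
  interpret P: module R P using P by (simp add: baer_def)
  note C = killed_compat[OF P.module_axioms]
  note cm = compat_modules[OF C]
  interpret N: module S "induced_module (killed P)" by (rule cm)
  let ?N = "induced_module (killed P)"
  show "module S ?N" by (rule cm)
  fix I g assume I: "ideal I S" and g: "\<forall>a\<in>I. g a \<in> carrier ?N"
    "\<forall>a\<in>I. \<forall>b\<in>I. g (a \<oplus>\<^bsub>S\<^esub> b) = g a \<oplus>\<^bsub>?N\<^esub> g b" "\<forall>r\<in>carrier S. \<forall>a\<in>I. g (r \<otimes>\<^bsub>S\<^esub> a) = r \<odot>\<^bsub>?N\<^esub> g a"
  interpret I: ideal I S by fact
  have sm: "r \<odot>\<^bsub>P\<^esub> m = \<pi> r \<odot>\<^bsub>?N\<^esub> m" if "r \<in> carrier R" "m \<in> carrier ?N" for r m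
    using compat_smult[OF C that] by simp
  let ?J = "{r \<in> carrier R. \<pi> r \<in> I}"
  have z: "(zero S) \<in> I" by simp
  have J: "ideal ?J R"
    by (rule R.ideal_of_closed) (use z in \<open>auto simp: pi_add pi_mult I.I_l_closed\<close>)
  have gN: "g (\<pi> r) \<in> carrier ?N" if "r \<in> ?J" for r using g(1) that by blast
  have g0: "g (zero S) = (zero P)"
  proof -
    have "g ((zero S) \<otimes>\<^bsub>S\<^esub> (zero S)) = (zero S) \<odot>\<^bsub>?N\<^esub> g (zero S)" using g(3) z S.zero_closed by blast
    then show ?thesis using g(1) z cm(4) by simp
  qed
  obtain q where q: "q \<in> carrier P" "\<forall>a\<in>?J. g (\<pi> a) = a \<odot>\<^bsub>P\<^esub> q"
  proof (rule baerD[OF P J, of "\<lambda>r. g (\<pi> r)"])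
    show "g (\<pi> a) \<in> carrier P" if "a \<in> ?J" for a using gN[OF that] by (simp flip: cm(3))
    show "g (\<pi> (a \<oplus>\<^bsub>R\<^esub> b)) = g (\<pi> a) \<oplus>\<^bsub>P\<^esub> g (\<pi> b)" if "a \<in> ?J" "b \<in> ?J" for a b
      using g(2) that cm(5) by (simp add: pi_add)
    show "g (\<pi> (r \<otimes>\<^bsub>R\<^esub> a)) = r \<odot>\<^bsub>P\<^esub> g (\<pi> a)" if "r \<in> carrier R" "a \<in> ?J" for r a
      using g(3) that sm[OF that(1) gN[OF that(2)]] by (simp add: pi_mult)
  qed
  have "x \<odot>\<^bsub>P\<^esub> q = (zero P)" using q(2) z g0 by (metis (no_types, lifting) mem_Collect_eq pi_x x_closed)
  then have qN: "q \<in> carrier ?N" using q(1) by (simp flip: cm(3))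
  have "g a = a \<odot>\<^bsub>?N\<^esub> q" if a: "a \<in> I" for a
  proof -
    obtain r where r: "r \<in> carrier R" "a = \<pi> r" using pi_lift[OF I.Icarr[OF a]] by blast
    then show ?thesis using q(2) a sm[OF r(1) qN] by auto
  qed
  with qN show "\<exists>q\<in>carrier ?N. \<forall>a\<in>I. g a = a \<odot>\<^bsub>?N\<^esub> q" by blast
qed

text \<open>On the ideal xR, sending x r to r y is well defined because x is regular; Baer's
  criterion writes this map as multiplication by some q, and evaluating it at x gives x q =
  y.\<close>

lemma baer_divisible:
  assumes P: "baer R P" and y: "y \<in> carrier P" shows "\<exists>z\<in>carrier P. x \<odot>\<^bsub>P\<^esub> z = y"
proof -
  interpret P: module R P using P by (simp add: baer_def)
  let ?I = "{x \<otimes>\<^bsub>R\<^esub> r | r. r \<in> carrier R}"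
  define k where "k a = (SOME r. r \<in> carrier R \<and> a = x \<otimes>\<^bsub>R\<^esub> r)" for a
  have cancel: "r = s" if "r \<in> carrier R" "s \<in> carrier R" "x \<otimes>\<^bsub>R\<^esub> r = x \<otimes>\<^bsub>R\<^esub> s" for r s
  proof -
    have "x \<otimes>\<^bsub>R\<^esub> (r \<ominus>\<^bsub>R\<^esub> s) = (zero R)" using that by (simp add: R.minus_eq R.r_distr R.r_minus R.r_neg)
    from regular[OF _ this] that show ?thesis by simp
  qed
  have k: "k (x \<otimes>\<^bsub>R\<^esub> r) = r" if r: "r \<in> carrier R" for r
  proof -
    have "k (x \<otimes>\<^bsub>R\<^esub> r) \<in> carrier R \<and> x \<otimes>\<^bsub>R\<^esub> r = x \<otimes>\<^bsub>R\<^esub> k (x \<otimes>\<^bsub>R\<^esub> r)" unfolding k_def by (rule someI[of _ r]) (use r in simp)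
    then show ?thesis using cancel[of r "k (x \<otimes>\<^bsub>R\<^esub> r)"] r by simp
  qed
  have I: "ideal ?I R"
  proof (rule R.ideal_of_closed)
    show "(zero R) \<in> ?I" using R.r_null[OF x_closed] R.zero_closed by force
    show "a \<oplus>\<^bsub>R\<^esub> b \<in> ?I" if "a \<in> ?I" "b \<in> ?I" for a b using that by (force simp flip: R.r_distr[OF _ _ x_closed])
    show "r \<otimes>\<^bsub>R\<^esub> a \<in> ?I" if ra: "r \<in> carrier R" "a \<in> ?I" for r a
    proof -
      obtain s where "s \<in> carrier R" "a = x \<otimes>\<^bsub>R\<^esub> s" using ra(2) by blast
      with ra(1) have "r \<otimes>\<^bsub>R\<^esub> a = x \<otimes>\<^bsub>R\<^esub> (r \<otimes>\<^bsub>R\<^esub> s)" by (simp add: R.m_lcomm)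
      with ra(1) \<open>s \<in> carrier R\<close> show ?thesis by blast
    qed
  qed auto
  obtain q where q: "q \<in> carrier P" "\<forall>a\<in>?I. k a \<odot>\<^bsub>P\<^esub> y = a \<odot>\<^bsub>P\<^esub> q"
  proof (rule baerD[OF P I, of "\<lambda>a. k a \<odot>\<^bsub>P\<^esub> y"])
    show "k a \<odot>\<^bsub>P\<^esub> y \<in> carrier P" if "a \<in> ?I" for a using that k y by auto
    show "k (a \<oplus>\<^bsub>R\<^esub> b) \<odot>\<^bsub>P\<^esub> y = k a \<odot>\<^bsub>P\<^esub> y \<oplus>\<^bsub>P\<^esub> k b \<odot>\<^bsub>P\<^esub> y" if "a \<in> ?I" "b \<in> ?I" for a b
      using that y by (auto simp: k P.smult_l_distr simp flip: R.r_distr[OF _ _ x_closed])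
    show "k (r \<otimes>\<^bsub>R\<^esub> a) \<odot>\<^bsub>P\<^esub> y = r \<odot>\<^bsub>P\<^esub> (k a \<odot>\<^bsub>P\<^esub> y)" if ra: "r \<in> carrier R" "a \<in> ?I" for r a
    proof -
      obtain s where s: "s \<in> carrier R" "a = x \<otimes>\<^bsub>R\<^esub> s" using ra(2) by blast
      have "r \<otimes>\<^bsub>R\<^esub> a = x \<otimes>\<^bsub>R\<^esub> (r \<otimes>\<^bsub>R\<^esub> s)" using ra(1) s by (simp add: R.m_lcomm)
      then show ?thesis using ra(1) s y by (simp add: k P.smult_assoc1)
    qed
  qed
  have "x \<otimes>\<^bsub>R\<^esub> \<one>\<^bsub>R\<^esub> \<in> ?I" using R.one_closed by blast
  from bspec[OF q(2) this] have "x \<odot>\<^bsub>P\<^esub> q = y" using y k[OF R.one_closed] by simp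
  with q(1) show ?thesis by blast
qed

end

section \<open>The injective resolution of S\<close>

locale gorenstein_quotient = regular_quotient +
  fixes n :: nat and I :: "nat => ('a, nat => 'a) module" and d and \<eta>
  assumes inj_res: "injective_resolution R (regular_module R) n I d \<eta>"
begin

lemma I_baer: "baer R (I i)"
  by (rule injective_imp_baer[OF R.is_cring]) (use inj_res in \<open>simp add: injective_resolution_def\<close>)

lemma I_module: "module R (I i)"
  using I_baer by (simp add: baer_def)

lemma d_lin: "lin R (I i) (I (Suc i)) (d i)"
  and d_exact: "d i ` carrier (I i) = {y \<in> carrier (I (Suc i)). d (Suc i) y = \<zero>\<^bsub>I (Suc (Suc i))\<^esub>}"
  and eta_lin: "lin R Rg (I 0) \<eta>" and eta_inj: "inj_on \<eta> (carrier R)"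
  and eta_exact: "\<eta> ` carrier R = {y \<in> carrier (I 0). d 0 y = \<zero>\<^bsub>I (Suc 0)\<^esub>}"
  and I_zero: "n < i ==> zero_module (I i)"
  using inj_res by (auto simp: injective_resolution_def mod_hom_iff mod_kernel_def)

abbreviation J where "J i \<equiv> killed (I i)"
abbreviation SJ where "SJ i \<equiv> induced_module (killed (I i))"

lemma J_module: "module R (J i)" by (rule killed_is_module[OF I_module])
lemma J_compat: "compat (J i) (SJ i)" by (rule killed_compat[OF I_module])
lemma J_lin: "lin R (J i) (J (Suc i)) (d i)" by (rule lin_killed[OF I_module I_module d_lin])

lemma d_d: "y \<in> carrier (I i) ==> d (Suc i) (d i y) = \<zero>\<^bsub>I (Suc (Suc i))\<^esub>"
  using d_exact[of i] by blast

lemma d_eta: "r \<in> carrier R ==> d 0 (\<eta> r) = \<zero>\<^bsub>I (Suc 0)\<^esub>"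
  using eta_exact by blast

text \<open>An element of \<open>J 0\<close> killed by d is \<eta> r with x r = 0. In other words
  Hom(S, R) = 0.\<close>

lemma d0_inj: "inj_on (d 0) (carrier (J 0))"
proof (rule lin_inj_on[OF J_module J_module J_lin])
  fix y assume y: "y \<in> carrier (J 0)" "d 0 y = \<zero>\<^bsub>J (Suc 0)\<^esub>"
  then have "y \<in> \<eta> ` carrier R" unfolding eta_exact by simp
  then obtain r where r: "r \<in> carrier R" "y = \<eta> r" by blast
  have "\<eta> (x \<otimes>\<^bsub>R\<^esub> r) = \<eta> (zero R)"
    using y(1) r lin_smult[OF eta_lin x_closed] lin_zero[OF Rg.module_axioms I_module eta_lin] by simp
  then have "x \<otimes>\<^bsub>R\<^esub> r = (zero R)" using eta_inj r(1) by (simp add: inj_on_eq_iff)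
  then have "r = (zero R)" by (rule regular[OF r(1)])
  then show "y = \<zero>\<^bsub>J 0\<^esub>" using r(2) lin_zero[OF Rg.module_axioms I_module eta_lin] by simp
qed

text \<open>\<open>SJ 0\<close> is injective over S, so the inverse of the embedding into
  \<open>SJ (Suc 0)\<close>, defined on the image, extends to the whole module.\<close>

lemma retraction_exists: "\<exists>\<rho>. lin R (J (Suc 0)) (J 0) \<rho> \<and> (\<forall>y\<in>carrier (J 0). \<rho> (d 0 y) = y)"
proof -
  have S0: "module S (SJ 0)" and S1: "module S (SJ (Suc 0))" by (rule compat_modules[OF J_compat])+
  have l: "lin S (SJ 0) (SJ (Suc 0)) (d 0)" using J_lin compat_lin[OF J_compat J_compat] by blast
  let ?A = "d 0 ` carrier (SJ 0)"
  have A: "submodule ?A S (SJ (Suc 0))" by (rule submodule_image[OF S0 S1 l])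
  have c: "carrier (SJ i) = carrier (J i)" for i using compat_modules(3)[OF J_compat] by simp
  have inj: "inj_on (d 0) (carrier (SJ 0))" using d0_inj unfolding c .
  let ?g = "inv_into (carrier (SJ 0)) (d 0)"
  interpret S0: module S "SJ 0" by (rule S0)
  have gi: "?g (d 0 y) = y" if "y \<in> carrier (SJ 0)" for y using inj that by simp
  have "lin S (SJ (Suc 0)\<lparr>carrier := ?A\<rparr>) (SJ 0) ?g"
    unfolding lin_def
  proof (intro conjI ballI funcsetI)
    fix u assume "u \<in> carrier (SJ (Suc 0)\<lparr>carrier := ?A\<rparr>)"
    then obtain y where y: "y \<in> carrier (SJ 0)" "u = d 0 y" by auto
    show "?g u \<in> carrier (SJ 0)" unfolding y(2) gi[OF y(1)] by (rule y(1))
    show "?g (s \<odot>\<^bsub>SJ (Suc 0)\<lparr>carrier := ?A\<rparr>\<^esub> u) = s \<odot>\<^bsub>SJ 0\<^esub> ?g u" if s: "s \<in> carrier S" for s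
    proof -
      have "?g (d 0 (s \<odot>\<^bsub>SJ 0\<^esub> y)) = s \<odot>\<^bsub>SJ 0\<^esub> y" by (rule gi[OF S0.smult_closed[OF s y(1)]])
      then show ?thesis unfolding y(2) gi[OF y(1)] lin_smult[OF l s y(1)] by simp
    qed
    fix u' assume "u' \<in> carrier (SJ (Suc 0)\<lparr>carrier := ?A\<rparr>)"
    then obtain y' where y': "y' \<in> carrier (SJ 0)" "u' = d 0 y'" by auto
    have "?g (d 0 (y \<oplus>\<^bsub>SJ 0\<^esub> y')) = y \<oplus>\<^bsub>SJ 0\<^esub> y'" by (rule gi[OF S0.M.a_closed[OF y(1) y'(1)]])
    then show "?g (u \<oplus>\<^bsub>SJ (Suc 0)\<lparr>carrier := ?A\<rparr>\<^esub> u') = ?g u \<oplus>\<^bsub>SJ 0\<^esub> ?g u'"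
      unfolding y(2) y'(2) gi[OF y(1)] gi[OF y'(1)] lin_add[OF l y(1) y'(1)] by simp
  qed
  then obtain \<rho> where \<rho>: "lin S (SJ (Suc 0)) (SJ 0) \<rho>" "\<forall>a\<in>?A. \<rho> a = ?g a"
    by (rule baer_extend[OF baer_killed[OF I_baer] S1 A])
  have "\<rho> (d 0 y) = y" if "y \<in> carrier (J 0)" for y
    using \<rho>(2) gi[of y] that unfolding c by simp
  then show ?thesis using \<rho>(1) compat_lin[OF J_compat J_compat] by blast
qed

definition \<rho> where "\<rho> = (SOME \<rho>. lin R (J (Suc 0)) (J 0) \<rho> \<and> (\<forall>y\<in>carrier (J 0). \<rho> (d 0 y) = y))"

lemma rho_lin: "lin R (J (Suc 0)) (J 0) \<rho>" and rho_d: "y \<in> carrier (J 0) ==> \<rho> (d 0 y) = y"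
  using someI_ex[OF retraction_exists] unfolding \<rho>_def by blast+

text \<open>The projection of \<open>J (Suc 0)\<close> onto the complement of the image of
  \<open>J 0\<close> that the retraction determines.\<close>

definition pr where "pr y = y \<ominus>\<^bsub>J (Suc 0)\<^esub> d 0 (\<rho> y)"

lemma d_rho: "y \<in> carrier (J (Suc 0)) ==> d 0 (\<rho> y) \<in> carrier (J (Suc 0))"
  using lin_closed[OF J_lin[of 0] lin_closed[OF rho_lin]] .

lemma pr_lin: "lin R (J (Suc 0)) (J (Suc 0)) pr"
proof -
  interpret J1: module R "J (Suc 0)" by (rule J_module)
  have c: "d 0 (\<rho> y) \<in> carrier (J (Suc 0))" if "y \<in> carrier (J (Suc 0))" for y using d_rho that .
  note l = lin_comp[OF rho_lin J_lin[of 0]]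
  show ?thesis
    unfolding lin_def pr_def
  proof (intro conjI ballI funcsetI)
    fix y assume y: "y \<in> carrier (J (Suc 0))"
    show "y \<ominus>\<^bsub>J (Suc 0)\<^esub> d 0 (\<rho> y) \<in> carrier (J (Suc 0))" by (rule J1.M.minus_closed[OF y c[OF y]])
    show "(r \<odot>\<^bsub>J (Suc 0)\<^esub> y) \<ominus>\<^bsub>J (Suc 0)\<^esub> d 0 (\<rho> (r \<odot>\<^bsub>J (Suc 0)\<^esub> y)) = r \<odot>\<^bsub>J (Suc 0)\<^esub> (y \<ominus>\<^bsub>J (Suc 0)\<^esub> d 0 (\<rho> y))" if r: "r \<in> carrier R" for r
      unfolding lin_smult[OF l r y] J1.M.minus_eq J1.smult_r_distr[OF r y J1.M.a_inv_closed[OF c[OF y]]] J1.smult_r_minus[OF r c[OF y]] ..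
    fix y' assume y': "y' \<in> carrier (J (Suc 0))"
    show "(y \<oplus>\<^bsub>J (Suc 0)\<^esub> y') \<ominus>\<^bsub>J (Suc 0)\<^esub> d 0 (\<rho> (y \<oplus>\<^bsub>J (Suc 0)\<^esub> y')) = (y \<ominus>\<^bsub>J (Suc 0)\<^esub> d 0 (\<rho> y)) \<oplus>\<^bsub>J (Suc 0)\<^esub> (y' \<ominus>\<^bsub>J (Suc 0)\<^esub> d 0 (\<rho> y'))"
      unfolding lin_add[OF l y y'] using y y' c[OF y] c[OF y']
      by (simp add: J1.M.minus_eq J1.M.minus_add J1.M.a_ac del: killed_simps)
  qed
qed

lemma pr_d: "y \<in> carrier (J 0) ==> pr (d 0 y) = \<zero>\<^bsub>J (Suc 0)\<^esub>"
proof -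
  interpret J1: module R "J (Suc 0)" by (rule J_module)
  assume y: "y \<in> carrier (J 0)"
  show ?thesis unfolding pr_def rho_d[OF y] by (rule J1.M.minus_self[OF lin_closed[OF J_lin y]])
qed

lemma rho_pr: "y \<in> carrier (J (Suc 0)) ==> \<rho> (pr y) = \<zero>\<^bsub>J 0\<^esub>"
proof -
  interpret J0: module R "J 0" by (rule J_module)
  assume y: "y \<in> carrier (J (Suc 0))"
  show ?thesis
    unfolding pr_def lin_minus[OF J_module J_module rho_lin y d_rho[OF y]] rho_d[OF lin_closed[OF rho_lin y]]
    by (rule J0.M.minus_self[OF lin_closed[OF rho_lin y]])
qed

text \<open>The kernel of the retraction stands for the quotient of \<open>J (Suc 0)\<close> by the
  image of \<open>J 0\<close>; being a submodule it keeps the element type.\<close>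

definition K0 where "K0 = (J (Suc 0))\<lparr>carrier := {y \<in> carrier (J (Suc 0)). \<rho> y = \<zero>\<^bsub>J 0\<^esub>}\<rparr>"

lemma K0_module: "module R K0"
  unfolding K0_def by (rule submodule.submodule_is_module[OF submodule_kernel[OF J_module J_module rho_lin] J_module])

lemma K0_carrier: "carrier K0 = {y \<in> carrier (J (Suc 0)). \<rho> y = \<zero>\<^bsub>J 0\<^esub>}"
  and K0_ops: "(zero K0) = \<zero>\<^bsub>J (Suc 0)\<^esub>" "add K0 = add (J (Suc 0))" "smult K0 = smult (J (Suc 0))"
  by (simp_all add: K0_def)

lemma pr_mem: "y \<in> carrier (J (Suc 0)) ==> pr y \<in> carrier K0"
  unfolding K0_carrier using lin_closed[OF pr_lin] rho_pr by blast

lemma pr_id: "y \<in> carrier K0 ==> pr y = y"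
proof -
  interpret J1: module R "J (Suc 0)" by (rule J_module)
  assume "y \<in> carrier K0"
  then have y: "y \<in> carrier (J (Suc 0))" "\<rho> y = \<zero>\<^bsub>J 0\<^esub>" by (auto simp: K0_carrier)
  show ?thesis unfolding pr_def y(2) lin_zero[OF J_module J_module J_lin] by (rule J1.M.minus_zero_right[OF y(1)])
qed

lemma K0_compat: "compat K0 (induced_module K0)"
  by (rule induced_module_compat[OF K0_module]) (auto simp: K0_def)

lemma d_pr: "y \<in> carrier (J (Suc 0)) ==> d (Suc 0) (pr y) = d (Suc 0) y"
proof -
  interpret J2: module R "J (Suc (Suc 0))" by (rule J_module)
  assume y: "y \<in> carrier (J (Suc 0))"
  have "\<rho> y \<in> carrier (I 0)" using lin_closed[OF rho_lin y] by simp
  then have "d (Suc 0) (d 0 (\<rho> y)) = \<zero>\<^bsub>J (Suc (Suc 0))\<^esub>" using d_d by simp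
  then show ?thesis
    unfolding pr_def lin_minus[OF J_module J_module J_lin y d_rho[OF y]]
    using J2.M.minus_zero_right[OF lin_closed[OF J_lin y]] by (simp only:)
qed

text \<open>A direct summand of an injective module is injective: solve in \<open>SJ (Suc 0)\<close>
  and project the solution with \<open>pr\<close>.\<close>

lemma baer_K0: "baer S (induced_module K0)"
  unfolding baer_def
proof (intro conjI allI impI; (elim conjE)?)
  let ?N = "induced_module K0" and ?M = "SJ (Suc 0)"
  note cK = compat_modules[OF K0_compat] and cJ = compat_modules[OF J_compat[of "Suc 0"]]
  show "module S ?N" by (rule cK)
  interpret N: module S ?N by (rule cK)
  interpret M: module S ?M by (rule cJ)
  have lp: "lin S ?M ?M pr" using pr_lin compat_lin[OF J_compat J_compat] by blast
  have sub: "m \<in> carrier ?M" if "m \<in> carrier ?N" for m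
    using that unfolding cK(3)[symmetric] cJ(3)[symmetric] K0_carrier by blast
  have sm: "s \<odot>\<^bsub>?N\<^esub> m = s \<odot>\<^bsub>?M\<^esub> m" if sm: "s \<in> carrier S" "m \<in> carrier ?N" for s m
  proof -
    obtain r where r: "r \<in> carrier R" "s = \<pi> r" using pi_lift[OF sm(1)] by blast
    show ?thesis
      unfolding r(2) compat_smult[OF K0_compat r(1) sm(2)] compat_smult[OF J_compat r(1) sub[OF sm(2)]] K0_ops ..
  qed
  have add: "add ?N = add ?M" using cK(5) cJ(5) K0_ops(2) by simp
  fix I g assume I: "ideal I S" and g: "\<forall>a\<in>I. g a \<in> carrier ?N"
    "\<forall>a\<in>I. \<forall>b\<in>I. g (a \<oplus>\<^bsub>S\<^esub> b) = g a \<oplus>\<^bsub>?N\<^esub> g b" "\<forall>r\<in>carrier S. \<forall>a\<in>I. g (r \<otimes>\<^bsub>S\<^esub> a) = r \<odot>\<^bsub>?N\<^esub> g a"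
  interpret I: ideal I S by fact
  obtain q where q: "q \<in> carrier ?M" "\<forall>a\<in>I. g a = a \<odot>\<^bsub>?M\<^esub> q"
  proof (rule baerD[OF baer_killed[OF I_baer] I, of g])
    show "g a \<in> carrier ?M" if "a \<in> I" for a using sub g(1) that by blast
    show "g (a \<oplus>\<^bsub>S\<^esub> b) = g a \<oplus>\<^bsub>?M\<^esub> g b" if "a \<in> I" "b \<in> I" for a b using g(2) that by (simp add: add)
    show "g (r \<otimes>\<^bsub>S\<^esub> a) = r \<odot>\<^bsub>?M\<^esub> g a" if "r \<in> carrier S" "a \<in> I" for r a using g(1,3) that sm by simp
  qed
  have qN: "pr q \<in> carrier ?N" using pr_mem[of q] q(1) unfolding cK(3)[symmetric] cJ(3)[symmetric] by blast
  have "g a = a \<odot>\<^bsub>?N\<^esub> pr q" if a: "a \<in> I" for a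
  proof -
    have aS: "a \<in> carrier S" by (rule I.Icarr[OF a])
    have "g a \<in> carrier K0" using g(1) a unfolding cK(3) by blast
    then have "g a = pr (g a)" by (simp add: pr_id)
    also have "\<dots> = pr (a \<odot>\<^bsub>?M\<^esub> q)" using q(2) a by simp
    also have "\<dots> = a \<odot>\<^bsub>?M\<^esub> pr q" by (rule lin_smult[OF lp aS q(1)])
    finally show ?thesis using sm[OF aS qN] by simp
  qed
  with qN show "\<exists>q\<in>carrier ?N. \<forall>a\<in>I. g a = a \<odot>\<^bsub>?N\<^esub> q" by blast
qed

text \<open>The connecting map \<open>R \<rightarrow> J\<^sub>1 / d J\<^sub>0\<close>, with kernel \<open>xR\<close>.\<close>

definition \<zeta> where "\<zeta> r = pr (d 0 (SOME z. z \<in> carrier (I 0) \<and> x \<odot>\<^bsub>I 0\<^esub> z = \<eta> r))"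

lemma d_z_mem:
  assumes "r \<in> carrier R" "z \<in> carrier (I 0)" "x \<odot>\<^bsub>I 0\<^esub> z = \<eta> r" shows "d 0 z \<in> carrier (J (Suc 0))"
  using lin_closed[OF d_lin assms(2)] lin_smult[OF d_lin x_closed assms(2), symmetric] d_eta[OF assms(1)] assms(3) by simp

text \<open>Two such z differ by an element of \<open>J 0\<close>, whose image under d is killed by
  \<open>pr\<close>.\<close>

lemma zeta_eq:
  assumes r: "r \<in> carrier R" and z: "z \<in> carrier (I 0)" "x \<odot>\<^bsub>I 0\<^esub> z = \<eta> r" shows "\<zeta> r = pr (d 0 z)"
proof -
  interpret I0: module R "I 0" by (rule I_module)
  interpret J1: module R "J (Suc 0)" by (rule J_module)
  let ?z = "SOME z. z \<in> carrier (I 0) \<and> x \<odot>\<^bsub>I 0\<^esub> z = \<eta> r"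
  have z': "?z \<in> carrier (I 0) \<and> x \<odot>\<^bsub>I 0\<^esub> ?z = \<eta> r" by (rule someI[of _ z]) (use z in simp)
  have "x \<odot>\<^bsub>I 0\<^esub> (?z \<ominus>\<^bsub>I 0\<^esub> z) = \<zero>\<^bsub>I 0\<^esub>"
    using lin_minus[OF I_module I_module lin_x[OF I_module] conjunct1[OF z'] z(1)] z z' lin_closed[OF eta_lin, of r] r by simp
  then have j: "?z \<ominus>\<^bsub>I 0\<^esub> z \<in> carrier (J 0)" using z z' by simp
  have a: "d 0 ?z \<in> carrier (J (Suc 0))" and b: "d 0 z \<in> carrier (J (Suc 0))" using d_z_mem[OF r] z z' by blast+
  have e: "(?z \<ominus>\<^bsub>I 0\<^esub> z) \<oplus>\<^bsub>I 0\<^esub> z = ?z" using z z' by simp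
  have "d 0 ((?z \<ominus>\<^bsub>I 0\<^esub> z) \<oplus>\<^bsub>I 0\<^esub> z) = d 0 (?z \<ominus>\<^bsub>I 0\<^esub> z) \<oplus>\<^bsub>I (Suc 0)\<^esub> d 0 z"
    by (rule lin_add[OF d_lin I0.M.minus_closed[OF conjunct1[OF z'] z(1)] z(1)])
  then have "d 0 ?z = d 0 (?z \<ominus>\<^bsub>I 0\<^esub> z) \<oplus>\<^bsub>I (Suc 0)\<^esub> d 0 z" unfolding e .
  then have "pr (d 0 ?z) = pr (d 0 (?z \<ominus>\<^bsub>I 0\<^esub> z) \<oplus>\<^bsub>J (Suc 0)\<^esub> d 0 z)" by simp
  also have "\<dots> = pr (d 0 (?z \<ominus>\<^bsub>I 0\<^esub> z)) \<oplus>\<^bsub>J (Suc 0)\<^esub> pr (d 0 z)" by (rule lin_add[OF pr_lin lin_closed[OF J_lin j] b])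
  also have "\<dots> = pr (d 0 z)" unfolding pr_d[OF j] by (rule J1.M.l_zero[OF lin_closed[OF pr_lin b]])
  finally show ?thesis by (simp add: \<zeta>_def)
qed

lemma zeta_witness:
  assumes "r \<in> carrier R" obtains z where "z \<in> carrier (I 0)" "x \<odot>\<^bsub>I 0\<^esub> z = \<eta> r" "\<zeta> r = pr (d 0 z)" "d 0 z \<in> carrier (J (Suc 0))"
proof -
  obtain z where z: "z \<in> carrier (I 0)" "x \<odot>\<^bsub>I 0\<^esub> z = \<eta> r"
    using baer_divisible[OF I_baer, of "\<eta> r" 0] lin_closed[OF eta_lin] assms by auto
  then show ?thesis by (intro that[OF z zeta_eq[OF assms z] d_z_mem[OF assms z]])
qed

lemma zeta_lin: "lin R Rg K0 \<zeta>"
  unfolding lin_def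
proof (intro conjI ballI funcsetI)
  interpret I0: module R "I 0" by (rule I_module)
  fix r assume "r \<in> carrier Rg"
  then have r: "r \<in> carrier R" by simp
  obtain z where z: "z \<in> carrier (I 0)" "x \<odot>\<^bsub>I 0\<^esub> z = \<eta> r" "\<zeta> r = pr (d 0 z)" "d 0 z \<in> carrier (J (Suc 0))" using r by (rule zeta_witness)
  show "\<zeta> r \<in> carrier K0" unfolding z(3) by (rule pr_mem[OF z(4)])
  show "\<zeta> (c \<odot>\<^bsub>Rg\<^esub> r) = c \<odot>\<^bsub>K0\<^esub> \<zeta> r" if c: "c \<in> carrier R" for c
  proof -
    have "x \<odot>\<^bsub>I 0\<^esub> (c \<odot>\<^bsub>I 0\<^esub> z) = \<eta> (c \<otimes>\<^bsub>R\<^esub> r)"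
      using c r z lin_smult[OF eta_lin c] by (metis I0.smult_assoc1 R.m_comm regular_module_simps(1,4) x_closed)
    from zeta_eq[OF _ _ this] have "\<zeta> (c \<otimes>\<^bsub>R\<^esub> r) = pr (d 0 (c \<odot>\<^bsub>I 0\<^esub> z))" using c r z(1) by simp
    also have "\<dots> = pr (c \<odot>\<^bsub>J (Suc 0)\<^esub> d 0 z)" using lin_smult[OF d_lin c z(1)] by simp
    also have "\<dots> = c \<odot>\<^bsub>J (Suc 0)\<^esub> pr (d 0 z)" by (rule lin_smult[OF pr_lin c z(4)])
    finally show ?thesis by (simp add: z(3) K0_ops)
  qed
  fix r' assume "r' \<in> carrier Rg"
  then have r': "r' \<in> carrier R" by simp
  obtain z' where z': "z' \<in> carrier (I 0)" "x \<odot>\<^bsub>I 0\<^esub> z' = \<eta> r'" "\<zeta> r' = pr (d 0 z')" "d 0 z' \<in> carrier (J (Suc 0))" using r' by (rule zeta_witness)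
  have "x \<odot>\<^bsub>I 0\<^esub> (z \<oplus>\<^bsub>I 0\<^esub> z') = \<eta> (r \<oplus>\<^bsub>R\<^esub> r')"
    using r r' z z' lin_add[OF eta_lin, of r r'] by (simp add: I0.smult_r_distr)
  from zeta_eq[OF _ _ this] have "\<zeta> (r \<oplus>\<^bsub>R\<^esub> r') = pr (d 0 (z \<oplus>\<^bsub>I 0\<^esub> z'))" using r r' z(1) z'(1) by simp
  also have "\<dots> = pr (d 0 z \<oplus>\<^bsub>J (Suc 0)\<^esub> d 0 z')" using lin_add[OF d_lin z(1) z'(1)] by simp
  also have "\<dots> = pr (d 0 z) \<oplus>\<^bsub>J (Suc 0)\<^esub> pr (d 0 z')" by (rule lin_add[OF pr_lin z(4) z'(4)])
  finally show "\<zeta> (r \<oplus>\<^bsub>Rg\<^esub> r') = \<zeta> r \<oplus>\<^bsub>K0\<^esub> \<zeta> r'" by (simp add: z(3) z'(3) K0_ops)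
qed

text \<open>If \<zeta> r = 0, then z can be corrected by an element of \<open>J 0\<close> so that d
  kills it, which makes it some \<eta> s; multiplying by x gives r = x s.\<close>

lemma zeta_kernel:
  assumes r: "r \<in> carrier R" shows "\<zeta> r = (zero K0) \<longleftrightarrow> \<pi> r = (zero S)"
proof
  interpret I0: module R "I 0" by (rule I_module)
  interpret I1: module R "I (Suc 0)" by (rule I_module)
  interpret J1: module R "J (Suc 0)" by (rule J_module)
  interpret J0: module R "J 0" by (rule J_module)
  {
    assume "\<pi> r = (zero S)"
    then obtain s where s: "s \<in> carrier R" "r = x \<otimes>\<^bsub>R\<^esub> s" using kernel[OF r] by blast
    have es: "\<eta> s \<in> carrier (I 0)" using lin_closed[OF eta_lin] s(1) by simp
    have "\<zeta> r = pr (d 0 (\<eta> s))" by (rule zeta_eq[OF r es]) (use lin_smult[OF eta_lin x_closed] s in simp)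
    also have "\<dots> = \<zero>\<^bsub>J (Suc 0)\<^esub>" using lin_zero[OF J_module J_module pr_lin] d_eta[OF s(1)] by simp
    finally show "\<zeta> r = (zero K0)" by (simp add: K0_ops)
  next
    assume 0: "\<zeta> r = (zero K0)"
    obtain z where z: "z \<in> carrier (I 0)" "x \<odot>\<^bsub>I 0\<^esub> z = \<eta> r" "\<zeta> r = pr (d 0 z)" "d 0 z \<in> carrier (J (Suc 0))" using r by (rule zeta_witness)
    let ?j = "\<rho> (d 0 z)"
    have j: "?j \<in> carrier (J 0)" by (rule lin_closed[OF rho_lin z(4)])
    then have jI: "?j \<in> carrier (I 0)" "x \<odot>\<^bsub>I 0\<^esub> ?j = \<zero>\<^bsub>I 0\<^esub>" by simp_all
    have eq: "d 0 z = d 0 ?j"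
      using 0 z(3) J1.M.minus_eq_zero_iff[OF z(4) d_rho[OF z(4)]] by (simp add: pr_def K0_ops)
    have "d 0 (z \<ominus>\<^bsub>I 0\<^esub> ?j) = \<zero>\<^bsub>I (Suc 0)\<^esub>"
      using lin_minus[OF I_module I_module d_lin z(1) jI(1)] eq lin_closed[OF d_lin jI(1)] by simp
    then have "z \<ominus>\<^bsub>I 0\<^esub> ?j \<in> \<eta> ` carrier R" unfolding eta_exact using z(1) jI(1) by simp
    then obtain s where s: "s \<in> carrier R" "z \<ominus>\<^bsub>I 0\<^esub> ?j = \<eta> s" by blast
    have "\<eta> (x \<otimes>\<^bsub>R\<^esub> s) = x \<odot>\<^bsub>I 0\<^esub> (z \<ominus>\<^bsub>I 0\<^esub> ?j)" using lin_smult[OF eta_lin x_closed] s by simp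
    also have "\<dots> = \<eta> r"
      using lin_minus[OF I_module I_module lin_x[OF I_module] z(1) jI(1)] jI(2) z(2) lin_closed[OF eta_lin, of r] r by simp
    finally have "x \<otimes>\<^bsub>R\<^esub> s = r" using eta_inj s(1) r by (simp add: inj_on_eq_iff)
    then show "\<pi> r = (zero S)" using s(1) by (auto simp: pi_mult)
  }
qed

text \<open>A cocycle y in \<open>K0\<close> is d z, and x z is a cocycle because x kills y; so x z
  = \<eta> r and y = \<zeta> r. Together with \<open>zeta_kernel\<close> this identifies Ext of S
  into R in degree 1 with S.\<close>

lemma zeta_image: "\<zeta> ` carrier R = {y \<in> carrier K0. d (Suc 0) y = \<zero>\<^bsub>J (Suc (Suc 0))\<^esub>}"
proof (intro equalityI subsetI)
  fix y assume "y \<in> \<zeta> ` carrier R"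
  then obtain r where r: "r \<in> carrier R" "y = \<zeta> r" by blast
  obtain z where z: "z \<in> carrier (I 0)" "x \<odot>\<^bsub>I 0\<^esub> z = \<eta> r" "\<zeta> r = pr (d 0 z)" "d 0 z \<in> carrier (J (Suc 0))" using r(1) by (rule zeta_witness)
  show "y \<in> {y \<in> carrier K0. d (Suc 0) y = \<zero>\<^bsub>J (Suc (Suc 0))\<^esub>}"
    using pr_mem[OF z(4)] d_pr[OF z(4)] d_d[OF z(1)] by (simp add: r(2) z(3))
next
  interpret I0: module R "I 0" by (rule I_module)
  fix y assume "y \<in> {y \<in> carrier K0. d (Suc 0) y = \<zero>\<^bsub>J (Suc (Suc 0))\<^esub>}"
  then have yK: "y \<in> carrier K0" and dy: "d (Suc 0) y = \<zero>\<^bsub>I (Suc (Suc 0))\<^esub>" by simp_all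
  then have y: "y \<in> carrier (I (Suc 0))" "x \<odot>\<^bsub>I (Suc 0)\<^esub> y = \<zero>\<^bsub>I (Suc 0)\<^esub>" by (simp_all add: K0_carrier)
  then obtain z where z: "z \<in> carrier (I 0)" "y = d 0 z" using d_exact[of 0] dy by blast
  have "d 0 (x \<odot>\<^bsub>I 0\<^esub> z) = \<zero>\<^bsub>I (Suc 0)\<^esub>" using lin_smult[OF d_lin x_closed z(1)] y(2) z(2) by simp
  then have "x \<odot>\<^bsub>I 0\<^esub> z \<in> \<eta> ` carrier R" unfolding eta_exact using z(1) by simp
  then obtain r where r: "r \<in> carrier R" "x \<odot>\<^bsub>I 0\<^esub> z = \<eta> r" by blast
  have "\<zeta> r = y" using zeta_eq[OF r(1) z(1) r(2)] pr_id[OF yK] z(2) by simp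
  with r(1) show "y \<in> \<zeta> ` carrier R" by blast
qed

text \<open>Vanishing of Ext of S into R in degrees from 2 on, by divisibility: y = d z, then x z =
  d w with w = x w', and z - d w' is killed by x.\<close>

lemma J_exact:
  assumes y: "y \<in> carrier (J (Suc (Suc i)))" "d (Suc (Suc i)) y = \<zero>\<^bsub>I (Suc (Suc (Suc i)))\<^esub>"
  obtains z where "z \<in> carrier (J (Suc i))" "y = d (Suc i) z"
proof -
  interpret I1: module R "I (Suc i)" by (rule I_module)
  interpret I2: module R "I (Suc (Suc i))" by (rule I_module)
  have yI: "y \<in> carrier (I (Suc (Suc i)))" "x \<odot>\<^bsub>I (Suc (Suc i))\<^esub> y = \<zero>\<^bsub>I (Suc (Suc i))\<^esub>" using y(1) by simp_all
  obtain z where z: "z \<in> carrier (I (Suc i))" "y = d (Suc i) z" using d_exact[of "Suc i"] yI(1) y(2) by blast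
  have "d (Suc i) (x \<odot>\<^bsub>I (Suc i)\<^esub> z) = \<zero>\<^bsub>I (Suc (Suc i))\<^esub>" using lin_smult[OF d_lin x_closed z(1)] yI(2) z(2) by simp
  then obtain w where w: "w \<in> carrier (I i)" "x \<odot>\<^bsub>I (Suc i)\<^esub> z = d i w" using d_exact[of i] z(1) x_closed I1.smult_closed by blast
  obtain w' where w': "w' \<in> carrier (I i)" "x \<odot>\<^bsub>I i\<^esub> w' = w" using baer_divisible[OF I_baer w(1)] by blast
  have dw': "d i w' \<in> carrier (I (Suc i))" by (rule lin_closed[OF d_lin w'(1)])
  have "x \<odot>\<^bsub>I (Suc i)\<^esub> d i w' = d i w" using lin_smult[OF d_lin x_closed w'(1)] w'(2) by simp
  then have "x \<odot>\<^bsub>I (Suc i)\<^esub> (z \<ominus>\<^bsub>I (Suc i)\<^esub> d i w') = \<zero>\<^bsub>I (Suc i)\<^esub>"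
    using lin_minus[OF I_module I_module lin_x[OF I_module] z(1) dw'] w(2) lin_closed[OF d_lin w(1)] by simp
  then have "z \<ominus>\<^bsub>I (Suc i)\<^esub> d i w' \<in> carrier (J (Suc i))" using z(1) dw' by simp
  moreover have "d (Suc i) (z \<ominus>\<^bsub>I (Suc i)\<^esub> d i w') = y"
    using lin_minus[OF I_module I_module d_lin z(1) dw'] d_d[OF w'(1)] z(2) yI(1) by simp
  ultimately show ?thesis by (intro that) auto
qed

text \<open>Renumbered from 0, so the differential out of \<open>K i\<close> is
  \<open>d (Suc i)\<close> and one position of I is lost.\<close>

definition K where "K i = (case i of 0 => K0 | Suc j => J (Suc (Suc j)))"

lemma K_simps [simp]: "K 0 = K0" "K (Suc j) = J (Suc (Suc j))"
  by (simp_all add: K_def)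

lemma K_compat: "compat (K i) (induced_module (K i))"
  using K0_compat J_compat by (cases i) auto

lemma K_baer: "baer S (induced_module (K i))"
  using baer_K0 baer_killed[OF I_baer] by (cases i) auto

lemma K_lin: "lin R (K i) (K (Suc i)) (d (Suc i))"
proof (cases i)
  case 0
  then show ?thesis using J_lin[of "Suc 0"] by (auto simp: lin_def K0_def)
next
  case (Suc j)
  show ?thesis unfolding Suc K_simps by (rule J_lin)
qed

lemma K_exact: "d (Suc i) ` carrier (K i) = {y \<in> carrier (K (Suc i)). d (Suc (Suc i)) y = \<zero>\<^bsub>K (Suc (Suc i))\<^esub>}"
proof (intro equalityI subsetI)
  fix y assume "y \<in> d (Suc i) ` carrier (K i)"
  then obtain z where z: "z \<in> carrier (K i)" "y = d (Suc i) z" by blast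
  have zI: "z \<in> carrier (I (Suc i))" using z(1) by (cases i) (auto simp: K0_carrier)
  show "y \<in> {y \<in> carrier (K (Suc i)). d (Suc (Suc i)) y = \<zero>\<^bsub>K (Suc (Suc i))\<^esub>}"
    using lin_closed[OF K_lin z(1)] d_d[OF zI] z(2) by simp
next
  fix y assume "y \<in> {y \<in> carrier (K (Suc i)). d (Suc (Suc i)) y = \<zero>\<^bsub>K (Suc (Suc i))\<^esub>}"
  then have "y \<in> carrier (J (Suc (Suc i)))" "d (Suc (Suc i)) y = \<zero>\<^bsub>I (Suc (Suc (Suc i)))\<^esub>" by simp_all
  then obtain z where z: "z \<in> carrier (J (Suc i))" "y = d (Suc i) z" by (rule J_exact)
  show "y \<in> d (Suc i) ` carrier (K i)"
  proof (cases i)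
    case 0
    then show ?thesis using pr_mem[of z] d_pr[of z] z by (intro image_eqI[of _ _ "pr z"]) simp_all
  next
    case (Suc j)
    then show ?thesis using z by auto
  qed
qed

text \<open>The modules \<open>K i\<close> become S-modules by \<open>induced_module\<close> and are
  moved along \<sigma> to the element type that \<open>injective_resolution\<close> demands; the map
  out of S is \<zeta>, which depends only on the class modulo x.\<close>

theorem quotient_injective_resolution:
  fixes \<sigma> :: "(nat => 'a) => (nat => 'c)"
  assumes \<sigma>: "inj \<sigma>"
  shows "\<exists>I' d' \<eta>'. injective_resolution S (regular_module S) n I' d' \<eta>'"
proof -
  define L where "L i = induced_module (K i)" for i
  define T where "T i = image_module \<sigma> (L i)" for i
  define \<eta>0 where "\<eta>0 s = \<zeta> (SOME r. r \<in> carrier R \<and> \<pi> r = s)" for s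
  define D where "D i u = \<sigma> (d (Suc i) (the_inv \<sigma> u))" for i u
  note cL = compat_modules[OF K_compat, folded L_def]
  have Lm: "module S (L i)" for i by (rule cL(2))
  have Tm: "module S (T i)" for i unfolding T_def by (rule image_module_is_module[OF \<sigma> Lm])
  have \<zeta>_eq: "\<zeta> r = \<zeta> r'" if rr: "r \<in> carrier R" "r' \<in> carrier R" and "\<pi> r = \<pi> r'" for r r'
  proof -
    interpret K0: module R K0 by (rule K0_module)
    have "\<zeta> (r \<ominus>\<^bsub>R\<^esub> r') = (zero K0)" using that by (simp add: zeta_kernel pi_minus)
    then have "\<zeta> r \<ominus>\<^bsub>K0\<^esub> \<zeta> r' = (zero K0)"
      using lin_minus[OF Rg.module_axioms K0_module zeta_lin, of r r'] rr by simp
    then show ?thesis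
      using K0.M.minus_eq_zero_iff[of "\<zeta> r" "\<zeta> r'"] lin_closed[OF zeta_lin] rr by simp
  qed
  have \<eta>0: "\<eta>0 (\<pi> r) = \<zeta> r" if r: "r \<in> carrier R" for r
  proof -
    have "(SOME r'. r' \<in> carrier R \<and> \<pi> r' = \<pi> r) \<in> carrier R \<and> \<pi> (SOME r'. r' \<in> carrier R \<and> \<pi> r' = \<pi> r) = \<pi> r"
      by (rule someI[of _ r]) (use r in simp)
    then show ?thesis unfolding \<eta>0_def using r by (intro \<zeta>_eq) blast+
  qed
  have \<eta>0_lin: "lin S Sg (L 0) \<eta>0"
    unfolding lin_def
  proof (intro conjI ballI funcsetI)
    fix s assume "s \<in> carrier Sg"
    then obtain r where r: "r \<in> carrier R" "s = \<pi> r" using pi_lift[of s] by auto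
    have zr: "\<zeta> r \<in> carrier (L 0)" using lin_closed[OF zeta_lin, of r] r(1) cL(3)[of 0] by simp
    show "\<eta>0 s \<in> carrier (L 0)" unfolding r(2) \<eta>0[OF r(1)] by (rule zr)
    show "\<eta>0 (t \<odot>\<^bsub>Sg\<^esub> s) = t \<odot>\<^bsub>L 0\<^esub> \<eta>0 s" if t: "t \<in> carrier S" for t
    proof -
      obtain r' where r': "r' \<in> carrier R" "t = \<pi> r'" using pi_lift[OF t] by blast
      have "\<eta>0 (t \<odot>\<^bsub>Sg\<^esub> s) = \<zeta> (r' \<otimes>\<^bsub>R\<^esub> r)" using \<eta>0[of "r' \<otimes>\<^bsub>R\<^esub> r"] r r' by (simp add: pi_mult)
      also have "\<dots> = r' \<odot>\<^bsub>K0\<^esub> \<zeta> r" using lin_smult[OF zeta_lin r'(1), of r] r(1) by simp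
      also have "\<dots> = t \<odot>\<^bsub>L 0\<^esub> \<zeta> r" unfolding r'(2) L_def using compat_smult[OF K_compat r'(1), of "\<zeta> r" 0] zr by (simp add: L_def)
      finally show ?thesis unfolding r(2) \<eta>0[OF r(1)] .
    qed
    fix s' assume "s' \<in> carrier Sg"
    then obtain r' where r': "r' \<in> carrier R" "s' = \<pi> r'" using pi_lift[of s'] by auto
    have "\<eta>0 (s \<oplus>\<^bsub>Sg\<^esub> s') = \<zeta> (r \<oplus>\<^bsub>R\<^esub> r')" using \<eta>0[of "r \<oplus>\<^bsub>R\<^esub> r'"] r r' by (simp add: pi_add)
    also have "\<dots> = \<zeta> r \<oplus>\<^bsub>L 0\<^esub> \<zeta> r'" using lin_add[OF zeta_lin, of r r'] r(1) r'(1) cL(5)[of 0] by simp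
    finally show "\<eta>0 (s \<oplus>\<^bsub>Sg\<^esub> s') = \<eta>0 s \<oplus>\<^bsub>L 0\<^esub> \<eta>0 s'" unfolding r(2) r'(2) \<eta>0[OF r(1)] \<eta>0[OF r'(1)] .
  qed
  have lD: "lin S (T i) (T (Suc i)) (D i)" for i
  proof -
    have "lin S (L i) (L (Suc i)) (d (Suc i))" unfolding L_def compat_lin[OF K_compat K_compat] by (rule K_lin)
    from lin_comp[OF lin_comp[OF lin_image_module(2)[OF \<sigma>] this] lin_image_module(1)[OF \<sigma>]]
    show ?thesis unfolding T_def D_def .
  qed
  have l\<eta>: "lin S Sg (T 0) (\<lambda>s. \<sigma> (\<eta>0 s))" unfolding T_def by (rule lin_comp[OF \<eta>0_lin lin_image_module(1)[OF \<sigma>]])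
  have cT: "carrier (T i) = \<sigma> ` carrier (K i)" and zT: "\<zero>\<^bsub>T i\<^esub> = \<sigma> \<zero>\<^bsub>K i\<^esub>" for i
    using cL(3,4)[of i] by (simp_all add: T_def)
  have D\<sigma>: "D i (\<sigma> y) = \<sigma> (d (Suc i) y)" for i y using \<sigma> by (simp add: D_def the_inv_f_f)
  have \<sigma>_eq: "\<sigma> a = \<sigma> b \<longleftrightarrow> a = b" for a b using \<sigma> by (simp add: inj_eq)
  have ker: "{u \<in> carrier (T i). D i u = \<zero>\<^bsub>T (Suc i)\<^esub>} = \<sigma> ` {y \<in> carrier (K i). d (Suc i) y = \<zero>\<^bsub>K (Suc i)\<^esub>}" for i
    unfolding cT zT by (auto simp: D\<sigma> \<sigma>_eq simp del: K_simps)
  have exD: "D i ` carrier (T i) = {u \<in> carrier (T (Suc i)). D (Suc i) u = \<zero>\<^bsub>T (Suc (Suc i))\<^esub>}" for i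
    unfolding ker unfolding cT K_exact[symmetric] by (simp add: image_image D\<sigma> del: K_simps)
  have ex\<eta>: "(\<lambda>s. \<sigma> (\<eta>0 s)) ` carrier S = {u \<in> carrier (T 0). D 0 u = \<zero>\<^bsub>T (Suc 0)\<^esub>}"
  proof -
    have "\<eta>0 ` carrier S = \<zeta> ` carrier R" unfolding surj[symmetric] by (simp add: image_image \<eta>0)
    then have "(\<lambda>s. \<sigma> (\<eta>0 s)) ` carrier S = \<sigma> ` \<zeta> ` carrier R" by (metis image_image)
    then show ?thesis unfolding ker zeta_image by simp
  qed
  have inj\<eta>: "inj_on (\<lambda>s. \<sigma> (\<eta>0 s)) (carrier S)"
  proof -
    have "inj_on (\<lambda>s. \<sigma> (\<eta>0 s)) (carrier Sg)"
    proof (rule lin_inj_on[OF Sg.module_axioms Tm l\<eta>])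
      fix s assume s: "s \<in> carrier Sg" "\<sigma> (\<eta>0 s) = \<zero>\<^bsub>T 0\<^esub>"
      then obtain r where r: "r \<in> carrier R" "s = \<pi> r" using pi_lift[of s] by auto
      have "\<zeta> r = (zero K0)" using s(2) unfolding zT \<sigma>_eq r(2) \<eta>0[OF r(1)] by simp
      then show "s = (zero Sg)" using zeta_kernel[OF r(1)] r(2) by simp
    qed
    then show ?thesis by simp
  qed
  have "injective_resolution S Sg n T (\<lambda>i. restrict (D i) (carrier (T i))) (restrict (\<lambda>s. \<sigma> (\<eta>0 s)) (carrier S))"
    unfolding injective_resolution_def mod_kernel_def
  proof (intro conjI allI impI)
    show "injective_module S (T i)" for i
      unfolding T_def L_def by (rule baer_imp_injective[OF baer_image_module[OF \<sigma> K_baer]])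
    show "zero_module (T i)" if "n < i" for i
    proof -
      obtain j where j: "i = Suc j" using \<open>n < i\<close> by (cases i) auto
      interpret J: module R "J (Suc (Suc j))" by (rule J_module)
      have "carrier (J (Suc (Suc j))) \<subseteq> {\<zero>\<^bsub>J (Suc (Suc j))\<^esub>}" using I_zero[of "Suc (Suc j)"] \<open>n < i\<close> j by (auto simp: zero_module_def)
      then have "carrier (J (Suc (Suc j))) = {\<zero>\<^bsub>J (Suc (Suc j))\<^esub>}" using J.M.zero_closed by blast
      then show ?thesis unfolding zero_module_def cT zT j K_simps by simp
    qed
    show "restrict (\<lambda>s. \<sigma> (\<eta>0 s)) (carrier S) \<in> mod_hom S Sg (T 0)" using lin_restrict_mod_hom[OF Sg.module_axioms l\<eta>] by simp
    show "inj_on (restrict (\<lambda>s. \<sigma> (\<eta>0 s)) (carrier S)) (carrier Sg)" using inj\<eta> by (simp add: inj_on_restrict_eq)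
    show "restrict (D i) (carrier (T i)) \<in> mod_hom S (T i) (T (Suc i))" for i by (rule lin_restrict_mod_hom[OF Tm lD])
    show "restrict (\<lambda>s. \<sigma> (\<eta>0 s)) (carrier S) ` carrier Sg = {x \<in> carrier (T 0). restrict (D 0) (carrier (T 0)) x = \<zero>\<^bsub>T 1\<^esub>}"
      using ex\<eta> by (auto simp: image_restrict_eq)
    show "restrict (D i) (carrier (T i)) ` carrier (T i) =
        {x \<in> carrier (T (Suc i)). restrict (D (Suc i)) (carrier (T (Suc i))) x = \<zero>\<^bsub>T (Suc (Suc i))\<^esub>}" for i
      using exD[of i] by (auto simp: image_restrict_eq)
  qed
  then show ?thesis by blast
qed

end

section \<open>Indices and gaps of vanishing patterns\<close>

text \<open>A pattern Z holds at i when the module in degree i vanishes.\<close>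

definition index_at :: "(nat => bool) => nat => bool" where
  "index_at Z n \<longleftrightarrow> (\<forall>i>n. Z i) \<and> \<not> Z n"

definition gap_length :: "(nat => bool) => nat => bool" where
  "gap_length Z t \<longleftrightarrow> (\<exists>n. (\<forall>i. n + 1 \<le> i \<and> i \<le> n + t \<longrightarrow> Z i) \<and> \<not> Z n \<and> \<not> Z (n + t + 1))"

definition bounded_on :: "((nat => bool) => bool) => ((nat => bool) => nat => bool) => bool" where
  "bounded_on P C \<longleftrightarrow> (\<exists>c. \<forall>Z n. P Z \<and> C Z n \<longrightarrow> n \<le> c)"

lemma Sup_enat_finite_iff: "Sup {enat n | n. Q n} < \<infinity> \<longleftrightarrow> (\<exists>c. \<forall>n. Q n \<longrightarrow> n \<le> c)"
proof
  assume "Sup {enat n | n. Q n} < \<infinity>"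
  then obtain c where c: "Sup {enat n | n. Q n} = enat c" by (cases "Sup {enat n | n. Q n}") auto
  have "n \<le> c" if "Q n" for n
  proof -
    have "enat n \<le> Sup {enat n | n. Q n}" by (rule Sup_upper) (use that in blast)
    then show ?thesis by (simp add: c)
  qed
  then show "\<exists>c. \<forall>n. Q n \<longrightarrow> n \<le> c" by blast
next
  assume "\<exists>c. \<forall>n. Q n \<longrightarrow> n \<le> c"
  then obtain c where c: "\<forall>n. Q n \<longrightarrow> n \<le> c" by blast
  have "Sup {enat n | n. Q n} \<le> enat c" by (rule Sup_least) (use c in auto)
  also have "\<dots> < \<infinity>" by simp
  finally show "Sup {enat n | n. Q n} < \<infinity>" .
qed

text \<open>What the long exact sequence relating the (co)homology \<open>Z\<close> over \<open>R/(x)\<close> to the (co)homology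
  \<open>Z'\<close> over \<open>R\<close> says about vanishing.\<close>

definition coned :: "(nat => bool) => (nat => bool) => bool" where
  "coned Z Z' \<longleftrightarrow> (\<forall>m. Z (Suc m) \<and> Z m \<longrightarrow> Z' (Suc m)) \<and> (\<forall>n. Z' (Suc n) \<and> Z (Suc (Suc n)) \<longrightarrow> Z n) \<and>
    (\<forall>k. Z' (Suc (Suc k)) \<and> Z k \<longrightarrow> Z (Suc (Suc k)))"

lemma conedD:
  assumes "coned Z Z'"
  shows "Z (Suc m) ==> Z m ==> Z' (Suc m)" "Z' (Suc m) ==> Z (Suc (Suc m)) ==> Z m"
    "Z' (Suc (Suc m)) ==> Z m ==> Z (Suc (Suc m))"
  using assms unfolding coned_def by blast+

text \<open>The top nonzero degree n over S survives in degree n + 1 over R, since its other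
  neighbour in the sequence lies in degree n + 2 and vanishes.\<close>

lemma coned_index:
  assumes c: "coned Z Z'" and i: "index_at Z n" shows "index_at Z' (Suc n)"
proof -
  have z: "Z i" if "n < i" for i using i that unfolding index_at_def by blast
  have nz: "\<not> Z n" using i unfolding index_at_def by blast
  have "Z' i" if "Suc n < i" for i
  proof -
    obtain m where m: "i = Suc m" "n < m" using \<open>Suc n < i\<close> by (cases i) auto
    show ?thesis unfolding m(1) by (rule conedD(1)[OF c z z]) (use m(2) in simp_all)
  qed
  moreover have "\<not> Z' (Suc n)"
  proof
    assume "Z' (Suc n)"
    from conedD(2)[OF c this z] nz show False by simp
  qed
  ultimately show ?thesis unfolding index_at_def by blast
qed

text \<open>The left end moves up by one and the right end stays, so the gap loses one. Length at
  least two makes degree n + 2 vanish, which keeps the new left end nonzero.\<close>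

lemma coned_gap:
  assumes c: "coned Z Z'" and g: "gap_length Z (Suc (Suc t))" shows "gap_length Z' (Suc t)"
proof -
  from g obtain n where n: "\<forall>i. n + 1 \<le> i \<and> i \<le> n + Suc (Suc t) \<longrightarrow> Z i" "\<not> Z n" "\<not> Z (n + Suc (Suc t) + 1)"
    unfolding gap_length_def by blast
  have z: "Z i" if "n < i" "i \<le> n + Suc (Suc t)" for i using n(1) that by (simp add: Suc_le_eq)
  have "Z' i" if i: "Suc n + 1 \<le> i" "i \<le> Suc n + Suc t" for i
  proof -
    obtain m where m: "i = Suc m" using i(1) by (cases i) auto
    show ?thesis unfolding m by (rule conedD(1)[OF c z z]) (use i m in simp_all)
  qed
  moreover have "\<not> Z' (Suc n)"
  proof
    assume "Z' (Suc n)"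
    from conedD(2)[OF c this z] n(2) show False by simp
  qed
  moreover have "\<not> Z' (Suc n + Suc t + 1)"
  proof
    assume "Z' (Suc n + Suc t + 1)"
    then have "Z' (Suc (Suc (n + Suc t)))" by simp
    from conedD(3)[OF c this z] n(3) show False by simp
  qed
  ultimately show ?thesis unfolding gap_length_def by blast
qed

text \<open>What the passage from \<open>(M, N)\<close> to \<open>(M'/xM', N'/xN')\<close> for suitable syzygies \<open>M'\<close>, \<open>N'\<close> of
  \<open>M\<close>, \<open>N\<close> does to vanishing; the middle pattern belongs to \<open>(M', N')\<close>.\<close>

definition reduced :: "nat => nat => (nat => bool) => (nat => bool) => bool" where
  "reduced s n0 Z Z' \<longleftrightarrow> (\<exists>Y. (\<forall>i>n0. Y i \<longleftrightarrow> Z (i + s)) \<and> ((\<forall>i. Y i) \<or> \<not> Y 0) \<and> (\<forall>i. Z' i \<longrightarrow> Y i) \<and>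
    (\<forall>i. Y i \<and> Y (Suc i) \<and> Y (Suc (Suc i)) \<longrightarrow> Z' (Suc i)))"

lemma reduced_index:
  assumes r: "reduced s n0 Z Z'" and i: "index_at Z n" and n: "n0 + s < n"
  shows "\<exists>m. index_at Z' m \<and> n \<le> m + s"
proof -
  obtain Y where Y: "\<And>i. n0 < i ==> Y i \<longleftrightarrow> Z (i + s)" "\<And>i. Z' i ==> Y i"
    "\<And>i. Y i ==> Y (Suc i) ==> Y (Suc (Suc i)) ==> Z' (Suc i)"
    using r unfolding reduced_def by blast
  define k where "k = n - s"
  have k: "n0 < k" "n = k + s" using n by (auto simp: k_def)
  have yk: "\<not> Y k" and y: "Y i" if "k < i" for i using i Y(1)[of k] Y(1)[of i] k that by (auto simp: index_at_def)
  have "\<not> Z' k" using Y(2) yk by blast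
  moreover have "Z' j" if "Suc k < j" for j
  proof -
    obtain j' where "j = Suc j'" "k < j'" using \<open>Suc k < j\<close> by (cases j) auto
    then show ?thesis using Y(3) y by simp
  qed
  \<comment> \<open>Vanishing of Y above k settles \<open>Z'\<close> only above k + 1; in degree k +
    1 either case may occur.\<close>
  ultimately have "index_at Z' (if Z' (Suc k) then k else Suc k)"
    unfolding index_at_def by (metis Suc_lessI)
  then show ?thesis using k(2) by (intro exI[of _ "if Z' (Suc k) then k else Suc k"]) auto
qed

text \<open>A run of zeros with a nonzero degree on either side lies in a gap, found by going to the
  nearest nonzero degrees.\<close>

lemma gap_between:
  assumes "\<not> Z a" "a \<le> p" "\<not> Z q" "p < q" and z: "\<And>i. p < i ==> i < p + l + 1 ==> Z i"
  shows "\<exists>t\<ge>l. gap_length Z t"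
proof -
  define a' where "a' = (GREATEST i. \<not> Z i \<and> i \<le> p)"
  define r where "r = (LEAST i. \<not> Z i \<and> p < i)"
  have a': "\<not> Z a' \<and> a' \<le> p"
    unfolding a'_def by (rule GreatestI_nat[of "\<lambda>i. \<not> Z i \<and> i \<le> p" a p]) (use assms in auto)
  have a'_max: "i \<le> a'" if "\<not> Z i" "i \<le> p" for i
    unfolding a'_def by (rule Greatest_le_nat[of "\<lambda>i. \<not> Z i \<and> i \<le> p" i p]) (use that in auto)
  have r: "\<not> Z r \<and> p < r" unfolding r_def by (rule LeastI[of "\<lambda>i. \<not> Z i \<and> p < i" q]) (use assms in auto)
  have r_min: "r \<le> i" if "\<not> Z i" "p < i" for i
    unfolding r_def by (rule Least_le) (use that in auto)
  have rl: "p + l < r" using z[of r] r by force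
  have "Z i" if "a' + 1 \<le> i" "i < r" for i
    using a'_max[of i] r_min[of i] that by (cases "i \<le> p") auto
  then have "gap_length Z (r - a' - 1)"
    unfolding gap_length_def using a' r by (intro exI[of _ a']) auto
  moreover have "l \<le> r - a' - 1" using rl conjunct2[OF a'] by simp
  ultimately show ?thesis by blast
qed

text \<open>The loss n0 + s + 2: Y follows Z only beyond n0 and with shift s, and three consecutive
  zeros of Y are needed for one zero of \<open>Z'\<close>.\<close>

lemma reduced_gap:
  assumes r: "reduced s n0 Z Z'" and g: "gap_length Z (n0 + s + 2 + l)"
  shows "\<exists>t\<ge>l. gap_length Z' t"
proof -
  obtain Y where Y: "\<And>i. n0 < i ==> Y i \<longleftrightarrow> Z (i + s)" "(\<forall>i. Y i) \<or> \<not> Y 0" "\<And>i. Z' i ==> Y i"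
    "\<And>i. Y i ==> Y (Suc i) ==> Y (Suc (Suc i)) ==> Z' (Suc i)"
    using r unfolding reduced_def by blast
  obtain n where n: "\<And>i. n + 1 \<le> i ==> i \<le> n + (n0 + s + 2 + l) ==> Z i" "\<not> Z (n + (n0 + s + 2 + l) + 1)"
    using g by (auto simp: gap_length_def)
  \<comment> \<open>Y vanishes strictly between p and q; here q is the right end of the gap of Z,
    shifted down by s.\<close>
  define p where "p = max n0 (n - s)"
  define q where "q = n + n0 + l + 3"
  have y: "Y i" if "p < i" "i < q" for i
  proof -
    have "Z (i + s)" by (rule n(1)) (use that in \<open>auto simp: p_def q_def\<close>)
    then show ?thesis using Y(1)[of i] that by (auto simp: p_def)
  qed
  have "\<not> Y q" using Y(1)[of q] n(2) by (simp add: q_def ac_simps numeral_eq_Suc)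
  \<comment> \<open>As Y does not hold everywhere, degree 0 is nonzero; it bounds the gap on the
    left.\<close>
  then have zq: "\<not> Z' q" and z0: "\<not> Z' 0" using Y(2,3) by blast+
  have pq: "p + l + 3 \<le> q" by (auto simp: p_def q_def)
  show ?thesis
  proof (rule gap_between[OF z0 _ zq, of "Suc p"])
    fix i assume i: "Suc p < i" "i < Suc p + l + 1"
    then obtain j where j: "i = Suc j" by (cases i) auto
    show "Z' i" unfolding j by (rule Y(4)) (rule y; use i j pq in simp)+
  qed (use pq in auto)
qed

lemma bounded_on_transfer:
  assumes c: "\<And>Z. P' Z ==> \<exists>Z'. P Z' \<and> coned Z Z'"
    and r: "\<And>Z. P Z ==> \<exists>Z'. P' Z' \<and> reduced s n0 Z Z'"
  shows "bounded_on P index_at \<longleftrightarrow> bounded_on P' index_at" "bounded_on P gap_length \<longleftrightarrow> bounded_on P' gap_length"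
proof -
  show "bounded_on P index_at \<longleftrightarrow> bounded_on P' index_at"
  proof
    assume "bounded_on P index_at"
    then obtain b where b: "\<And>Z n. P Z ==> index_at Z n ==> n \<le> b" unfolding bounded_on_def by blast
    have "n \<le> b" if "P' Z" "index_at Z n" for Z n
    proof -
      from c[OF that(1)] obtain Z' where "P Z'" "coned Z Z'" by blast
      with b coned_index that(2) have "Suc n \<le> b" by blast
      then show ?thesis by simp
    qed
    then show "bounded_on P' index_at" unfolding bounded_on_def by blast
  next
    assume "bounded_on P' index_at"
    then obtain b where b: "\<And>Z n. P' Z ==> index_at Z n ==> n \<le> b" unfolding bounded_on_def by blast
    have "n \<le> n0 + s + b" if "P Z" "index_at Z n" for Z n
    proof (cases "n0 + s < n")
      case True
      from r[OF that(1)] obtain Z' where Z': "P' Z'" "reduced s n0 Z Z'" by blast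
      from reduced_index[OF Z'(2) that(2) True] obtain m where "index_at Z' m" "n \<le> m + s" by blast
      with b[OF Z'(1)] have "m \<le> b" by blast
      then show ?thesis using \<open>n \<le> m + s\<close> by simp
    qed simp
    then show "bounded_on P index_at" unfolding bounded_on_def by blast
  qed
  show "bounded_on P gap_length \<longleftrightarrow> bounded_on P' gap_length"
  proof
    assume "bounded_on P gap_length"
    then obtain b where b: "\<And>Z n. P Z ==> gap_length Z n ==> n \<le> b" unfolding bounded_on_def by blast
    have "n \<le> Suc b" if "P' Z" "gap_length Z n" for Z n
    \<comment> \<open>\<open>coned_gap\<close> says nothing about gaps of length 0 and 1, which lie
      below the bound anyway.\<close>
    proof (cases "n \<le> 1")
      case False
      then obtain t where t: "n = Suc (Suc t)" by (metis One_nat_def less_eq_nat.simps(1) not0_implies_Suc not_less_eq_eq)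
      from c[OF that(1)] obtain Z' where "P Z'" "coned Z Z'" by blast
      with b coned_gap that(2)[unfolded t] have "Suc t \<le> b" by blast
      then show ?thesis using t by simp
    qed simp
    then show "bounded_on P' gap_length" unfolding bounded_on_def by blast
  next
    assume "bounded_on P' gap_length"
    then obtain b where b: "\<And>Z n. P' Z ==> gap_length Z n ==> n \<le> b" unfolding bounded_on_def by blast
    have "n \<le> n0 + s + 2 + b" if "P Z" "gap_length Z n" for Z n
    proof (cases "n0 + s + 2 \<le> n")
      case True
      then obtain l where l: "n = n0 + s + 2 + l" using le_Suc_ex by blast
      from r[OF that(1)] obtain Z' where Z': "P' Z'" "reduced s n0 Z Z'" by blast
      from reduced_gap[OF Z'(2) that(2)[unfolded l]] obtain t where "l \<le> t" "gap_length Z' t" by blast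
      with b[OF Z'(1)] have "l \<le> b" by (meson le_trans)
      then show ?thesis using l by simp
    qed simp
    then show "bounded_on P gap_length" unfolding bounded_on_def by blast
  qed
qed

section \<open>Vanishing patterns of Ext and Tor\<close>

definition ext_pattern :: "('a, 'r) ring_scheme => (nat => bool) => bool" where
  "ext_pattern R Z \<longleftrightarrow> (\<exists>(M :: 'a coset_module) (N :: 'a coset_module).
    fg_module R M \<and> fg_module R N \<and> Z = (\<lambda>n. zero_module (Ext_module R M N n)))"

definition tor_pattern :: "('a, 'r) ring_scheme => (nat => bool) => bool" where
  "tor_pattern R Z \<longleftrightarrow> (\<exists>(M :: 'a coset_module) (N :: 'a coset_module).
    fg_module R M \<and> fg_module R N \<and> Z = (\<lambda>n. zero_module (Tor_module R M N n)))"

text \<open>Finiteness of a supremum of natural numbers means a common bound, so all four invariants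
  become statements about vanishing patterns.\<close>

lemma index_gap_finite_iff:
  "Ext_index R < \<infinity> \<longleftrightarrow> bounded_on (ext_pattern R) index_at"
  "Tor_index R < \<infinity> \<longleftrightarrow> bounded_on (tor_pattern R) index_at"
  "Ext_bounded R \<longleftrightarrow> bounded_on (ext_pattern R) gap_length"
  "Tor_bounded R \<longleftrightarrow> bounded_on (tor_pattern R) gap_length"
  unfolding Ext_index_def Tor_index_def Ext_bounded_def Tor_bounded_def Ext_gap_def Tor_gap_def Sup_enat_finite_iff
    bounded_on_def ext_pattern_def tor_pattern_def has_index_def has_gap_def index_at_def gap_length_def
  by (intro arg_cong[where f = Ex] ext; blast)+

lemma exact_at_iso:
  assumes N: "module R N" and N': "module R N'" and \<phi>: "lin R N N' \<phi>" "bij_betw \<phi> (carrier N) (carrier N')"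
    and A: "A \<in> mat R r q" and B: "B \<in> mat R q p"
  shows "exact_at N p q B A \<longleftrightarrow> exact_at N' p q B A"
proof
  interpret N: module R N by (rule N)
  interpret N': module R N' by (rule N')
  have inj: "a = b" if "a \<in> carrier N" "b \<in> carrier N" "\<phi> a = \<phi> b" for a b
    by (rule inj_onD[OF bij_betw_imp_inj_on[OF \<phi>(2)] that(3,1,2)])
  have im: "\<phi> ` carrier N = carrier N'" by (rule bij_betw_imp_surj_on[OF \<phi>(2)])
  assume ex: "exact_at N p q B A"
  show "exact_at N' p q B A"
    unfolding exact_at_def
  proof (intro ballI impI)
    fix v assume v: "v \<in> vec N' q" "act N' q A v = (\<lambda>i. (zero N'))"
    have "v i \<in> \<phi> ` carrier N" if "i < q" for i unfolding im using v(1) by simp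
    from lift_vec[OF N N' \<phi>(1) v(1) this] obtain u where u: "u \<in> vec N q" "v = (\<lambda>i. \<phi> (u i))" by blast
    have z: "(\<lambda>i. \<phi> (act N q A u i)) = (\<lambda>i. (zero N'))"
      using v(2) act_lin[OF N N' \<phi>(1) A u(1)] unfolding u(2) by simp
    have "act N q A u = (\<lambda>i. (zero N))"
    proof
      fix i show "act N q A u i = (zero N)"
        by (rule inj) (use fun_cong[OF z, of i] lin_zero[OF N N' \<phi>(1)] N.vec_closed[OF N.act_closed[OF A u(1)]] in simp_all)
    qed
    from exact_atD[OF ex u(1) this] obtain w where w: "w \<in> vec N p" "u = act N p B w" by blast
    show "\<exists>w\<in>vec N' p. v = act N' p B w"
      by (rule bexI[OF _ lin_vec[OF N N' \<phi>(1) w(1)]]) (simp only: act_lin[OF N N' \<phi>(1) B w(1)] u(2) w(2))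
  qed
next
  interpret N: module R N by (rule N)
  interpret N': module R N' by (rule N')
  have im: "\<phi> ` carrier N = carrier N'" by (rule bij_betw_imp_surj_on[OF \<phi>(2)])
  assume ex: "exact_at N' p q B A"
  show "exact_at N p q B A"
    unfolding exact_at_def
  proof (intro ballI impI)
    fix u assume u: "u \<in> vec N q" "act N q A u = (\<lambda>i. (zero N))"
    have "act N' q A (\<lambda>i. \<phi> (u i)) = (\<lambda>i. (zero N'))"
      unfolding act_lin[OF N N' \<phi>(1) A u(1)] u(2) by (simp add: lin_zero[OF N N' \<phi>(1)])
    from exact_atD[OF ex lin_vec[OF N N' \<phi>(1) u(1)] this] obtain w'
      where w': "w' \<in> vec N' p" "(\<lambda>i. \<phi> (u i)) = act N' p B w'" by blast
    have "w' i \<in> \<phi> ` carrier N" if "i < p" for i unfolding im using w'(1) by simp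
    from lift_vec[OF N N' \<phi>(1) w'(1) this] obtain w where w: "w \<in> vec N p" "w' = (\<lambda>i. \<phi> (w i))" by blast
    have e: "(\<lambda>i. \<phi> (u i)) = (\<lambda>i. \<phi> (act N p B w i))" unfolding w'(2) w(2) act_lin[OF N N' \<phi>(1) B w(1)] ..
    have "u = act N p B w"
    proof
      fix i show "u i = act N p B w i"
        by (rule inj_onD[OF bij_betw_imp_inj_on[OF \<phi>(2)] fun_cong[OF e, of i]])
          (use u(1) N.vec_closed[OF N.act_closed[OF B w(1)]] in simp_all)
    qed
    with w(1) show "\<exists>w\<in>vec N p. u = act N p B w" by blast
  qed
qed

lemma fg_module_image:
  assumes fg: "fg_module R M" and M': "module R M'" and \<phi>: "lin R M M' \<phi>" "\<phi> ` carrier M = carrier M'"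
  shows "fg_module R M'"
proof -
  have M: "module R M" using fg by (simp add: fg_module_def)
  interpret M: module R M by (rule M)
  interpret Rg: module R "regular_module R" by (rule M.R.regular_module_is_module)
  obtain n e where e: "e \<in> vec M n" "\<forall>m\<in>carrier M. \<exists>v\<in>vec (regular_module R) n. m = lincomb M v e n"
    by (rule fg_module_gens[OF fg])
  have ec: "e i \<in> carrier M" for i using e(1) by simp
  show ?thesis
  proof (rule fg_moduleI[OF M', of "\<lambda>i. \<phi> (e i)"])
    show "\<phi> (e i) \<in> carrier M'" for i by (rule lin_closed[OF \<phi>(1) ec])
    fix m' assume "m' \<in> carrier M'"
    then obtain m where m: "m \<in> carrier M" "m' = \<phi> m" unfolding \<phi>(2)[symmetric] by blast
    from bspec[OF e(2) m(1)] obtain v where v: "v \<in> vec (regular_module R) n" "m = lincomb M v e n" by blast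
    have vc: "v i \<in> carrier R" for i using v(1) by simp
    have "m' = lincomb M' v (\<lambda>i. \<phi> (e i)) n" unfolding m(2) v(2) by (rule lincomb_lin[OF M M' \<phi>(1) vc ec])
    with vc show "\<exists>r. (\<forall>i. r i \<in> carrier R) \<and> m' = lincomb M' r (\<lambda>i. \<phi> (e i)) n" by blast
  qed
qed

lemma mres_iso:
  assumes res: "mres R M b A e" and M': "module R M'" and \<phi>: "lin R M M' \<phi>" "bij_betw \<phi> (carrier M) (carrier M')"
  shows "mres R M' b A (\<lambda>i. \<phi> (e i))"
proof -
  note M = mres_module[OF res]
  interpret M: module R M by (rule M)
  interpret Rg: module R "regular_module R" by (rule M.R.regular_module_is_module)
  let ?n = "b (Suc 0)"
  have ec: "e i \<in> carrier M" for i using mres_gen[OF res] by simp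
  have l: "lincomb M' v (\<lambda>i. \<phi> (e i)) ?n = \<phi> (lincomb M v e ?n)" if "v \<in> vec (regular_module R) ?n" for v
    by (rule lincomb_lin[OF M M' \<phi>(1) _ ec, symmetric]) (use that in simp)
  have "\<phi> m = (zero M') \<longleftrightarrow> m = (zero M)" if "m \<in> carrier M" for m
    using inj_on_eq_iff[OF bij_betw_imp_inj_on[OF \<phi>(2)] that M.M.zero_closed] by (simp add: lin_zero[OF M M' \<phi>(1)])
  then have "lincomb M' v (\<lambda>i. \<phi> (e i)) ?n = (zero M') \<longleftrightarrow> lincomb M v e ?n = (zero M)" if "v \<in> vec (regular_module R) ?n" for v
    unfolding l[OF that] using M.lincomb_closed[of v e] ec that by simp
  then have k: "res_ker R M' b A (\<lambda>i. \<phi> (e i)) k = res_ker R M b A e k" for k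
    unfolding res_ker_def by auto
  have s: "\<exists>v\<in>vec (regular_module R) ?n. m' = lincomb M' v (\<lambda>i. \<phi> (e i)) ?n" if m': "m' \<in> carrier M'" for m'
  proof -
    obtain m where m: "m \<in> carrier M" "m' = \<phi> m" using m' unfolding bij_betw_imp_surj_on[OF \<phi>(2), symmetric] by blast
    from mres_surj[OF res m(1)] obtain v where v: "v \<in> vec (regular_module R) ?n" "m = lincomb M v e ?n" by blast
    show ?thesis by (rule bexI[OF _ v(1)]) (simp only: l[OF v(1)] m(2) v(2))
  qed
  show ?thesis
    unfolding mres_def k
    using M' mres_b0[OF res] mres_mat[OF res] lin_vec[OF M M' \<phi>(1) mres_gen[OF res]] mres_exact[OF res] s by blast
qed

lemma fg_module_coset_iso:
  assumes fg: "fg_module R (M :: ('a, 'b, 'm) module_scheme)"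
  obtains M' :: "'a coset_module" and \<phi> where "fg_module R M'" "lin R M M' \<phi>" "bij_betw \<phi> (carrier M) (carrier M')"
proof -
  interpret M: module R M using fg by (simp add: fg_module_def)
  obtain n K \<phi> where \<phi>: "submodule K R (free_module R {..<n})" "\<phi> \<in> mod_hom R M (quot_module (free_module R {..<n::nat}) K)"
    "bij_betw \<phi> (carrier M) (carrier (quot_module (free_module R {..<n}) K))"
    by (rule fg_module_iso_quotient[OF fg])
  let ?Q = "quot_module (free_module R {..<n}) K"
  have Q: "module R ?Q" by (rule quot_module_is_module[OF free_module_is_module[OF M.R.is_cring] \<phi>(1)])
  have l: "lin R M ?Q \<phi>" using \<phi>(2) by (simp add: mod_hom_iff)
  show ?thesis by (rule that[OF fg_module_image[OF fg Q l bij_betw_imp_surj_on[OF \<phi>(3)]] l \<phi>(3)])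
qed

context
  fixes R :: "('a, 'r) ring_scheme"
  assumes R: "cring R" "noetherian_ring R"
begin

text \<open>The modules may have elements of any type: each is isomorphic to a quotient of a free
  module of finite rank, and neither the matrices of a resolution nor exactness change under
  isomorphism.\<close>

lemma patternI:
  assumes M: "mres R M b A e" "fg_module R M" and N: "fg_module R N"
  shows "ext_pattern R (EXT N b A)" "tor_pattern R (TOR N b A)"
proof -
  obtain M' :: "'a coset_module" and \<phi> where M': "fg_module R M'" "lin R M M' \<phi>" "bij_betw \<phi> (carrier M) (carrier M')"
    by (rule fg_module_coset_iso[OF M(2)])
  obtain N' :: "'a coset_module" and \<psi> where N': "fg_module R N'" "lin R N N' \<psi>" "bij_betw \<psi> (carrier N) (carrier N')"
    by (rule fg_module_coset_iso[OF N])
  have mM': "module R M'" and mN: "module R N" and mN': "module R N'" using M'(1) N N'(1) by (simp_all add: fg_module_def)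
  note res = mres_iso[OF M(1) mM' M'(2,3)]
  note iso = exact_at_iso[OF mN mN' N'(2,3)]
  have "EXT N b A n \<longleftrightarrow> zero_module (Ext_module R M' N' n)" for n
    unfolding Ext_module_zero_iff[OF res mN'] EXT_def by (rule iso) (simp only: transp_mat, rule mres_mat[OF M(1)])+
  then show "ext_pattern R (EXT N b A)" unfolding ext_pattern_def using M'(1) N'(1) by blast
  have "TOR N b A n \<longleftrightarrow> zero_module (Tor_module R M' N' n)" for n
    unfolding Tor_module_zero_iff[OF res mN'] TOR_def by (rule iso) (rule mres_mat[OF M(1)])+
  then show "tor_pattern R (TOR N b A)" unfolding tor_pattern_def using M'(1) N'(1) by blast
qed

lemma ext_patternE:
  assumes "ext_pattern R Z"
  obtains M N :: "'a coset_module" and b A e where "fg_module R M" "fg_module R N" "mres R M b A e" "Z = EXT N b A"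
proof -
  obtain M N :: "'a coset_module" where 1: "fg_module R M" "fg_module R N" "Z = (\<lambda>n. zero_module (Ext_module R M N n))"
    using assms unfolding ext_pattern_def by blast
  obtain b A e where res: "mres R M b A e" by (rule mres_exists[OF R 1(1)])
  have N: "module R N" using 1(2) by (simp add: fg_module_def)
  show ?thesis by (rule that[OF 1(1,2) res]) (simp add: 1(3) Ext_module_zero_iff[OF res N] fun_eq_iff)
qed

lemma tor_patternE:
  assumes "tor_pattern R Z"
  obtains M N :: "'a coset_module" and b A e where "fg_module R M" "fg_module R N" "mres R M b A e" "Z = TOR N b A"
proof -
  obtain M N :: "'a coset_module" where 1: "fg_module R M" "fg_module R N" "Z = (\<lambda>n. zero_module (Tor_module R M N n))"
    using assms unfolding tor_pattern_def by blast
  obtain b A e where res: "mres R M b A e" by (rule mres_exists[OF R 1(1)])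
  have N: "module R N" using 1(2) by (simp add: fg_module_def)
  show ?thesis by (rule that[OF 1(1,2) res]) (simp add: 1(3) Tor_module_zero_iff[OF res N] fun_eq_iff)
qed

end

text \<open>M and N are regarded as R-modules; the cone resolves M over R, and the change of rings
  sequences compare the two patterns.\<close>

lemma (in regular_quotient) cone_patterns:
  assumes R: "noetherian_ring R" and S: "noetherian_ring S"
  shows "ext_pattern S Z ==> \<exists>Z'. ext_pattern R Z' \<and> coned Z Z'" "tor_pattern S Z ==> \<exists>Z'. tor_pattern R Z' \<and> coned Z Z'"
proof -
  have R': "cring R" and S': "cring S" by unfold_locales
  assume "ext_pattern S Z"
  then obtain M N :: "'s coset_module" and g D e where 1: "fg_module S M" "fg_module S N" "mres S M g D e" "Z = EXT N g D"
    by (rule ext_patternE[OF S' S])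
  have PM: "compat (restrict_scalars M) M" and QN: "compat (restrict_scalars N) N"
    using 1(1,2) by (auto intro!: restrict_scalars_compat simp: fg_module_def)
  obtain d h where "cone R S \<pi> x M (restrict_scalars M) g D e d h" by (rule cone_exists[OF 1(3) PM])
  then interpret c: cone R S \<pi> x M "restrict_scalars M" g D e d h .
  have "coned Z (EXT (restrict_scalars N) c.F c.E)"
    unfolding coned_def 1(4) using c.EXT_sequence[OF QN] by blast
  moreover have "ext_pattern R (EXT (restrict_scalars N) c.F c.E)"
    by (rule patternI(1)[OF R' R c.cone_mres]) (use 1(1,2) compat_fg[OF PM] compat_fg[OF QN] in simp_all)
  ultimately show "\<exists>Z'. ext_pattern R Z' \<and> coned Z Z'" by blast
next
  have R': "cring R" and S': "cring S" by unfold_locales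
  assume "tor_pattern S Z"
  then obtain M N :: "'s coset_module" and g D e where 1: "fg_module S M" "fg_module S N" "mres S M g D e" "Z = TOR N g D"
    by (rule tor_patternE[OF S' S])
  have PM: "compat (restrict_scalars M) M" and QN: "compat (restrict_scalars N) N"
    using 1(1,2) by (auto intro!: restrict_scalars_compat simp: fg_module_def)
  obtain d h where "cone R S \<pi> x M (restrict_scalars M) g D e d h" by (rule cone_exists[OF 1(3) PM])
  then interpret c: cone R S \<pi> x M "restrict_scalars M" g D e d h .
  have "coned Z (TOR (restrict_scalars N) c.F c.E)"
    unfolding coned_def 1(4) using c.TOR_sequence[OF QN] by blast
  moreover have "tor_pattern R (TOR (restrict_scalars N) c.F c.E)"
    by (rule patternI(2)[OF R' R c.cone_mres]) (use 1(1,2) compat_fg[OF PM] compat_fg[OF QN] in simp_all)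
  ultimately show "\<exists>Z'. tor_pattern R Z' \<and> coned Z Z'" by blast
qed

section \<open>Reduction modulo a regular element\<close>

lemma lincomb_carrier_update [simp]: "lincomb (M\<lparr>carrier := H\<rparr>) r z k = lincomb M r z k"
  by (induction k) simp_all

lemma act_vec_module: "act (vec_module M m) q A v = (\<lambda>i t. act M q A (\<lambda>l. v l t) i)"
  by (simp add: act_def lincomb_vec_module)

text \<open>A vector over a power of M is treated one coordinate t at a time. This supplies free
  modules as coefficients.\<close>

lemma exact_at_vec_module:
  assumes M: "module R M" and B: "B \<in> mat R q p" and ex: "exact_at M p q B A"
  shows "exact_at (vec_module M m) p q B A"
  unfolding exact_at_def
proof (intro ballI impI)
  interpret M: module R M by (rule M)
  interpret Q: module R "vec_module M m" by (rule vec_module_is_module[OF M])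
  fix v assume v: "v \<in> vec (vec_module M m) q" "act (vec_module M m) q A v = (\<lambda>i. \<zero>\<^bsub>vec_module M m\<^esub>)"
  have vi: "v i \<in> vec M m" for i using Q.vec_closed[OF v(1), of i] by simp
  have vt: "(\<lambda>l. v l t) \<in> vec M q" for t
    using vi vec_zero_outside[OF v(1)] by (simp add: vec_def del: M.vec_closed)
  have z: "act M q A (\<lambda>l. v l t) = (\<lambda>i. (zero M))" for t
    using v(2) unfolding act_vec_module by (simp add: fun_eq_iff)
  have "\<forall>t. \<exists>w. w \<in> vec M p \<and> (\<lambda>l. v l t) = act M p B w"
    using ex vt z unfolding exact_at_def by blast
  from choice[OF this] obtain W where W: "\<And>t. W t \<in> vec M p" "\<And>t. (\<lambda>l. v l t) = act M p B (W t)" by blast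
  \<comment> \<open>Coordinates from m on are reset to zero: the chosen \<open>W t\<close> need not
    vanish there.\<close>
  define w where "w i t = (if t < m then W t i else (zero M))" for i t
  have w: "w \<in> vec (vec_module M m) p"
    unfolding vec_def
  proof (intro CollectI conjI allI impI)
    show "w i \<in> carrier (vec_module M m)" for i
      using M.vec_closed[OF W(1)] by (simp add: vec_def w_def del: M.vec_closed)
    show "w i = \<zero>\<^bsub>vec_module M m\<^esub>" if "p \<le> i" for i
      using vec_zero_outside[OF W(1) that] by (simp add: w_def fun_eq_iff)
  qed
  have wt: "(\<lambda>l. w l t) = (if t < m then W t else (\<lambda>l. (zero M)))" for t by (simp add: w_def)
  have "v = act (vec_module M m) p B w"
  proof (intro ext)
    fix i t
    show "v i t = act (vec_module M m) p B w i t"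
    proof (cases "t < m")
      case True
      then show ?thesis unfolding act_vec_module wt using fun_cong[OF W(2)[of t], of i] by simp
    next
      case False
      then show ?thesis unfolding act_vec_module wt
        using vec_zero_outside[OF vi[of i], of t] B by simp
    qed
  qed
  with w show "\<exists>w\<in>vec (vec_module M m) p. v = act (vec_module M m) p B w" by blast
qed

context
  fixes R :: "('a, 'r) ring_scheme" and M :: "('a, 'b, 'm) module_scheme" and b A e
  assumes res: "mres R M b A e"
begin

text \<open>With coefficients R the complex is the resolution itself, exact in positive
  degrees.\<close>

lemma TOR_regular: "TOR (regular_module R) b A (Suc i)"
  unfolding TOR_def exact_at_def
proof (intro ballI impI)
  fix v assume "v \<in> vec (regular_module R) (b (Suc (Suc i)))"
    "act (regular_module R) (b (Suc (Suc i))) (A (Suc i)) v = (\<lambda>i. \<zero>\<^bsub>regular_module R\<^esub>)"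
  then have "v \<in> res_ker R M b A e (Suc i)" by (simp add: res_ker_def)
  then show "\<exists>w\<in>vec (regular_module R) (b (Suc (Suc (Suc i)))).
      v = act (regular_module R) (b (Suc (Suc (Suc i)))) (A (Suc (Suc i))) w"
    unfolding mres_exact[OF res] by blast
qed

lemma TOR_free: "TOR (vec_module (regular_module R) m) b A (Suc i)"
  using TOR_regular[of i] unfolding TOR_def
  by (rule exact_at_vec_module[OF cring.regular_module_is_module[OF module.axioms(1)[OF mres_module[OF res]]] mres_mat[OF res]])

lemma EXT_free:
  assumes "injective_resolution R (regular_module R) n I d \<eta>" "n < i"
  shows "EXT (vec_module (regular_module R) m) b A i"
proof -
  have Rg: "module R (regular_module R)"
    by (rule cring.regular_module_is_module[OF module.axioms(1)[OF mres_module[OF res]]])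
  have "transp (A i) \<in> mat R (b (Suc i)) (b i)" unfolding transp_mat by (rule mres_mat[OF res])
  from exact_at_vec_module[OF Rg this] EXT_above_injective_dim[OF res assms(1) Rg assms(2)]
  show ?thesis unfolding EXT_def by blast
qed

lemma mres_mat_transp: "transp (A n) \<in> mat R (b (Suc n)) (b n)"
  unfolding transp_mat by (rule mres_mat[OF res])

context
  fixes K :: "('a, 'k, 'k2) module_scheme" and F :: "('a, 'f, 'f2) module_scheme" and N :: "('a, 'n, 'n2) module_scheme" and i p
  assumes se: "short_exact R K F N i p"
begin

lemma EXT_quotient: "EXT F b A n ==> EXT K b A (Suc n) ==> EXT N b A n"
  unfolding EXT_def
  by (rule exact_at_quotient[OF se mres_mat_transp mres_mat_transp mres_mat_transp mres_complex_transp[OF res]])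

lemma EXT_sub: "EXT F b A (Suc n) ==> EXT N b A n ==> EXT K b A (Suc n)"
  unfolding EXT_def
  by (rule exact_at_sub[OF se mres_mat_transp mres_mat_transp mres_mat_transp mres_complex_transp[OF res]])

lemma TOR_quotient: "TOR F b A (Suc n) ==> TOR K b A n ==> TOR N b A (Suc n)"
  unfolding TOR_def
  by (rule exact_at_quotient[OF se mres_mat[OF res] mres_mat[OF res] mres_mat[OF res] mres_complex[OF res]])

lemma TOR_sub: "TOR F b A n ==> TOR N b A (Suc n) ==> TOR K b A n"
  unfolding TOR_def
  by (rule exact_at_sub[OF se mres_mat[OF res] mres_mat[OF res] mres_mat[OF res] mres_complex[OF res]])

end

end

context regular_quotient
begin

definition x_quot :: "('a, 'y, 'm) module_scheme => ('a, 'y set) module" where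
  "x_quot P = quot_module P ((\<lambda>y. x \<odot>\<^bsub>P\<^esub> y) ` carrier P)"

context
  fixes P :: "('a, 'y, 'm) module_scheme"
  assumes P: "module R P" and reg: "\<And>y. y \<in> carrier P ==> x \<odot>\<^bsub>P\<^esub> y = (zero P) ==> y = (zero P)"
begin

private lemma sub: "submodule ((\<lambda>y. x \<odot>\<^bsub>P\<^esub> y) ` carrier P) R P"
  by (rule submodule_image[OF P P lin_x[OF P]])

lemma x_quot_exact: "short_exact R P P (x_quot P) (\<lambda>y. x \<odot>\<^bsub>P\<^esub> y) (\<lambda>y. (\<lambda>y. x \<odot>\<^bsub>P\<^esub> y) ` carrier P +>\<^bsub>P\<^esub> y)"
  unfolding short_exact_def x_quot_def
  using P quot_module_is_module[OF P sub] lin_x[OF P] lin_coset[OF P sub] lin_inj_on[OF P P lin_x[OF P] reg]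
    quot_carrier[OF P sub] coset_eq_zero_iff[OF P sub]
  by simp

lemma x_quot_compat: "compat (x_quot P) (induced_module (x_quot P))"
proof (rule induced_module_compat)
  show "module R (x_quot P)" unfolding x_quot_def by (rule quot_module_is_module[OF P sub])
  fix m assume "m \<in> carrier (x_quot P)"
  then obtain y where y: "y \<in> carrier P" "m = (\<lambda>y. x \<odot>\<^bsub>P\<^esub> y) ` carrier P +>\<^bsub>P\<^esub> y"
    unfolding x_quot_def quot_carrier[OF P sub] by blast
  have "x \<odot>\<^bsub>P\<^esub> y \<in> (\<lambda>y. x \<odot>\<^bsub>P\<^esub> y) ` carrier P" using y(1) by blast
  then show "x \<odot>\<^bsub>x_quot P\<^esub> m = \<zero>\<^bsub>x_quot P\<^esub>"
    unfolding x_quot_def y(2) lin_smult[OF lin_coset[OF P sub] x_closed y(1), symmetric]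
    using coset_eq_zero_iff[OF P sub lin_closed[OF lin_x[OF P] y(1)]] by blast
qed

lemma x_quot_fg: "fg_module R P ==> fg_module S (induced_module (x_quot P))"
  using x_quot_exact unfolding compat_fg[OF x_quot_compat, symmetric] short_exact_def
  by (elim conjE) (rule fg_module_image)

end

text \<open>The reduced matrices resolve M/xM over S and act on N/xN as the original ones do. So Ext
  and Tor over S of M/xM and N/xN are read off the R-complexes with coefficients N/xN.\<close>

lemma x_quot_patterns:
  assumes S: "noetherian_ring S" and fg: "fg_module R M" "fg_module R N" and res: "mres R M b A e"
    and regM: "\<And>y. y \<in> carrier M ==> x \<odot>\<^bsub>M\<^esub> y = (zero M) ==> y = (zero M)"
    and regN: "\<And>y. y \<in> carrier N ==> x \<odot>\<^bsub>N\<^esub> y = (zero N) ==> y = (zero N)"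
  shows "ext_pattern S (EXT (x_quot N) b A)" "tor_pattern S (TOR (x_quot N) b A)"
proof -
  have M: "module R M" and N: "module R N" using fg by (simp_all add: fg_module_def)
  have S': "cring S" by unfold_locales
  note seM = x_quot_exact[OF M regM, unfolded short_exact_def]
  let ?p = "\<lambda>y. (\<lambda>y. x \<odot>\<^bsub>M\<^esub> y) ` carrier M +>\<^bsub>M\<^esub> y"
  have p: "lin R M (x_quot M) ?p" "?p ` carrier M = carrier (x_quot M)" using seM by blast+
  have ker: "?p m = \<zero>\<^bsub>x_quot M\<^esub> \<longleftrightarrow> (\<exists>m'\<in>carrier M. m = x \<odot>\<^bsub>M\<^esub> m')" if "m \<in> carrier M" for m
    using seM that by blast
  have res': "mres S (induced_module (x_quot M)) b (\<lambda>n. map_mat (A n)) (\<lambda>i. ?p (e i))"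
    by (rule mres_mod_regular[OF res x_quot_compat[OF M regM] p regM ker])
  have c: "compat (x_quot N) (induced_module (x_quot N))" by (rule x_quot_compat[OF N regN])
  have qM: "fg_module S (induced_module (x_quot M))" by (rule x_quot_fg[OF M regM fg(1)])
  have qN: "fg_module S (induced_module (x_quot N))" by (rule x_quot_fg[OF N regN fg(2)])
  have EXT_eq: "EXT (induced_module (x_quot N)) b (\<lambda>n. map_mat (A n)) n \<longleftrightarrow> EXT (x_quot N) b A n" for n
    unfolding EXT_def map_mat_transp[symmetric] by (rule compat_exact_at[OF c]) (rule mres_mat_transp[OF res])+
  show "ext_pattern S (EXT (x_quot N) b A)"
    using patternI(1)[OF S' S res' qM qN] unfolding ext[of "EXT (induced_module (x_quot N)) b (\<lambda>n. map_mat (A n))", OF EXT_eq] .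
  have TOR_eq: "TOR (induced_module (x_quot N)) b (\<lambda>n. map_mat (A n)) n \<longleftrightarrow> TOR (x_quot N) b A n" for n
    unfolding TOR_def by (rule compat_exact_at[OF c mres_mat[OF res] mres_mat[OF res]])
  show "tor_pattern S (TOR (x_quot N) b A)"
    using patternI(2)[OF S' S res' qM qN] unfolding ext[of "TOR (induced_module (x_quot N)) b (\<lambda>n. map_mat (A n))", OF TOR_eq] .
qed

text \<open>Nakayama's lemma in a power of N, applied to cycles modulo boundaries;
  \<open>exact_at_mod_regular\<close> provides the decomposition that it asks for.\<close>

lemma exact_at_of_x_quot:
  assumes loc: "local_ring R" "maximalideal \<mm> R" "x \<in> \<mm>" and N: "noeth R N"
    and reg: "\<And>y. y \<in> carrier N ==> x \<odot>\<^bsub>N\<^esub> y = (zero N) ==> y = (zero N)"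
    and A: "A \<in> mat R r q" and B: "B \<in> mat R q k" and AB: "matmul R q A B = (\<lambda>i j. (zero R))"
    and ex: "exact_at (x_quot N) k q B A"
  shows "exact_at N k q B A"
proof -
  have mN: "module R N" using N by (simp add: noeth_def)
  let ?V = "vec_module N q" and ?Z = "{v \<in> vec N q. act N q A v = (\<lambda>i. (zero N))}" and ?B = "act N k B ` vec N k"
  have mod: "module R (vec_module N j)" for j by (rule vec_module_is_module[OF mN])
  have "submodule {v \<in> carrier ?V. act N q A v = \<zero>\<^bsub>vec_module N r\<^esub>} R ?V"
    by (rule submodule_kernel[OF mod mod lin_act_vec_module[OF mN A]])
  then have Z: "submodule ?Z R ?V" by simp
  have "submodule (act N k B ` carrier (vec_module N k)) R ?V"
    by (rule submodule_image[OF mod mod lin_act_vec_module[OF mN B]])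
  then have B': "submodule ?B R ?V" by simp
  have "?Z \<subseteq> ?B"
  proof (rule nakayama[OF loc noeth_vec_module[OF N] Z B'])
    fix v assume "v \<in> ?Z"
    then have v: "v \<in> vec N q" "act N q A v = (\<lambda>i. (zero N))" by blast+
    obtain u w where u: "u \<in> vec N q" "act N q A u = (\<lambda>i. (zero N))" "w \<in> vec N k"
      "v = (\<lambda>j. x \<odot>\<^bsub>N\<^esub> u j \<oplus>\<^bsub>N\<^esub> act N k B w j)"
      by (rule exact_at_mod_regular[OF x_quot_exact[OF mN reg] x_closed A B AB ex v])
    show "\<exists>u\<in>?Z. \<exists>w\<in>?B. v = x \<odot>\<^bsub>?V\<^esub> u \<oplus>\<^bsub>?V\<^esub> w"
      by (rule bexI[of _ u], rule bexI[of _ "act N k B w"]) (use u in simp_all)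
  qed
  then show ?thesis unfolding exact_at_def by blast
qed

end

section \<open>Syzygies\<close>

text \<open>For q = k this is the usual module of relations among k generators. For q > k the
  coordinates from k on are unconstrained, as if zero generators had been added, and span a free
  summand.\<close>

definition rel_module :: "('a, 'r) ring_scheme => ('a, 'y, 'n) module_scheme => (nat => 'y) => nat => nat => ('a, nat => 'a) module" where
  "rel_module R N e k q = (vec_module (regular_module R) q)\<lparr>carrier :=
    {v \<in> vec (regular_module R) q. lincomb N v e k = (zero N)}\<rparr>"

lemma rel_module_simps [simp]:
  "carrier (rel_module R N e k q) = {v \<in> vec (regular_module R) q. lincomb N v e k = (zero N)}"
  "\<zero>\<^bsub>rel_module R N e k q\<^esub> = (\<lambda>i. (zero R))"
  "u \<oplus>\<^bsub>rel_module R N e k q\<^esub> v = (\<lambda>i. u i \<oplus>\<^bsub>R\<^esub> v i)"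
  "r \<odot>\<^bsub>rel_module R N e k q\<^esub> v = (\<lambda>i. r \<otimes>\<^bsub>R\<^esub> v i)"
  by (simp_all add: rel_module_def)

lemma lincomb_rel_module: "lincomb (rel_module R N e k q) r z n = (\<lambda>i. lincomb (regular_module R) r (\<lambda>j. z j i) n)"
  by (simp add: rel_module_def lincomb_vec_module)

context
  fixes R :: "('a, 'r) ring_scheme" and N :: "('a, 'y, 'n) module_scheme" and e :: "nat => 'y" and k q :: nat
  assumes R: "noetherian_ring R" and N: "module R N" and e: "\<And>i. e i \<in> carrier N"
begin

interpretation N: module R N by (rule N)
interpretation Rg: module R "regular_module R" by (rule N.R.regular_module_is_module)

lemma lin_lincomb_vec: "lin R (vec_module (regular_module R) q) N (\<lambda>v. lincomb N v e k)"
  unfolding lin_def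
  by (auto simp: e N.lincomb_add_left N.lincomb_smult_left)

lemma rel_module_fg: "fg_module R (rel_module R N e k q)"
proof -
  have "submodule {v \<in> carrier (vec_module (regular_module R) q). lincomb N v e k = (zero N)} R (vec_module (regular_module R) q)"
    by (rule submodule_kernel[OF vec_module_is_module[OF Rg.module_axioms] N lin_lincomb_vec])
  from noeth_fg[OF noeth_vec_module[OF noeth_regular[OF N.R.is_cring R]] this]
  show ?thesis by (simp add: rel_module_def)
qed

lemma rel_module_is_module: "module R (rel_module R N e k q)"
  using rel_module_fg by (simp add: fg_module_def)

lemma rel_module_exact:
  assumes "k \<le> q" and gen: "\<And>y. y \<in> carrier N ==> \<exists>v\<in>vec (regular_module R) k. y = lincomb N v e k"
  shows "short_exact R (rel_module R N e k q) (vec_module (regular_module R) q) N (\<lambda>v. v) (\<lambda>v. lincomb N v e k)"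
  unfolding short_exact_def
proof (intro conjI)
  show "lin R (rel_module R N e k q) (vec_module (regular_module R) q) (\<lambda>v. v)" by (auto simp: lin_def)
  show "(\<lambda>v. lincomb N v e k) ` carrier (vec_module (regular_module R) q) = carrier N"
  proof (intro equalityI subsetI)
    fix y assume "y \<in> (\<lambda>v. lincomb N v e k) ` carrier (vec_module (regular_module R) q)"
    then show "y \<in> carrier N" using lin_closed[OF lin_lincomb_vec] by blast
  next
    fix y assume "y \<in> carrier N"
    from gen[OF this] obtain v where v: "v \<in> vec (regular_module R) k" "y = lincomb N v e k" by blast
    have "v \<in> carrier (vec_module (regular_module R) q)"
      using v(1) \<open>k \<le> q\<close> by (simp add: vec_def del: Rg.vec_closed N.R.vec_regular_closed)
    with v(2) show "y \<in> (\<lambda>v. lincomb N v e k) ` carrier (vec_module (regular_module R) q)" by blast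
  qed
qed (use rel_module_is_module vec_module_is_module[OF Rg.module_axioms] N lin_lincomb_vec in auto)

end

definition syz_rank :: "(nat => nat) => nat => nat" where
  "syz_rank b = hat 0 (\<lambda>n. b (Suc (Suc n)))"

definition syz_mat :: "('a, 'r) ring_scheme => (nat => nat => nat => 'a) => nat => nat => nat => 'a" where
  "syz_mat R A = hat (\<lambda>i j. (zero R)) (\<lambda>n. A (Suc (Suc n)))"

lemma syz_simps [simp]:
  "syz_rank b 0 = 0" "syz_rank b (Suc n) = b (Suc (Suc n))"
  "syz_mat R A 0 = (\<lambda>i j. (zero R))" "syz_mat R A (Suc n) = A (Suc (Suc n))"
  by (simp_all add: syz_rank_def syz_mat_def)

text \<open>Degree 0 is left out: there the complex of the syzygy meets the padding, while the
  original complex continues.\<close>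

lemma syz_shift:
  "EXT N (syz_rank b) (syz_mat R A) (Suc n) \<longleftrightarrow> EXT N b A (Suc (Suc n))"
  "TOR N (syz_rank b) (syz_mat R A) (Suc n) \<longleftrightarrow> TOR N b A (Suc (Suc n))"
  by (simp_all add: EXT_def TOR_def)

lemma exact_at_trivial:
  assumes N: "module R N" and B: "B \<in> mat R 0 p" shows "exact_at N p 0 B A"
proof -
  interpret N: module R N by (rule N)
  have "v = act N p B (\<lambda>i. (zero N))" if "v \<in> vec N 0" for v
    using vec_zero_outside[OF that] B by (simp add: fun_eq_iff)
  then show ?thesis unfolding exact_at_def using N.zero_vec by blast
qed

lemma mres_zero_module:
  assumes M: "module R M" and Z: "carrier M = {(zero M)}"
  shows "mres R M (\<lambda>n. 0) (\<lambda>n i j. (zero R)) (\<lambda>i. (zero M))"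
proof -
  interpret M: module R M by (rule M)
  interpret Rg: module R "regular_module R" by (rule M.R.regular_module_is_module)
  have v0: "vec (regular_module R) 0 = {\<lambda>i. (zero R)}"
    by (auto simp: vec_def simp del: Rg.vec_closed M.R.vec_regular_closed)
  show ?thesis
    unfolding mres_def res_ker_def v0 using M Z by (auto simp: act_def)
qed

context
  fixes R :: "('a, 'r) ring_scheme" and M :: "('a, 'y, 'm) module_scheme" and b A e
  assumes R: "noetherian_ring R" and res: "mres R M b A e"
begin

interpretation M: module R M by (rule mres_module[OF res])
interpretation Rg: module R "regular_module R" by (rule M.R.regular_module_is_module)

abbreviation "syz \<equiv> rel_module R M e (b (Suc 0)) (b (Suc 0))"

lemma syz_carrier: "carrier syz = res_ker R M b A e 0"
  by (simp add: res_ker_def)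

lemma syz_module: "module R syz" and syz_fg: "fg_module R syz"
  using rel_module_is_module[OF R M.module_axioms] rel_module_fg[OF R M.module_axioms] mres_gen[OF res] by simp_all

lemma lincomb_syz:
  assumes "v \<in> vec (regular_module R) n"
  shows "lincomb syz v (\<lambda>j i. A (Suc 0) i j) m = act (regular_module R) m (A (Suc 0)) v"
  unfolding lincomb_rel_module act_def
  by (intro ext M.R.lincomb_regular_comm M.R.mat_entry[OF mres_mat[OF res]] M.R.vec_regular_closed[OF assms])

text \<open>The columns of \<open>A (Suc 0)\<close> generate the first syzygy module, and the rest
  of the resolution is reused.\<close>

lemma mres_syz: "mres R syz (syz_rank b) (syz_mat R A) (\<lambda>j i. A (Suc 0) i j)"
proof -
  let ?e = "\<lambda>j i. A (Suc 0) i j" and ?n = "b (Suc (Suc 0))"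
  interpret sz: module R syz by (rule syz_module)
  have col: "?e j \<in> carrier syz" for j
  proof (cases "j < ?n")
    case True
    have "act (regular_module R) ?n (A (Suc 0)) (unit_vector R j) \<in> res_ker R M b A e 0"
      by (rule act_mem_res_ker[OF res M.R.unit_vector_vec[OF True]])
    then show ?thesis unfolding syz_carrier M.R.act_unit_vector[OF mres_mat[OF res] True] .
  next
    case False
    then have "?e j = (zero syz)" using mres_mat[OF res, of "Suc 0"] by (simp add: mat_def del: M.R.mat_entry)
    then show ?thesis using sz.M.zero_closed by metis
  qed
  have e: "?e \<in> vec syz ?n"
    unfolding vec_def
  proof (intro CollectI conjI allI impI)
    show "?e j = (zero syz)" if "?n \<le> j" for j
      using mres_mat[OF res, of "Suc 0"] that by (simp add: mat_def del: M.R.mat_entry)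
  qed (rule col)
  have m: "syz_mat R A n \<in> mat R (syz_rank b n) (syz_rank b (Suc n))" for n
    by (cases n) (use mres_mat[OF res] in simp_all)
  have s: "\<exists>v\<in>vec (regular_module R) ?n. y = lincomb syz v ?e ?n" if y: "y \<in> carrier syz" for y
  proof -
    obtain v where "v \<in> vec (regular_module R) ?n" "y = act (regular_module R) ?n (A (Suc 0)) v"
      using y unfolding syz_carrier mres_exact[OF res] by blast
    then show ?thesis by (intro bexI[of _ v]) (simp_all only: lincomb_syz)
  qed
  have k: "res_ker R syz (syz_rank b) (syz_mat R A) ?e n = res_ker R M b A e (Suc n)" for n
  proof (cases n)
    case 0
    have "lincomb syz v ?e ?n = (zero syz) \<longleftrightarrow> act (regular_module R) ?n (A (Suc 0)) v = (\<lambda>i. (zero R))"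
      if "v \<in> vec (regular_module R) ?n" for v
      by (simp add: lincomb_syz[OF that])
    then show ?thesis unfolding res_ker_def 0 by auto
  next
    case (Suc l)
    then show ?thesis by (simp add: res_ker_def)
  qed
  show ?thesis
    unfolding mres_def k using syz_module m e s mres_exact[OF res] by simp
qed

text \<open>Hom and tensor product of \<open>M'\<close> and \<open>N'\<close> do not vanish when \<open>N'\<close> contains the free summand
  spanned by the last unit vector: restrict a coordinate function of the ambient free module of \<open>M'\<close>.\<close>

context
  fixes N :: "('a, 'z, 'n) module_scheme" and f :: "nat => 'z" and k :: nat
  assumes N: "module R N" and f: "\<And>i. f i \<in> carrier N"
begin

interpretation N: module R N by (rule N)

abbreviation "relN \<equiv> rel_module R N f k (Suc k)"

interpretation K: module R relN by (rule rel_module_is_module[OF R N f])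

lemma last_unit_vector: "unit_vector R k \<in> carrier relN"
  by (simp add: unit_vector_def[of R k, THEN fun_cong] N.lincomb_zero_left f)

lemma complex_entry: "lincomb (regular_module R) (A (Suc 0) j) (\<lambda>i. A (Suc (Suc 0)) i l) (b (Suc (Suc 0))) = (zero R)"
  using fun_cong[OF fun_cong[OF mres_complex[OF res, of "Suc 0"], of j], of l] by (simp add: matmul_def)

lemma EXT_syz_nonzero:
  assumes nz: "A (Suc 0) j l \<noteq> (zero R)" shows "\<not> EXT relN (syz_rank b) (syz_mat R A) 0"
proof
  assume ex: "EXT relN (syz_rank b) (syz_mat R A) 0"
  let ?n = "b (Suc (Suc 0))" and ?u = "unit_vector R k"
  \<comment> \<open>The homomorphism from the syzygy of M to \<open>relN\<close> that multiplies the
    last unit vector with the j-th coordinate; it is a cocycle since consecutive matrices multiply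
    to zero.\<close>
  define v where "v i = A (Suc 0) j i \<odot>\<^bsub>relN\<^esub> ?u" for i
  have Ac: "A n i' j' \<in> carrier R" for n i' j' by (rule M.R.mat_entry[OF mres_mat[OF res]])
  have v: "v \<in> vec relN ?n"
    unfolding vec_def
  proof (intro CollectI conjI allI impI)
    show "v i \<in> carrier relN" for i unfolding v_def by (rule K.smult_closed[OF Ac last_unit_vector])
    show "v i = (zero relN)" if "?n \<le> i" for i
    proof -
      have "A (Suc 0) j i = (zero R)" using mres_mat[OF res, of "Suc 0"] that by (simp add: mat_def del: M.R.mat_entry)
      then show ?thesis unfolding v_def using K.smult_l_null[OF last_unit_vector] by (simp only:)
    qed
  qed
  have "act relN ?n (transp (A (Suc (Suc 0)))) v = (\<lambda>i. (zero relN))"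
  proof (intro ext)
    fix l' t
    have "act relN ?n (transp (A (Suc (Suc 0)))) v l' t =
        lincomb (regular_module R) (\<lambda>i. A (Suc (Suc 0)) i l') (\<lambda>i. ?u t \<otimes>\<^bsub>R\<^esub> A (Suc 0) j i) ?n"
      unfolding act_def transp_def lincomb_rel_module v_def by (simp add: Ac M.R.m_comm[of _ "?u t"])
    also have "\<dots> = ?u t \<otimes>\<^bsub>R\<^esub> lincomb (regular_module R) (\<lambda>i. A (Suc (Suc 0)) i l') (A (Suc 0) j) ?n"
      using Rg.lincomb_smult_right[of "?u t" "\<lambda>i. A (Suc (Suc 0)) i l'" "A (Suc 0) j" ?n] Ac by simp
    also have "\<dots> = (zero R)"
      using complex_entry[of j l'] M.R.lincomb_regular_comm[of "A (Suc 0) j" "\<lambda>i. A (Suc (Suc 0)) i l'" ?n] Ac by simp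
    finally show "act relN ?n (transp (A (Suc (Suc 0)))) v l' t = (zero relN) t" by simp
  qed
  with ex v obtain w where "v = act relN 0 (transp (syz_mat R A 0)) w"
    unfolding EXT_def syz_simps exact_at_def by blast
  \<comment> \<open>In degree 0 the only coboundary is zero.\<close>
  then have "v l = (zero relN)" by (simp add: act_def)
  from fun_cong[OF this, of k] have "A (Suc 0) j l \<otimes>\<^bsub>R\<^esub> \<one>\<^bsub>R\<^esub> = (zero R)" by (simp add: v_def unit_vector_def)
  with nz Ac show False by simp
qed

lemma TOR_syz_nonzero:
  assumes nz: "A (Suc 0) j l \<noteq> (zero R)" shows "\<not> TOR relN (syz_rank b) (syz_mat R A) 0"
proof
  assume ex: "TOR relN (syz_rank b) (syz_mat R A) 0"
  let ?n = "b (Suc (Suc 0))" and ?n' = "b (Suc (Suc (Suc 0)))" and ?u = "unit_vector R k"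
  have l: "l < ?n" using nz mres_mat[OF res, of "Suc 0"] by (auto simp: mat_def not_less simp del: M.R.mat_entry intro: ccontr)
  \<comment> \<open>The tensor of the l-th generator with the last unit vector. If it were a
    boundary, its last coordinate would put the l-th unit vector into the image of
    \<open>A (Suc (Suc 0))\<close>, and column l of \<open>A (Suc 0)\<close> would vanish.\<close>
  define v where "v i = (if i = l then ?u else (zero relN))" for i
  have v: "v \<in> vec relN ?n"
    unfolding vec_def
  proof (intro CollectI conjI allI impI)
    show "v i \<in> carrier relN" for i unfolding v_def using last_unit_vector K.M.zero_closed by (cases "i = l") (simp_all only: if_True if_False simp_thms)
    show "v i = (zero relN)" if "?n \<le> i" for i using that l by (simp add: v_def)
  qed
  have "act relN ?n (\<lambda>i j. (zero R)) v = (\<lambda>i. (zero relN))" by (rule K.act_zero_mat[OF v])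
  with ex v obtain w where w: "w \<in> vec relN ?n'" "v = act relN ?n' (A (Suc (Suc 0))) w"
    unfolding TOR_def syz_simps exact_at_def by blast
  have wc: "w i \<in> vec (regular_module R) (Suc k)" for i using K.vec_closed[OF w(1), of i] by simp
  have wk: "(\<lambda>i. w i k) \<in> vec (regular_module R) ?n'"
    unfolding vec_def
  proof (intro CollectI conjI allI impI)
    show "w i k \<in> carrier (regular_module R)" for i by (rule Rg.vec_closed[OF wc])
    show "w i k = \<zero>\<^bsub>regular_module R\<^esub>" if "?n' \<le> i" for i using vec_zero_outside[OF w(1) that] by simp
  qed
  have "act (regular_module R) ?n' (A (Suc (Suc 0))) (\<lambda>i. w i k) = (\<lambda>i. v i k)"
    unfolding w(2) act_def lincomb_rel_module ..
  also have "\<dots> = unit_vector R l" by (auto simp: v_def unit_vector_def)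
  finally have u: "act (regular_module R) ?n' (A (Suc (Suc 0))) (\<lambda>i. w i k) = unit_vector R l" .
  have "(\<lambda>i. A (Suc 0) i l) = act (regular_module R) ?n (A (Suc 0)) (unit_vector R l)"
    by (rule M.R.act_unit_vector[OF mres_mat[OF res] l, symmetric])
  also have "\<dots> = (\<lambda>i. \<zero>\<^bsub>regular_module R\<^esub>)"
    unfolding u[symmetric]
    by (rule Rg.act_act_zero[OF mres_mat[OF res] mres_mat[OF res] mres_complex[OF res] wk])
  finally show False using nz by (simp add: fun_eq_iff)
qed

end

text \<open>A zero matrix \<open>A (Suc 0)\<close> means that M is free and its syzygy zero; this is
  the alternative in \<open>reduced\<close> in which everything vanishes.\<close>

lemma syz_zero:
  assumes z: "\<And>j l. A (Suc 0) j l = (zero R)" and N: "module R N"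
  shows "EXT N (syz_rank b) (syz_mat R A) n" "TOR N (syz_rank b) (syz_mat R A) n"
proof -
  interpret sz: module R syz by (rule syz_module)
  have A: "A (Suc 0) = (\<lambda>i j. (zero R))" by (intro ext z)
  have "carrier syz \<subseteq> {(zero syz)}"
    unfolding syz_carrier mres_exact[OF res] A by auto
  then have "carrier syz = {(zero syz)}" using sz.M.zero_closed by blast
  note r = mres_zero_module[OF syz_module this]
  show "EXT N (syz_rank b) (syz_mat R A) n"
    unfolding mres_EXT_unique[OF mres_syz r N] unfolding EXT_def
    by (rule exact_at_trivial[OF N]) (simp add: transp_def)
  show "TOR N (syz_rank b) (syz_mat R A) n"
    unfolding mres_TOR_unique[OF mres_syz r N] unfolding TOR_def
    by (rule exact_at_trivial[OF N]) simp
qed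

end

context regular_quotient
begin

lemma rel_module_regular:
  assumes "y \<in> carrier (rel_module R N f k q)" "x \<odot>\<^bsub>rel_module R N f k q\<^esub> y = \<zero>\<^bsub>rel_module R N f k q\<^esub>"
  shows "y = \<zero>\<^bsub>rel_module R N f k q\<^esub>"
proof -
  have "y \<in> vec Rg q" "(\<lambda>i. x \<otimes>\<^bsub>R\<^esub> y i) = (\<lambda>i. (zero R))" using assms by simp_all
  from regular_vec[OF this] show ?thesis by simp
qed

text \<open>Ext of the two syzygies in degree i is Ext of M and \<open>N'\<close> in degree i + 1
  and hence, beyond the length n0 of the injective resolution, Ext of M and N in degree i: the
  shifts cancel. For Tor both shifts go the same way, whence the 2, and positive degrees suffice
  since free modules are acyclic there.\<close>

lemma syzygy_patterns:
  assumes loc: "local_ring R" "maximalideal \<mm> R" "x \<in> \<mm>" and S: "noetherian_ring S"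
  shows "injective_resolution R (regular_module R) n0 I d \<eta> ==> ext_pattern R Z ==> \<exists>Z'. ext_pattern S Z' \<and> reduced 0 n0 Z Z'"
    and "tor_pattern R Z ==> \<exists>Z'. tor_pattern S Z' \<and> reduced 2 0 Z Z'"
proof -
  have R': "cring R" and R: "noetherian_ring R" using loc(1) by (simp_all add: local_ring_def)
  {
    fix M N :: "'a coset_module" and b A e
    assume fgM: "fg_module R M" and fgN: "fg_module R N" and res: "mres R M b A e"
    have N: "module R N" using fgN by (simp add: fg_module_def)
    interpret N: module R N by (rule N)
    obtain k f where f: "f \<in> vec N k" "\<forall>y\<in>carrier N. \<exists>v\<in>vec Rg k. y = lincomb N v f k" by (rule fg_module_gens[OF fgN])
    have fc: "f i \<in> carrier N" for i using f(1) by simp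
    \<comment> \<open>N is given one more generator than needed, namely zero; the extra coordinate
      is the free summand that keeps degree 0 nonzero.\<close>
    let ?M = "rel_module R M e (b (Suc 0)) (b (Suc 0))" and ?N = "rel_module R N f k (Suc k)"
      and ?b = "syz_rank b" and ?A = "syz_mat R A"
    note res' = mres_syz[OF R res]
    have fgN': "fg_module R ?N" and mN': "module R ?N" by (rule rel_module_fg[OF R N fc] rel_module_is_module[OF R N fc])+
    have se: "short_exact R ?N (vec_module Rg (Suc k)) N (\<lambda>v. v) (\<lambda>v. lincomb N v f k)"
      by (rule rel_module_exact[OF R N fc]) (use f(2) in auto)
    have se': "short_exact R ?N ?N (x_quot ?N) (\<lambda>y. x \<odot>\<^bsub>?N\<^esub> y) (\<lambda>y. (\<lambda>y. x \<odot>\<^bsub>?N\<^esub> y) ` carrier ?N +>\<^bsub>?N\<^esub> y)"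
      by (rule x_quot_exact[OF mN' rel_module_regular])
    note nk = exact_at_of_x_quot[OF loc noeth_fg_module[OF R' R fgN'] rel_module_regular]
    have zero: "(\<forall>i. EXT ?N ?b ?A i) \<and> (\<forall>i. TOR ?N ?b ?A i) \<or> \<not> EXT ?N ?b ?A 0 \<and> \<not> TOR ?N ?b ?A 0"
    proof (cases "\<forall>j l. A (Suc 0) j l = (zero R)")
      case True
      then show ?thesis using syz_zero[OF R res _ mN'] by blast
    next
      case False
      then show ?thesis using EXT_syz_nonzero[where f = f and k = k, OF R res N fc] TOR_syz_nonzero[where f = f and k = k, OF R res N fc] by blast
    qed
    have pat: "ext_pattern S (EXT (x_quot ?N) ?b ?A)"
      by (rule x_quot_patterns(1)[OF S syz_fg[OF R res] fgN' res' rel_module_regular rel_module_regular])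
    have pat': "tor_pattern S (TOR (x_quot ?N) ?b ?A)"
      by (rule x_quot_patterns(2)[OF S syz_fg[OF R res] fgN' res' rel_module_regular rel_module_regular])
    have "\<exists>Z'. ext_pattern S Z' \<and> reduced 0 n0 (EXT N b A) Z'" if inj: "injective_resolution R Rg n0 I d \<eta>" for n0 I d \<eta>
    proof (intro exI conjI)
      show "ext_pattern S (EXT (x_quot ?N) ?b ?A)" by (rule pat)
      show "reduced 0 n0 (EXT N b A) (EXT (x_quot ?N) ?b ?A)"
        unfolding reduced_def
      proof (intro exI[of _ "EXT ?N ?b ?A"] conjI allI impI)
        fix i assume i: "n0 < i"
        then obtain j where j: "i = Suc j" by (cases i) auto
        have "EXT N b A (Suc j) \<longleftrightarrow> EXT ?N b A (Suc (Suc j))"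
          using EXT_quotient[OF res se, of "Suc j"] EXT_sub[OF res se, of "Suc j"] EXT_free[OF res inj] i j by auto
        then show "EXT ?N ?b ?A i \<longleftrightarrow> EXT N b A (i + 0)" by (simp add: j syz_shift)
      next
        show "(\<forall>i. EXT ?N ?b ?A i) \<or> \<not> EXT ?N ?b ?A 0" using zero by blast
        show "EXT ?N ?b ?A i" if "EXT (x_quot ?N) ?b ?A i" for i
          unfolding EXT_def
          by (rule nk[OF _ _ mres_mat_transp[OF res'] mres_mat_transp[OF res'] mres_complex_transp[OF res'] that[unfolded EXT_def]])
        \<comment> \<open>Ext uses the vanishing in degrees i + 1 and i + 2, Tor that in degrees i
          and i + 1; asking for all three in \<open>reduced\<close> covers both.\<close>
        show "EXT (x_quot ?N) ?b ?A (Suc i)" if "EXT ?N ?b ?A i \<and> EXT ?N ?b ?A (Suc i) \<and> EXT ?N ?b ?A (Suc (Suc i))" for i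
          using EXT_quotient[OF res' se'] that by blast
      qed
    qed
    moreover have "\<exists>Z'. tor_pattern S Z' \<and> reduced 2 0 (TOR N b A) Z'"
    proof (intro exI conjI)
      show "tor_pattern S (TOR (x_quot ?N) ?b ?A)" by (rule pat')
      show "reduced 2 0 (TOR N b A) (TOR (x_quot ?N) ?b ?A)"
        unfolding reduced_def
      proof (intro exI[of _ "TOR ?N ?b ?A"] conjI allI impI)
        fix i :: nat assume i: "0 < i"
        then obtain j where j: "i = Suc j" by (cases i) auto
        have "TOR N b A (Suc (Suc (Suc j))) \<longleftrightarrow> TOR ?N b A (Suc (Suc j))"
          using TOR_quotient[OF res se, of "Suc (Suc j)"] TOR_sub[OF res se, of "Suc (Suc j)"] TOR_free[OF res] by blast
        then show "TOR ?N ?b ?A i \<longleftrightarrow> TOR N b A (i + 2)" by (simp add: j syz_shift numeral_2_eq_2)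
      next
        show "(\<forall>i. TOR ?N ?b ?A i) \<or> \<not> TOR ?N ?b ?A 0" using zero by blast
        show "TOR ?N ?b ?A i" if "TOR (x_quot ?N) ?b ?A i" for i
          unfolding TOR_def
          by (rule nk[OF _ _ mres_mat[OF res'] mres_mat[OF res'] mres_complex[OF res'] that[unfolded TOR_def]])
        show "TOR (x_quot ?N) ?b ?A (Suc i)" if "TOR ?N ?b ?A i \<and> TOR ?N ?b ?A (Suc i) \<and> TOR ?N ?b ?A (Suc (Suc i))" for i
          using TOR_quotient[OF res' se'] that by blast
      qed
    qed
    ultimately have "(\<forall>n0 I d \<eta>. injective_resolution R Rg n0 I d \<eta> \<longrightarrow> (\<exists>Z'. ext_pattern S Z' \<and> reduced 0 n0 (EXT N b A) Z')) \<and>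
      (\<exists>Z'. tor_pattern S Z' \<and> reduced 2 0 (TOR N b A) Z')" by blast
  }
  note main = this
  show "\<exists>Z'. ext_pattern S Z' \<and> reduced 0 n0 Z Z'" if inj: "injective_resolution R (regular_module R) n0 I d \<eta>" and p: "ext_pattern R Z"
  proof (rule ext_patternE[OF R' R p])
    fix M N :: "'a coset_module" and b A e
    assume "fg_module R M" "fg_module R N" "mres R M b A e" "Z = EXT N b A"
    with main[of M N b A e] inj show ?thesis by blast
  qed
  show "\<exists>Z'. tor_pattern S Z' \<and> reduced 2 0 Z Z'" if p: "tor_pattern R Z"
  proof (rule tor_patternE[OF R' R p])
    fix M N :: "'a coset_module" and b A e
    assume "fg_module R M" "fg_module R N" "mres R M b A e" "Z = TOR N b A"
    with main[of M N b A e] show ?thesis by blast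
  qed
qed

end

section \<open>The quotient by a principal ideal\<close>

lemma injective_dim_finite_iff: "injective_dim R M < \<infinity> \<longleftrightarrow> (\<exists>n I d \<eta>. injective_resolution R M n I d \<eta>)"
proof
  assume "\<exists>n I d \<eta>. injective_resolution R M n I d \<eta>"
  then obtain n where "enat n \<in> {enat n | n. \<exists>I d \<eta>. injective_resolution R M n I d \<eta>}" by blast
  then have "injective_dim R M \<le> enat n" unfolding injective_dim_def by (rule Inf_lower)
  also have "\<dots> < \<infinity>" by simp
  finally show "injective_dim R M < \<infinity>" .
next
  assume "injective_dim R M < \<infinity>"
  then show "\<exists>n I d \<eta>. injective_resolution R M n I d \<eta>"
    unfolding injective_dim_def Inf_less_iff by blast
qed

lemma (in cring) regular_quotient_principal:
  assumes x: "x \<in> carrier R" and reg: "\<And>y. y \<in> carrier R ==> x \<otimes> y = \<zero> ==> y = \<zero>"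
  shows "regular_quotient R (R Quot PIdl x) ((+>) (PIdl x)) x"
proof -
  note I = cgenideal_ideal[OF x]
  interpret I: ideal "PIdl x" R by (rule I)
  have Q: "cring (R Quot PIdl x)" by (rule I.quotient_is_cring[OF is_cring])
  show ?thesis
  proof (rule regular_quotient.intro[OF is_cring Q regular_quotient_axioms.intro])
    show "(+>) (PIdl x) \<in> ring_hom R (R Quot PIdl x)" by (rule I.rcos_ring_hom)
    show "(+>) (PIdl x) ` carrier R = carrier (R Quot PIdl x)" by (auto simp: FactRing_def A_RCOSETS_def')
    fix y assume y: "y \<in> carrier R"
    have "PIdl x +> y = PIdl x \<longleftrightarrow> y \<in> PIdl x"
      using I.rcos_const_imp_mem[OF y] I.a_rcos_const[of y] by blast
    moreover have "y \<in> PIdl x \<longleftrightarrow> (\<exists>z\<in>carrier R. y = x \<otimes> z)"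
      using m_comm[OF x] unfolding cgenideal_def by auto
    moreover have "\<zero>\<^bsub>R Quot PIdl x\<^esub> = PIdl x" by (simp add: FactRing_def)
    ultimately show "PIdl x +> y = \<zero>\<^bsub>R Quot PIdl x\<^esub> \<longleftrightarrow> (\<exists>z\<in>carrier R. y = x \<otimes> z)" by simp
  qed (use x reg in auto)
qed

context regular_quotient
begin

lemma ideal_preimage:
  assumes J: "ideal J S" shows "ideal {r \<in> carrier R. \<pi> r \<in> J} R"
proof -
  interpret J: ideal J S by (rule J)
  show ?thesis
    by (rule R.ideal_of_closed) (auto simp: pi_add pi_mult J.I_l_closed)
qed

lemma quotient_noetherian:
  assumes "noetherian_ring R" shows "noetherian_ring S"
proof -
  interpret nR: noetherian_ring R by fact
  show ?thesis
  proof (rule noetherian_ring.intro[OF S.ring_axioms noetherian_ring_axioms.intro])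
    fix J assume J: "ideal J S"
    interpret J: ideal J S by (rule J)
    from nR.finetely_gen[OF ideal_preimage[OF J]] obtain A
      where A: "A \<subseteq> carrier R" "finite A" "{r \<in> carrier R. \<pi> r \<in> J} = genideal R A" by blast
    have AJ: "A \<subseteq> {r \<in> carrier R. \<pi> r \<in> J}" unfolding A(3) by (rule R.genideal_self[OF A(1)])
    have \<pi>A: "\<pi> ` A \<subseteq> carrier S" using A(1) by auto
    have "genideal S (\<pi> ` A) \<subseteq> J" by (rule S.genideal_minimal[OF J]) (use AJ in blast)
    moreover have "J \<subseteq> genideal S (\<pi> ` A)"
    proof
      fix s assume s: "s \<in> J"
      obtain r where r: "r \<in> carrier R" "s = \<pi> r" using pi_lift[OF J.Icarr[OF s]] by blast
      have "genideal R A \<subseteq> {r \<in> carrier R. \<pi> r \<in> genideal S (\<pi> ` A)}"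
        by (rule R.genideal_minimal[OF ideal_preimage[OF S.genideal_ideal[OF \<pi>A]]])
          (use A(1) S.genideal_self[OF \<pi>A] in blast)
      then show "s \<in> genideal S (\<pi> ` A)" unfolding A(3)[symmetric] using r s by blast
    qed
    ultimately show "\<exists>B\<subseteq>carrier S. finite B \<and> J = genideal S B"
      using \<pi>A A(2) by (intro exI[of _ "\<pi> ` A"]) auto
  qed
qed

text \<open>The only maximal ideal is the image of \<mm>: the preimage of any maximal ideal lies in
  \<mm>, and the image is proper because x lies in \<mm>.\<close>

lemma quotient_local:
  assumes R: "local_ring R" and m: "maximalideal \<mm> R" and x: "x \<in> \<mm>"
  shows "local_ring S"
proof -
  have R': "cring R" "noetherian_ring R" and uniq: "\<exists>!\<mm>. maximalideal \<mm> R" using R by (simp_all add: local_ring_def)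
  have S: "cring S" "noetherian_ring S" by (rule S.is_cring) (rule quotient_noetherian[OF R'(2)])
  interpret m: maximalideal \<mm> R by (rule m)
  have one: "\<one>\<^bsub>R\<^esub> \<notin> \<mm>" using m.one_imp_carrier m.I_notcarr by blast
  let ?n = "\<pi> ` \<mm>"
  have n: "ideal ?n S"
  proof (rule S.ideal_of_closed)
    show "?n \<subseteq> carrier S" using m.Icarr by auto
    show "(zero S) \<in> ?n" using pi_zero m.zero_closed by (metis imageI)
    show "a \<oplus>\<^bsub>S\<^esub> b \<in> ?n" if ab: "a \<in> ?n" "b \<in> ?n" for a b
    proof -
      obtain r s where rs: "r \<in> \<mm>" "a = \<pi> r" "s \<in> \<mm>" "b = \<pi> s" using ab by blast
      have "a \<oplus>\<^bsub>S\<^esub> b = \<pi> (r \<oplus>\<^bsub>R\<^esub> s)" using rs m.Icarr by (simp add: pi_add)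
      then show ?thesis using m.a_closed[OF rs(1,3)] by blast
    qed
    show "c \<otimes>\<^bsub>S\<^esub> a \<in> ?n" if ca: "c \<in> carrier S" "a \<in> ?n" for c a
    proof -
      obtain r where r: "r \<in> carrier R" "c = \<pi> r" using pi_lift[OF ca(1)] by blast
      obtain s where s: "s \<in> \<mm>" "a = \<pi> s" using ca(2) by blast
      have "c \<otimes>\<^bsub>S\<^esub> a = \<pi> (r \<otimes>\<^bsub>R\<^esub> s)" using r s m.Icarr by (simp add: pi_mult)
      then show ?thesis using m.I_l_closed[OF s(1) r(1)] by blast
    qed
  qed
  have one_n: "\<one>\<^bsub>S\<^esub> \<notin> ?n"
  proof
    assume "\<one>\<^bsub>S\<^esub> \<in> ?n"
    then obtain r where r: "r \<in> \<mm>" "\<one>\<^bsub>S\<^esub> = \<pi> r" by blast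
    have rc: "r \<in> carrier R" by (rule m.Icarr[OF r(1)])
    have "\<pi> (\<one>\<^bsub>R\<^esub> \<ominus>\<^bsub>R\<^esub> r) = (zero S)" using rc r(2) by (simp add: pi_minus flip: r(2))
    then obtain z where z: "z \<in> carrier R" "\<one>\<^bsub>R\<^esub> \<ominus>\<^bsub>R\<^esub> r = x \<otimes>\<^bsub>R\<^esub> z" using kernel[of "\<one>\<^bsub>R\<^esub> \<ominus>\<^bsub>R\<^esub> r"] rc by auto
    have "(\<one>\<^bsub>R\<^esub> \<ominus>\<^bsub>R\<^esub> r) \<oplus>\<^bsub>R\<^esub> r \<in> \<mm>"
      unfolding z(2) by (rule m.a_closed[OF m.I_r_closed[OF x z(1)] r(1)])
    then show False using one rc by simp
  qed
  have max: "J = ?n" if J: "maximalideal J S" for J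
  proof -
    interpret J: maximalideal J S by (rule J)
    let ?J = "{r \<in> carrier R. \<pi> r \<in> J}"
    have "\<one>\<^bsub>S\<^esub> \<notin> J" using J.one_imp_carrier J.I_notcarr by blast
    then have "?J \<noteq> carrier R" using R.one_closed pi_one by (metis (mono_tags, lifting) mem_Collect_eq)
    then obtain m' where m': "maximalideal m' R" "?J \<subseteq> m'" by (rule maximal_ideal_exists[OF R' ideal_preimage[OF J.ideal_axioms]])
    have "m' = \<mm>" using uniq m m'(1) by blast
    have "J \<subseteq> ?n"
    proof
      fix s assume s: "s \<in> J"
      obtain r where r: "r \<in> carrier R" "s = \<pi> r" using pi_lift[OF J.Icarr[OF s]] by blast
      then have "r \<in> \<mm>" using m'(2) s \<open>m' = \<mm>\<close> by blast
      then show "s \<in> ?n" using r(2) by blast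
    qed
    moreover have "?n \<subseteq> carrier S" using m.Icarr pi_closed by blast
    ultimately have "?n = J \<or> ?n = carrier S" by (rule J.I_maximal[OF n])
    then show ?thesis using one_n S.one_closed by metis
  qed
  have "?n \<noteq> carrier S" using one_n S.one_closed by metis
  then obtain J where "maximalideal J S" by (rule maximal_ideal_exists[OF S n])
  then have "\<exists>!J. maximalideal J S" using max by blast
  then show ?thesis using S by (simp add: local_ring_def)
qed

end

lemma regular_quotient_gorenstein:
  fixes R :: "('a, 'r) ring_scheme" and S :: "('a set, 't) ring_scheme"
  assumes rq: "regular_quotient R S \<pi> x" and R: "gorenstein_local_ring R" and m: "maximalideal \<mm> R" "x \<in> \<mm>"
  shows "gorenstein_local_ring S"
proof -
  interpret regular_quotient R S \<pi> x by (rule rq)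
  obtain n I d \<eta> where "injective_resolution R (regular_module R) n I d \<eta>"
    using R unfolding gorenstein_local_ring_def injective_dim_finite_iff by blast
  then interpret gorenstein_quotient R S \<pi> x n I d \<eta> by unfold_locales
  \<comment> \<open>Elements of S are sets, so sequences embed by singletons. The injection need not
    respect any structure, as the operations are transported along it.\<close>
  have "inj (\<lambda>(f :: nat => 'a) k. {f k})" by (auto simp: inj_def fun_eq_iff)
  from quotient_injective_resolution[OF this] show ?thesis
    using R quotient_local[OF _ m] unfolding gorenstein_local_ring_def injective_dim_finite_iff by blast
qed

theorem proposition3p2:
  fixes R :: "('a, 'r) ring_scheme" (structure)
    and d :: nat and \<mm> :: "'a set" and x :: 'a
  assumes "gorenstein_local_ring R"
    and "krull_dim R = enat d"
    and "maximalideal \<mm> R"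
    and "x \<in> \<mm>"
    and "\<forall>y \<in> carrier R. x \<otimes> y = \<zero> \<longrightarrow> y = \<zero>"
  shows "(AB_ring R \<longleftrightarrow> AB_ring (R Quot PIdl x)) \<and>
    (Tor_index R < \<infinity> \<longleftrightarrow> Tor_index (R Quot PIdl x) < \<infinity>) \<and>
    (Ext_bounded R \<longleftrightarrow> Ext_bounded (R Quot PIdl x)) \<and>
    (Tor_bounded R \<longleftrightarrow> Tor_bounded (R Quot PIdl x))"
proof -
  have loc: "local_ring R" using assms(1) by (simp add: gorenstein_local_ring_def)
  then have R: "cring R" "noetherian_ring R" by (simp_all add: local_ring_def)
  interpret m: maximalideal \<mm> R by (rule assms(3))
  have x: "x \<in> carrier R" by (rule m.Icarr[OF assms(4)])
  have rq: "regular_quotient R (R Quot PIdl x) ((+>) (PIdl x)) x"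
    by (rule cring.regular_quotient_principal[OF R(1) x]) (use assms(5) in blast)
  interpret rq: regular_quotient R "R Quot PIdl x" "(+>) (PIdl x)" x by (rule rq)
  have S: "noetherian_ring (R Quot PIdl x)" by (rule rq.quotient_noetherian[OF R(2)])
  obtain n I \<delta> \<eta> where inj: "injective_resolution R (regular_module R) n I \<delta> \<eta>"
    using assms(1) unfolding gorenstein_local_ring_def injective_dim_finite_iff by blast
  have G: "gorenstein_local_ring (R Quot PIdl x)" by (rule regular_quotient_gorenstein[OF rq assms(1,3,4)])
  note syz = rq.syzygy_patterns[OF loc assms(3,4) S]
  note E = bounded_on_transfer[of "ext_pattern (R Quot PIdl x)" "ext_pattern R",
      OF rq.cone_patterns(1)[OF R(2) S] syz(1)[OF inj]]
  note T = bounded_on_transfer[of "tor_pattern (R Quot PIdl x)" "tor_pattern R",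
      OF rq.cone_patterns(2)[OF R(2) S] syz(2)]
  \<comment> \<open>Both rings are local Gorenstein, so the AB condition comes down to a bound on
    the Ext-index.\<close>
  show ?thesis
    unfolding AB_ring_def index_gap_finite_iff using assms(1) G E T by blast
qed

end
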